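(* Let $u=(u_1,\dots,u_d)$ and $v=(v_1,\dots,v_d)$ be two $d$-tuples of one-parameter unitary groups, and suppose that $d_{\mathrm D}(u,v)\le\delta<\infty$. Then there exist a Hilbert space $\mathcal H$, $d$-tuples $U=(U_1,\dots,U_d)$ and $V=(V_1,\dots,V_d)$ of one-parameter unitary groups on $\mathcal H$, both of infinite multiplicity, with $u\sim U$ and $v\sim V$, and selfadjoint (possibly unbounded) operators $A_1,\dots,A_d$ and $B_1,\dots,B_d$ in $\mathcal H$ such that for all $k=1,\dots,d$: $\operatorname{dom}A_k=\operatorname{dom}B_k$, $U_k(t)=\exp(itA_k)$ and $V_k(t)=\exp(itB_k)$ for all $t\in\mathbb R$, and \[ \|B_k-A_k\|\le 5\sqrt2\,\delta^{1/2}, \] i.e. $B_k-A_k$ (defined on the dense subspace $\operatorname{dom}A_k=\operatorname{dom} B_k$) is bounded with norm at most $5\sqrt2\,\delta^{1/2}$.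
   Context: A one-parameter unitary group on a separable Hilbert space $\mathcal H$ is a group homomorphism $u\colon\mathbb R\to\mathcal U(\mathcal H)$ into the group of unitary operators on $\mathcal H$ that is continuous in the strong operator topology. In a $d$-tuple $u=(u_1,\dots,u_d)$ of one-parameter unitary groups all $u_k$ act on the same Hilbert space. Equivalence: $d$-tuples $u$ on $\mathcal H$ and $v$ on $\mathcal K$ are equivalent, written $u\sim v$, if there are faithful normal representations $\pi\colon\mathcal B(\mathcal H)\to\mathcal B(\mathcal L)$ and $\rho\colon\mathcal B(\mathcal K)\to\mathcal B(\mathcal L)$ on a common Hilbert space $\mathcal L$ such that $\pi(u_k(t))=\rho(v_k(t))$ for all $k=1,\dots,d$ and all $t\in\mathbb R$. (Every faithful normal representation of $\mathcal B(\mathcal H)$ on $\mathcal G$ has the form $\pi(a)=W^*(a\otimes 1_{\mathcal F})W$ for a Hilbert space $\mathcal F$ and a unitary $W\colon\mathcal G\to\mathcal H\otimes\mathcal F$.) A tuple is of infinite multiplicity if it is unitarily equivalent to its infinite ampliation, where the infinite ampliation of $w$ is $w\otimes 1_{\ell^2(\mathbb N)}$. Dilation: for $c>0$, write $u\prec_c v$ if there exist Hilbert spaces $\mathcal H\subseteq\mathcal K$ and $d$-tuples of one-parameter unitary groups $U=(U_1,\dots,U_d)$ on $\mathcal H$ and $V=(V_1,\dots,V_d)$ on $\mathcal K$ with $u\sim U$, $v\sim V$ and \[ U_k(t)=P_{\mathcal H}\,C(t)V_k(t)\big|_{\mathcal H} \] for all $k=1,\dots,d$ and all $t$ in a neighborhood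 of $0$, where $P_{\mathcal H}$ is the orthogonal projection of $\mathcal K$ onto $\mathcal H$ and $C(t)$ is a family of (real) constants (independent of $k$) with $C(t)\le e^{t^2c}$. Dilation distance: $d_{\mathrm D}(u,v):=\max\left(\inf\{c: u\prec_c v\},\ \inf\{c: v\prec_c u\}\right)$, with $\inf\emptyset=\infty$.
   Formalization: The formal theorem assumes δ > 0; for δ = 0 the claim fails, since the infimum in d_D need not be attained: diagonal groups with point spectra G = ℤ+√2ℤ and G+√2/2 have d_D = 0 but are not equivalent, while δ = 0 would force A_k = B_k and u ∼ v. *)

theory Defs
  imports "HOL-Analysis.Analysis" "HOL-Library.Infinite_Typeclass"
begin

section \<open>Complex Hilbert spaces\<close>

text \<open>The inner product is linear in its second argument.  Positive definiteness and the norm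
  are inherited from the underlying real inner product.\<close>

class complex_inner = real_inner +
  fixes scaleC :: "complex \<Rightarrow> 'a \<Rightarrow> 'a" (infixr "*\<^sub>C" 75)
    and cinner :: "'a \<Rightarrow> 'a \<Rightarrow> complex"
  assumes scaleC_add_right: "a *\<^sub>C (x + y) = a *\<^sub>C x + a *\<^sub>C y"
    and scaleC_add_left: "(a + b) *\<^sub>C x = a *\<^sub>C x + b *\<^sub>C x"
    and scaleC_scaleC: "a *\<^sub>C b *\<^sub>C x = (a * b) *\<^sub>C x"
    and scaleR_scaleC: "r *\<^sub>R x = complex_of_real r *\<^sub>C x"
    and cinner_commute: "cinner x y = cnj (cinner y x)"
    and cinner_add_right: "cinner x (y + z) = cinner x y + cinner x z"
    and cinner_scaleC_right: "cinner x (a *\<^sub>C y) = a * cinner x y"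
    and inner_eq_Re_cinner: "inner x y = Re (cinner x y)"

class chilbert_space = complex_inner + complete_space

instantiation complex :: chilbert_space
begin
definition scaleC_complex :: "complex \<Rightarrow> complex \<Rightarrow> complex" where
  "scaleC_complex a x = a * x"
definition cinner_complex :: "complex \<Rightarrow> complex \<Rightarrow> complex" where
  "cinner_complex x y = cnj x * y"
instance
  by standard (auto simp: scaleC_complex_def cinner_complex_def algebra_simps scaleR_conv_of_real
      inner_complex_def)
end

lemma norm_scaleC: "norm (a *\<^sub>C (x :: 'a :: complex_inner)) = cmod a * norm x"
proof -
  have l: "cinner (a *\<^sub>C x) y = cnj a * cinner x y" for y
    by (metis cinner_commute cinner_scaleC_right complex_cnj_mult)
  have "inner (a *\<^sub>C x) (a *\<^sub>C x) = Re ((a * cnj a) * cinner x x)"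
    by (simp add: inner_eq_Re_cinner l cinner_scaleC_right mult.assoc mult.left_commute)
  also have "\<dots> = (cmod a)\<^sup>2 * inner x x"
    by (simp add: complex_norm_square [symmetric] inner_eq_Re_cinner)
  finally show ?thesis
    by (simp add: norm_eq_sqrt_inner real_sqrt_mult)
qed

lemma cmod_cinner_le: "cmod (cinner x y) \<le> norm x * norm (y :: 'a :: complex_inner)"
proof (cases "cinner x y = 0")
  case False
  define a where "a = cnj (cinner x y) / cmod (cinner x y)"
  have "cmod a = 1" using False by (simp add: a_def norm_divide)
  have "a * cinner x y = cmod (cinner x y)"
    using False by (simp add: a_def complex_norm_square [symmetric] power2_eq_square mult.commute)
  then have "cmod (cinner x y) = inner x (a *\<^sub>C y)"
    by (simp add: inner_eq_Re_cinner cinner_scaleC_right)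
  also have "\<dots> \<le> norm x * norm (a *\<^sub>C y)"
    by (rule norm_cauchy_schwarz)
  finally show ?thesis using \<open>cmod a = 1\<close> by (simp add: norm_scaleC)
qed simp


subsection \<open>Square-summable families\<close>

typedef (overloaded) ('i, 'a) l2 =
  "{f :: 'i \<Rightarrow> 'a :: complex_inner. (\<lambda>i. (norm (f i))\<^sup>2) summable_on UNIV}"
  by (rule exI [of _ "\<lambda>_. 0"]) simp

setup_lifting type_definition_l2

text \<open>As \<open>'l\<close> ranges over all types, the closed subspaces of \<open>'l ell2\<close> exhaust the complex Hilbert
  spaces up to unitary equivalence; \<open>'l ell2\<close> serves as the universe in which Hilbert spaces that
  are claimed to exist are sought.\<close>

type_synonym 'l ell2 = "('l, complex) l2"

lemma l2_add_summable:
  fixes f g :: "'i \<Rightarrow> 'a :: complex_inner"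
  assumes "(\<lambda>i. (norm (f i))\<^sup>2) summable_on A" "(\<lambda>i. (norm (g i))\<^sup>2) summable_on A"
  shows "(\<lambda>i. (norm (f i + g i))\<^sup>2) summable_on A"
proof (rule summable_on_comparison_test)
  show "(\<lambda>i. 2 * (norm (f i))\<^sup>2 + 2 * (norm (g i))\<^sup>2) summable_on A"
    using assms by (intro summable_on_add summable_on_cmult_right)
  fix i
  have "norm (f i + g i) \<le> norm (f i) + norm (g i)" by (rule norm_triangle_ineq)
  then have "(norm (f i + g i))\<^sup>2 \<le> (norm (f i) + norm (g i))\<^sup>2"
    by (simp add: power_mono)
  also have "\<dots> \<le> 2 * (norm (f i))\<^sup>2 + 2 * (norm (g i))\<^sup>2"
    using zero_le_power2 [of "norm (f i) - norm (g i)"] by (simp add: power2_eq_square algebra_simps)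
  finally show "(norm (f i + g i))\<^sup>2 \<le> 2 * (norm (f i))\<^sup>2 + 2 * (norm (g i))\<^sup>2" .
qed auto

lemma l2_cinner_summable:
  fixes f g :: "'i \<Rightarrow> 'a :: complex_inner"
  assumes "(\<lambda>i. (norm (f i))\<^sup>2) summable_on A" "(\<lambda>i. (norm (g i))\<^sup>2) summable_on A"
  shows "(\<lambda>i. cinner (f i) (g i)) summable_on A"
proof (rule abs_summable_summable, rule summable_on_comparison_test)
  show "(\<lambda>i. (norm (f i))\<^sup>2 + (norm (g i))\<^sup>2) summable_on A"
    using assms by (intro summable_on_add)
  fix i
  have "2 * (norm (f i) * norm (g i)) \<le> (norm (f i))\<^sup>2 + (norm (g i))\<^sup>2"
    using zero_le_power2 [of "norm (f i) - norm (g i)"] by (simp add: power2_eq_square algebra_simps)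
  moreover have "0 \<le> norm (f i) * norm (g i)" by simp
  ultimately show "norm (cinner (f i) (g i)) \<le> (norm (f i))\<^sup>2 + (norm (g i))\<^sup>2"
    using cmod_cinner_le [of "f i" "g i"] by linarith
qed auto

lemma l2_scaleC_summable:
  fixes f :: "'i \<Rightarrow> 'a :: complex_inner"
  assumes "(\<lambda>i. (norm (f i))\<^sup>2) summable_on A"
  shows "(\<lambda>i. (norm (a *\<^sub>C f i))\<^sup>2) summable_on A"
  using summable_on_cmult_right [OF assms, of "(cmod a)\<^sup>2"]
  by (simp add: norm_scaleC power_mult_distrib)

instantiation l2 :: (type, complex_inner) complex_inner
begin

lift_definition zero_l2 :: "('a, 'b) l2" is "\<lambda>_. 0" by simp
lift_definition plus_l2 :: "('a, 'b) l2 \<Rightarrow> ('a, 'b) l2 \<Rightarrow> ('a, 'b) l2" is "\<lambda>f g i. f i + g i"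
  by (rule l2_add_summable)
lift_definition uminus_l2 :: "('a, 'b) l2 \<Rightarrow> ('a, 'b) l2" is "\<lambda>f i. - f i" by simp
lift_definition minus_l2 :: "('a, 'b) l2 \<Rightarrow> ('a, 'b) l2 \<Rightarrow> ('a, 'b) l2" is "\<lambda>f g i. f i - g i"
  using l2_add_summable [where g = "\<lambda>i. - g i" for g] by fastforce
lift_definition scaleC_l2 :: "complex \<Rightarrow> ('a, 'b) l2 \<Rightarrow> ('a, 'b) l2" is "\<lambda>a f i. a *\<^sub>C f i"
  by (rule l2_scaleC_summable)
lift_definition scaleR_l2 :: "real \<Rightarrow> ('a, 'b) l2 \<Rightarrow> ('a, 'b) l2" is "\<lambda>r f i. r *\<^sub>R f i"
  unfolding scaleR_scaleC by (rule l2_scaleC_summable)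
lift_definition cinner_l2 :: "('a, 'b) l2 \<Rightarrow> ('a, 'b) l2 \<Rightarrow> complex"
  is "\<lambda>f g. \<Sum>\<^sub>\<infinity>i. cinner (f i) (g i)" .

definition inner_l2 :: "('a, 'b) l2 \<Rightarrow> ('a, 'b) l2 \<Rightarrow> real" where
  "inner_l2 f g = Re (cinner f g)"
definition norm_l2 :: "('a, 'b) l2 \<Rightarrow> real" where
  "norm_l2 f = sqrt (inner f f)"
definition dist_l2 :: "('a, 'b) l2 \<Rightarrow> ('a, 'b) l2 \<Rightarrow> real" where
  "dist_l2 f g = norm (f - g)"
definition sgn_l2 :: "('a, 'b) l2 \<Rightarrow> ('a, 'b) l2" where
  "sgn_l2 f = inverse (norm f) *\<^sub>R f"
definition uniformity_l2 :: "(('a, 'b) l2 \<times> ('a, 'b) l2) filter" where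
  "uniformity_l2 = (INF e\<in>{0<..}. principal {(x, y). dist x y < e})"
definition open_l2 :: "('a, 'b) l2 set \<Rightarrow> bool" where
  "open_l2 U \<longleftrightarrow> (\<forall>x\<in>U. \<forall>\<^sub>F (x', y) in uniformity. x' = x \<longrightarrow> y \<in> U)"

lemma cinner_self_of_real: "cinner x x = complex_of_real ((norm (x :: 'c :: complex_inner))\<^sup>2)"
proof -
  have "Im (cinner x x) = 0" using cinner_commute [of x x] by (simp add: complex_eq_iff)
  then show ?thesis
    by (simp add: complex_eq_iff norm_eq_sqrt_inner inner_eq_Re_cinner [symmetric])
qed

lemma cinner_l2_self: "cinner f f = complex_of_real (\<Sum>\<^sub>\<infinity>i. (norm (Rep_l2 f i))\<^sup>2)"
  for f :: "('a, 'b) l2"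
proof -
  have "((\<lambda>i. (norm (Rep_l2 f i))\<^sup>2) has_sum (\<Sum>\<^sub>\<infinity>i. (norm (Rep_l2 f i))\<^sup>2)) UNIV"
    using Rep_l2 [of f] by (simp add: has_sum_infsum)
  then show ?thesis
    unfolding cinner_l2.rep_eq cinner_self_of_real
    by (intro infsumI) (rule has_sum_of_real)
qed

instance
proof
  fix x y z :: "('a, 'b) l2" and a b :: complex and r s :: real
  show "x + y + z = x + (y + z)" by transfer (simp add: add.assoc)
  show "x + y = y + x" by transfer (simp add: add.commute)
  show "0 + x = x" by transfer simp
  show "- x + x = 0" by transfer simp
  show "x - y = x + - y" by transfer simp
  show "r *\<^sub>R (x + y) = r *\<^sub>R x + r *\<^sub>R y" by transfer (simp add: scaleR_add_right)
  show "(r + s) *\<^sub>R x = r *\<^sub>R x + s *\<^sub>R x" by transfer (simp add: scaleR_add_left)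
  show "r *\<^sub>R s *\<^sub>R x = (r * s) *\<^sub>R x" by transfer simp
  show "1 *\<^sub>R x = x" by transfer simp
  show "a *\<^sub>C (x + y) = a *\<^sub>C x + a *\<^sub>C y" by transfer (simp add: scaleC_add_right)
  show "(a + b) *\<^sub>C x = a *\<^sub>C x + b *\<^sub>C x" by transfer (simp add: scaleC_add_left)
  show "a *\<^sub>C b *\<^sub>C x = (a * b) *\<^sub>C x" by transfer (simp add: scaleC_scaleC)
  show "r *\<^sub>R x = complex_of_real r *\<^sub>C x" by transfer (simp add: scaleR_scaleC)
  show comm: "cinner x y = cnj (cinner y x)" for x y :: "('a, 'b) l2"
    by transfer (subst cinner_commute, simp)
  show addr: "cinner x (y + z) = cinner x y + cinner x z" for x y z :: "('a, 'b) l2"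
    by transfer (simp add: cinner_add_right infsum_add l2_cinner_summable)
  show scr: "cinner x (a *\<^sub>C y) = a * cinner x y" for x y :: "('a, 'b) l2" and a
    by transfer (simp add: cinner_scaleC_right infsum_cmult_right l2_cinner_summable)
  show "inner x y = Re (cinner x y)" by (simp add: inner_l2_def)
  show sym: "inner x y = inner y x" for x y :: "('a, 'b) l2"
    using comm [of x y] by (simp add: inner_l2_def)
  show "inner (x + y) z = inner x z + inner y z"
    using addr [of z x y] by (simp add: sym [of _ z]) (simp add: inner_l2_def)
  have "r *\<^sub>R x = complex_of_real r *\<^sub>C x" by transfer (simp add: scaleR_scaleC)
  then show "inner (r *\<^sub>R x) y = r * inner x y"
    using scr [of y "complex_of_real r" x] by (simp add: sym [of _ y]) (simp add: inner_l2_def)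
  show "0 \<le> inner x x" by (simp add: inner_l2_def cinner_l2_self infsum_nonneg)
  show "inner x x = 0 \<longleftrightarrow> x = 0"
  proof
    assume "inner x x = 0"
    then have z: "(\<Sum>\<^sub>\<infinity>i. (norm (Rep_l2 x i))\<^sup>2) = 0" by (simp add: inner_l2_def cinner_l2_self)
    have "(norm (Rep_l2 x i))\<^sup>2 = 0" for i
      by (rule nonneg_infsum_le_0D [where A = UNIV and f = "\<lambda>i. (norm (Rep_l2 x i))\<^sup>2"])
        (use z Rep_l2 [of x] in auto)
    then have "Rep_l2 x = Rep_l2 0" by (auto simp: zero_l2.rep_eq)
    then show "x = 0" by (simp add: Rep_l2_inject)
  next
    assume "x = 0"
    then show "inner x x = 0" by (simp add: inner_l2_def cinner_l2_self zero_l2.rep_eq)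
  qed
  show "norm x = sqrt (inner x x)" by (rule norm_l2_def)
  show "dist x y = norm (x - y)" by (rule dist_l2_def)
  show "sgn x = scaleR (inverse (norm x)) x" by (rule sgn_l2_def)
  show "uniformity = (INF e\<in>{0<..}. principal {(x, y). dist x y < (e::real)} ::
      (('a, 'b) l2 \<times> ('a, 'b) l2) filter)" by (rule uniformity_l2_def)
  show "open U \<longleftrightarrow> (\<forall>x\<in>U. \<forall>\<^sub>F (x', y) in uniformity. x' = x \<longrightarrow> y \<in> U)"
    for U :: "('a, 'b) l2 set" by (rule open_l2_def)
qed

end

lemma norm_l2_power2: "(norm f)\<^sup>2 = (\<Sum>\<^sub>\<infinity>i. (norm (Rep_l2 f i))\<^sup>2)"
  for f :: "('i, 'a :: complex_inner) l2"
  by (simp add: norm_l2_def inner_l2_def cinner_l2_self infsum_nonneg)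

lemma sum_norm_Rep_l2_le: "finite F \<Longrightarrow> (\<Sum>i\<in>F. (norm (Rep_l2 f i))\<^sup>2) \<le> (norm f)\<^sup>2"
  for f :: "('i, 'a :: complex_inner) l2"
  unfolding norm_l2_power2 by (rule finite_sum_le_infsum) (use Rep_l2 [of f] in auto)

lemma norm_Rep_l2_le: "norm (Rep_l2 f i) \<le> norm f" for f :: "('i, 'a :: complex_inner) l2"
  using sum_norm_Rep_l2_le [of "{i}" f] by (simp add: power2_le_iff_abs_le)

instance l2 :: (type, chilbert_space) chilbert_space
proof
  fix X :: "nat \<Rightarrow> ('a, 'b) l2"
  assume X: "Cauchy X"
  have "Cauchy (\<lambda>n. Rep_l2 (X n) i)" for i
  proof (rule metric_CauchyI)
    fix e :: real assume "0 < e"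
    then obtain M where M: "\<forall>m\<ge>M. \<forall>n\<ge>M. dist (X m) (X n) < e"
      using X by (meson metric_CauchyD)
    have "dist (Rep_l2 (X m) i) (Rep_l2 (X n) i) \<le> dist (X m) (X n)" for m n
      using norm_Rep_l2_le [of "X m - X n" i] by (simp add: dist_norm minus_l2.rep_eq)
    with M show "\<exists>M. \<forall>m\<ge>M. \<forall>n\<ge>M. dist (Rep_l2 (X m) i) (Rep_l2 (X n) i) < e"
      by (meson le_less_trans)
  qed
  then have "\<forall>i. \<exists>l. (\<lambda>n. Rep_l2 (X n) i) \<longlonglongrightarrow> l"
    by (simp add: Cauchy_convergent_iff convergent_def)
  then obtain f where f: "\<And>i. (\<lambda>n. Rep_l2 (X n) i) \<longlonglongrightarrow> f i" by metis
  have bound: "\<exists>M. \<forall>m\<ge>M. \<forall>F. finite F \<longrightarrow> (\<Sum>i\<in>F. (norm (Rep_l2 (X m) i - f i))\<^sup>2) \<le> e\<^sup>2"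
    if "0 < e" for e :: real
  proof -
    obtain M where M: "\<forall>m\<ge>M. \<forall>n\<ge>M. dist (X m) (X n) < e"
      using X \<open>0 < e\<close> by (meson metric_CauchyD)
    have "(\<Sum>i\<in>F. (norm (Rep_l2 (X m) i - f i))\<^sup>2) \<le> e\<^sup>2" if "m \<ge> M" "finite F" for m F
    proof (rule tendsto_upperbound)
      show "(\<lambda>n. \<Sum>i\<in>F. (norm (Rep_l2 (X m) i - Rep_l2 (X n) i))\<^sup>2)
          \<longlonglongrightarrow> (\<Sum>i\<in>F. (norm (Rep_l2 (X m) i - f i))\<^sup>2)"
        by (intro tendsto_intros f)
      have "(\<Sum>i\<in>F. (norm (Rep_l2 (X m) i - Rep_l2 (X n) i))\<^sup>2) \<le> e\<^sup>2" if "n \<ge> M" for n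
      proof -
        have "(\<Sum>i\<in>F. (norm (Rep_l2 (X m) i - Rep_l2 (X n) i))\<^sup>2) \<le> (norm (X m - X n))\<^sup>2"
          using sum_norm_Rep_l2_le [OF \<open>finite F\<close>, of "X m - X n"] by (simp add: minus_l2.rep_eq)
        also have "\<dots> \<le> e\<^sup>2"
          using M \<open>m \<ge> M\<close> \<open>n \<ge> M\<close> by (intro power_mono) (auto simp: dist_norm less_imp_le)
        finally show ?thesis .
      qed
      then show "\<forall>\<^sub>F n in sequentially. (\<Sum>i\<in>F. (norm (Rep_l2 (X m) i - Rep_l2 (X n) i))\<^sup>2) \<le> e\<^sup>2"
        by (auto simp: eventually_sequentially)
    qed simp
    then show ?thesis by blast
  qed
  have summ: "(\<lambda>i. (norm (g i))\<^sup>2) summable_on UNIV"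
    if "\<forall>F. finite F \<longrightarrow> (\<Sum>i\<in>F. (norm (g i))\<^sup>2) \<le> c" for g :: "'a \<Rightarrow> 'b" and c
    using that by (intro nonneg_bdd_above_summable_on) (auto intro!: bdd_aboveI)
  obtain M where M: "\<forall>m\<ge>M. \<forall>F. finite F \<longrightarrow> (\<Sum>i\<in>F. (norm (Rep_l2 (X m) i - f i))\<^sup>2) \<le> 1\<^sup>2"
    using bound [of 1] by auto
  then have "(\<lambda>i. (norm (Rep_l2 (X M) i - f i))\<^sup>2) summable_on UNIV"
    by (intro summ) auto
  then have "(\<lambda>i. (norm (f i - Rep_l2 (X M) i))\<^sup>2) summable_on UNIV"
    by (simp add: norm_minus_commute)
  from l2_add_summable [OF this, of "Rep_l2 (X M)"] Rep_l2 [of "X M"]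
  have fl2: "(\<lambda>i. (norm (f i))\<^sup>2) summable_on UNIV" by simp
  define L where "L = Abs_l2 f"
  have L: "Rep_l2 L = f" using fl2 by (simp add: L_def Abs_l2_inverse)
  have "X \<longlonglongrightarrow> L"
  proof (rule metric_LIMSEQ_I)
    fix r :: real assume "0 < r"
    then obtain M where
      M: "\<forall>m\<ge>M. \<forall>F. finite F \<longrightarrow> (\<Sum>i\<in>F. (norm (Rep_l2 (X m) i - f i))\<^sup>2) \<le> (r/2)\<^sup>2"
      using bound [of "r/2"] by auto
    have "dist (X m) L < r" if "m \<ge> M" for m
    proof -
      have "(norm (X m - L))\<^sup>2 \<le> (r/2)\<^sup>2"
        unfolding norm_l2_power2
        by (rule infsum_le_finite_sums) (use M that Rep_l2 [of "X m - L"] in \<open>auto simp: minus_l2.rep_eq L\<close>)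
      then have "norm (X m - L) \<le> r/2"
        using \<open>0 < r\<close> by (simp add: power2_le_iff_abs_le)
      then show ?thesis using \<open>0 < r\<close> by (simp add: dist_norm)
    qed
    then show "\<exists>M. \<forall>m\<ge>M. dist (X m) L < r" by blast
  qed
  then show "convergent X" by (auto simp: convergent_def)
qed


section \<open>Subspaces and bounded operators\<close>

definition csubspace :: "'a :: complex_inner set \<Rightarrow> bool" where
  "csubspace H \<longleftrightarrow> 0 \<in> H \<and> (\<forall>x\<in>H. \<forall>y\<in>H. x + y \<in> H) \<and> (\<forall>a. \<forall>x\<in>H. a *\<^sub>C x \<in> H)"

text \<open>Hilbert spaces are rendered as closed complex subspaces \<open>H\<close> of a type of class
  \<open>chilbert_space\<close>; \<open>H\<close> itself is a Hilbert space since the type is complete.\<close>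

definition hilbert :: "'a :: chilbert_space set \<Rightarrow> bool" where
  "hilbert H \<longleftrightarrow> csubspace H \<and> closed H"

definition clinear_on :: "'a set \<Rightarrow> ('a :: complex_inner \<Rightarrow> 'b :: complex_inner) \<Rightarrow> bool" where
  "clinear_on D T \<longleftrightarrow> (\<forall>x\<in>D. \<forall>y\<in>D. T (x + y) = T x + T y) \<and> (\<forall>a. \<forall>x\<in>D. T (a *\<^sub>C x) = a *\<^sub>C T x)"

text \<open>\<open>bounded_ops H\<close> is $\mathcal B(H)$.  Its elements are extensional on \<open>H\<close>, so that equality in
  $\mathcal B(H)$ is equality in HOL.\<close>

definition bounded_ops :: "'a :: chilbert_space set \<Rightarrow> ('a \<Rightarrow> 'a) set" where
  "bounded_ops H = {T \<in> H \<rightarrow>\<^sub>E H. clinear_on H T \<and> (\<exists>c. \<forall>x\<in>H. norm (T x) \<le> c * norm x)}"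

definition adjoint_pair :: "'a :: chilbert_space set \<Rightarrow> ('a \<Rightarrow> 'a) \<Rightarrow> ('a \<Rightarrow> 'a) \<Rightarrow> bool" where
  "adjoint_pair H S T \<longleftrightarrow> (\<forall>x\<in>H. \<forall>y\<in>H. cinner (S x) y = cinner x (T y))"

definition selfadjoint_ops :: "'a :: chilbert_space set \<Rightarrow> ('a \<Rightarrow> 'a) set" where
  "selfadjoint_ops H = {T \<in> bounded_ops H. adjoint_pair H T T}"

text \<open>The operator order; it is only used for selfadjoint operators, whose quadratic forms are real.\<close>

definition op_le :: "'a :: chilbert_space set \<Rightarrow> ('a \<Rightarrow> 'a) \<Rightarrow> ('a \<Rightarrow> 'a) \<Rightarrow> bool" where
  "op_le H S T \<longleftrightarrow> (\<forall>x\<in>H. Re (cinner x (S x)) \<le> Re (cinner x (T x)))"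

definition is_op_sup :: "'a :: chilbert_space set \<Rightarrow> ('a \<Rightarrow> 'a) set \<Rightarrow> ('a \<Rightarrow> 'a) \<Rightarrow> bool" where
  "is_op_sup H \<D> S \<longleftrightarrow> S \<in> selfadjoint_ops H \<and> (\<forall>T\<in>\<D>. op_le H T S) \<and>
     (\<forall>R\<in>selfadjoint_ops H. (\<forall>T\<in>\<D>. op_le H T R) \<longrightarrow> op_le H S R)"

definition unitary_ops :: "'a :: chilbert_space set \<Rightarrow> ('a \<Rightarrow> 'a) set" where
  "unitary_ops H =
     {T \<in> bounded_ops H. T ` H = H \<and> (\<forall>x\<in>H. \<forall>y\<in>H. cinner (T x) (T y) = cinner x y)}"

definition orth_proj :: "'a :: chilbert_space set \<Rightarrow> 'a \<Rightarrow> 'a" where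
  "orth_proj H x = (THE y. y \<in> H \<and> (\<forall>z\<in>H. cinner z (x - y) = 0))"


section \<open>Tuples of one-parameter unitary groups\<close>

definition unitary_group :: "'a :: chilbert_space set \<Rightarrow> (real \<Rightarrow> 'a \<Rightarrow> 'a) \<Rightarrow> bool" where
  "unitary_group H w \<longleftrightarrow> hilbert H \<and> separable_space (top_of_set H) \<and>
     (\<forall>t. w t \<in> unitary_ops H) \<and>
     (\<forall>s t. w (s + t) = compose H (w s) (w t)) \<and>
     (\<forall>x\<in>H. continuous_on UNIV (\<lambda>t. w t x))"

text \<open>A \<open>d\<close>-tuple is a family indexed by \<open>k < d\<close>; its values at \<open>k \<ge> d\<close> play no role.  The conditions
  on the space are repeated because of the case \<open>d = 0\<close>.\<close>

definition unitary_tuple ::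
  "nat \<Rightarrow> 'a :: chilbert_space set \<Rightarrow> (nat \<Rightarrow> real \<Rightarrow> 'a \<Rightarrow> 'a) \<Rightarrow> bool" where
  "unitary_tuple d H u \<longleftrightarrow> hilbert H \<and> separable_space (top_of_set H) \<and>
     (\<forall>k<d. unitary_group H (u k))"


subsection \<open>Equivalence\<close>

text \<open>Normality is preservation of suprema of bounded increasing nets of selfadjoint operators,
  a net being replaced by its range, an upward directed set.\<close>

definition normal_map ::
  "'a :: chilbert_space set \<Rightarrow> 'b :: chilbert_space set \<Rightarrow> (('a \<Rightarrow> 'a) \<Rightarrow> 'b \<Rightarrow> 'b) \<Rightarrow> bool" where
  "normal_map H L \<pi> \<longleftrightarrow>
     (\<forall>\<D> S. \<D> \<subseteq> selfadjoint_ops H \<and> \<D> \<noteq> {} \<and>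
        (\<forall>A\<in>\<D>. \<forall>B\<in>\<D>. \<exists>C\<in>\<D>. op_le H A C \<and> op_le H B C) \<and> is_op_sup H \<D> S
        \<longrightarrow> is_op_sup L (\<pi> ` \<D>) (\<pi> S))"

definition representation ::
  "'a :: chilbert_space set \<Rightarrow> 'b :: chilbert_space set \<Rightarrow> (('a \<Rightarrow> 'a) \<Rightarrow> 'b \<Rightarrow> 'b) \<Rightarrow> bool" where
  "representation H L \<pi> \<longleftrightarrow> \<pi> ` bounded_ops H \<subseteq> bounded_ops L \<and>
     \<pi> (\<lambda>x\<in>H. x) = (\<lambda>x\<in>L. x) \<and>
     (\<forall>S\<in>bounded_ops H. \<forall>T\<in>bounded_ops H. \<pi> (\<lambda>x\<in>H. S x + T x) = (\<lambda>x\<in>L. \<pi> S x + \<pi> T x)) \<and>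
     (\<forall>a. \<forall>T\<in>bounded_ops H. \<pi> (\<lambda>x\<in>H. a *\<^sub>C T x) = (\<lambda>x\<in>L. a *\<^sub>C \<pi> T x)) \<and>
     (\<forall>S\<in>bounded_ops H. \<forall>T\<in>bounded_ops H. \<pi> (compose H S T) = compose L (\<pi> S) (\<pi> T)) \<and>
     (\<forall>S\<in>bounded_ops H. \<forall>T\<in>bounded_ops H. adjoint_pair H S T \<longrightarrow> adjoint_pair L (\<pi> S) (\<pi> T))"

definition faithful_normal_rep ::
  "'a :: chilbert_space set \<Rightarrow> 'b :: chilbert_space set \<Rightarrow> (('a \<Rightarrow> 'a) \<Rightarrow> 'b \<Rightarrow> 'b) \<Rightarrow> bool" where
  "faithful_normal_rep H L \<pi> \<longleftrightarrow>
     representation H L \<pi> \<and> inj_on \<pi> (bounded_ops H) \<and> normal_map H L \<pi>"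

text \<open>The common Hilbert space \<open>L\<close> need not be separable; it ranges over the closed subspaces
  of \<open>'l ell2\<close>.\<close>

definition tuple_equiv :: "'l itself \<Rightarrow> nat \<Rightarrow>
    'a :: chilbert_space set \<Rightarrow> (nat \<Rightarrow> real \<Rightarrow> 'a \<Rightarrow> 'a) \<Rightarrow>
    'b :: chilbert_space set \<Rightarrow> (nat \<Rightarrow> real \<Rightarrow> 'b \<Rightarrow> 'b) \<Rightarrow> bool" where
  "tuple_equiv _ d H u K v \<longleftrightarrow>
     (\<exists>(L :: 'l ell2 set) \<pi> \<rho>. hilbert L \<and> faithful_normal_rep H L \<pi> \<and> faithful_normal_rep K L \<rho> \<and>
        (\<forall>k<d. \<forall>t. \<pi> (u k t) = \<rho> (v k t)))"


subsection \<open>Infinite multiplicity\<close>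

definition unitarily_equiv :: "nat \<Rightarrow>
    'a :: chilbert_space set \<Rightarrow> (nat \<Rightarrow> real \<Rightarrow> 'a \<Rightarrow> 'a) \<Rightarrow>
    'b :: chilbert_space set \<Rightarrow> (nat \<Rightarrow> real \<Rightarrow> 'b \<Rightarrow> 'b) \<Rightarrow> bool" where
  "unitarily_equiv d H u K v \<longleftrightarrow>
     (\<exists>W. clinear_on H W \<and> W ` H = K \<and> (\<forall>x\<in>H. \<forall>y\<in>H. cinner (W x) (W y) = cinner x y) \<and>
        (\<forall>k<d. \<forall>t. \<forall>x\<in>H. W (u k t x) = v k t (W x)))"

text \<open>$H \otimes \ell^2(\mathbb N)$ is realised as the space of square-summable sequences in \<open>H\<close>, the
  elementary tensor $x \otimes f$ being the sequence with entries \<open>f n *\<^sub>C x\<close>; see the lemmas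
  \<open>cinner_elem_tensor\<close>, \<open>elem_tensor_total\<close> and \<open>ampl_op_elem_tensor\<close>.\<close>

definition ampl_space :: "'a :: chilbert_space set \<Rightarrow> (nat, 'a) l2 set" where
  "ampl_space H = {f. \<forall>n. Rep_l2 f n \<in> H}"

definition ampl_op :: "'a :: chilbert_space set \<Rightarrow> ('a \<Rightarrow> 'a) \<Rightarrow> (nat, 'a) l2 \<Rightarrow> (nat, 'a) l2" where
  "ampl_op H T = (\<lambda>f\<in>ampl_space H. Abs_l2 (\<lambda>n. T (Rep_l2 f n)))"

definition infinite_multiplicity ::
  "nat \<Rightarrow> 'a :: chilbert_space set \<Rightarrow> (nat \<Rightarrow> real \<Rightarrow> 'a \<Rightarrow> 'a) \<Rightarrow> bool" where
  "infinite_multiplicity d H u \<longleftrightarrow>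
     unitarily_equiv d H u (ampl_space H) (\<lambda>k t. ampl_op H (u k t))"

definition elem_tensor :: "'a :: chilbert_space \<Rightarrow> nat ell2 \<Rightarrow> (nat, 'a) l2" where
  "elem_tensor x f = Abs_l2 (\<lambda>n. Rep_l2 f n *\<^sub>C x)"

lemma Rep_elem_tensor: "Rep_l2 (elem_tensor x f) = (\<lambda>n. Rep_l2 f n *\<^sub>C x)"
proof -
  have "(\<lambda>n. (norm (Rep_l2 f n *\<^sub>C x))\<^sup>2) summable_on UNIV"
    using summable_on_cmult_left [of "\<lambda>n. (norm (Rep_l2 f n))\<^sup>2" UNIV "(norm x)\<^sup>2"] Rep_l2 [of f]
    by (simp add: norm_scaleC power_mult_distrib)
  then show ?thesis by (simp add: elem_tensor_def Abs_l2_inverse)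
qed

lemma cinner_elem_tensor: "cinner (elem_tensor x f) (elem_tensor y g) = cinner x y * cinner f g"
proof -
  have l: "cinner (a *\<^sub>C x) z = cnj a * cinner x z" for a and z :: 'a
    by (metis cinner_commute cinner_scaleC_right complex_cnj_mult)
  have "(\<lambda>n. cinner (Rep_l2 f n) (Rep_l2 g n)) summable_on UNIV"
    using Rep_l2 [of f] Rep_l2 [of g] by (auto intro: l2_cinner_summable)
  then show ?thesis
    by (simp add: cinner_l2.rep_eq Rep_elem_tensor l cinner_scaleC_right infsum_cmult_right
        [symmetric] cinner_complex_def mult_ac)
qed

lemma elem_tensor_total:
  assumes "hilbert H" "h \<in> ampl_space H" "\<And>x f. x \<in> H \<Longrightarrow> cinner (elem_tensor x f) h = 0"
  shows "h = 0"
proof -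
  have "Rep_l2 h n = 0" for n
  proof -
    define \<delta> :: "nat ell2" where "\<delta> = Abs_l2 (\<lambda>m. if m = n then 1 else 0)"
    have "(\<lambda>m. (cmod (if m = n then 1 else 0))\<^sup>2) summable_on UNIV"
      by (rule finite_nonzero_values_imp_summable_on) auto
    then have \<delta>: "Rep_l2 \<delta> = (\<lambda>m. if m = n then 1 else 0)"
      by (simp add: \<delta>_def Abs_l2_inverse)
    have z: "0 *\<^sub>C x = 0" for x :: 'a using scaleR_scaleC [of 0 x] by simp
    have o: "1 *\<^sub>C x = x" for x :: 'a using scaleR_scaleC [of 1 x] by simp
    have c0: "cinner 0 x = 0" for x :: 'a
      using cinner_scaleC_right [of x 0 0] cinner_commute [of 0 x] by (simp add: z)
    let ?x = "Rep_l2 h n"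
    have "0 = cinner (elem_tensor ?x \<delta>) h"
      using assms by (simp add: ampl_space_def)
    also have "\<dots> = (\<Sum>\<^sub>\<infinity>m. if m = n then cinner ?x ?x else 0)"
      by (simp add: cinner_l2.rep_eq Rep_elem_tensor \<delta> z o c0 if_distrib if_distribR cong: if_cong)
    also have "\<dots> = infsum (\<lambda>m. if m = n then cinner ?x ?x else 0) {n}"
      by (rule infsum_cong_neutral) auto
    also have "\<dots> = cinner ?x ?x" by simp
    finally show ?thesis by (simp add: cinner_self_of_real)
  qed
  then have "Rep_l2 h = Rep_l2 0" by (auto simp: zero_l2.rep_eq)
  then show ?thesis by (simp add: Rep_l2_inject)
qed

lemma ampl_op_elem_tensor:
  assumes "hilbert H" "T \<in> bounded_ops H" "x \<in> H"
  shows "ampl_op H T (elem_tensor x f) = elem_tensor (T x) f"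
proof -
  have "elem_tensor x f \<in> ampl_space H"
    using assms by (simp add: ampl_space_def Rep_elem_tensor hilbert_def csubspace_def)
  then show ?thesis
    using assms unfolding ampl_op_def
    by (simp add: Rep_elem_tensor bounded_ops_def clinear_on_def) (simp add: elem_tensor_def)
qed


section \<open>The dilation distance\<close>

definition dilates_to :: "'l itself \<Rightarrow> real \<Rightarrow> nat \<Rightarrow>
    'a :: chilbert_space set \<Rightarrow> (nat \<Rightarrow> real \<Rightarrow> 'a \<Rightarrow> 'a) \<Rightarrow>
    'b :: chilbert_space set \<Rightarrow> (nat \<Rightarrow> real \<Rightarrow> 'b \<Rightarrow> 'b) \<Rightarrow> bool" where
  "dilates_to universe c d H\<^sub>0 u K\<^sub>0 v \<longleftrightarrow>
     (\<exists>(H :: 'l ell2 set) K U V. H \<subseteq> K \<and> unitary_tuple d H U \<and> unitary_tuple d K V \<and>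
        tuple_equiv universe d H\<^sub>0 u H U \<and> tuple_equiv universe d K\<^sub>0 v K V \<and>
        (\<exists>C :: real \<Rightarrow> real. (\<forall>t. C t \<le> exp (t\<^sup>2 * c)) \<and>
           (\<forall>\<^sub>F t in nhds 0. \<forall>k<d. \<forall>x\<in>H. U k t x = C t *\<^sub>R orth_proj H (V k t x))))"

definition dilation_dist :: "'l itself \<Rightarrow> nat \<Rightarrow>
    'a :: chilbert_space set \<Rightarrow> (nat \<Rightarrow> real \<Rightarrow> 'a \<Rightarrow> 'a) \<Rightarrow>
    'b :: chilbert_space set \<Rightarrow> (nat \<Rightarrow> real \<Rightarrow> 'b \<Rightarrow> 'b) \<Rightarrow> ereal" where
  "dilation_dist universe d H u K v =
     max (Inf {ereal c | c. 0 < c \<and> dilates_to universe c d H u K v})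
         (Inf {ereal c | c. 0 < c \<and> dilates_to universe c d K v H u})"


section \<open>Unbounded selfadjoint operators and their exponentials\<close>

text \<open>An unbounded operator in \<open>H\<close> is given by its domain \<open>D\<close> and a function \<open>A\<close>, of which only the
  values on \<open>D\<close> matter.  The last condition says that the graph of the adjoint of \<open>A\<close> is the
  graph of \<open>A\<close>.\<close>

definition selfadjoint_operator ::
  "'a :: chilbert_space set \<Rightarrow> 'a set \<Rightarrow> ('a \<Rightarrow> 'a) \<Rightarrow> bool" where
  "selfadjoint_operator H D A \<longleftrightarrow> csubspace D \<and> D \<subseteq> H \<and> H \<subseteq> closure D \<and>
     A ` D \<subseteq> H \<and> clinear_on D A \<and>
     (\<forall>y\<in>H. \<forall>z\<in>H. (\<forall>x\<in>D. cinner y (A x) = cinner z x) \<longleftrightarrow> y \<in> D \<and> z = A y)"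

definition projection_valued_measure ::
  "'a :: chilbert_space set \<Rightarrow> (real set \<Rightarrow> 'a \<Rightarrow> 'a) \<Rightarrow> bool" where
  "projection_valued_measure H E \<longleftrightarrow>
     (\<forall>S\<in>sets borel. E S \<in> selfadjoint_ops H \<and> compose H (E S) (E S) = E S) \<and>
     E UNIV = (\<lambda>x\<in>H. x) \<and>
     (\<forall>F :: nat \<Rightarrow> real set. range F \<subseteq> sets borel \<and> disjoint_family F
        \<longrightarrow> (\<forall>x\<in>H. (\<lambda>n. E (F n) x) sums E (\<Union>n. F n) x))"

definition vector_measure ::
  "(real set \<Rightarrow> 'a \<Rightarrow> 'a) \<Rightarrow> 'a :: chilbert_space \<Rightarrow> real measure" where
  "vector_measure E x = measure_of UNIV (sets borel) (\<lambda>S. ennreal (Re (cinner x (E S x))))"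

text \<open>\<open>T\<close> with domain \<open>D\<close> is $\int f\,dE$; the quadratic form determines \<open>T\<close> by polarisation, as \<open>D\<close>
  is a dense subspace of \<open>H\<close>.\<close>

definition is_spectral_integral :: "'a :: chilbert_space set \<Rightarrow> (real set \<Rightarrow> 'a \<Rightarrow> 'a) \<Rightarrow>
    (real \<Rightarrow> complex) \<Rightarrow> 'a set \<Rightarrow> ('a \<Rightarrow> 'a) \<Rightarrow> bool" where
  "is_spectral_integral H E f D T \<longleftrightarrow>
     D = {x\<in>H. integrable (vector_measure E x) (\<lambda>s. (cmod (f s))\<^sup>2)} \<and>
     T ` D \<subseteq> H \<and> clinear_on D T \<and>
     (\<forall>x\<in>D. cinner x (T x) = (\<integral>s. f s \<partial>vector_measure E x))"

text \<open>\<open>is_exp_i t H D A T\<close> says that $T = \exp(itA)$ in the sense of the Borel functional calculus: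
  \<open>E\<close> is the spectral measure of \<open>A\<close>.\<close>

definition is_exp_i ::
  "real \<Rightarrow> 'a :: chilbert_space set \<Rightarrow> 'a set \<Rightarrow> ('a \<Rightarrow> 'a) \<Rightarrow> ('a \<Rightarrow> 'a) \<Rightarrow> bool" where
  "is_exp_i t H D A T \<longleftrightarrow>
     (\<exists>E. projection_valued_measure H E \<and> is_spectral_integral H E (\<lambda>s. complex_of_real s) D A \<and>
        is_spectral_integral H E (\<lambda>s. exp (\<i> * complex_of_real (t * s))) H T)"

end

theory Submission
  imports Defs "HOL-Probability.Probability"
begin

text \<open>A faithful normal representation is an ampliation up to unitary equivalence, so equivalent
  tuples embed, exactly intertwined, into each other's infinite ampliation.  If \<open>u\<close> dilates to \<open>v\<close>
  with $C(t) \le e^{ct^2}$, then $\lVert v_k(t) x - u_k(t) x \rVert \le \sqrt{2c}\,|t|\,\lVert x \rVert$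
  near $t = 0$.  The dilation distance thus provides, for every $c > \delta$, isometries of
  $H_0$ into $K_0^\infty$ and of $K_0$ into $H_0^\infty$ that intertwine up to $\sqrt{2c}\,|t|$.
  A swindle turns the first one into a unitary of $K_0^\infty$ onto $H_0^\infty \oplus K_0^\infty$
  at the cost of a factor $\sqrt 5$; combining the two directions gives a unitary of
  $K_0^\infty$ onto $H_0^\infty$ that intertwines up to $2\sqrt 5\,\sqrt{2c}\,|t|$, which is
  $5\sqrt 2\,\sqrt\delta\,|t|$ for $c = \frac 54 \delta$.

  The generator of a one-parameter group \<open>w\<close> has the domain of those \<open>x\<close> for which
  $\lVert w(t) x - x \rVert = O(|t|)$.  Hence two groups at distance at most $\varepsilon |t|$ near
  \<open>0\<close> have generators with the same domain, and comparing difference quotients bounds the difference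
  of the generators by $\varepsilon$.  Stone's theorem itself comes from Bochner's theorem for
  $t \mapsto \langle x, w(t) x \rangle$: the functional calculus is the $L^2$-continuous extension of
  the one for trigonometric polynomials.\<close>

section \<open>Complex inner product spaces\<close>

text \<open>Each half of the dilation distance only yields an isometry into an ampliation, never a
  unitary. A Cantor-Bernstein argument would cut the spaces along infinitely many ranges, each
  preserved only approximately by the groups. The swindle makes a single cut: an almost intertwining
  isometry of H into K lets the ampliation K' absorb the ampliation H' at a fixed cost. Absorbing in
  both directions leaves just two inexact steps, from K' to H' + K' and from K' + H' to H'. A second
  obstacle is that the space carrying an equivalence may be nonseparable, whereas an ampliation has
  countable multiplicity. So the structure theorem for normal representations is not established as
  a unitary equivalence; only a countable orthonormal part of the multiplicity space is extracted,
  large enough to carry the image of a separable space. Finally, dilations relate the groups only at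
  small times. Almost intertwining is local in time as well, which suffices because a generator is a
  derivative at 0; exact intertwining extends to all times by the group law.\<close>

interpretation scaleC: bounded_bilinear "scaleC :: complex \<Rightarrow> 'a :: complex_inner \<Rightarrow> 'a"
proof
  fix a b :: complex and x y :: 'a and r :: real
  show "(a + b) *\<^sub>C x = a *\<^sub>C x + b *\<^sub>C x" by (rule scaleC_add_left)
  show "a *\<^sub>C (x + y) = a *\<^sub>C x + a *\<^sub>C y" by (rule scaleC_add_right)
  show "(r *\<^sub>R a) *\<^sub>C x = r *\<^sub>R a *\<^sub>C x"
    by (simp add: scaleR_scaleC [of r "a *\<^sub>C x"] scaleC_scaleC scaleR_conv_of_real)
  show "a *\<^sub>C r *\<^sub>R x = r *\<^sub>R a *\<^sub>C x"
    by (simp add: scaleR_scaleC scaleC_scaleC mult.commute)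
  show "\<exists>K. \<forall>(a::complex) (x::'a). norm (a *\<^sub>C x) \<le> norm a * norm x * K"
    by (rule exI [of _ 1]) (simp add: norm_scaleC)
qed

lemma cinner_scaleC_left: "cinner (a *\<^sub>C x) y = cnj a * cinner x (y :: 'a :: complex_inner)"
  by (metis cinner_commute cinner_scaleC_right complex_cnj_mult)

text \<open>Conjugate linearity in the first argument does no harm, as
  \<open>bounded_bilinear\<close> refers to real scalars; the gain is the stock of rules for sums,
  differences, zero and limits.\<close>

interpretation cinner: bounded_bilinear "cinner :: 'a :: complex_inner \<Rightarrow> 'a \<Rightarrow> complex"
proof
  fix x y z :: 'a and r :: real
  show "cinner (x + y) z = cinner x z + cinner y z"
    by (metis cinner_add_right cinner_commute complex_cnj_add)
  show "cinner x (y + z) = cinner x y + cinner x z" by (rule cinner_add_right)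
  show "cinner (r *\<^sub>R x) y = r *\<^sub>R cinner x y"
    by (simp add: scaleR_scaleC [of r x] cinner_scaleC_left scaleR_conv_of_real)
  show "cinner x (r *\<^sub>R y) = r *\<^sub>R cinner x y"
    by (simp add: scaleR_scaleC [of r y] cinner_scaleC_right scaleR_conv_of_real)
  show "\<exists>K. \<forall>x y :: 'a. norm (cinner x y) \<le> norm x * norm y * K"
    by (rule exI [of _ 1]) (simp add: cmod_cinner_le)
qed

lemma scaleC_one [simp]: "1 *\<^sub>C x = (x :: 'a :: complex_inner)"
  using scaleR_scaleC [of 1 x] by simp

lemma cinner_self_eq_0 [simp]: "cinner x x = 0 \<longleftrightarrow> x = (0 :: 'a :: complex_inner)"
  by (simp add: cinner_self_of_real)

lemma norm_add_sq: "(norm (x + y))\<^sup>2 = (norm x)\<^sup>2 + (norm y)\<^sup>2 + 2 * Re (cinner x (y :: 'a :: complex_inner))"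
  by (simp add: power2_norm_eq_inner inner_add_left inner_add_right inner_commute
      flip: inner_eq_Re_cinner)

lemma norm_diff_sq: "(norm (x - y))\<^sup>2 = (norm x)\<^sup>2 + (norm y)\<^sup>2 - 2 * Re (cinner x (y :: 'a :: complex_inner))"
  using norm_add_sq [of x "-y"] by (simp add: cinner.minus_right)

lemma norm_add_sq_orth: "cinner x y = 0 \<Longrightarrow> (norm (x + y))\<^sup>2 = (norm x)\<^sup>2 + (norm (y :: 'a :: complex_inner))\<^sup>2"
  by (simp add: norm_add_sq)

lemma cinner_eq_0_commute: "cinner x y = 0 \<longleftrightarrow> cinner y (x :: 'a :: complex_inner) = 0"
  by (metis cinner_commute complex_cnj_zero)

lemma Re_cinner_commute: "Re (cinner x y) = Re (cinner y (x :: 'a :: complex_inner))"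
  by (subst cinner_commute) simp

lemma csubspace_0: "csubspace H \<Longrightarrow> 0 \<in> H"
  and csubspace_add: "csubspace H \<Longrightarrow> x \<in> H \<Longrightarrow> y \<in> H \<Longrightarrow> x + y \<in> H"
  and csubspace_scaleC: "csubspace H \<Longrightarrow> x \<in> H \<Longrightarrow> a *\<^sub>C x \<in> H"
  by (auto simp: csubspace_def)

lemma csubspace_scaleR: "csubspace H \<Longrightarrow> x \<in> H \<Longrightarrow> r *\<^sub>R x \<in> H"
  by (simp add: scaleR_scaleC csubspace_scaleC)

lemma csubspace_diff: "csubspace H \<Longrightarrow> x \<in> H \<Longrightarrow> y \<in> H \<Longrightarrow> x - y \<in> H"
  using csubspace_add [of H x "(-1) *\<^sub>C y"] csubspace_scaleC [of H y "-1"]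
  by (simp add: scaleC.minus_left)

lemma csubspace_sum: "csubspace H \<Longrightarrow> (\<And>i. i \<in> I \<Longrightarrow> f i \<in> H) \<Longrightarrow> sum f I \<in> H"
  by (induction I rule: infinite_finite_induct) (auto simp: csubspace_0 csubspace_add)

lemma clinear_on_add: "clinear_on H T \<Longrightarrow> x \<in> H \<Longrightarrow> y \<in> H \<Longrightarrow> T (x + y) = T x + T y"
  and clinear_on_scaleC: "clinear_on H T \<Longrightarrow> x \<in> H \<Longrightarrow> T (a *\<^sub>C x) = a *\<^sub>C T x"
  by (auto simp: clinear_on_def)

lemma clinear_on_0: "clinear_on H T \<Longrightarrow> csubspace H \<Longrightarrow> T 0 = 0"
  using clinear_on_scaleC [of H T 0 0] by (auto simp: csubspace_0 scaleC.zero_left)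

lemma clinear_on_diff: "clinear_on H T \<Longrightarrow> csubspace H \<Longrightarrow> x \<in> H \<Longrightarrow> y \<in> H \<Longrightarrow> T (x - y) = T x - T y"
  using clinear_on_add [of H T "x - y" y] by (auto simp: csubspace_diff)

lemma clinear_on_scaleR: "clinear_on H T \<Longrightarrow> x \<in> H \<Longrightarrow> T (r *\<^sub>R x) = r *\<^sub>R T x"
  by (simp add: scaleR_scaleC clinear_on_scaleC)

lemma clinear_on_sum:
  "clinear_on H T \<Longrightarrow> csubspace H \<Longrightarrow> (\<And>i. i \<in> I \<Longrightarrow> f i \<in> H) \<Longrightarrow> T (sum f I) = (\<Sum>i\<in>I. T (f i))"
  by (induction I rule: infinite_finite_induct)
    (auto simp: clinear_on_0 clinear_on_add csubspace_sum)

lemma hilbert_csubspace: "hilbert H \<Longrightarrow> csubspace H"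
  and hilbert_closed: "hilbert H \<Longrightarrow> closed H"
  by (auto simp: hilbert_def)

lemma csubspace_closure:
  fixes H :: "'a :: complex_inner set"
  assumes "csubspace H" shows "csubspace (closure H)"
  unfolding csubspace_def
proof (intro conjI ballI allI)
  show "0 \<in> closure H" using assms closure_subset csubspace_0 by blast
  fix x a assume x: "x \<in> closure H"
  then obtain f where f: "\<And>n. f n \<in> H" "f \<longlonglongrightarrow> x" by (auto simp: closure_sequential)
  have "(\<lambda>n. a *\<^sub>C f n) \<longlonglongrightarrow> a *\<^sub>C x" by (intro scaleC.tendsto f tendsto_const)
  then show "a *\<^sub>C x \<in> closure H"
    unfolding closure_sequential using assms f(1)
    by (intro exI [of _ "\<lambda>n. a *\<^sub>C f n"]) (simp add: csubspace_scaleC)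
  fix y assume "y \<in> closure H"
  then obtain g where g: "\<And>n. g n \<in> H" "g \<longlonglongrightarrow> y" by (auto simp: closure_sequential)
  have "(\<lambda>n. f n + g n) \<longlonglongrightarrow> x + y" by (intro tendsto_add f g)
  then show "x + y \<in> closure H"
    unfolding closure_sequential using assms f(1) g(1)
    by (intro exI [of _ "\<lambda>n. f n + g n"]) (simp add: csubspace_add)
qed

lemma hilbert_closure: "csubspace H \<Longrightarrow> hilbert (closure H)"
  by (simp add: hilbert_def csubspace_closure)

lemma orth_complement_closed:
  fixes y :: "'a :: complex_inner"
  shows "closed {x. cinner y x = 0}"
  by (intro closed_Collect_eq continuous_on_const cinner.continuous_on continuous_on_id)

lemma orth_closure:
  fixes y :: "'a :: complex_inner"
  assumes "\<And>x. x \<in> M \<Longrightarrow> cinner y x = 0" "x \<in> closure M"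
  shows "cinner y x = 0"
proof -
  have "closure M \<subseteq> {x. cinner y x = 0}"
    by (rule closure_minimal) (use assms orth_complement_closed in auto)
  then show ?thesis using assms by auto
qed

lemma orth_dense_imp_0:
  fixes y :: "'a :: complex_inner"
  assumes "\<And>x. x \<in> M \<Longrightarrow> cinner y x = 0" "y \<in> closure M"
  shows "y = 0"
  using orth_closure [of M y y] assms by simp


subsection \<open>Orthogonal projections\<close>

text \<open>A minimising sequence for the distance from \<open>x\<close> to \<open>M\<close> is
  Cauchy by the parallelogram law, since midpoints stay in \<open>M\<close>; minimality of the limit
  under perturbations within \<open>M\<close> is orthogonality.\<close>

lemma orth_proj_ex:
  fixes M :: "'a :: chilbert_space set"
  assumes M: "hilbert M"
  shows "\<exists>y\<in>M. \<forall>z\<in>M. cinner z (x - y) = 0"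
proof -
  have sub: "csubspace M" and cl: "closed M" using M by (auto simp: hilbert_def)
  define D where "D = (\<lambda>z. norm (x - z)) ` M"
  define \<delta> where "\<delta> = Inf D"
  have bdd: "bdd_below D" unfolding D_def by (rule bdd_belowI2 [of _ 0]) simp
  have ne: "D \<noteq> {}" using csubspace_0 [OF sub] by (auto simp: D_def)
  have \<delta>: "\<delta> \<le> norm (x - z)" if "z \<in> M" for z
    unfolding \<delta>_def using that bdd by (intro cInf_lower) (auto simp: D_def)
  have \<delta>0: "0 \<le> \<delta>" unfolding \<delta>_def using ne by (intro cInf_greatest) (auto simp: D_def)
  have "\<exists>z\<in>M. norm (x - z) < \<delta> + 1 / Suc n" for n
    using cInf_lessD [OF ne, of "\<delta> + 1 / Suc n"] by (auto simp: D_def \<delta>_def)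
  then obtain f where f: "\<And>n. f n \<in> M" "\<And>n. norm (x - f n) < \<delta> + 1 / Suc n" by metis
  have par: "(norm (a - b))\<^sup>2 \<le> 2 * ((norm (x - a))\<^sup>2 - \<delta>\<^sup>2) + 2 * ((norm (x - b))\<^sup>2 - \<delta>\<^sup>2)"
    if "a \<in> M" "b \<in> M" for a b
  proof -
    have "(1/2) *\<^sub>R (a + b) \<in> M" using sub that by (intro csubspace_scaleR csubspace_add)
    then have "\<delta>\<^sup>2 \<le> (norm (x - (1/2) *\<^sub>R (a + b)))\<^sup>2" using \<delta> \<delta>0 by (intro power_mono) auto
    also have "x - (1/2) *\<^sub>R (a + b) = (1/2) *\<^sub>R ((x - a) + (x - b))"
      by (simp add: algebra_simps flip: scaleR_add_left)
    finally have "4 * \<delta>\<^sup>2 \<le> (norm ((x - a) + (x - b)))\<^sup>2"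
      by (simp add: power_divide power2_eq_square)
    moreover have "(norm (a - b))\<^sup>2 + (norm ((x - a) + (x - b)))\<^sup>2
        = 2 * (norm (x - a))\<^sup>2 + 2 * (norm (x - b))\<^sup>2"
      using norm_diff_sq [of "x - b" "x - a"] norm_add_sq [of "x - a" "x - b"]
        Re_cinner_commute [of "x - a" "x - b"] by simp
    ultimately show ?thesis by (simp add: algebra_simps)
  qed
  have lim: "(\<lambda>n. norm (x - f n)) \<longlonglongrightarrow> \<delta>"
  proof (rule tendsto_sandwich [of "\<lambda>_. \<delta>" _ _ "\<lambda>n. \<delta> + 1 / Suc n"])
    show "(\<lambda>n. \<delta> + 1 / real (Suc n)) \<longlonglongrightarrow> \<delta>"
      using tendsto_add [OF tendsto_const LIMSEQ_inverse_real_of_nat, of \<delta>]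
      by (simp add: inverse_eq_divide)
    show "\<forall>\<^sub>F n in sequentially. norm (x - f n) \<le> \<delta> + 1 / Suc n"
      using f(2) by (intro always_eventually allI less_imp_le)
  qed (use f \<delta> in auto)
  have "Cauchy f"
  proof (rule metric_CauchyI)
    fix e :: real assume "0 < e"
    have "(\<lambda>n. 2 * ((norm (x - f n))\<^sup>2 - \<delta>\<^sup>2)) \<longlonglongrightarrow> 2 * (\<delta>\<^sup>2 - \<delta>\<^sup>2)"
      by (intro tendsto_intros lim)
    then have "\<forall>\<^sub>F n in sequentially. 2 * ((norm (x - f n))\<^sup>2 - \<delta>\<^sup>2) < e\<^sup>2 / 2"
      using \<open>0 < e\<close> by (intro order_tendstoD(2)) auto
    then obtain N where N: "\<And>n. n \<ge> N \<Longrightarrow> 2 * ((norm (x - f n))\<^sup>2 - \<delta>\<^sup>2) < e\<^sup>2 / 2"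
      by (auto simp: eventually_sequentially)
    have "dist (f m) (f n) < e" if "m \<ge> N" "n \<ge> N" for m n
    proof -
      have "(norm (f m - f n))\<^sup>2 < e\<^sup>2"
        using par [OF f(1) f(1), of m n] N [OF that(1)] N [OF that(2)] by linarith
      then show ?thesis using \<open>0 < e\<close> by (simp add: dist_norm power2_less_imp_less)
    qed
    then show "\<exists>N. \<forall>m\<ge>N. \<forall>n\<ge>N. dist (f m) (f n) < e" by blast
  qed
  then obtain y where y: "f \<longlonglongrightarrow> y" by (auto simp: Cauchy_convergent_iff convergent_def)
  have "y \<in> M" using closed_sequentially [OF cl] f(1) y by blast
  have dy: "norm (x - y) = \<delta>"
    by (rule LIMSEQ_unique [OF _ lim]) (intro tendsto_intros y)
  have "cinner z (x - y) = 0" if z: "z \<in> M" for z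
  proof (cases "z = 0")
    case False
    \<comment> \<open>The coefficient of \<open>x - y\<close> along \<open>z\<close>: subtracting
      this component would shorten \<open>x - y\<close> below the minimal distance unless
      \<open>a = 0\<close>.\<close>
    define a where "a = cinner z (x - y) / of_real ((norm z)\<^sup>2)"
    have "y + a *\<^sub>C z \<in> M" using sub z \<open>y \<in> M\<close> by (intro csubspace_add csubspace_scaleC)
    then have "\<delta>\<^sup>2 \<le> (norm (x - (y + a *\<^sub>C z)))\<^sup>2" using \<delta> \<delta>0 by (intro power_mono) auto
    also have "x - (y + a *\<^sub>C z) = (x - y) - a *\<^sub>C z" by simp
    also have "(norm ((x - y) - a *\<^sub>C z))\<^sup>2
        = \<delta>\<^sup>2 + (cmod a)\<^sup>2 * (norm z)\<^sup>2 - 2 * Re (a * cinner (x - y) z)"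
      by (simp add: norm_diff_sq dy norm_scaleC power_mult_distrib cinner_scaleC_right)
    also have "a * cinner (x - y) z = of_real ((cmod a)\<^sup>2 * (norm z)\<^sup>2)"
    proof -
      have "cinner z (x - y) = a * of_real ((norm z)\<^sup>2)" using False by (simp add: a_def)
      then have "cinner (x - y) z = cnj a * of_real ((norm z)\<^sup>2)"
        using cinner_commute [of "x - y" z] by simp
      then show ?thesis by (simp flip: complex_norm_square mult.assoc)
    qed
    finally have "(cmod a)\<^sup>2 * (norm z)\<^sup>2 \<le> 0" by (simp add: mult.commute)
    then have "(cmod a * norm z)\<^sup>2 \<le> 0" by (simp add: power_mult_distrib mult.commute)
    then have "a = 0" using False by simp
    then show ?thesis using False by (simp add: a_def)
  qed (simp add: cinner.zero_left)
  with \<open>y \<in> M\<close> show ?thesis by blast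
qed

lemma orth_proj_unique:
  fixes M :: "'a :: chilbert_space set"
  assumes M: "csubspace M" and "y \<in> M" "\<And>z. z \<in> M \<Longrightarrow> cinner z (x - y) = 0"
  shows "orth_proj M x = y"
  unfolding orth_proj_def
proof (rule the_equality)
  show "y \<in> M \<and> (\<forall>z\<in>M. cinner z (x - y) = 0)" using assms by blast
  fix w assume w: "w \<in> M \<and> (\<forall>z\<in>M. cinner z (x - w) = 0)"
  then have "y - w \<in> M" using M assms csubspace_diff by blast
  then have "cinner (y - w) ((x - w) - (x - y)) = 0"
    using w assms(3) by (subst cinner.diff_right) simp
  then show "w = y" by simp
qed

lemma orth_proj_in: "hilbert M \<Longrightarrow> orth_proj M x \<in> M"
  and orth_proj_orth: "hilbert M \<Longrightarrow> z \<in> M \<Longrightarrow> cinner z (x - orth_proj M x) = 0"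
proof -
  assume M: "hilbert M"
  obtain y where y: "y \<in> M" "\<And>z. z \<in> M \<Longrightarrow> cinner z (x - y) = 0" using orth_proj_ex [OF M] by blast
  then have "orth_proj M x = y" by (rule orth_proj_unique [OF hilbert_csubspace [OF M]])
  with y show "orth_proj M x \<in> M" and "z \<in> M \<Longrightarrow> cinner z (x - orth_proj M x) = 0" by auto
qed

lemma orth_proj_id: "csubspace M \<Longrightarrow> x \<in> M \<Longrightarrow> orth_proj M x = x"
  by (rule orth_proj_unique) (auto simp: cinner.zero_right)

lemma cinner_orth_proj: "hilbert M \<Longrightarrow> z \<in> M \<Longrightarrow> cinner z (orth_proj M x) = cinner z x"
  using orth_proj_orth [of M z x] by (simp add: cinner.diff_right)

lemma orth_proj_add: "hilbert M \<Longrightarrow> orth_proj M (x + y) = orth_proj M x + orth_proj M y"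
  by (rule orth_proj_unique)
    (auto simp: hilbert_csubspace orth_proj_in csubspace_add cinner.diff_right cinner.add_right
      cinner_orth_proj)

lemma orth_proj_scaleC: "hilbert M \<Longrightarrow> orth_proj M (a *\<^sub>C x) = a *\<^sub>C orth_proj M x"
  by (rule orth_proj_unique)
    (auto simp: hilbert_csubspace orth_proj_in csubspace_scaleC cinner.diff_right
      cinner_scaleC_right cinner_orth_proj)

lemma orth_proj_diff: "hilbert M \<Longrightarrow> orth_proj M (x - y) = orth_proj M x - orth_proj M y"
  using orth_proj_add [of M "x - y" y] by simp

lemma norm_orth_proj_sq:
  "hilbert M \<Longrightarrow> (norm x)\<^sup>2 = (norm (orth_proj M x))\<^sup>2 + (norm (x - orth_proj M x))\<^sup>2"
  using norm_add_sq_orth [of "orth_proj M x" "x - orth_proj M x"]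
  by (simp add: orth_proj_orth orth_proj_in)

lemma norm_orth_proj_le: "hilbert M \<Longrightarrow> norm (orth_proj M x) \<le> norm x"
  using norm_orth_proj_sq [of M x] by (simp add: power2_le_imp_le)

lemma norm_orth_proj_compl_le: "hilbert M \<Longrightarrow> norm (x - orth_proj M x) \<le> norm x"
  using norm_orth_proj_sq [of M x] by (simp add: power2_le_imp_le)


subsection \<open>Isometries\<close>

definition isometry_on ::
  "'a :: chilbert_space set \<Rightarrow> 'b :: chilbert_space set \<Rightarrow> ('a \<Rightarrow> 'b) \<Rightarrow> bool" where
  "isometry_on H K S \<longleftrightarrow> clinear_on H S \<and> S ` H \<subseteq> K \<and> (\<forall>x\<in>H. norm (S x) = norm x)"

lemma isometry_onD:
  assumes "isometry_on H K S"
  shows "clinear_on H S" "x \<in> H \<Longrightarrow> S x \<in> K" "x \<in> H \<Longrightarrow> norm (S x) = norm x"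
  using assms by (auto simp: isometry_on_def)

text \<open>Polarisation: norms of sums determine the real part, and passing from \<open>y\<close>
  to -i times \<open>y\<close> turns the imaginary part into a real part.\<close>

lemma isometry_on_cinner:
  assumes S: "isometry_on H K S" and H: "csubspace H" and x: "x \<in> H" and y: "y \<in> H"
  shows "cinner (S x) (S y) = cinner x y"
proof -
  have Re: "Re (cinner (S u) (S v)) = Re (cinner u v)" if "u \<in> H" "v \<in> H" for u v
  proof -
    have "(norm (S u + S v))\<^sup>2 = (norm (u + v))\<^sup>2"
      using isometry_onD(3) [OF S csubspace_add [OF H that]]
        clinear_on_add [OF isometry_onD(1) [OF S] that] by simp
    then show ?thesis
      using that by (simp add: norm_add_sq isometry_onD(3) [OF S])
  qed
  have "S ((-\<i>) *\<^sub>C y) = (-\<i>) *\<^sub>C S y"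
    by (rule clinear_on_scaleC [OF isometry_onD(1) [OF S] y])
  then have "Im (cinner (S x) (S y)) = Im (cinner x y)"
    using Re [of x "(-\<i>) *\<^sub>C y"] x y H
    by (simp add: cinner_scaleC_right csubspace_scaleC del: scaleC.minus_left)
  with Re x y show ?thesis by (simp add: complex_eq_iff)
qed

lemma isometry_on_inj:
  assumes S: "isometry_on H K S" and H: "csubspace H"
  shows "inj_on S H"
proof (rule inj_onI)
  fix x y assume "x \<in> H" "y \<in> H" "S x = S y"
  then have "norm (S (x - y)) = 0"
    using clinear_on_diff [OF isometry_onD(1) [OF S] H, of x y] by simp
  then show "x = y"
    using isometry_onD(3) [OF S, of "x - y"] H \<open>x \<in> H\<close> \<open>y \<in> H\<close> by (simp add: csubspace_diff)
qed

lemma isometry_on_dist: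
  assumes S: "isometry_on H K S" and H: "csubspace H" "x \<in> H" "y \<in> H"
  shows "dist (S x) (S y) = dist x y"
  using clinear_on_diff [OF isometry_onD(1) [OF S] H] isometry_onD(3) [OF S, of "x - y"] H
  by (simp add: dist_norm csubspace_diff)

lemma csubspace_image:
  assumes "clinear_on H S" "csubspace H"
  shows "csubspace (S ` H)"
  unfolding csubspace_def
proof (intro conjI ballI allI)
  show "0 \<in> S ` H" using clinear_on_0 [OF assms] csubspace_0 [OF assms(2)] by force
  fix x a assume "x \<in> S ` H"
  then obtain u where u: "u \<in> H" "x = S u" by blast
  then show "a *\<^sub>C x \<in> S ` H"
    using assms by (intro image_eqI [of _ _ "a *\<^sub>C u"]) (auto simp: csubspace_scaleC clinear_on_scaleC)
  fix y assume "y \<in> S ` H"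
  then obtain v where v: "v \<in> H" "y = S v" by blast
  with u show "x + y \<in> S ` H"
    using assms by (intro image_eqI [of _ _ "u + v"]) (auto simp: csubspace_add clinear_on_add)
qed

text \<open>Closedness comes from completeness: the preimages of a convergent sequence are Cauchy
  because \<open>S\<close> preserves distances, and their limit stays in \<open>H\<close>.\<close>

lemma hilbert_isometry_image:
  assumes S: "isometry_on H K S" and H: "hilbert H"
  shows "hilbert (S ` H)"
  unfolding hilbert_def
proof
  have H': "csubspace H" using H by (rule hilbert_csubspace)
  show "csubspace (S ` H)" using S H' by (intro csubspace_image) (auto simp: isometry_on_def)
  show "closed (S ` H)"
    unfolding closed_sequential_limits
  proof (intro allI impI; elim conjE)
    fix f l assume f: "\<forall>n. f n \<in> S ` H" "f \<longlonglongrightarrow> l"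
    then have "\<forall>n. \<exists>x\<in>H. f n = S x" by auto
    then obtain g where g: "\<And>n. g n \<in> H" "\<And>n. f n = S (g n)" by metis
    have "Cauchy f" using f(2) by (rule LIMSEQ_imp_Cauchy)
    then have "Cauchy g"
      using g isometry_on_dist [OF S H'] by (simp add: Cauchy_def)
    then obtain x where x: "g \<longlonglongrightarrow> x" by (auto simp: Cauchy_convergent_iff convergent_def)
    have xH: "x \<in> H" by (rule closed_sequentially [OF hilbert_closed [OF H] _ x]) (simp add: g(1))
    have "(\<lambda>n. dist (g n) x) = (\<lambda>n. dist (f n) (S x))"
      using g isometry_on_dist [OF S H' _ xH] by simp
    then have "f \<longlonglongrightarrow> S x" using x tendsto_dist_iff [of g] tendsto_dist_iff [of f] by metis
    then have "l = S x" using f(2) LIMSEQ_unique by blast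
    then show "l \<in> S ` H" using xH by simp
  qed
qed

text \<open>The Hilbert space adjoint of the isometry \<open>S\<close>, obtained without the Riesz
  representation theorem: project onto the range and invert \<open>S\<close> there.\<close>

definition isom_adj :: "'a :: chilbert_space set \<Rightarrow> ('a \<Rightarrow> 'b :: chilbert_space) \<Rightarrow> 'b \<Rightarrow> 'a" where
  "isom_adj H S y = inv_into H S (orth_proj (S ` H) y)"

lemma isom_adj:
  assumes S: "isometry_on H K S" and H: "hilbert H"
  shows isom_adj_in: "isom_adj H S y \<in> H"
    and isom_adj_proj: "S (isom_adj H S y) = orth_proj (S ` H) y"
    and norm_isom_adj: "norm (isom_adj H S y) = norm (orth_proj (S ` H) y)"
    and isom_adj_isom: "x \<in> H \<Longrightarrow> isom_adj H S (S x) = x"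
    and cinner_isom_adj: "x \<in> H \<Longrightarrow> cinner x (isom_adj H S y) = cinner (S x) y"
proof -
  have M: "hilbert (S ` H)" using S H by (rule hilbert_isometry_image)
  have P: "orth_proj (S ` H) y \<in> S ` H" for y by (rule orth_proj_in [OF M])
  show i: "isom_adj H S y \<in> H" for y unfolding isom_adj_def using P by (rule inv_into_into)
  show e: "S (isom_adj H S y) = orth_proj (S ` H) y" for y
    unfolding isom_adj_def using P by (rule f_inv_into_f)
  show "norm (isom_adj H S y) = norm (orth_proj (S ` H) y)"
    using isometry_onD(3) [OF S i [of y]] e [of y] by simp
  show "isom_adj H S (S x) = x" if "x \<in> H"
    using that isometry_on_inj [OF S hilbert_csubspace [OF H]] orth_proj_id [of "S ` H" "S x"]
      hilbert_csubspace [OF M]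
    by (simp add: isom_adj_def)
  show "cinner x (isom_adj H S y) = cinner (S x) y" if "x \<in> H"
    using isometry_on_cinner [OF S hilbert_csubspace [OF H] that i [of y]]
      cinner_orth_proj [OF M, of "S x" y] that e by simp
qed

lemma isom_adj_linear:
  assumes S: "isometry_on H K S" and H: "hilbert H"
  shows "isom_adj H S (y + z) = isom_adj H S y + isom_adj H S z"
    and "isom_adj H S (a *\<^sub>C y) = a *\<^sub>C isom_adj H S y"
proof -
  note i = isom_adj_in [OF S H] and e = isom_adj_proj [OF S H]
  have M: "hilbert (S ` H)" using S H by (rule hilbert_isometry_image)
  note inj = isometry_on_inj [OF S hilbert_csubspace [OF H]]
  have H': "csubspace H" using H by (rule hilbert_csubspace)
  show "isom_adj H S (y + z) = isom_adj H S y + isom_adj H S z"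
    by (rule inj_onD [OF inj])
      (use i e M H' isometry_onD(1) [OF S] in \<open>auto simp: clinear_on_add orth_proj_add csubspace_add\<close>)
  show "isom_adj H S (a *\<^sub>C y) = a *\<^sub>C isom_adj H S y"
    by (rule inj_onD [OF inj])
      (use i e M H' isometry_onD(1) [OF S] in \<open>auto simp: clinear_on_scaleC orth_proj_scaleC csubspace_scaleC\<close>)
qed

subsection \<open>Orthonormalisation\<close>

text \<open>Zero vectors are admitted in an orthonormal system, so that no vector of a dependent
  sequence has to be discarded by the Gram-Schmidt process.\<close>

definition orthonormal_upto :: "(nat \<Rightarrow> 'a :: complex_inner) \<Rightarrow> nat \<Rightarrow> bool" where
  "orthonormal_upto e N \<longleftrightarrow> (\<forall>i<N. \<forall>j<N. i \<noteq> j \<longrightarrow> cinner (e i) (e j) = 0) \<and>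
     (\<forall>i<N. e i = 0 \<or> norm (e i) = 1)"

text \<open>For an orthonormal system in the above sense this is the orthogonal projection onto the
  span of the first \<open>N\<close> vectors.\<close>

definition partial_proj :: "(nat \<Rightarrow> 'a :: complex_inner) \<Rightarrow> nat \<Rightarrow> 'a \<Rightarrow> 'a" where
  "partial_proj e N y = (\<Sum>i<N. cinner (e i) y *\<^sub>C e i)"

text \<open>For orthonormal \<open>e\<close> this is the linear span, encoded by fixed points so
  that membership directly provides a stage \<open>N\<close> whose projection leaves the vector
  unchanged.\<close>

definition fin_span :: "(nat \<Rightarrow> 'a :: complex_inner) \<Rightarrow> 'a set" where
  "fin_span e = {z. \<exists>N. partial_proj e N z = z}"

lemma cinner_partial_proj:
  assumes "orthonormal_upto e N" "i < N"
  shows "cinner (e i) (partial_proj e N y) = cinner (e i) y"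
proof -
  have "cinner (e i) (partial_proj e N y) = (\<Sum>j<N. cinner (e j) y * cinner (e i) (e j))"
    by (simp add: partial_proj_def cinner.sum_right cinner_scaleC_right)
  also have "\<dots> = (\<Sum>j<N. if j = i then cinner (e i) y else 0)"
  proof (rule sum.cong)
    fix j assume "j \<in> {..<N}"
    then have "j \<noteq> i \<Longrightarrow> cinner (e i) (e j) = 0" "e i = 0 \<or> cinner (e i) (e i) = 1"
      using assms by (auto simp: orthonormal_upto_def cinner_self_of_real)
    then show "cinner (e j) y * cinner (e i) (e j) = (if j = i then cinner (e i) y else 0)"
      by (auto simp: cinner.zero_left)
  qed simp
  finally show ?thesis using assms by simp
qed

lemma partial_proj_add: "partial_proj e N (x + y) = partial_proj e N x + partial_proj e N y"
  by (simp add: partial_proj_def cinner.add_right scaleC.add_left sum.distrib)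

lemma partial_proj_scaleC: "partial_proj e N (a *\<^sub>C x) = a *\<^sub>C partial_proj e N x"
  by (simp add: partial_proj_def cinner_scaleC_right scaleC.sum_right scaleC_scaleC)

lemma partial_proj_diff: "partial_proj e N (x - y) = partial_proj e N x - partial_proj e N y"
  by (simp add: partial_proj_def cinner.diff_right scaleC.diff_left sum_subtractf)

lemma partial_proj_selfadjoint:
  "cinner (partial_proj e N x) y = cinner x (partial_proj e N y)"
proof -
  have "cnj (cinner (e i) x) = cinner x (e i)" for i by (metis cinner_commute)
  then show ?thesis
    by (simp add: partial_proj_def cinner.sum_left cinner.sum_right cinner_scaleC_left
        cinner_scaleC_right mult.commute)
qed

lemma partial_proj_partial_proj:
  assumes "orthonormal_upto e N" "M \<le> N"
  shows "partial_proj e M (partial_proj e N y) = partial_proj e M y"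
  unfolding partial_proj_def [of e M]
  using assms by (intro sum.cong) (auto simp: cinner_partial_proj)

lemma partial_proj_orth:
  assumes "orthonormal_upto e N"
  shows "cinner (partial_proj e N y) (y - partial_proj e N y) = 0"
  using partial_proj_partial_proj [OF assms order_refl, of y]
  by (simp add: partial_proj_selfadjoint partial_proj_diff cinner.zero_right)

lemma norm_partial_proj_sq:
  assumes "orthonormal_upto e N"
  shows "(norm (partial_proj e N y))\<^sup>2 = (\<Sum>i<N. (cmod (cinner (e i) y))\<^sup>2)"
proof -
  have "of_real ((norm (partial_proj e N y))\<^sup>2) = cinner y (partial_proj e N y)"
    using partial_proj_partial_proj [OF assms order_refl, of y]
    by (simp only: cinner_self_of_real [symmetric] partial_proj_selfadjoint)
  also have "\<dots> = (\<Sum>i<N. cinner (e i) y * cnj (cinner (e i) y))"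
  proof -
    have "cnj (cinner (e i) y) = cinner y (e i)" for i by (metis cinner_commute)
    then show ?thesis by (simp add: partial_proj_def cinner.sum_right cinner_scaleC_right)
  qed
  also have "\<dots> = of_real (\<Sum>i<N. (cmod (cinner (e i) y))\<^sup>2)"
    by (simp flip: complex_norm_square)
  finally show ?thesis using of_real_eq_iff by blast
qed

lemma norm_partial_proj_pythagoras:
  assumes "orthonormal_upto e N"
  shows "(norm y)\<^sup>2 = (norm (partial_proj e N y))\<^sup>2 + (norm (y - partial_proj e N y))\<^sup>2"
  using norm_add_sq_orth [OF partial_proj_orth [OF assms, of y]] by simp

lemma norm_diff_partial_proj_le:
  assumes "orthonormal_upto e N" shows "norm (y - partial_proj e N y) \<le> norm y"
  using norm_partial_proj_pythagoras [OF assms, of y] by (simp add: power2_le_imp_le)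

text \<open>A vector fixed at stage \<open>M\<close> is a combination of the first \<open>M\<close>
  vectors, hence orthogonal to all later ones, whose terms then vanish.\<close>

lemma partial_proj_fixed_mono:
  assumes e: "orthonormal_upto e N" and "M \<le> N" and z: "partial_proj e M z = z"
  shows "partial_proj e N z = z"
proof -
  have "cinner (e i) z = 0" if i: "M \<le> i" "i < N" for i
  proof -
    have "cinner (e i) z = cinner (e i) (partial_proj e M z)" using z by simp
    also have "\<dots> = (\<Sum>j<M. cinner (e j) z * cinner (e i) (e j))"
      by (simp add: partial_proj_def cinner.sum_right cinner_scaleC_right)
    also have "\<dots> = 0" using e i by (intro sum.neutral) (auto simp: orthonormal_upto_def)
    finally show ?thesis .
  qed
  then have "partial_proj e N z = partial_proj e M z"
    unfolding partial_proj_def using \<open>M \<le> N\<close>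
    by (intro sum.mono_neutral_right) (auto simp: scaleC.zero_left)
  with z show ?thesis by simp
qed

lemma csubspace_fin_span:
  assumes e: "\<And>N. orthonormal_upto e N"
  shows "csubspace (fin_span e)"
  unfolding csubspace_def
proof (intro conjI ballI allI)
  show "0 \<in> fin_span e" by (auto simp: fin_span_def partial_proj_def intro: exI [of _ 0])
  fix x a assume "x \<in> fin_span e"
  then obtain M where M: "partial_proj e M x = x" by (auto simp: fin_span_def)
  then show "a *\<^sub>C x \<in> fin_span e"
    unfolding fin_span_def by (auto simp: partial_proj_scaleC intro!: exI [of _ M])
  fix y assume "y \<in> fin_span e"
  then obtain N where N: "partial_proj e N y = y" by (auto simp: fin_span_def)
  have "partial_proj e (max M N) x = x" "partial_proj e (max M N) y = y"
    using partial_proj_fixed_mono [OF e _ M] partial_proj_fixed_mono [OF e _ N] by auto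
  then show "x + y \<in> fin_span e"
    unfolding fin_span_def by (auto simp: partial_proj_add intro!: exI [of _ "max M N"])
qed

lemma in_fin_span:
  assumes e: "\<And>N. orthonormal_upto e N" shows "e i \<in> fin_span e"
proof -
  have "partial_proj e (Suc i) (e i) = cinner (e i) (e i) *\<^sub>C e i"
    using e [of "Suc i"] unfolding partial_proj_def
    by (subst sum.remove [of _ i])
      (auto simp: orthonormal_upto_def scaleC.zero_left intro!: sum.neutral)
  also have "\<dots> = e i"
    using e [of "Suc i"] by (auto simp: orthonormal_upto_def cinner_self_of_real scaleC.zero_right)
  finally show ?thesis unfolding fin_span_def by blast
qed

text \<open>If \<open>z\<close> in the span is close to \<open>y\<close>, then from some stage on
  the remainder of \<open>y\<close> equals the remainder of \<open>y - z\<close>, which is no longer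
  than \<open>y - z\<close>.\<close>

lemma partial_proj_tendsto:
  assumes e: "\<And>N. orthonormal_upto e N" and y: "y \<in> closure (fin_span e)"
  shows "(\<lambda>N. partial_proj e N y) \<longlonglongrightarrow> y"
proof (rule metric_LIMSEQ_I)
  fix r :: real assume "0 < r"
  with y obtain z where z: "z \<in> fin_span e" "dist z y < r"
    by (meson closure_approachable)
  then obtain M where M: "partial_proj e M z = z" by (auto simp: fin_span_def)
  have "dist (partial_proj e N y) y < r" if "N \<ge> M" for N
  proof -
    have "y - partial_proj e N y = (y - z) - partial_proj e N (y - z)"
      using partial_proj_fixed_mono [OF e that M] by (simp add: partial_proj_diff)
    then have "norm (y - partial_proj e N y) \<le> norm (y - z)"
      using norm_diff_partial_proj_le [OF e, of "y - z" N] by (simp only:)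
    then show ?thesis using z(2) by (simp add: dist_norm norm_minus_commute)
  qed
  then show "\<exists>no. \<forall>n\<ge>no. dist (partial_proj e n y) y < r" by blast
qed

lemma parseval:
  assumes e: "\<And>N. orthonormal_upto e N" and y: "y \<in> closure (fin_span e)"
  shows "((\<lambda>i. (cmod (cinner (e i) y))\<^sup>2) has_sum (norm y)\<^sup>2) UNIV"
proof -
  have "(\<lambda>N. (norm (partial_proj e N y))\<^sup>2) \<longlonglongrightarrow> (norm y)\<^sup>2"
    by (intro tendsto_intros partial_proj_tendsto assms)
  then have "(\<lambda>i. (cmod (cinner (e i) y))\<^sup>2) sums (norm y)\<^sup>2"
    by (simp add: sums_def norm_partial_proj_sq [OF e])
  then show ?thesis by (intro norm_summable_imp_has_sum) (auto simp: sums_iff)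
qed

text \<open>\<open>sgn\<close> normalises a nonzero remainder and sends the remainder 0 of a
  dependent vector to 0, so one formula covers both cases.\<close>

fun gram_schmidt :: "(nat \<Rightarrow> 'a :: complex_inner) \<Rightarrow> nat \<Rightarrow> 'a" where
  "gram_schmidt x n = sgn (x n - (\<Sum>i<n. cinner (gram_schmidt x i) (x n) *\<^sub>C gram_schmidt x i))"

declare gram_schmidt.simps [simp del]

lemma gram_schmidt_eq: "gram_schmidt x n = sgn (x n - partial_proj (gram_schmidt x) n (x n))"
  unfolding partial_proj_def by (rule gram_schmidt.simps)

lemma orthonormal_gram_schmidt: "orthonormal_upto (gram_schmidt x) N"
proof (induction N)
  case 0 show ?case by (simp add: orthonormal_upto_def)
next
  case (Suc N)
  have "cinner (gram_schmidt x i) (gram_schmidt x N) = 0" if "i < N" for i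
    using cinner_partial_proj [OF Suc that]
    by (subst gram_schmidt_eq [of x N])
      (simp add: sgn_div_norm cinner.scaleR_right cinner.diff_right)
  moreover from this have "cinner (gram_schmidt x N) (gram_schmidt x i) = 0" if "i < N" for i
    using that cinner_eq_0_commute by blast
  moreover have "gram_schmidt x N = 0 \<or> norm (gram_schmidt x N) = 1"
    by (subst (1 2) gram_schmidt_eq) (simp add: norm_sgn sgn_zero_iff)
  ultimately show ?case using Suc unfolding orthonormal_upto_def less_Suc_eq by blast
qed

lemma in_fin_span_gram_schmidt: "x n \<in> fin_span (gram_schmidt x)"
proof -
  let ?e = "gram_schmidt x" and ?r = "x n - partial_proj (gram_schmidt x) n (x n)"
  have sub: "csubspace (fin_span ?e)" by (rule csubspace_fin_span [OF orthonormal_gram_schmidt])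
  have "norm ?r *\<^sub>R ?e n = ?r"
    by (subst gram_schmidt_eq) (cases "?r = 0"; simp add: sgn_div_norm)
  moreover have "norm ?r *\<^sub>R ?e n \<in> fin_span ?e"
    by (intro csubspace_scaleR sub in_fin_span orthonormal_gram_schmidt)
  ultimately have "?r \<in> fin_span ?e" by simp
  moreover have "partial_proj ?e n (x n) \<in> fin_span ?e"
    unfolding partial_proj_def
    by (intro csubspace_sum csubspace_scaleC sub in_fin_span orthonormal_gram_schmidt)
  ultimately show ?thesis using csubspace_add [OF sub, of ?r "partial_proj ?e n (x n)"] by simp
qed

lemma gram_schmidt_in:
  assumes "csubspace M" "\<And>i. x i \<in> M" shows "gram_schmidt x n \<in> M"
proof (induction n rule: less_induct)
  case (less n)
  have "partial_proj (gram_schmidt x) n (x n) \<in> M"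
    unfolding partial_proj_def using less by (intro csubspace_sum csubspace_scaleC assms) auto
  then show ?case
    by (subst gram_schmidt_eq)
      (auto simp: sgn_div_norm intro!: csubspace_scaleR csubspace_diff assms)
qed


subsection \<open>Separability\<close>

lemma separable_imp_dense_seq:
  assumes "separable_space (top_of_set H)" "H \<noteq> {}"
  obtains x :: "nat \<Rightarrow> 'a :: metric_space" where "range x \<subseteq> H" "H \<subseteq> closure (range x)"
proof -
  obtain C where C: "countable C" "C \<subseteq> H" "top_of_set H closure_of C = H"
    using assms by (auto simp: separable_space_def)
  then have "H \<subseteq> closure C" by (auto simp: closure_of_subtopology Int_absorb1)
  then have "C \<noteq> {}" using assms by auto
  then have "range (from_nat_into C) = C" using C by (simp add: range_from_nat_into)
  then show thesis using that [of "from_nat_into C"] C \<open>H \<subseteq> closure C\<close> by simp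
qed

lemma separable_spaceI:
  fixes H :: "'a :: metric_space set"
  assumes "countable C" "C \<subseteq> H" "H \<subseteq> closure C"
  shows "separable_space (top_of_set H)"
  unfolding separable_space_def
  using assms by (intro exI [of _ C]) (auto simp: closure_of_subtopology Int_absorb1)

lemma separable_isometry_image:
  fixes H :: "'a :: chilbert_space set"
  assumes S: "isometry_on H K S" and H: "csubspace H" and sep: "separable_space (top_of_set H)"
  shows "separable_space (top_of_set (S ` H))"
proof -
  obtain x where x: "range x \<subseteq> H" "H \<subseteq> closure (range (x :: nat \<Rightarrow> 'a))"
    using separable_imp_dense_seq [OF sep] csubspace_0 [OF H] by blast
  show ?thesis
  proof (rule separable_spaceI)
    show "countable (range (\<lambda>n. S (x n)))" by simp
    show "range (\<lambda>n. S (x n)) \<subseteq> S ` H" using x by auto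
    show "S ` H \<subseteq> closure (range (\<lambda>n. S (x n)))"
    proof (clarsimp simp: closure_approachable)
      fix y and r :: real assume "y \<in> H" "0 < r"
      then have "y \<in> closure (range x)" using x(2) by blast
      then obtain n where "dist (x n) y < r" using \<open>0 < r\<close> by (auto simp: closure_approachable)
      moreover have "x n \<in> H" using x(1) by blast
      ultimately show "\<exists>n. dist (S (x n)) (S y) < r"
        using isometry_on_dist [OF S H, of "x n" y] \<open>y \<in> H\<close> by (intro exI [of _ n]) simp
    qed
  qed
qed

lemma orthonormal_basis_exists:
  fixes H :: "'a :: chilbert_space set"
  assumes "csubspace H" and sep: "separable_space (top_of_set H)"
  shows "\<exists>e :: nat \<Rightarrow> 'a. (\<forall>N. orthonormal_upto e N) \<and> range e \<subseteq> H \<and> H \<subseteq> closure (fin_span e)"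
proof -
  obtain x where x: "range x \<subseteq> H" "H \<subseteq> closure (range (x :: nat \<Rightarrow> 'a))"
    using separable_imp_dense_seq [OF sep] csubspace_0 [OF assms(1)] by blast
  have "range x \<subseteq> fin_span (gram_schmidt x)" by (auto intro: in_fin_span_gram_schmidt)
  then have "H \<subseteq> closure (fin_span (gram_schmidt x))"
    using x(2) closure_mono by blast
  moreover have "gram_schmidt x n \<in> H" for n using x by (intro gram_schmidt_in assms) auto
  ultimately show ?thesis using orthonormal_gram_schmidt by blast
qed

text \<open>The coordinates with respect to an orthonormal basis are placed along an injection of
  the natural numbers into \<open>'l\<close>, which exists as \<open>'l\<close> is infinite;
  Parseval preserves the norm.\<close>

lemma separable_embeds_ell2:
  fixes H :: "'a :: chilbert_space set"
  assumes "csubspace H" and "separable_space (top_of_set H)"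
  shows "\<exists>\<Phi> :: 'a \<Rightarrow> 'l :: infinite ell2. isometry_on H UNIV \<Phi>"
proof -
  obtain e :: "nat \<Rightarrow> 'a"
    where e: "(\<forall>N. orthonormal_upto e N) \<and> range e \<subseteq> H \<and> H \<subseteq> closure (fin_span e)"
    using orthonormal_basis_exists [OF assms] by (rule exE)
  obtain \<iota> :: "nat \<Rightarrow> 'l" where \<iota>: "inj \<iota>"
    using infinite_countable_subset [OF infinite_UNIV] by blast
  define g where "g x l = (if l \<in> range \<iota> then cinner (e (inv \<iota> l)) x else 0)" for x l
  have hs: "((\<lambda>l. (norm (g x l))\<^sup>2) has_sum (norm x)\<^sup>2) UNIV" if "x \<in> H" for x
  proof -
    have "((\<lambda>i. (cmod (cinner (e i) x))\<^sup>2) has_sum (norm x)\<^sup>2) UNIV"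
      using e that by (intro parseval) auto
    then have "((\<lambda>l. (norm (g x l))\<^sup>2) has_sum (norm x)\<^sup>2) (range \<iota>)"
      using \<iota> by (subst has_sum_reindex) (auto simp: o_def g_def)
    then show ?thesis
      by (rule has_sum_cong_neutral [THEN iffD1, rotated -1]) (auto simp: g_def)
  qed
  then have Rep: "Rep_l2 (Abs_l2 (g x)) = g x" if "x \<in> H" for x
    using that by (intro Abs_l2_inverse) (auto simp: summable_on_def)
  have "isometry_on H UNIV (\<lambda>x. Abs_l2 (g x))"
    unfolding isometry_on_def clinear_on_def
  proof (intro conjI ballI allI)
    fix x assume x: "x \<in> H"
    have "(norm (Abs_l2 (g x)))\<^sup>2 = (norm x)\<^sup>2"
      unfolding norm_l2_power2 Rep [OF x] using hs [OF x] by (rule infsumI)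
    then show "norm (Abs_l2 (g x)) = norm x" by simp
    fix a
    have "Rep_l2 (Abs_l2 (g (a *\<^sub>C x))) = Rep_l2 (a *\<^sub>C Abs_l2 (g x))"
      using x assms
      by (auto simp: Rep csubspace_scaleC scaleC_l2.rep_eq g_def cinner_scaleC_right
          scaleC_complex_def)
    then show "Abs_l2 (g (a *\<^sub>C x)) = a *\<^sub>C Abs_l2 (g x)" by (simp add: Rep_l2_inject)
    fix y assume y: "y \<in> H"
    have "Rep_l2 (Abs_l2 (g (x + y))) = Rep_l2 (Abs_l2 (g x) + Abs_l2 (g y))"
      using x y assms by (auto simp: Rep csubspace_add plus_l2.rep_eq g_def cinner.add_right)
    then show "Abs_l2 (g (x + y)) = Abs_l2 (g x) + Abs_l2 (g y)" by (simp add: Rep_l2_inject)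
  qed simp
  then show ?thesis by blast
qed

section \<open>Ampliations\<close>

lemma l2_eqI: "(\<And>i. Rep_l2 f i = Rep_l2 g i) \<Longrightarrow> f = g"
  by (metis Rep_l2_inject ext)

lemma has_sum_norm_l2: "((\<lambda>i. (norm (Rep_l2 f i))\<^sup>2) has_sum (norm f)\<^sup>2) UNIV"
  for f :: "('i, 'a :: complex_inner) l2"
  using Rep_l2 [of f] by (simp add: norm_l2_power2 has_sum_infsum)

lemma l2_construct:
  fixes g :: "'i \<Rightarrow> 'a :: complex_inner"
  assumes "((\<lambda>i. (norm (g i))\<^sup>2) has_sum s) UNIV"
  shows "Rep_l2 (Abs_l2 g) = g" "(norm (Abs_l2 g))\<^sup>2 = s"
proof -
  show Rep: "Rep_l2 (Abs_l2 g) = g" using assms by (intro Abs_l2_inverse) (auto simp: summable_on_def)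
  show "(norm (Abs_l2 g))\<^sup>2 = s" unfolding norm_l2_power2 Rep using assms by (rule infsumI)
qed

lemma norm_l2_le:
  fixes f :: "('i, 'a :: complex_inner) l2" and g :: "('i, 'b :: complex_inner) l2"
  assumes "\<And>i. norm (Rep_l2 f i) \<le> c * norm (Rep_l2 g i)" "0 \<le> c"
  shows "norm f \<le> c * norm g"
proof -
  have "(norm f)\<^sup>2 \<le> c\<^sup>2 * (norm g)\<^sup>2"
  proof (rule has_sum_mono [OF has_sum_norm_l2 has_sum_cmult_right [OF has_sum_norm_l2]])
    show "(norm (Rep_l2 f i))\<^sup>2 \<le> c\<^sup>2 * (norm (Rep_l2 g i))\<^sup>2" for i
      using power_mono [OF assms(1) [of i], of 2] by (simp add: power_mult_distrib)
  qed
  then have "(norm f)\<^sup>2 \<le> (c * norm g)\<^sup>2" by (simp add: power_mult_distrib)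
  then show ?thesis by (rule power2_le_imp_le) (simp add: assms)
qed

lemma norm_l2_eq:
  fixes f :: "('i, 'a :: complex_inner) l2" and g :: "('i, 'b :: complex_inner) l2"
  assumes "\<And>i. norm (Rep_l2 f i) = norm (Rep_l2 g i)"
  shows "norm f = norm g"
  using norm_l2_le [of f 1 g] norm_l2_le [of g 1 f] assms by force

lemma hilbert_ampl_space:
  fixes H :: "'a :: chilbert_space set"
  assumes "hilbert H" shows "hilbert (ampl_space H)"
  unfolding hilbert_def
proof
  have H: "csubspace H" "closed H" using assms by (auto simp: hilbert_def)
  then show "csubspace (ampl_space H)"
    by (auto simp: csubspace_def ampl_space_def zero_l2.rep_eq plus_l2.rep_eq scaleC_l2.rep_eq)
  show "closed (ampl_space H)"
    unfolding closed_sequential_limits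
  proof (intro allI impI; elim conjE)
    fix X and L :: "(nat, 'a) l2" assume X: "\<forall>n. X n \<in> ampl_space H" "X \<longlonglongrightarrow> L"
    have "Rep_l2 L i \<in> H" for i
    proof (rule closed_sequentially [OF H(2)])
      show "Rep_l2 (X n) i \<in> H" for n using X by (auto simp: ampl_space_def)
      have "(\<lambda>n. norm (X n - L)) \<longlonglongrightarrow> 0" by (rule tendsto_norm_zero [OF LIM_zero [OF X(2)]])
      then have "(\<lambda>n. norm (Rep_l2 (X n) i - Rep_l2 L i)) \<longlonglongrightarrow> 0"
      proof (rule tendsto_sandwich [OF _ _ tendsto_const, rotated -1])
        show "\<forall>\<^sub>F n in sequentially. norm (Rep_l2 (X n) i - Rep_l2 L i) \<le> norm (X n - L)"
          by (intro always_eventually allI) (metis norm_Rep_l2_le minus_l2.rep_eq)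
      qed simp
      then show "(\<lambda>n. Rep_l2 (X n) i) \<longlonglongrightarrow> Rep_l2 L i"
        by (rule LIM_zero_cancel [OF tendsto_norm_zero_cancel])
    qed
    then show "L \<in> ampl_space H" by (simp add: ampl_space_def)
  qed
qed

section \<open>Ampliations of maps between different spaces\<close>

definition ampl_map ::
  "('a :: complex_inner \<Rightarrow> 'b :: complex_inner) \<Rightarrow> (nat, 'a) l2 \<Rightarrow> (nat, 'b) l2" where
  "ampl_map T f = Abs_l2 (\<lambda>n. T (Rep_l2 f n))"

lemma ampl_op_eq: "f \<in> ampl_space H \<Longrightarrow> ampl_op H T f = ampl_map T f"
  by (simp add: ampl_op_def ampl_map_def)

text \<open>\<open>Abs_l2\<close> reveals nothing about a sequence that is not square-summable; the
  bound, uniform over the entries of \<open>f\<close>, guarantees summability.\<close>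

lemma Rep_ampl_map:
  assumes "\<And>n. norm (T (Rep_l2 f n)) \<le> c * norm (Rep_l2 f n)"
  shows "Rep_l2 (ampl_map T f) = (\<lambda>n. T (Rep_l2 f n))"
  unfolding ampl_map_def
proof (intro Abs_l2_inverse CollectI, rule summable_on_comparison_test)
  show "(\<lambda>n. c\<^sup>2 * (norm (Rep_l2 f n))\<^sup>2) summable_on UNIV"
    using Rep_l2 [of f] by (intro summable_on_cmult_right) auto
  show "(norm (T (Rep_l2 f n)))\<^sup>2 \<le> c\<^sup>2 * (norm (Rep_l2 f n))\<^sup>2" for n
    using power_mono [OF assms(1) [of n], of 2] by (simp add: power_mult_distrib)
qed simp

lemma Rep_ampl_map_contraction:
  "(\<And>n. norm (T (Rep_l2 f n)) \<le> norm (Rep_l2 f n)) \<Longrightarrow> Rep_l2 (ampl_map T f) n = T (Rep_l2 f n)"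
  using Rep_ampl_map [of T f 1] by simp

lemma Rep_ampl_map_isometry:
  "isometry_on H K S \<Longrightarrow> f \<in> ampl_space H \<Longrightarrow> Rep_l2 (ampl_map S f) n = S (Rep_l2 f n)"
  by (rule Rep_ampl_map_contraction) (simp add: ampl_space_def isometry_onD)

lemma isometry_on_ampl:
  assumes S: "isometry_on H K S" and H: "hilbert H"
  shows "isometry_on (ampl_space H) (ampl_space K) (ampl_map S)"
proof -
  note R = Rep_ampl_map_isometry [OF S]
  have H': "csubspace (ampl_space H)" by (intro hilbert_csubspace hilbert_ampl_space H)
  have lin: "clinear_on H S" using S by (rule isometry_onD)
  show ?thesis
    unfolding isometry_on_def clinear_on_def
  proof (intro conjI ballI allI)
    show "ampl_map S ` ampl_space H \<subseteq> ampl_space K"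
      using isometry_onD(2) [OF S] by (auto simp: ampl_space_def R)
    fix f assume f: "f \<in> ampl_space H"
    then show "norm (ampl_map S f) = norm f"
      using isometry_onD(3) [OF S] by (intro norm_l2_eq) (auto simp: R ampl_space_def)
    show "ampl_map S (a *\<^sub>C f) = a *\<^sub>C ampl_map S f" for a
      using f clinear_on_scaleC [OF lin]
      by (intro l2_eqI)
        (simp add: R csubspace_scaleC [OF H' f] scaleC_l2.rep_eq, simp add: ampl_space_def)
    fix g assume g: "g \<in> ampl_space H"
    then show "ampl_map S (f + g) = ampl_map S f + ampl_map S g"
      using f clinear_on_add [OF lin]
      by (intro l2_eqI)
        (simp add: R csubspace_add [OF H' f] plus_l2.rep_eq, simp add: ampl_space_def)
  qed
qed

lemma ampl_map_inv:
  assumes S: "isometry_on H K S" and H: "hilbert H" and surj: "S ` H = K" and g: "g \<in> ampl_space K"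
  shows "\<exists>f\<in>ampl_space H. ampl_map S f = g"
proof -
  define h where "h n = inv_into H S (Rep_l2 g n)" for n
  have h: "h n \<in> H" "S (h n) = Rep_l2 g n" for n
    using g surj unfolding h_def ampl_space_def by (auto intro: inv_into_into f_inv_into_f)
  have "norm (h n) = norm (Rep_l2 g n)" for n using h isometry_onD(3) [OF S] by metis
  then have R: "Rep_l2 (Abs_l2 h) = h"
    using has_sum_norm_l2 [of g] by (intro l2_construct) auto
  then have "Abs_l2 h \<in> ampl_space H" using h by (simp add: ampl_space_def)
  moreover have "ampl_map S (Abs_l2 h) = g"
    using Rep_ampl_map_isometry [OF S \<open>Abs_l2 h \<in> ampl_space H\<close>] h R by (intro l2_eqI) simp
  ultimately show ?thesis by blast
qed

lemma ampl_map_surj: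
  assumes "isometry_on H K S" "hilbert H" "S ` H = K"
  shows "ampl_map S ` ampl_space H = ampl_space K"
  using ampl_map_inv [OF assms] isometry_onD(2) [OF isometry_on_ampl [OF assms(1,2)]] by blast

section \<open>Identification of the twofold ampliation with the simple one\<close>

definition flatten_l2 :: "(nat, (nat, 'a :: complex_inner) l2) l2 \<Rightarrow> (nat, 'a) l2" where
  "flatten_l2 F = Abs_l2 (\<lambda>n. case prod_decode n of (i, j) \<Rightarrow> Rep_l2 (Rep_l2 F i) j)"

lemma has_sum_prod_decode:
  "((\<lambda>n. g (prod_decode n)) has_sum s) UNIV \<longleftrightarrow> (g has_sum s) (UNIV \<times> UNIV)"
  using has_sum_reindex [OF inj_prod_decode [of UNIV], of g s] by (simp add: o_def surj_prod_decode)

text \<open>The sum over pairs may be taken row by row, the row sums being the squared norms of the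
  \<open>Rep_l2 F i\<close>; \<open>prod_decode\<close> reindexes the pairs by the natural
  numbers.\<close>

lemma flatten_l2:
  shows Rep_flatten_l2: "Rep_l2 (flatten_l2 F) n = (case prod_decode n of (i, j) \<Rightarrow> Rep_l2 (Rep_l2 F i) j)"
    and norm_flatten_l2: "norm (flatten_l2 F) = norm F"
proof -
  let ?g = "\<lambda>n. case prod_decode n of (i, j) \<Rightarrow> Rep_l2 (Rep_l2 F i) j"
  let ?h = "\<lambda>(i, j). (norm (Rep_l2 (Rep_l2 F i) j))\<^sup>2"
  have 1: "((\<lambda>j. ?h (i, j)) has_sum (norm (Rep_l2 F i))\<^sup>2) UNIV" for i
    using has_sum_norm_l2 [of "Rep_l2 F i"] by simp
  have "(?h has_sum (norm F)\<^sup>2) (UNIV \<times> UNIV)"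
  proof (rule has_sum_SigmaI [OF 1 has_sum_norm_l2])
    show "?h summable_on UNIV \<times> UNIV"
      using Rep_l2 [of F] by (intro summable_on_SigmaI [OF 1]) auto
  qed
  then have "((\<lambda>n. ?h (prod_decode n)) has_sum (norm F)\<^sup>2) UNIV" by (simp add: has_sum_prod_decode)
  then have "((\<lambda>n. (norm (?g n))\<^sup>2) has_sum (norm F)\<^sup>2) UNIV" by (simp add: case_prod_unfold)
  from l2_construct [OF this] show "Rep_l2 (flatten_l2 F) n = ?g n" "norm (flatten_l2 F) = norm F"
    unfolding flatten_l2_def by (auto simp: power2_eq_iff_nonneg)
qed

lemma isometry_on_flatten: "isometry_on (ampl_space (ampl_space H)) (ampl_space H) flatten_l2"
  unfolding isometry_on_def clinear_on_def
proof (intro conjI ballI allI)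
  show "flatten_l2 ` ampl_space (ampl_space H) \<subseteq> ampl_space H"
    by (auto simp: ampl_space_def Rep_flatten_l2 split: prod.splits)
qed (auto intro!: l2_eqI simp: norm_flatten_l2 Rep_flatten_l2 plus_l2.rep_eq scaleC_l2.rep_eq split: prod.splits)

text \<open>Cut \<open>g\<close> into rows along the pairing function. Fubini for nonnegative
  families makes each row, and the sequence of the row norms, square-summable.\<close>

lemma flatten_l2_surj: "flatten_l2 ` ampl_space (ampl_space H) = ampl_space H"
proof
  show "flatten_l2 ` ampl_space (ampl_space H) \<subseteq> ampl_space H"
    using isometry_on_flatten by (auto dest: isometry_onD)
  show "ampl_space H \<subseteq> flatten_l2 ` ampl_space (ampl_space H)"
  proof
    fix g assume g: "g \<in> ampl_space H"
    let ?h = "\<lambda>p. (norm (Rep_l2 g (prod_encode p)))\<^sup>2"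
    have "((\<lambda>n. ?h (prod_decode n)) has_sum (norm g)\<^sup>2) UNIV" using has_sum_norm_l2 [of g] by simp
    then have s: "?h summable_on UNIV \<times> UNIV"
      unfolding has_sum_prod_decode [of ?h] by (rule has_sum_imp_summable)
    have s1: "(\<lambda>j. ?h (i, j)) summable_on UNIV" for i
      using summable_on_SigmaD1 [of "\<lambda>i j. ?h (i, j)" UNIV "\<lambda>_. UNIV" i] s by (simp add: case_prod_unfold)
    define k where "k i = Abs_l2 (\<lambda>j. Rep_l2 g (prod_encode (i, j)))" for i
    have k: "Rep_l2 (k i) = (\<lambda>j. Rep_l2 g (prod_encode (i, j)))"
      "(norm (k i))\<^sup>2 = infsum (\<lambda>j. ?h (i, j)) UNIV" for i
      unfolding k_def using l2_construct [OF has_sum_infsum [OF s1 [of i]]] by auto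
    have "(\<lambda>i. (norm (k i))\<^sup>2) summable_on UNIV"
      unfolding k(2) by (rule summable_on_SigmaD [OF s s1])
    then have K: "Rep_l2 (Abs_l2 k) = k" by (intro Abs_l2_inverse) simp
    have "Abs_l2 k \<in> ampl_space (ampl_space H)" using g by (simp add: ampl_space_def K k)
    moreover have "flatten_l2 (Abs_l2 k) = g"
      by (rule l2_eqI) (simp add: Rep_flatten_l2 K k case_prod_unfold)
    ultimately show "g \<in> flatten_l2 ` ampl_space (ampl_space H)" by force
  qed
qed


subsection \<open>Direct sums\<close>

instantiation prod :: (complex_inner, complex_inner) complex_inner
begin
definition scaleC_prod :: "complex \<Rightarrow> 'a \<times> 'b \<Rightarrow> 'a \<times> 'b" where
  "scaleC_prod a p = (a *\<^sub>C fst p, a *\<^sub>C snd p)"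
definition cinner_prod :: "'a \<times> 'b \<Rightarrow> 'a \<times> 'b \<Rightarrow> complex" where
  "cinner_prod p q = cinner (fst p) (fst q) + cinner (snd p) (snd q)"
instance
proof
  fix x y :: "'a \<times> 'b"
  show "cinner x y = cnj (cinner y x)"
    unfolding cinner_prod_def by (metis cinner_commute complex_cnj_add)
qed (auto simp: scaleC_prod_def cinner_prod_def scaleC_add_right scaleC_add_left scaleC_scaleC
    cinner_add_right cinner_scaleC_right inner_prod_def inner_eq_Re_cinner algebra_simps
    scaleR_scaleC prod_eq_iff)
end

instance prod :: (chilbert_space, chilbert_space) chilbert_space ..

lemma hilbert_Times: "hilbert H \<Longrightarrow> hilbert K \<Longrightarrow> hilbert (H \<times> K)"
  by (auto simp: hilbert_def csubspace_def closed_Times scaleC_prod_def zero_prod_def)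

lemma norm_Pair_sq: "(norm (x, y))\<^sup>2 = (norm x)\<^sup>2 + (norm y)\<^sup>2"
  by (simp add: norm_Pair)

section \<open>Almost intertwining isometries\<close>

text \<open>What remains of a unitary tuple without continuity and separability. This algebraic part
  passes to ampliations and direct sums at once, and it is all that the estimates on intertwiners
  use.\<close>

definition isometric_action ::
  "nat \<Rightarrow> 'a :: chilbert_space set \<Rightarrow> (nat \<Rightarrow> real \<Rightarrow> 'a \<Rightarrow> 'a) \<Rightarrow> bool" where
  "isometric_action d H u \<longleftrightarrow> hilbert H \<and> (\<forall>k<d. (\<forall>t. isometry_on H H (u k t)) \<and>
     (\<forall>x\<in>H. u k 0 x = x) \<and> (\<forall>s t. \<forall>x\<in>H. u k (s + t) x = u k s (u k t x)))"

text \<open>The error is linear in \<open>t\<close> because division by \<open>t\<close> is to turn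
  it into a bound on generators. One neighbourhood of 0 serves all \<open>k\<close> and all vectors,
  which lets the estimate pass to ampliations.\<close>

definition almost_intertwines :: "nat \<Rightarrow> real \<Rightarrow>
    'a :: chilbert_space set \<Rightarrow> (nat \<Rightarrow> real \<Rightarrow> 'a \<Rightarrow> 'a) \<Rightarrow>
    'b :: chilbert_space set \<Rightarrow> (nat \<Rightarrow> real \<Rightarrow> 'b \<Rightarrow> 'b) \<Rightarrow> ('a \<Rightarrow> 'b) \<Rightarrow> bool" where
  "almost_intertwines d \<epsilon> H u K v S \<longleftrightarrow> isometry_on H K S \<and>
     (\<forall>\<^sub>F t in nhds 0. \<forall>k<d. \<forall>x\<in>H. norm (v k t (S x) - S (u k t x)) \<le> \<epsilon> * \<bar>t\<bar> * norm x)"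

lemma isometric_actionD:
  assumes "isometric_action d H u" "k < d"
  shows "isometry_on H H (u k t)" "x \<in> H \<Longrightarrow> u k 0 x = x"
    "x \<in> H \<Longrightarrow> u k (s + t) x = u k s (u k t x)" "x \<in> H \<Longrightarrow> u k t x \<in> H"
    "x \<in> H \<Longrightarrow> norm (u k t x) = norm x"
proof -
  show iso: "isometry_on H H (u k t)" using assms by (simp add: isometric_action_def)
  show "x \<in> H \<Longrightarrow> u k 0 x = x" "x \<in> H \<Longrightarrow> u k (s + t) x = u k s (u k t x)"
    using assms by (simp_all add: isometric_action_def)
  show "x \<in> H \<Longrightarrow> u k t x \<in> H" "x \<in> H \<Longrightarrow> norm (u k t x) = norm x"
    using isometry_onD(2,3) [OF iso] by auto
qed

lemma isometric_action_hilbert: "isometric_action d H u \<Longrightarrow> hilbert H"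
  by (simp add: isometric_action_def)

lemma cinner_isometric_action:
  assumes u: "isometric_action d H u" "k < d" and "x \<in> H" "y \<in> H"
  shows "cinner x (u k t y) = cinner (u k (- t) x) y"
proof -
  have "cinner (u k (- t) x) y = cinner (u k t (u k (- t) x)) (u k t y)"
    using isometry_on_cinner [OF isometric_actionD(1) [OF u, of t] hilbert_csubspace [OF
        isometric_action_hilbert [OF u(1)]] isometric_actionD(4) [OF u assms(3), of "-t"] assms(4)]
    by simp
  also have "u k t (u k (- t) x) = x"
    using isometric_actionD(3) [OF u assms(3), of t "- t"] isometric_actionD(2) [OF u assms(3)] by simp
  finally show ?thesis by simp
qed

lemma unitary_tuple_isometric_action:
  assumes "unitary_tuple d H u" shows "isometric_action d H u"
  unfolding isometric_action_def
proof (intro conjI allI impI ballI)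
  show "hilbert H" using assms by (simp add: unitary_tuple_def)
  fix k assume "k < d"
  then have g: "unitary_group H (u k)" using assms by (simp add: unitary_tuple_def)
  show iso: "isometry_on H H (u k t)" for t
  proof -
    have "u k t \<in> unitary_ops H" using g by (simp add: unitary_group_def)
    then have T: "clinear_on H (u k t)" "u k t ` H = H"
      "\<And>x. x \<in> H \<Longrightarrow> cinner (u k t x) (u k t x) = cinner x x"
      by (auto simp: unitary_ops_def bounded_ops_def)
    then have "(norm (u k t x))\<^sup>2 = (norm x)\<^sup>2" if "x \<in> H" for x
      using that unfolding cinner_self_of_real of_real_eq_iff by blast
    then show ?thesis using T by (simp add: isometry_on_def)
  qed
  fix x s t assume x: "x \<in> H"
  show comp: "u k (s + t) x = u k s (u k t x)" for s t
    using g x by (simp add: unitary_group_def compose_def)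
  have H: "csubspace H" using g by (simp add: unitary_group_def hilbert_def)
  \<comment> \<open>The definition of a group has no clause for time 0: the value there is
    idempotent and injective, hence the identity.\<close>
  have "u k 0 (u k 0 x) = u k 0 x" using comp [of 0 0] by simp
  then show "u k 0 x = x"
    using inj_onD [OF isometry_on_inj [OF iso H, of 0]] x isometry_onD(2) [OF iso [of 0] x] by blast
qed

lemma almost_intertwines_mono:
  assumes "almost_intertwines d \<epsilon> H u K v S" "\<epsilon> \<le> \<epsilon>'"
  shows "almost_intertwines d \<epsilon>' H u K v S"
  unfolding almost_intertwines_def
proof
  show "isometry_on H K S" using assms by (simp add: almost_intertwines_def)
  have "\<epsilon> * \<bar>t\<bar> * norm x \<le> \<epsilon>' * \<bar>t\<bar> * norm x" for t :: real and x :: 'a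
    using assms(2) by (intro mult_right_mono) auto
  note le = order_trans [OF _ this]
  have "\<forall>\<^sub>F t in nhds 0. \<forall>k<d. \<forall>x\<in>H. norm (v k t (S x) - S (u k t x)) \<le> \<epsilon> * \<bar>t\<bar> * norm x"
    using assms(1) by (simp add: almost_intertwines_def)
  then show "\<forall>\<^sub>F t in nhds 0. \<forall>k<d. \<forall>x\<in>H. norm (v k t (S x) - S (u k t x)) \<le> \<epsilon>' * \<bar>t\<bar> * norm x"
    by eventually_elim (use le in blast)
qed

lemma almost_intertwines_exact:
  assumes "isometry_on H K S" "\<And>k t x. k < d \<Longrightarrow> x \<in> H \<Longrightarrow> v k t (S x) = S (u k t x)"
  shows "almost_intertwines d 0 H u K v S"
  using assms by (auto simp: almost_intertwines_def)

lemma isometry_on_compose: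
  assumes "isometry_on H K S" "isometry_on K M T"
  shows "isometry_on H M (\<lambda>x. T (S x))"
  using assms by (auto simp: isometry_on_def clinear_on_def image_subset_iff)

text \<open>Errors add: w T S - T S u = (w T - T v) S + T (v S - S u), and neither \<open>S\<close>
  on the right nor \<open>T\<close> on the left changes norms.\<close>

lemma almost_intertwines_compose:
  assumes S: "almost_intertwines d \<epsilon> H u K v S" and T: "almost_intertwines d \<epsilon>' K v M w T"
    and u: "isometric_action d H u" and v: "isometric_action d K v"
  shows "almost_intertwines d (\<epsilon> + \<epsilon>') H u M w (\<lambda>x. T (S x))"
  unfolding almost_intertwines_def
proof
  have iS: "isometry_on H K S" and iT: "isometry_on K M T"
    using S T by (auto simp: almost_intertwines_def)
  then show "isometry_on H M (\<lambda>x. T (S x))" by (rule isometry_on_compose)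
  have K: "csubspace K" using v by (simp add: isometric_action_def hilbert_def)
  have "\<forall>\<^sub>F t in nhds 0. \<forall>k<d. \<forall>x\<in>H. norm (v k t (S x) - S (u k t x)) \<le> \<epsilon> * \<bar>t\<bar> * norm x"
    "\<forall>\<^sub>F t in nhds 0. \<forall>k<d. \<forall>x\<in>K. norm (w k t (T x) - T (v k t x)) \<le> \<epsilon>' * \<bar>t\<bar> * norm x"
    using S T by (auto simp: almost_intertwines_def)
  then show "\<forall>\<^sub>F t in nhds 0. \<forall>k<d. \<forall>x\<in>H.
      norm (w k t (T (S x)) - T (S (u k t x))) \<le> (\<epsilon> + \<epsilon>') * \<bar>t\<bar> * norm x"
  proof eventually_elim
    case (elim t)
    show ?case
    proof (intro allI impI ballI)
      fix k x assume k: "k < d" and x: "x \<in> H"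
      have Sx: "S x \<in> K" and Sux: "S (u k t x) \<in> K" and vSx: "v k t (S x) \<in> K"
        using isometry_onD(2) [OF iS] isometric_actionD(4) [OF u k] isometric_actionD(4) [OF v k] x
        by auto
      have "norm (T (v k t (S x)) - T (S (u k t x))) = norm (v k t (S x) - S (u k t x))"
        using isometry_on_dist [OF iT K vSx Sux] by (simp add: dist_norm)
      also have "\<dots> \<le> \<epsilon> * \<bar>t\<bar> * norm x" using elim(1) k x by blast
      finally have 1: "norm (T (v k t (S x)) - T (S (u k t x))) \<le> \<epsilon> * \<bar>t\<bar> * norm x" .
      have 2: "norm (w k t (T (S x)) - T (v k t (S x))) \<le> \<epsilon>' * \<bar>t\<bar> * norm x"
        using elim(2) k Sx isometry_onD(3) [OF iS x] by metis
      have "norm (w k t (T (S x)) - T (S (u k t x)))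
          \<le> norm (w k t (T (S x)) - T (v k t (S x))) + norm (T (v k t (S x)) - T (S (u k t x)))"
        by (rule norm_diff_triangle_ineq [of _ "T (v k t (S x))" "T (v k t (S x))", simplified])
      then show "norm (w k t (T (S x)) - T (S (u k t x))) \<le> (\<epsilon> + \<epsilon>') * \<bar>t\<bar> * norm x"
        using 1 2 by (simp add: distrib_right)
    qed
  qed
qed

lemma isometry_on_inv_into:
  assumes S: "isometry_on H K S" and H: "csubspace H" and surj: "S ` H = K"
  shows "isometry_on K H (inv_into H S)"
proof -
  note inj = isometry_on_inj [OF S H] and lin = isometry_onD(1) [OF S]
  have i: "inv_into H S y \<in> H" "S (inv_into H S y) = y" if "y \<in> K" for y
    using that surj by (auto intro: inv_into_into f_inv_into_f)
  have e: "inv_into H S y = x" if "x \<in> H" "S x = y" for x y using that inj by auto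
  show ?thesis
    unfolding isometry_on_def clinear_on_def
  proof (intro conjI ballI allI)
    show "inv_into H S ` K \<subseteq> H" using i by auto
    fix y assume y: "y \<in> K"
    show "norm (inv_into H S y) = norm y" using i [OF y] isometry_onD(3) [OF S] by metis
    show "inv_into H S (a *\<^sub>C y) = a *\<^sub>C inv_into H S y" for a
      using i [OF y] H lin by (intro e) (auto simp: csubspace_scaleC clinear_on_scaleC)
    fix z assume z: "z \<in> K"
    show "inv_into H S (y + z) = inv_into H S y + inv_into H S z"
      using i [OF y] i [OF z] H lin by (intro e) (auto simp: csubspace_add clinear_on_add)
  qed
qed

text \<open>Nothing is lost: apply the estimate for \<open>S\<close> at the preimage of
  \<open>y\<close> and use that \<open>S\<close> preserves distances.\<close>

lemma almost_intertwines_inverse: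
  assumes S: "almost_intertwines d \<epsilon> H u K v S" and surj: "S ` H = K"
    and u: "isometric_action d H u" and v: "isometric_action d K v"
  shows "almost_intertwines d \<epsilon> K v H u (inv_into H S)"
  unfolding almost_intertwines_def
proof
  have iS: "isometry_on H K S" using S by (auto simp: almost_intertwines_def)
  have H: "csubspace H" using u by (simp add: isometric_action_def hilbert_def)
  have i: "inv_into H S y \<in> H" "S (inv_into H S y) = y" if "y \<in> K" for y
    using that surj by (auto intro: inv_into_into f_inv_into_f)
  show iR: "isometry_on K H (inv_into H S)" by (rule isometry_on_inv_into [OF iS H surj])
  have "\<forall>\<^sub>F t in nhds 0. \<forall>k<d. \<forall>x\<in>H. norm (v k t (S x) - S (u k t x)) \<le> \<epsilon> * \<bar>t\<bar> * norm x"
    using S by (auto simp: almost_intertwines_def)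
  then show "\<forall>\<^sub>F t in nhds 0. \<forall>k<d. \<forall>y\<in>K.
      norm (u k t (inv_into H S y) - inv_into H S (v k t y)) \<le> \<epsilon> * \<bar>t\<bar> * norm y"
  proof eventually_elim
    case (elim t)
    show ?case
    proof (intro allI impI ballI)
      fix k y assume k: "k < d" and y: "y \<in> K"
      let ?x = "inv_into H S y"
      have vy: "v k t y \<in> K" and ux: "u k t ?x \<in> H"
        using isometric_actionD(4) [OF v k y] isometric_actionD(4) [OF u k i(1) [OF y]] by auto
      have "norm (u k t ?x - inv_into H S (v k t y)) = norm (S (u k t ?x) - v k t y)"
        using isometry_on_dist [OF iS H ux i(1) [OF vy]] i(2) [OF vy] by (simp add: dist_norm)
      also have "\<dots> = norm (v k t (S ?x) - S (u k t ?x))"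
        by (simp add: i(2) [OF y] norm_minus_commute)
      also have "\<dots> \<le> \<epsilon> * \<bar>t\<bar> * norm ?x" using elim k i(1) [OF y] by blast
      finally show "norm (u k t ?x - inv_into H S (v k t y)) \<le> \<epsilon> * \<bar>t\<bar> * norm y"
        using isometry_onD(3) [OF iR y] by simp
    qed
  qed
qed

abbreviation (input) "ampl_tuple H u \<equiv> \<lambda>k t. ampl_op H (u k t)"

lemma isometry_on_ampl_op:
  assumes "isometry_on H H T" "hilbert H"
  shows "isometry_on (ampl_space H) (ampl_space H) (ampl_op H T)"
  using isometry_on_ampl [OF assms] hilbert_csubspace [OF hilbert_ampl_space [OF assms(2)]]
  by (auto simp: isometry_on_def clinear_on_def ampl_op_eq csubspace_add csubspace_scaleC)

lemma isometric_action_ampl: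
  assumes u: "isometric_action d H u"
  shows "isometric_action d (ampl_space H) (ampl_tuple H u)"
  unfolding isometric_action_def
proof (intro conjI allI impI ballI)
  have H: "hilbert H" using u by (rule isometric_action_hilbert)
  show "hilbert (ampl_space H)" using H by (rule hilbert_ampl_space)
  fix k assume k: "k < d"
  show iso: "isometry_on (ampl_space H) (ampl_space H) (ampl_op H (u k t))" for t
    by (rule isometry_on_ampl_op [OF isometric_actionD(1) [OF u k] H])
  fix f assume f: "f \<in> ampl_space H"
  then have R: "Rep_l2 (ampl_map (u k t) f) n = u k t (Rep_l2 f n)" and "Rep_l2 f n \<in> H" for t n
    using Rep_ampl_map_isometry [OF isometric_actionD(1) [OF u k] f]
    by (auto simp: ampl_space_def)
  show "ampl_op H (u k 0) f = f"
    using f isometric_actionD(2) [OF u k] by (intro l2_eqI) (auto simp: ampl_op_eq R ampl_space_def)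
  fix s t
  have uf: "ampl_map (u k t) f \<in> ampl_space H"
    using isometry_onD(2) [OF iso f, of t] f by (simp add: ampl_op_eq)
  show "ampl_op H (u k (s + t)) f = ampl_op H (u k s) (ampl_op H (u k t) f)"
    using f uf Rep_ampl_map_isometry [OF isometric_actionD(1) [OF u k] uf]
      isometric_actionD(3) [OF u k]
    by (intro l2_eqI) (auto simp: ampl_op_eq R, simp add: ampl_space_def)
qed

text \<open>The estimate holds entry by entry for the same times \<open>t\<close>, so the constant
  survives summation over the entries.\<close>

lemma almost_intertwines_ampl:
  assumes S: "almost_intertwines d \<epsilon> H u K v S" and "0 \<le> \<epsilon>"
    and u: "isometric_action d H u" and v: "isometric_action d K v"
  shows "almost_intertwines d \<epsilon> (ampl_space H) (ampl_tuple H u) (ampl_space K) (ampl_tuple K v)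
    (ampl_map S)"
  unfolding almost_intertwines_def
proof
  have H: "hilbert H" using u by (rule isometric_action_hilbert)
  have iS: "isometry_on H K S" using S by (auto simp: almost_intertwines_def)
  show iA: "isometry_on (ampl_space H) (ampl_space K) (ampl_map S)"
    by (rule isometry_on_ampl [OF iS H])
  have "\<forall>\<^sub>F t in nhds 0. \<forall>k<d. \<forall>x\<in>H. norm (v k t (S x) - S (u k t x)) \<le> \<epsilon> * \<bar>t\<bar> * norm x"
    using S by (auto simp: almost_intertwines_def)
  then show "\<forall>\<^sub>F t in nhds 0. \<forall>k<d. \<forall>f\<in>ampl_space H. norm (ampl_op K (v k t) (ampl_map S f) -
      ampl_map S (ampl_op H (u k t) f)) \<le> \<epsilon> * \<bar>t\<bar> * norm f"
  proof eventually_elim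
    case (elim t)
    show ?case
    proof (intro allI impI ballI norm_l2_le)
      fix k f n assume k: "k < d" and f: "f \<in> ampl_space H"
      have uf: "ampl_map (u k t) f \<in> ampl_space H" and Sf: "ampl_map S f \<in> ampl_space K"
        using isometry_onD(2) [OF isometry_on_ampl [OF isometric_actionD(1) [OF u k] H] f]
          isometry_onD(2) [OF iA f] by auto
      have "Rep_l2 (ampl_op K (v k t) (ampl_map S f) - ampl_map S (ampl_op H (u k t) f)) n
          = v k t (S (Rep_l2 f n)) - S (u k t (Rep_l2 f n))"
        using Rep_ampl_map_isometry [OF isometric_actionD(1) [OF u k] f]
          Rep_ampl_map_isometry [OF isometric_actionD(1) [OF v k] Sf]
          Rep_ampl_map_isometry [OF iS f] Rep_ampl_map_isometry [OF iS uf]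
        by (simp add: minus_l2.rep_eq ampl_op_eq f Sf)
      then show "norm (Rep_l2 (ampl_op K (v k t) (ampl_map S f) - ampl_map S (ampl_op H (u k t) f)) n)
          \<le> \<epsilon> * \<bar>t\<bar> * norm (Rep_l2 f n)"
        using elim k f by (simp add: ampl_space_def)
    qed (use \<open>0 \<le> \<epsilon>\<close> in simp)
  qed
qed

lemma intertwines_flatten:
  assumes u: "isometric_action d H u"
  shows "almost_intertwines d 0 (ampl_space (ampl_space H)) (ampl_tuple (ampl_space H) (ampl_tuple H u))
    (ampl_space H) (ampl_tuple H u) flatten_l2"
proof (rule almost_intertwines_exact [OF isometry_on_flatten])
  fix k t F assume k: "k < d" and F: "F \<in> ampl_space (ampl_space H)"
  have H: "hilbert H" using u by (rule isometric_action_hilbert)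
  note iso = isometric_actionD(1) [OF u k, of t]
  have F': "Rep_l2 F n \<in> ampl_space H" for n using F by (simp add: ampl_space_def)
  have G: "flatten_l2 F \<in> ampl_space H" using F isometry_onD(2) [OF isometry_on_flatten] by blast
  show "ampl_op H (u k t) (flatten_l2 F) = flatten_l2 (ampl_op (ampl_space H) (ampl_op H (u k t)) F)"
    using Rep_ampl_map_isometry [OF iso G]
      Rep_ampl_map_isometry [OF isometry_on_ampl_op [OF iso H] F] Rep_ampl_map_isometry [OF iso F']
    by (intro l2_eqI) (simp add: ampl_op_eq F F' G Rep_flatten_l2 split: prod.splits)
qed

subsection \<open>The swindle\<close>

lemma has_sum_even_odd:
  fixes g :: "nat \<Rightarrow> real"
  shows "((\<lambda>n. g (2 * n)) has_sum a) UNIV \<Longrightarrow> ((\<lambda>n. g (2 * n + 1)) has_sum b) UNIV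
    \<Longrightarrow> (g has_sum (a + b)) UNIV"
proof -
  assume a: "((\<lambda>n. g (2 * n)) has_sum a) UNIV" and b: "((\<lambda>n. g (2 * n + 1)) has_sum b) UNIV"
  have "(g has_sum a) (range (\<lambda>n. 2 * n))" "(g has_sum b) (range (\<lambda>n. 2 * n + 1))"
    using a b by (simp_all add: has_sum_reindex inj_on_def o_def)
  moreover have "range (\<lambda>n::nat. 2 * n) \<inter> range (\<lambda>n. 2 * n + 1) = {}"
  proof (intro equals0I, elim IntE imageE)
    fix x m n :: nat assume "x = 2 * m" "x = 2 * n + 1" then show False by presburger
  qed
  ultimately have "(g has_sum (a + b)) (range (\<lambda>n. 2 * n) \<union> range (\<lambda>n. 2 * n + 1))"
    by (rule has_sum_Un_disjoint)
  also have "range (\<lambda>n::nat. 2 * n) \<union> range (\<lambda>n. 2 * n + 1) = UNIV"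
  proof (intro set_eqI iffI UNIV_I)
    fix n :: nat
    show "n \<in> range (\<lambda>n. 2 * n) \<union> range (\<lambda>n. 2 * n + 1)"
      by (cases "even n") (auto elim!: evenE oddE)
  qed
  finally show ?thesis .
qed

text \<open>\<open>even_l2\<close> and \<open>odd_l2\<close> are the adjoints of the isometries onto
  the even and the odd coordinates (generators of a Cuntz algebra); \<open>merge_l2\<close> inverts
  the pair.\<close>

definition even_l2 :: "(nat, 'a :: complex_inner) l2 \<Rightarrow> (nat, 'a) l2" where
  "even_l2 f = Abs_l2 (\<lambda>n. Rep_l2 f (2 * n))"

definition odd_l2 :: "(nat, 'a :: complex_inner) l2 \<Rightarrow> (nat, 'a) l2" where
  "odd_l2 f = Abs_l2 (\<lambda>n. Rep_l2 f (2 * n + 1))"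

definition merge_l2 :: "(nat, 'a :: complex_inner) l2 \<Rightarrow> (nat, 'a) l2 \<Rightarrow> (nat, 'a) l2" where
  "merge_l2 f g = Abs_l2 (\<lambda>n. if even n then Rep_l2 f (n div 2) else Rep_l2 g (n div 2))"

lemma Rep_even_odd_l2:
  fixes f :: "(nat, 'a :: complex_inner) l2"
  shows Rep_even_l2: "Rep_l2 (even_l2 f) n = Rep_l2 f (2 * n)"
    and Rep_odd_l2: "Rep_l2 (odd_l2 f) n = Rep_l2 f (2 * n + 1)"
    and norm_even_odd_l2: "(norm f)\<^sup>2 = (norm (even_l2 f))\<^sup>2 + (norm (odd_l2 f))\<^sup>2"
proof -
  have s: "(\<lambda>n. (norm (Rep_l2 f n))\<^sup>2) summable_on UNIV" using Rep_l2 [of f] by simp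
  have "(\<lambda>n. (norm (Rep_l2 f n))\<^sup>2) summable_on range (\<lambda>n. 2 * n)"
    "(\<lambda>n. (norm (Rep_l2 f n))\<^sup>2) summable_on range (\<lambda>n. 2 * n + 1)"
    by (rule summable_on_subset_banach [OF s], simp)+
  then have e: "(\<lambda>n. (norm (Rep_l2 f (2 * n)))\<^sup>2) summable_on UNIV"
    and o: "(\<lambda>n. (norm (Rep_l2 f (2 * n + 1)))\<^sup>2) summable_on UNIV"
    by (simp_all add: summable_on_reindex inj_on_def o_def)
  note E = l2_construct [OF has_sum_infsum [OF e]] and O = l2_construct [OF has_sum_infsum [OF o]]
  show "Rep_l2 (even_l2 f) n = Rep_l2 f (2 * n)" "Rep_l2 (odd_l2 f) n = Rep_l2 f (2 * n + 1)"
    unfolding even_l2_def odd_l2_def E(1) O(1) by auto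
  show "(norm f)\<^sup>2 = (norm (even_l2 f))\<^sup>2 + (norm (odd_l2 f))\<^sup>2"
    unfolding even_l2_def odd_l2_def E(2) O(2)
    by (rule has_sum_unique [OF has_sum_norm_l2 has_sum_even_odd]) (use e o in auto)
qed

lemma Rep_merge_l2:
  "Rep_l2 (merge_l2 f g) n = (if even n then Rep_l2 f (n div 2) else Rep_l2 g (n div 2))"
proof -
  let ?h = "\<lambda>n. if even n then Rep_l2 f (n div 2) else Rep_l2 g (n div 2)"
  have "((\<lambda>n. (norm (?h n))\<^sup>2) has_sum ((norm f)\<^sup>2 + (norm g)\<^sup>2)) UNIV"
    using has_sum_norm_l2 [of f] has_sum_norm_l2 [of g] by (intro has_sum_even_odd) auto
  then show ?thesis unfolding merge_l2_def by (simp add: l2_construct)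
qed

definition sum_tuple ::
  "(nat \<Rightarrow> real \<Rightarrow> 'a \<Rightarrow> 'a) \<Rightarrow> (nat \<Rightarrow> real \<Rightarrow> 'b \<Rightarrow> 'b) \<Rightarrow> nat \<Rightarrow> real \<Rightarrow> 'a \<times> 'b \<Rightarrow> 'a \<times> 'b" where
  "sum_tuple u v k t = map_prod (u k t) (v k t)"

lemma isometric_action_sum:
  assumes u: "isometric_action d H u" and v: "isometric_action d K v"
  shows "isometric_action d (H \<times> K) (sum_tuple u v)"
  unfolding isometric_action_def
proof (intro conjI allI impI ballI)
  show "hilbert (H \<times> K)" using u v by (intro hilbert_Times isometric_action_hilbert)
  fix k t assume k: "k < d"
  note iu = isometric_actionD [OF u k] and iv = isometric_actionD [OF v k]
  show "isometry_on (H \<times> K) (H \<times> K) (sum_tuple u v k t)"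
    using iu(4,5) iv(4,5) isometry_onD(1) [OF iu(1)] isometry_onD(1) [OF iv(1)]
    by (auto simp: isometry_on_def clinear_on_def sum_tuple_def norm_Pair scaleC_prod_def)
  fix p assume p: "p \<in> H \<times> K"
  then show "sum_tuple u v k 0 p = p" using iu(2) iv(2) by (auto simp: sum_tuple_def)
  show "sum_tuple u v k (s + t) p = sum_tuple u v k s (sum_tuple u v k t p)" for s t
    using p iu(3) iv(3) by (auto simp: sum_tuple_def)
qed

lemma intertwines_swap:
  "almost_intertwines d 0 (H \<times> K) (sum_tuple u v) (K \<times> H) (sum_tuple v u) prod.swap"
  by (rule almost_intertwines_exact)
    (auto simp: isometry_on_def clinear_on_def norm_Pair add.commute scaleC_prod_def sum_tuple_def)

lemma eventually_nhds_0_uminus: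
  assumes "\<forall>\<^sub>F t in nhds 0. P (t :: real)" shows "\<forall>\<^sub>F t in nhds 0. P (- t)"
proof -
  have "filterlim uminus (nhds (- 0 :: real)) (nhds 0)" by (intro tendsto_minus filterlim_ident)
  then show ?thesis using assms by (auto simp: filterlim_iff)
qed

text \<open>Passing to adjoints reverses time, so an estimate for \<open>S\<close> at
  \<open>- t\<close> becomes the estimate for its adjoint at \<open>t\<close>. Pairing the error
  vector \<open>z\<close> with itself brings all operators to the side where \<open>est\<close>
  applies.\<close>

lemma adjoint_almost_intertwines:
  assumes S: "isometry_on H K S" and u: "isometric_action d H u" and v: "isometric_action d K v"
    and k: "k < d" and y: "y \<in> K"
    and est: "\<And>x. x \<in> H \<Longrightarrow> norm (v k (- t) (S x) - S (u k (- t) x)) \<le> c * norm x"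
    and "0 \<le> c"
  shows "norm (isom_adj H S (v k t y) - u k t (isom_adj H S y)) \<le> c * norm y"
proof -
  have H: "hilbert H" using u by (rule isometric_action_hilbert)
  note adj = isom_adj [OF S H]
  define z where "z = isom_adj H S (v k t y) - u k t (isom_adj H S y)"
  have z: "z \<in> H"
    unfolding z_def using hilbert_csubspace [OF H] isometric_actionD(4) [OF u k] adj(1)
    by (intro csubspace_diff) auto
  have Sz: "S z \<in> K" using isometry_onD(2) [OF S z] .
  have "cinner z z = cinner z (isom_adj H S (v k t y)) - cinner z (u k t (isom_adj H S y))"
    by (simp add: z_def cinner.diff_right)
  also have "\<dots> = cinner (S z) (v k t y) - cinner (u k (- t) z) (isom_adj H S y)"
    using adj(5) [OF z] cinner_isometric_action [OF u k z adj(1)] by simp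
  also have "\<dots> = cinner (v k (- t) (S z) - S (u k (- t) z)) y"
    using adj(5) [OF isometric_actionD(4) [OF u k z]] cinner_isometric_action [OF v k Sz y]
    by (simp add: cinner.diff_left)
  finally have "cmod (cinner z z) \<le> norm (v k (- t) (S z) - S (u k (- t) z)) * norm y"
    by (simp add: cmod_cinner_le)
  also have "\<dots> \<le> c * norm z * norm y" by (intro mult_right_mono est z) auto
  finally have "norm z * norm z \<le> (c * norm y) * norm z"
    by (simp add: cinner_self_of_real power2_eq_square mult_ac norm_mult)
  then show ?thesis using \<open>0 \<le> c\<close> unfolding z_def [symmetric]
    by (cases "z = 0") (simp_all add: mult_le_cancel_right)
qed

text \<open>With $P = S S^*$ and the isometries $s_1, s_2$ of $\ell^2$ onto the even and the odd
  coordinates, the unitary is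
  $Z = (S^* \otimes s_1^*) \oplus (P \otimes s_2^* + (1 - P) \otimes 1)$.  Up to the error terms
  $S^* v - u S^*$ and $[P, v]$ it intertwines.\<close>

lemma swindle:
  assumes S: "almost_intertwines d \<epsilon> H u K v S" and \<epsilon>: "0 \<le> \<epsilon>"
    and u: "isometric_action d H u" and v: "isometric_action d K v"
  shows "\<exists>Z. almost_intertwines d (sqrt 5 * \<epsilon>) (ampl_space K) (ampl_tuple K v)
      (ampl_space H \<times> ampl_space K) (sum_tuple (ampl_tuple H u) (ampl_tuple K v)) Z \<and>
    Z ` ampl_space K = ampl_space H \<times> ampl_space K"
proof -
  have H: "hilbert H" and K: "hilbert K"
    using u v by (auto intro: isometric_action_hilbert)
  have cK: "csubspace K" and cH: "csubspace H" using H K by (auto simp: hilbert_csubspace)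
  have iS: "isometry_on H K S" using S by (simp add: almost_intertwines_def)
  define M where "M = S ` H"
  have M: "hilbert M" unfolding M_def by (rule hilbert_isometry_image [OF iS H])
  have MK: "M \<subseteq> K" using isometry_onD(2) [OF iS] by (auto simp: M_def)
  define R where "R = isom_adj H S"
  define P where "P = orth_proj M"
  note adj = isom_adj [OF iS H, folded R_def M_def P_def]
  note Rlin = isom_adj_linear [OF iS H, folded R_def]
  have Plin: "P (x + y) = P x + P y" "P (x - y) = P x - P y" "P (a *\<^sub>C x) = a *\<^sub>C P x" for x y a
    using M by (simp_all add: P_def orth_proj_add orth_proj_diff orth_proj_scaleC)
  have PM: "P x \<in> M" for x using M by (simp add: P_def orth_proj_in)
  have Pid: "P x = x" if "x \<in> M" for x
    using that M by (simp add: P_def orth_proj_id hilbert_csubspace)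
  have Porth: "cinner (P x) (y - P y) = 0" for x y
    using orth_proj_orth [OF M PM, of x y] by (simp add: P_def)
  have Ple: "norm (P x) \<le> norm x" for x using M by (simp add: P_def norm_orth_proj_le)
  have Rle: "norm (R x) \<le> norm x" for x using Ple adj(3) by simp
  have RP: "Rep_l2 (ampl_map P f) n = P (Rep_l2 f n)" for f n
    by (rule Rep_ampl_map_contraction) (rule Ple)
  have RR: "Rep_l2 (ampl_map R f) n = R (Rep_l2 f n)" for f n
    by (rule Rep_ampl_map_contraction) (rule Rle)
  note reps = RP RR Rep_even_l2 Rep_odd_l2 Rep_merge_l2 plus_l2.rep_eq minus_l2.rep_eq scaleC_l2.rep_eq
  define Z where "Z f = (ampl_map R (even_l2 f), ampl_map P (odd_l2 f) + (f - ampl_map P f))" for f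
  \<comment> \<open>Ranges of P and 1 - P are orthogonal entrywise. Two different sequences are
    allowed since in \<open>Z\<close> the P part comes from the odd entries of \<open>f\<close>, the
    other part from \<open>f\<close> itself.\<close>
  have l2orth: "cinner (ampl_map P f) (g - ampl_map P g) = 0" for f g
    unfolding cinner_l2.rep_eq by (simp add: reps Porth)
  have normP: "(norm (ampl_map P f + (g - ampl_map P g)))\<^sup>2
      = (norm (ampl_map P f))\<^sup>2 + (norm (g - ampl_map P g))\<^sup>2" for f g
    by (rule norm_add_sq_orth [OF l2orth])
  have Zlin: "Z (f + g) = Z f + Z g" "Z (a *\<^sub>C f) = a *\<^sub>C Z f" for f g a
    by (auto simp: Z_def scaleC_prod_def reps Plin Rlin scaleC.diff_right scaleC.add_right
        algebra_simps intro!: l2_eqI)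
  have Znorm: "norm (Z f) = norm f" for f
  proof -
    \<comment> \<open>The entries of P f are distributed: the even ones go to the first summand, the
      odd ones fill the P part of the second. Together they keep the norm of P f, and (1 - P) f
      stays in place.\<close>
    have "norm (ampl_map R (even_l2 f)) = norm (even_l2 (ampl_map P f))"
      by (rule norm_l2_eq) (simp add: reps adj(3))
    moreover have "ampl_map P (odd_l2 f) = odd_l2 (ampl_map P f)"
      by (rule l2_eqI) (simp add: reps)
    ultimately have "(norm (Z f))\<^sup>2 = (norm (ampl_map P f))\<^sup>2 + (norm (f - ampl_map P f))\<^sup>2"
      unfolding Z_def norm_Pair_sq normP norm_even_odd_l2 [of "ampl_map P f"] by simp
    also have "\<dots> = (norm f)\<^sup>2" using normP [of f f] by simp
    finally show ?thesis by simp
  qed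
  have Zmaps: "Z f \<in> ampl_space H \<times> ampl_space K" if "f \<in> ampl_space K" for f
    using that adj(1) PM MK cK
    by (auto simp: Z_def ampl_space_def reps subset_iff intro!: csubspace_add csubspace_diff)
  have iZ: "isometry_on (ampl_space K) (ampl_space H \<times> ampl_space K) Z"
    unfolding isometry_on_def clinear_on_def
    by (intro conjI ballI allI image_subsetI Zmaps Zlin Znorm)
  have RS: "R (S x) = x" if "x \<in> H" for x using adj(4) that by blast
  have Rq: "R (y - P y) = 0" for y
    using adj(3) [of "y - P y"] Pid [OF PM] by (simp add: Plin)
  have PS: "P (S x) = S x" if "x \<in> H" for x using that by (intro Pid) (simp add: M_def)
  have surj: "Z ` ampl_space K = ampl_space H \<times> ampl_space K"
  proof (intro equalityI subsetI)
    fix p assume "p \<in> ampl_space H \<times> ampl_space K"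
    then obtain h g where p: "p = (h, g)" "h \<in> ampl_space H" "g \<in> ampl_space K" by auto
    have Sh: "Rep_l2 (ampl_map S h) n = S (Rep_l2 h n)" and hH: "Rep_l2 h n \<in> H" for n
      using Rep_ampl_map_isometry [OF iS p(2)] p(2) by (auto simp: ampl_space_def)
    \<comment> \<open>The preimage: \<open>S h\<close> on the even and P g on the odd places of the
      P part, with the part (1 - P) g left unchanged.\<close>
    define f where "f = merge_l2 (ampl_map S h) (ampl_map P g) + (g - ampl_map P g)"
    have f: "Rep_l2 f n = (if even n then S (Rep_l2 h (n div 2)) else P (Rep_l2 g (n div 2)))
        + (Rep_l2 g n - P (Rep_l2 g n))" for n
      by (simp add: f_def reps Sh)
    have "Rep_l2 f n \<in> K" for n
      unfolding f using p(3) hH isometry_onD(2) [OF iS] PM MK cK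
      by (intro csubspace_add csubspace_diff) (auto simp: ampl_space_def)
    then have "f \<in> ampl_space K" by (simp add: ampl_space_def)
    moreover have "Z f = p"
    proof -
      have "ampl_map R (even_l2 f) = h"
        by (rule l2_eqI) (simp add: reps f Rlin RS hH Rq)
      moreover have "ampl_map P (odd_l2 f) + (f - ampl_map P f) = g"
        by (rule l2_eqI) (simp add: reps f Plin PS hH Pid [OF PM])
      ultimately show ?thesis by (simp add: Z_def p)
    qed
    ultimately show "p \<in> Z ` ampl_space K" by blast
  qed (use Zmaps in blast)
  have "\<forall>\<^sub>F t in nhds 0. \<forall>k<d. \<forall>x\<in>H. norm (v k t (S x) - S (u k t x)) \<le> \<epsilon> * \<bar>t\<bar> * norm x"
    using S by (simp add: almost_intertwines_def)
  \<comment> \<open>The estimate at \<open>- t\<close> is the one that controls the adjoint of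
    \<open>S\<close> at time \<open>t\<close>.\<close>
  moreover from eventually_nhds_0_uminus [OF this]
  have "\<forall>\<^sub>F t in nhds 0. \<forall>k<d. \<forall>x\<in>H.
      norm (v k (- t) (S x) - S (u k (- t) x)) \<le> \<epsilon> * \<bar>t\<bar> * norm x" by simp
  ultimately have "\<forall>\<^sub>F t in nhds 0. \<forall>k<d. \<forall>f\<in>ampl_space K.
      norm (sum_tuple (ampl_tuple H u) (ampl_tuple K v) k t (Z f) - Z (ampl_op K (v k t) f))
      \<le> sqrt 5 * \<epsilon> * \<bar>t\<bar> * norm f"
  proof eventually_elim
    case (elim t)
    let ?c = "\<epsilon> * \<bar>t\<bar>"
    have c: "0 \<le> ?c" using \<epsilon> by simp
    show ?case
    proof (intro allI impI ballI)
      fix k f assume k: "k < d" and f: "f \<in> ampl_space K"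
      note iu = isometric_actionD(1) [OF u k, of t] and iv = isometric_actionD(1) [OF v k, of t]
      have D1: "norm (R (v k t y) - u k t (R y)) \<le> ?c * norm y" if "y \<in> K" for y
        unfolding R_def using elim(2) k
        by (intro adjoint_almost_intertwines [OF iS u v k that _ c]) blast
      \<comment> \<open>The commutator splits as P v (1 - P) y - (1 - P) v P y. The two terms are
        orthogonal and each is bounded by \<open>?c\<close> times its own orthogonal component of
        \<open>y\<close>, so Pythagoras gives \<open>?c\<close> where the triangle inequality would
        give more.\<close>
      have D2: "norm (P (v k t y) - v k t (P y)) \<le> ?c * norm y" if y: "y \<in> K" for y
      proof -
        define q where "q = y - P y"
        have PyK: "P y \<in> K" using PM MK by blast
        have qK: "q \<in> K" unfolding q_def using cK y PyK by (rule csubspace_diff)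
        define b where "b = v k t (P y) - P (v k t (P y))"
        have u0: "u k t 0 = 0" by (rule clinear_on_0 [OF isometry_onD(1) [OF iu] cH])
        have "norm (P (v k t q)) \<le> ?c * norm q"
          using D1 [OF qK] Rq [of y] u0 adj(3) [of "v k t q"] by (simp add: q_def)
        then have a: "(norm (P (v k t q)))\<^sup>2 \<le> ?c\<^sup>2 * (norm q)\<^sup>2"
          using power_mono [of "norm (P (v k t q))" "?c * norm q" 2] by (simp add: power_mult_distrib)
        \<comment> \<open>With P y = \<open>S (R y)\<close> and P fixing the range of
          \<open>S\<close>, subtracting S u R y inside 1 - P changes nothing and exposes the error
          of \<open>S\<close>.\<close>
        have "b = (v k t (S (R y)) - S (u k t (R y))) - P (v k t (S (R y)) - S (u k t (R y)))"
          using PS [OF isometric_actionD(4) [OF u k adj(1)]] by (simp add: b_def Plin adj(2))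
        then have "norm b \<le> norm (v k t (S (R y)) - S (u k t (R y)))"
          using norm_orth_proj_compl_le [OF M] by (simp add: P_def)
        also have "\<dots> \<le> ?c * norm (P y)"
          using elim(1) k adj(1) [of y] adj(3) [of y] by metis
        finally have b: "(norm b)\<^sup>2 \<le> ?c\<^sup>2 * (norm (P y))\<^sup>2"
          using power_mono [of "norm b" "?c * norm (P y)" 2] by (simp add: power_mult_distrib)
        have "v k t y = v k t q + v k t (P y)"
          using clinear_on_add [OF isometry_onD(1) [OF iv] qK PyK] by (simp add: q_def)
        then have eq: "P (v k t y) - v k t (P y) = P (v k t q) - b" by (simp add: Plin b_def)
        have "cinner (P (v k t q)) b = 0" using Porth by (simp add: b_def)
        then have "(norm (P (v k t y) - v k t (P y)))\<^sup>2 = (norm (P (v k t q)))\<^sup>2 + (norm b)\<^sup>2"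
          unfolding eq by (simp add: norm_diff_sq)
        also have "\<dots> \<le> ?c\<^sup>2 * ((norm (P y))\<^sup>2 + (norm q)\<^sup>2)"
          using a b by (simp add: distrib_left)
        also have "(norm (P y))\<^sup>2 + (norm q)\<^sup>2 = (norm y)\<^sup>2"
          using norm_orth_proj_sq [OF M, of y] by (simp add: P_def q_def)
        finally have "(norm (P (v k t y) - v k t (P y)))\<^sup>2 \<le> (?c * norm y)\<^sup>2"
          by (simp add: power_mult_distrib)
        then show ?thesis by (rule power2_le_imp_le) (use \<epsilon> in simp)
      qed
      have fK: "Rep_l2 f n \<in> K" for n using f by (simp add: ampl_space_def)
      have vrep: "Rep_l2 (ampl_op K (v k t) g) n = v k t (Rep_l2 g n)" if "g \<in> ampl_space K" for g n
        using that Rep_ampl_map_isometry [OF iv that] by (simp add: ampl_op_eq)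
      have urep: "Rep_l2 (ampl_op H (u k t) g) n = u k t (Rep_l2 g n)" if "g \<in> ampl_space H" for g n
        using that Rep_ampl_map_isometry [OF iu that] by (simp add: ampl_op_eq)
      have eK: "even_l2 f \<in> ampl_space K" and oK: "odd_l2 f \<in> ampl_space K"
        using fK by (auto simp: ampl_space_def reps)
      have ReH: "ampl_map R g \<in> ampl_space H" for g using adj(1) by (simp add: ampl_space_def reps)
      have PK: "ampl_map P g \<in> ampl_space K" for g
        using PM MK by (auto simp: ampl_space_def reps subset_iff)
      have subK: "f - ampl_map P f \<in> ampl_space K"
        using csubspace_diff [OF hilbert_csubspace [OF hilbert_ampl_space [OF K]] f PK] .
      define p where "p = ampl_op H (u k t) (ampl_map R (even_l2 f)) - ampl_map R (even_l2 (ampl_op K (v k t) f))"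
      define q where "q g = ampl_op K (v k t) (ampl_map P g) - ampl_map P (ampl_op K (v k t) g)" for g
      have p: "norm p \<le> ?c * norm (even_l2 f)"
        using D1 [OF fK] c by (intro norm_l2_le)
          (auto simp: p_def reps vrep f urep ReH norm_minus_commute)
      have q: "norm (q g) \<le> ?c * norm g" if g: "g \<in> ampl_space K" for g
      proof (rule norm_l2_le [OF _ c])
        fix i
        have "Rep_l2 g i \<in> K" using g by (simp add: ampl_space_def)
        from D2 [OF this] show "norm (Rep_l2 (q g) i) \<le> ?c * norm (Rep_l2 g i)"
          by (simp add: q_def reps vrep g PK norm_minus_commute)
      qed
      have vodd: "odd_l2 (ampl_op K (v k t) f) = ampl_op K (v k t) (odd_l2 f)"
        by (rule l2_eqI) (simp add: reps vrep f oK)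
      have lin: "clinear_on (ampl_space K) (ampl_op K (v k t))"
        using isometry_on_ampl_op [OF iv K] by (rule isometry_onD)
      note cAK = hilbert_csubspace [OF hilbert_ampl_space [OF K]]
      have "sum_tuple (ampl_tuple H u) (ampl_tuple K v) k t (Z f) - Z (ampl_op K (v k t) f)
          = (p, q (odd_l2 f) - q f)"
        using clinear_on_add [OF lin PK subK, of "odd_l2 f"] clinear_on_diff [OF lin cAK f PK, of f]
        by (simp add: sum_tuple_def Z_def p_def q_def vodd)
      \<comment> \<open>The origin of sqrt 5: the first component contains one error term, the
        second contains two commutators, and 1^2 + 2^2 = 5.\<close>
      moreover have "(norm (p, q (odd_l2 f) - q f))\<^sup>2 \<le> 5 * (?c * norm f)\<^sup>2"
      proof -
        have "norm (even_l2 f) \<le> norm f" "norm (odd_l2 f) \<le> norm f"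
          using norm_even_odd_l2 [of f] by (auto intro!: power2_le_imp_le [of "norm (even_l2 f)"]
            power2_le_imp_le [of "norm (odd_l2 f)"])
        then have "?c * norm (even_l2 f) \<le> ?c * norm f" "?c * norm (odd_l2 f) \<le> ?c * norm f"
          using c by (auto intro: mult_left_mono)
        then have "norm p \<le> ?c * norm f" "norm (q (odd_l2 f) - q f) \<le> 2 * (?c * norm f)"
          using p q [OF oK] q [OF f] norm_triangle_ineq4 [of "q (odd_l2 f)" "q f"] by linarith+
        then have "(norm p)\<^sup>2 \<le> (?c * norm f)\<^sup>2" "(norm (q (odd_l2 f) - q f))\<^sup>2 \<le> (2 * (?c * norm f))\<^sup>2"
          by (intro power_mono; simp)+
        moreover have "(2 * (?c * norm f))\<^sup>2 = 4 * (?c * norm f)\<^sup>2" by (simp only: power_mult_distrib) simp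
        ultimately show ?thesis unfolding norm_Pair_sq by linarith
      qed
      ultimately have "(norm (sum_tuple (ampl_tuple H u) (ampl_tuple K v) k t (Z f)
          - Z (ampl_op K (v k t) f)))\<^sup>2 \<le> (sqrt 5 * \<epsilon> * \<bar>t\<bar> * norm f)\<^sup>2"
        by (simp add: power_mult_distrib)
      then show "norm (sum_tuple (ampl_tuple H u) (ampl_tuple K v) k t (Z f)
          - Z (ampl_op K (v k t) f)) \<le> sqrt 5 * \<epsilon> * \<bar>t\<bar> * norm f"
        by (rule power2_le_imp_le) (use \<epsilon> in simp)
    qed
  qed
  with iZ surj show ?thesis unfolding almost_intertwines_def by blast
qed


subsection \<open>Dilations\<close>

lemma unitary_group_tendsto:
  assumes "unitary_group H w" "x \<in> H"
  shows "((\<lambda>t. w t x) \<longlongrightarrow> w a x) (nhds a)"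
  using assms tendsto_at_iff_tendsto_nhds [of "\<lambda>t. w t x" a]
  by (auto simp: unitary_group_def continuous_on_eq_continuous_at continuous_within)

text \<open>Since U x = C P V x and U is isometric, Re <V x, U x> = |x|^2 / C, so |V x - U x|^2 = 2
  |x|^2 (1 - 1/C). Finally 1/C \<ge> exp(- c t^2) \<ge> 1 - c t^2.\<close>

lemma dilation_almost_intertwines:
  assumes U: "unitary_tuple d H U" and V: "unitary_tuple d K V" and HK: "H \<subseteq> K"
    and C: "\<And>t. C t \<le> exp (t\<^sup>2 * c)" and "0 \<le> c"
    and dil: "\<forall>\<^sub>F t in nhds 0. \<forall>k<d. \<forall>x\<in>H. U k t x = C t *\<^sub>R orth_proj H (V k t x)"
  shows "almost_intertwines d (sqrt (2 * c)) H U K V (\<lambda>x. x)"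
  unfolding almost_intertwines_def
proof
  show "isometry_on H K (\<lambda>x. x)" using HK by (auto simp: isometry_on_def clinear_on_def)
  have u: "isometric_action d H U" and v: "isometric_action d K V"
    using U V by (auto intro: unitary_tuple_isometric_action)
  have H: "hilbert H" using U by (simp add: unitary_tuple_def)
  have K: "csubspace K" using V by (simp add: unitary_tuple_def hilbert_def)
  show "\<forall>\<^sub>F t in nhds 0. \<forall>k<d. \<forall>x\<in>H. norm (V k t x - U k t x) \<le> sqrt (2 * c) * \<bar>t\<bar> * norm x"
  proof (cases "d = 0 \<or> H = {0}")
    case True
    have "V k t 0 - U k t 0 = 0" if "k < d" for k t
      using clinear_on_0 [OF isometry_onD(1) [OF isometric_actionD(1) [OF u that]] hilbert_csubspace [OF H]]
        clinear_on_0 [OF isometry_onD(1) [OF isometric_actionD(1) [OF v that]] K] by simp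
    with True show ?thesis by (intro always_eventually) auto
  next
    case False
    \<comment> \<open>\<open>C\<close> is bounded from above only, but dividing by it requires
      positivity. For small \<open>t\<close> both <x0, U x0> and <x0, V x0> have positive real part,
      and \<open>C t\<close> is the ratio of these real parts.\<close>
    then obtain x0 where x0: "x0 \<in> H" "x0 \<noteq> 0" and d: "0 < d"
      using csubspace_0 [OF hilbert_csubspace [OF H]] by auto
    have pos: "0 < Re (cinner x0 x0)" using x0 by (simp add: cinner_self_of_real)
    have gU: "unitary_group H (U 0)" and gV: "unitary_group K (V 0)"
      using U V d by (auto simp: unitary_tuple_def)
    have "((\<lambda>t. Re (cinner x0 (U 0 t x0))) \<longlongrightarrow> Re (cinner x0 (U 0 0 x0))) (nhds 0)"
      "((\<lambda>t. Re (cinner x0 (V 0 t x0))) \<longlongrightarrow> Re (cinner x0 (V 0 0 x0))) (nhds 0)"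
      using x0 HK by (auto intro!: tendsto_Re cinner.tendsto tendsto_const
          unitary_group_tendsto [OF gU] unitary_group_tendsto [OF gV])
    then have "\<forall>\<^sub>F t in nhds 0. 0 < Re (cinner x0 (U 0 t x0))"
      "\<forall>\<^sub>F t in nhds 0. 0 < Re (cinner x0 (V 0 t x0))"
      using pos isometric_actionD(2) [OF u d x0(1)] isometric_actionD(2) [OF v d, of x0] x0(1) HK
      by (auto elim!: order_tendstoD)
    with dil show ?thesis
    proof eventually_elim
      case (elim t)
      have "Re (cinner x0 (U 0 t x0)) = C t * Re (cinner x0 (V 0 t x0))"
        using elim(1) d x0(1) cinner_orth_proj [OF H x0(1), of "V 0 t x0"]
        by (simp add: cinner.scaleR_right)
      then have C0: "0 < C t" using elim(2,3) by (simp add: zero_less_mult_iff)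
      have "1 - c * t\<^sup>2 \<le> exp (- (t\<^sup>2 * c))" using exp_ge_add_one_self [of "- (t\<^sup>2 * c)"] by (simp add: mult.commute)
      also have "\<dots> = 1 / exp (t\<^sup>2 * c)" by (simp add: exp_minus inverse_eq_divide)
      also have "\<dots> \<le> 1 / C t" using C0 C [of t] by (intro divide_left_mono) auto
      finally have invC: "1 - 1 / C t \<le> c * t\<^sup>2" by simp
      show ?case
      proof (intro allI impI ballI)
        fix k x assume k: "k < d" and x: "x \<in> H"
        have xK: "x \<in> K" using x HK by blast
        have Ux: "U k t x = C t *\<^sub>R orth_proj H (V k t x)" using elim(1) k x by blast
        have "Re (cinner (U k t x) (V k t x)) = Re (cinner (U k t x) (orth_proj H (V k t x)))"
          using cinner_orth_proj [OF H isometric_actionD(4) [OF u k x]] by simp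
        also have "\<dots> = Re (cinner (U k t x) (U k t x)) / C t"
          using C0 by (subst (3) Ux) (simp add: cinner.scaleR_right)
        also have "\<dots> = (norm x)\<^sup>2 / C t"
          using isometric_actionD(5) [OF u k x] by (simp add: cinner_self_of_real)
        finally have "Re (cinner (V k t x) (U k t x)) = (norm x)\<^sup>2 / C t"
          by (subst Re_cinner_commute)
        then have "(norm (V k t x - U k t x))\<^sup>2 = 2 * (norm x)\<^sup>2 * (1 - 1 / C t)"
          using isometric_actionD(5) [OF u k x] isometric_actionD(5) [OF v k xK]
          by (simp add: norm_diff_sq algebra_simps)
        also have "\<dots> \<le> 2 * (norm x)\<^sup>2 * (c * t\<^sup>2)" using invC by (intro mult_left_mono) auto
        also have "\<dots> = (sqrt (2 * c) * \<bar>t\<bar> * norm x)\<^sup>2"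
          using \<open>0 \<le> c\<close> by (simp add: power_mult_distrib)
        finally show "norm (V k t x - U k t x) \<le> sqrt (2 * c) * \<bar>t\<bar> * norm x"
          by (rule power2_le_imp_le) (use \<open>0 \<le> c\<close> in simp)
      qed
    qed
  qed
qed

section \<open>Normal representations\<close>

definition rank_one :: "'a :: complex_inner set \<Rightarrow> 'a \<Rightarrow> 'a \<Rightarrow> 'a \<Rightarrow> 'a" where
  "rank_one H x y = (\<lambda>z\<in>H. cinner y z *\<^sub>C x)"

lemma bounded_opsD:
  assumes "T \<in> bounded_ops H"
  shows "x \<in> H \<Longrightarrow> T x \<in> H" "clinear_on H T" "T \<in> extensional H"
  using assms by (auto simp: bounded_ops_def PiE_def)

lemma bounded_opsI:
  assumes "\<And>x. x \<in> H \<Longrightarrow> T x \<in> H" "clinear_on H T" "\<And>x. x \<in> H \<Longrightarrow> norm (T x) \<le> c * norm x"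
    "T \<in> extensional H"
  shows "T \<in> bounded_ops H"
  using assms by (auto simp: bounded_ops_def PiE_def)

lemma rank_one_bounded:
  assumes "csubspace H" "x \<in> H" shows "rank_one H x y \<in> bounded_ops H"
proof (rule bounded_opsI)
  show "norm (rank_one H x y z) \<le> (norm x * norm y) * norm z" if "z \<in> H" for z
    using that mult_right_mono [OF cmod_cinner_le [of y z], of "norm x"]
    by (simp add: rank_one_def norm_scaleC mult_ac)
qed (use assms in \<open>auto simp: rank_one_def clinear_on_def csubspace_add csubspace_scaleC
      cinner.add_right scaleC.add_left cinner_scaleC_right scaleC_scaleC\<close>)

lemma rank_one_adjoint: "adjoint_pair H (rank_one H x y) (rank_one H y x)"
proof -
  have "cnj (cinner y z) = cinner z y" for z by (metis cinner_commute)
  then show ?thesis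
    by (auto simp: adjoint_pair_def rank_one_def cinner_scaleC_left cinner_scaleC_right)
qed

lemma compose_rank_one:
  "T \<in> bounded_ops H \<Longrightarrow> x \<in> H \<Longrightarrow> csubspace H \<Longrightarrow> compose H T (rank_one H x y) = rank_one H (T x) y"
  by (auto simp: compose_def rank_one_def fun_eq_iff restrict_def clinear_on_scaleC dest: bounded_opsD(2))

lemma id_bounded: "csubspace H \<Longrightarrow> (\<lambda>x\<in>H. x) \<in> bounded_ops H"
  by (rule bounded_opsI [where c = 1]) (auto simp: clinear_on_def csubspace_def)

section \<open>Representations and their multiplicity spaces\<close>

locale hilbert_rep =
  fixes H :: "'a :: chilbert_space set" and L :: "'b :: chilbert_space set" and \<pi>
  assumes H: "hilbert H" and L: "hilbert L" and rep: "representation H L \<pi>"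
begin

lemma cH: "csubspace H" and cL: "csubspace L" using H L by (auto simp: hilbert_def)

lemma rep_bounded: "T \<in> bounded_ops H \<Longrightarrow> \<pi> T \<in> bounded_ops L"
  using rep by (auto simp: representation_def)

lemma rep_id: "\<pi> (\<lambda>x\<in>H. x) = (\<lambda>x\<in>L. x)"
  using rep by (auto simp: representation_def)

lemma rep_compose:
  assumes "S \<in> bounded_ops H" "T \<in> bounded_ops H" "y \<in> L"
  shows "\<pi> S (\<pi> T y) = \<pi> (compose H S T) y"
  using rep assms by (auto simp: representation_def compose_def)

lemma rep_add:
  assumes "S \<in> bounded_ops H" "T \<in> bounded_ops H" "y \<in> L"
  shows "\<pi> (\<lambda>x\<in>H. S x + T x) y = \<pi> S y + \<pi> T y"
  using rep assms by (auto simp: representation_def)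

lemma rep_scaleC:
  assumes "T \<in> bounded_ops H" "y \<in> L"
  shows "\<pi> (\<lambda>x\<in>H. a *\<^sub>C T x) y = a *\<^sub>C \<pi> T y"
  using rep assms by (auto simp: representation_def)

lemma rep_zero: "y \<in> L \<Longrightarrow> \<pi> (\<lambda>x\<in>H. 0) y = 0"
  using rep_scaleC [OF id_bounded [OF cH], of y 0] by (simp add: scaleC.zero_left restrict_def cong: if_cong)

lemma rep_adjoint:
  assumes "S \<in> bounded_ops H" "T \<in> bounded_ops H" "adjoint_pair H S T" "x \<in> L" "y \<in> L"
  shows "cinner (\<pi> S x) y = cinner x (\<pi> T y)"
  using rep assms by (auto simp: representation_def adjoint_pair_def)

lemma rep_in: "T \<in> bounded_ops H \<Longrightarrow> y \<in> L \<Longrightarrow> \<pi> T y \<in> L"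
  using rep_bounded bounded_opsD by blast

lemma rep_selfadjoint:
  assumes "T \<in> selfadjoint_ops H" shows "\<pi> T \<in> selfadjoint_ops L"
  using assms rep_bounded rep_adjoint by (auto simp: selfadjoint_ops_def adjoint_pair_def)

end

locale unit_rep = hilbert_rep +
  fixes e assumes e: "e \<in> H" "norm e = 1"
begin

abbreviation "ro \<equiv> rank_one H"

lemma ro: "x \<in> H \<Longrightarrow> ro x y \<in> bounded_ops H"
  by (rule rank_one_bounded [OF cH])

lemma ee: "cinner e e = 1" using e by (simp add: cinner_self_of_real)

text \<open>For fixed \<open>e\<close>, the assignment of \<open>j f x\<close> to x tensor f is the
  isometry of H tensor \<open>F\<close> into \<open>L\<close> behind the structure theorem.
  \<open>F\<close>, the range of the projection representing |e><e|, is the multiplicity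
  space.\<close>

definition j where "j f x = \<pi> (ro x e) f"

definition F where "F = {f\<in>L. \<pi> (ro e e) f = f}"

lemma F_L: "f \<in> F \<Longrightarrow> f \<in> L" by (simp add: F_def)

lemma csubspace_F: "csubspace F"
  using bounded_opsD(2) [OF rep_bounded [OF ro [OF e(1), of e]]] cL
  by (auto simp: csubspace_def F_def clinear_on_add clinear_on_scaleC clinear_on_0)

lemma ro_ro:
  assumes "x \<in> H" "a \<in> H" "f \<in> L"
  shows "\<pi> (ro x y) (\<pi> (ro a b) f) = cinner y a *\<^sub>C \<pi> (ro x b) f"
proof -
  have "compose H (ro x y) (ro a b) = (\<lambda>z\<in>H. cinner y a *\<^sub>C ro x b z)"
    using assms by (auto simp: compose_def rank_one_def fun_eq_iff restrict_def csubspace_scaleC [OF cH]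
        cinner_scaleC_right scaleC_scaleC mult.commute)
  then show ?thesis using rep_compose [OF ro ro] rep_scaleC [OF ro] assms by simp
qed

lemma j_in: "x \<in> H \<Longrightarrow> f \<in> L \<Longrightarrow> j f x \<in> L"
  unfolding j_def by (intro rep_in ro)

text \<open>Moving one factor across leaves |e><x| |y><e| = <x,y> |e><e|, and the image of |e><e|
  fixes \<open>g\<close>.\<close>

lemma cinner_j:
  assumes "x \<in> H" "y \<in> H" "f \<in> F" "g \<in> F"
  shows "cinner (j f x) (j g y) = cinner x y * cinner f g"
proof -
  have f: "f \<in> L" and g: "g \<in> L" using assms by (auto simp: F_L)
  have "cinner (j f x) (j g y) = cinner f (\<pi> (ro e x) (\<pi> (ro y e) g))"
    unfolding j_def using rep_adjoint [OF ro ro rank_one_adjoint, of x e f "\<pi> (ro y e) g"]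
      assms e f g rep_in ro by simp
  also have "\<dots> = cinner f (cinner x y *\<^sub>C g)"
    using assms e g ro_ro by (simp add: F_def)
  finally show ?thesis by (simp add: cinner_scaleC_right)
qed

lemma clinear_j:
  assumes "f \<in> L" shows "clinear_on H (j f)"
proof -
  have "ro (x + y) e = (\<lambda>z\<in>H. ro x e z + ro y e z)" for x y
    by (auto simp: rank_one_def scaleC.add_right fun_eq_iff)
  moreover have "ro (a *\<^sub>C x) e = (\<lambda>z\<in>H. a *\<^sub>C ro x e z)" for a x
    by (auto simp: rank_one_def scaleC_scaleC fun_eq_iff mult.commute)
  ultimately show ?thesis
    using assms ro by (simp add: clinear_on_def j_def rep_add rep_scaleC)
qed

lemma isometry_j:
  assumes "f \<in> F" "norm f = 1" shows "isometry_on H L (j f)"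
proof -
  have "(norm (j f x))\<^sup>2 = (norm x)\<^sup>2" if "x \<in> H" for x
  proof -
    have "of_real ((norm (j f x))\<^sup>2) = (of_real ((norm x)\<^sup>2) :: complex)"
      using cinner_j [OF that that assms(1,1)] assms(2) by (simp add: cinner_self_of_real)
    then show ?thesis using of_real_eq_iff by blast
  qed
  then show ?thesis
    using clinear_j [OF F_L [OF assms(1)]] j_in F_L [OF assms(1)] by (auto simp: isometry_on_def)
qed

text \<open>From T |x><e| = |T x><e|: on the image of H tensor \<open>F\<close> the representation
  acts as T tensor 1.\<close>

lemma rep_j:
  assumes "T \<in> bounded_ops H" "f \<in> L" "x \<in> H"
  shows "\<pi> T (j f x) = j f (T x)"
  unfolding j_def using rep_compose [OF assms(1) ro assms(2), of x e] assms cH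
  by (simp add: compose_rank_one)

lemma ro_in_F: "y \<in> L \<Longrightarrow> \<pi> (ro e x) y \<in> F"
  using e by (simp add: F_def rep_in ro ro_ro ee)

lemma ro_eq_j: "x \<in> H \<Longrightarrow> y \<in> L \<Longrightarrow> \<pi> (ro x x) y = j (\<pi> (ro e x) y) x"
  using e by (simp add: j_def ro_ro ee)

end

text \<open>Normality is only needed along the partial sums of an orthonormal basis, where it makes the
  images of the finite-rank projections converge strongly to the identity.\<close>

lemma (in hilbert_rep) rep_partial_proj_closure:
  assumes normal: "normal_map H L \<pi>"
    and b: "\<And>N. orthonormal_upto b N" "\<And>n. b n \<in> H" "H \<subseteq> closure (fin_span b)"
    and y: "y \<in> L"
  shows "y \<in> closure {z. \<exists>N. z = (\<Sum>i<N. \<pi> (rank_one H (b i) (b i)) y)}"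
proof -
  define P where "P N = (\<lambda>z\<in>H. partial_proj b N z)" for N
  have Pin: "partial_proj b N z \<in> H" for N z
    unfolding partial_proj_def using b(2) cH by (intro csubspace_sum csubspace_scaleC)
  have Pb: "P N \<in> bounded_ops H" for N
  proof (rule bounded_opsI)
    show "norm (P N z) \<le> 1 * norm z" if "z \<in> H" for z
      using that norm_partial_proj_pythagoras [OF b(1), of z N]
      by (simp add: P_def power2_le_imp_le)
  qed (use Pin cH in \<open>auto simp: P_def clinear_on_def partial_proj_add partial_proj_scaleC
        csubspace_add csubspace_scaleC\<close>)
  have Psa: "P N \<in> selfadjoint_ops H" for N
    using Pb by (auto simp: selfadjoint_ops_def adjoint_pair_def P_def partial_proj_selfadjoint)
  have quadP: "Re (cinner z (partial_proj b N z)) = (norm (partial_proj b N z))\<^sup>2" for N z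
  proof -
    have "cinner z (partial_proj b N z) = cinner (partial_proj b N z) (partial_proj b N z)"
      using partial_proj_partial_proj [OF b(1) order_refl, of N z]
      by (metis partial_proj_selfadjoint)
    then show ?thesis by (simp add: cinner_self_of_real)
  qed
  have Pmono: "op_le H (P M) (P N)" if "M \<le> N" for M N
  proof -
    have "(norm (partial_proj b M z))\<^sup>2 \<le> (norm (partial_proj b N z))\<^sup>2" for z
      unfolding norm_partial_proj_sq [OF b(1)] using that by (intro sum_mono2) auto
    then show ?thesis by (simp add: op_le_def P_def quadP)
  qed
  have id_sa: "(\<lambda>x\<in>H. x) \<in> selfadjoint_ops H"
    using id_bounded [OF cH] by (auto simp: selfadjoint_ops_def adjoint_pair_def)
  have "is_op_sup H (range P) (\<lambda>x\<in>H. x)"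
    unfolding is_op_sup_def
  proof (intro conjI ballI impI)
    fix T assume "T \<in> range P"
    then obtain N where T: "T = P N" by blast
    have "(norm (partial_proj b N z))\<^sup>2 \<le> (norm z)\<^sup>2" for z
      using norm_partial_proj_pythagoras [OF b(1), of z N] by simp
    then show "op_le H T (\<lambda>x\<in>H. x)"
      by (simp add: op_le_def T P_def quadP cinner_self_of_real)
  next
    fix R assume R: "R \<in> selfadjoint_ops H" "\<forall>T\<in>range P. op_le H T R"
    show "op_le H (\<lambda>x\<in>H. x) R"
      unfolding op_le_def
    proof
      fix z assume z: "z \<in> H"
      have "(\<lambda>N. Re (cinner z (partial_proj b N z))) \<longlonglongrightarrow> Re (cinner z z)"
        using z b by (intro tendsto_Re cinner.tendsto tendsto_const partial_proj_tendsto) auto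
      moreover have "Re (cinner z (partial_proj b N z)) \<le> Re (cinner z (R z))" for N
        using R(2) z by (auto simp: op_le_def P_def)
      ultimately show "Re (cinner z ((\<lambda>x\<in>H. x) z)) \<le> Re (cinner z (R z))"
        using z by (auto intro: LIMSEQ_le_const2)
    qed
  qed (rule id_sa)
  moreover have "\<exists>C\<in>range P. op_le H A C \<and> op_le H B C" if "A \<in> range P" "B \<in> range P" for A B
  proof -
    from that obtain M N where "A = P M" "B = P N" by blast
    then show ?thesis using Pmono [of M "max M N"] Pmono [of N "max M N"] by auto
  qed
  ultimately have sup: "is_op_sup L (\<pi> ` range P) (\<lambda>x\<in>L. x)"
    unfolding rep_id [symmetric] using Psa
    by (intro normal [unfolded normal_map_def, rule_format]) auto
  define Q where "Q N = \<pi> (P N)" for N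
  have Qsum: "Q N z = (\<Sum>i<N. \<pi> (rank_one H (b i) (b i)) z)" if "z \<in> L" for N z
  proof (induction N)
    case 0
    have "P 0 = (\<lambda>x\<in>H. 0)" by (auto simp: P_def partial_proj_def)
    then show ?case using rep_zero [OF that] by (simp add: Q_def)
  next
    case (Suc N)
    have "P (Suc N) = (\<lambda>x\<in>H. P N x + rank_one H (b N) (b N) x)"
      by (auto simp: P_def partial_proj_def rank_one_def)
    then show ?case
      using Suc rep_add [OF Pb rank_one_bounded [OF cH b(2)] that] by (simp add: Q_def)
  qed
  have Qin: "Q N z \<in> L" if "z \<in> L" for N z unfolding Q_def using that Pb by (intro rep_in)
  have Qlin: "clinear_on L (Q N)" for N unfolding Q_def using rep_bounded [OF Pb] by (rule bounded_opsD)
  have Qadj: "cinner (Q N x) z = cinner x (Q N z)" if "x \<in> L" "z \<in> L" for N x z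
    using rep_selfadjoint [OF Psa [of N]] that by (auto simp: Q_def selfadjoint_ops_def adjoint_pair_def)
  have QQ: "Q N (Q M z) = Q M z" if "M \<le> N" "z \<in> L" for M N z
  proof -
    have "partial_proj b N (partial_proj b M x) = partial_proj b M x" for x
      using partial_proj_fixed_mono [OF b(1) that(1) partial_proj_partial_proj [OF b(1) order_refl]] .
    then have "compose H (P N) (P M) = P M" by (auto simp: compose_def P_def Pin fun_eq_iff)
    then show ?thesis using rep_compose [OF Pb Pb that(2)] by (simp add: Q_def)
  qed
  have Qorth: "cinner (Q N z) (z - Q N z) = 0" if "z \<in> L" for N z
    using Qadj [OF that csubspace_diff [OF cL that Qin [OF that, of N]], of N]
      QQ [OF order_refl that, of N] clinear_on_diff [OF Qlin cL that Qin [OF that, of N], of N]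
    by (simp add: cinner.zero_right)
  have Qpyth: "(norm z)\<^sup>2 = (norm (Q N z))\<^sup>2 + (norm (z - Q N z))\<^sup>2" if "z \<in> L" for N z
    using norm_add_sq_orth [OF Qorth [OF that, of N]] by simp
  \<comment> \<open>The union of the increasing ranges of the projections \<open>Q N\<close>; what
    has to be shown is essentially its density in \<open>L\<close>.\<close>
  define V where "V = {z\<in>L. \<exists>N. Q N z = z}"
  have V: "csubspace V"
    unfolding csubspace_def
  proof (intro conjI ballI allI)
    show "0 \<in> V" using clinear_on_0 [OF Qlin cL] csubspace_0 [OF cL] by (auto simp: V_def)
    fix x a assume "x \<in> V"
    then obtain M where M: "x \<in> L" "Q M x = x" by (auto simp: V_def)
    then show "a *\<^sub>C x \<in> V"
      using clinear_on_scaleC [OF Qlin M(1)] csubspace_scaleC [OF cL M(1)]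
      by (auto simp: V_def intro!: exI [of _ M])
    fix y assume "y \<in> V"
    then obtain N where N: "y \<in> L" "Q N y = y" by (auto simp: V_def)
    have "Q (max M N) x = x" "Q (max M N) y = y"
      using QQ [of M "max M N" x] QQ [of N "max M N" y] M N by auto
    then show "x + y \<in> V"
      using clinear_on_add [OF Qlin M(1) N(1)] csubspace_add [OF cL M(1) N(1)]
      by (auto simp: V_def intro!: exI [of _ "max M N"])
  qed
  have hV: "hilbert (closure V)" by (rule hilbert_closure [OF V])
  have VL: "closure V \<subseteq> L" by (rule closure_minimal) (use L in \<open>auto simp: V_def hilbert_def\<close>)
  define y0 where "y0 = y - orth_proj (closure V) y"
  have y0L: "y0 \<in> L" unfolding y0_def using VL orth_proj_in [OF hV] y cL by (intro csubspace_diff) auto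
  have y0: "cinner y0 z = 0" if "z \<in> V" for z
    using orth_proj_orth [OF hV, of z y] closure_subset that by (auto simp: y0_def cinner_eq_0_commute)
  have "y0 = 0"
  proof (rule ccontr)
    assume ne: "y0 \<noteq> 0"
    define c where "c = 1 / (norm y0)\<^sup>2"
    \<comment> \<open>The projection onto the orthogonal complement of \<open>y0\<close>. It still
      dominates every \<open>Q N\<close> but vanishes at \<open>y0\<close>, so the identity could
      not be the least upper bound.\<close>
    define R where "R = (\<lambda>z\<in>L. z - of_real c *\<^sub>C rank_one L y0 y0 z)"
    have ro: "rank_one L y0 y0 \<in> bounded_ops L" by (rule rank_one_bounded [OF cL y0L])
    have quad: "cinner z (R z) = cinner z z - of_real (c * (cmod (cinner y0 z))\<^sup>2)" if "z \<in> L" for z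
    proof -
      have "cinner z y0 * cinner y0 z = of_real ((cmod (cinner y0 z))\<^sup>2)"
        by (subst cinner_commute [of z y0]) (simp only: complex_norm_square mult.commute)
      then show ?thesis using that
        by (simp add: R_def rank_one_def cinner.diff_right cinner_scaleC_right mult_ac)
    qed
    have Rb: "R \<in> bounded_ops L"
    proof (rule bounded_opsI)
      show "R z \<in> L" if "z \<in> L" for z
        using that bounded_opsD(1) [OF ro] cL by (auto simp: R_def intro!: csubspace_diff csubspace_scaleC)
      show "clinear_on L R"
        using bounded_opsD(2) [OF ro] cL
        by (auto simp: R_def clinear_on_def csubspace_add csubspace_scaleC scaleC.add_right
            scaleC.diff_right scaleC_scaleC mult.commute)
      show "norm (R z) \<le> (1 + c * (norm y0 * norm y0)) * norm z" if "z \<in> L" for z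
      proof -
        have "norm (R z) \<le> norm z + c * (cmod (cinner y0 z) * norm y0)"
          using that norm_triangle_ineq4 [of z "of_real c *\<^sub>C rank_one L y0 y0 z"]
          by (simp add: R_def rank_one_def norm_scaleC c_def norm_divide norm_power)
        also have "\<dots> \<le> norm z + c * ((norm y0 * norm z) * norm y0)"
          by (intro add_left_mono mult_left_mono mult_right_mono cmod_cinner_le) (auto simp: c_def)
        finally show ?thesis by (simp add: algebra_simps)
      qed
    qed (simp add: R_def)
    have "R \<in> selfadjoint_ops L"
    proof -
      have "cnj (cinner y0 z) = cinner z y0" for z by (metis cinner_commute)
      then show ?thesis
        using Rb by (auto simp: selfadjoint_ops_def adjoint_pair_def R_def rank_one_def
            cinner.diff_left cinner.diff_right cinner_scaleC_left cinner_scaleC_right)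
    qed
    moreover have "op_le L T R" if "T \<in> \<pi> ` range P" for T
      unfolding op_le_def
    proof
      fix z assume z: "z \<in> L"
      from that obtain N where T: "T = Q N" by (auto simp: Q_def)
      have "Q N z \<in> V" using QQ [OF order_refl z, of N] Qin [OF z] by (auto simp: V_def)
      then have "cinner y0 z = cinner y0 (z - Q N z)" using y0 by (simp add: cinner.diff_right)
      then have "(cmod (cinner y0 z))\<^sup>2 \<le> (norm y0 * norm (z - Q N z))\<^sup>2"
        using cmod_cinner_le by (intro power_mono) auto
      then have "c * (cmod (cinner y0 z))\<^sup>2 \<le> (norm (z - Q N z))\<^sup>2"
        using ne by (simp add: c_def power_mult_distrib field_simps)
      moreover have "Re (cinner z (Q N z)) = (norm (Q N z))\<^sup>2"
        using Qadj [OF z Qin [OF z], of N N] QQ [OF order_refl z, of N]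
        by (metis Qadj Qin Re_complex_of_real cinner_self_of_real z)
      ultimately show "Re (cinner z (T z)) \<le> Re (cinner z (R z))"
        using Qpyth [OF z, of N] by (simp add: quad [OF z] T cinner_self_of_real)
    qed
    ultimately have "op_le L (\<lambda>x\<in>L. x) R" using sup by (simp add: is_op_sup_def)
    then have "Re (cinner y0 y0) \<le> Re (cinner y0 (R y0))" using y0L by (auto simp: op_le_def)
    moreover have "c * (cmod (cinner y0 y0))\<^sup>2 > 0" using ne by (simp add: c_def)
    ultimately show False using quad [OF y0L] by simp
  qed
  then have "y \<in> closure V" using orth_proj_in [OF hV, of y] by (simp add: y0_def)
  show ?thesis
  proof (unfold closure_approachable, intro allI impI)
    fix r :: real assume "0 < r"
    with \<open>y \<in> closure V\<close> obtain z where z: "z \<in> V" "dist z y < r" by (meson closure_approachable)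
    then obtain N where N: "z \<in> L" "Q N z = z" by (auto simp: V_def)
    have d: "y - z \<in> L" using cL y N(1) by (rule csubspace_diff)
    have eq: "y - Q N y = (y - z) - Q N (y - z)" using clinear_on_diff [OF Qlin cL y N(1)] N(2) by simp
    have "(norm (y - Q N y))\<^sup>2 \<le> (norm (y - z))\<^sup>2"
      using Qpyth [OF d, of N] zero_le_power2 [of "norm (Q N (y - z))"] unfolding eq by linarith
    then have "norm (y - Q N y) \<le> norm (y - z)" by (rule power2_le_imp_le) simp
    then have "dist (Q N y) y < r" using z(2) by (simp add: dist_norm norm_minus_commute)
    then show "\<exists>w\<in>{z. \<exists>N. z = (\<Sum>i<N. \<pi> (rank_one H (b i) (b i)) y)}. dist w y < r"
      unfolding Qsum [OF y] by blast
  qed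
qed

section \<open>From equivalence to an exactly intertwining isometry\<close>

lemma unitary_bounded: "unitary_group H w \<Longrightarrow> w t \<in> bounded_ops H"
  by (simp add: unitary_group_def unitary_ops_def)

lemma isometry_ext_cinner:
  assumes "csubspace H" "x \<in> H" "y \<in> H" "\<And>z. z \<in> H \<Longrightarrow> cinner z x = cinner z (y :: 'a :: complex_inner)"
  shows "x = y"
proof -
  have "cinner (x - y) (x - y) = 0"
    using assms csubspace_diff [of H x y] by (simp add: cinner.diff_right)
  then show ?thesis by simp
qed

text \<open>A unit vector of the multiplicity space of \<pi> gives an isometry \<open>J\<close> of
  \<open>H\<close> into \<open>L\<close> with J u = \<rho>(v) J. Expanding \<open>J\<close> along an
  orthonormal sequence in the multiplicity space of \<rho> yields maps into \<open>K\<close> that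
  intertwine u with v, and Parseval assembles them into an isometry.\<close>

lemma equiv_imp_intertwiner_aux:
  fixes H :: "'a :: chilbert_space set" and K :: "'b :: chilbert_space set" and L :: "'c :: chilbert_space set"
  assumes u: "unitary_tuple d H u" and v: "unitary_tuple d K v"
    and L: "hilbert L" and \<pi>: "faithful_normal_rep H L \<pi>" and \<rho>: "faithful_normal_rep K L \<rho>"
    and eq: "\<And>k t. k < d \<Longrightarrow> \<pi> (u k t) = \<rho> (v k t)"
    and e0: "e0 \<in> H" "norm e0 = 1" and e: "e \<in> K" "norm e = 1"
  shows "\<exists>S. almost_intertwines d 0 H u (ampl_space K) (ampl_tuple K v) S"
proof -
  have H: "hilbert H" and K: "hilbert K" using u v by (auto simp: unitary_tuple_def)
  interpret a: unit_rep H L \<pi> e0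
    using H L \<pi> e0 by unfold_locales (auto simp: faithful_normal_rep_def)
  interpret b: unit_rep K L \<rho> e
    using K L \<rho> e by unfold_locales (auto simp: faithful_normal_rep_def)
  \<comment> \<open>Faithfulness enters here: a rank-one projection has a nonzero image, so the
    multiplicity space of \<pi> contains a unit vector.\<close>
  have "\<exists>f\<in>L. \<pi> (a.ro e0 e0) f \<noteq> 0"
  proof (rule ccontr)
    assume "\<not> (\<exists>f\<in>L. \<pi> (a.ro e0 e0) f \<noteq> 0)"
    moreover have z: "(\<lambda>x\<in>H. 0 *\<^sub>C a.ro e0 e0 x) \<in> bounded_ops H"
      by (rule bounded_opsI [where c = 0]) (auto simp: clinear_on_def scaleC.zero_left scaleC.zero_right
          csubspace_0 [OF a.cH] csubspace_add [OF a.cH] csubspace_scaleC [OF a.cH])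
    moreover have "\<pi> (a.ro e0 e0) \<in> bounded_ops L" "\<pi> (\<lambda>x\<in>H. 0 *\<^sub>C a.ro e0 e0 x) \<in> bounded_ops L"
      using a.ro e0 z by (auto intro: a.rep_bounded)
    moreover have "\<pi> (\<lambda>x\<in>H. 0 *\<^sub>C a.ro e0 e0 x) y = 0" if "y \<in> L" for y
      using a.rep_scaleC [OF a.ro [OF e0(1)] that, of 0] by (simp add: scaleC.zero_left)
    ultimately have "\<pi> (a.ro e0 e0) = \<pi> (\<lambda>x\<in>H. 0 *\<^sub>C a.ro e0 e0 x)"
      by (intro extensionalityI [of _ L]) (auto dest: bounded_opsD)
    then have "a.ro e0 e0 = (\<lambda>x\<in>H. 0 *\<^sub>C a.ro e0 e0 x)"
      using \<pi> a.ro [OF e0(1)] z by (auto simp: faithful_normal_rep_def dest: inj_onD)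
    then have "a.ro e0 e0 e0 = 0" using e0 by (metis restrict_apply' scaleC.zero_left)
    then show False using e0 a.ee by (auto simp: rank_one_def)
  qed
  then obtain f' where f': "f' \<in> L" "\<pi> (a.ro e0 e0) f' \<noteq> 0" by blast
  define f where "f = sgn (\<pi> (a.ro e0 e0) f')"
  have f: "f \<in> a.F" "norm f = 1"
    using f' by (auto simp: f_def norm_sgn sgn_div_norm intro: csubspace_scaleR a.csubspace_F a.ro_in_F)
  define J where "J = a.j f"
  have J: "isometry_on H L J" unfolding J_def by (rule a.isometry_j [OF f])
  obtain x :: "nat \<Rightarrow> 'a" where x: "range x \<subseteq> H" "H \<subseteq> closure (range x)"
    using separable_imp_dense_seq [of H] u csubspace_0 [OF a.cH] by (auto simp: unitary_tuple_def)
  have "separable_space (top_of_set K)" using v by (simp add: unitary_tuple_def)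
  then obtain b where b': "(\<forall>N. orthonormal_upto b N) \<and> range b \<subseteq> K \<and> K \<subseteq> closure (fin_span b)"
    using orthonormal_basis_exists [OF b.cH] by blast
  then have b: "orthonormal_upto b N" "b n \<in> K" "K \<subseteq> closure (fin_span b)" for N n by auto
  have Jx: "J (x m) \<in> L" for m using isometry_onD(2) [OF J] x(1) by blast
  \<comment> \<open>The component of \<open>J (x m)\<close> along a basis vector of
    \<open>K\<close>, moved into the multiplicity space of \<rho>. Since \<open>H\<close> and
    \<open>K\<close> are separable, countably many such vectors suffice, however large
    \<open>L\<close> is.\<close>
  define z where "z p = \<rho> (b.ro e (b (snd (prod_decode p)))) (J (x (fst (prod_decode p))))" for p
  define g where "g = gram_schmidt z"
  have z: "z p \<in> b.F" for p unfolding z_def using Jx by (rule b.ro_in_F)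
  have g: "g n \<in> b.F" for n unfolding g_def using z by (intro gram_schmidt_in b.csubspace_F)
  have g_on: "orthonormal_upto g N" for N unfolding g_def by (rule orthonormal_gram_schmidt)
  have g01: "g n = 0 \<or> norm (g n) = 1" for n using g_on [of "Suc n"] by (simp add: orthonormal_upto_def)
  \<comment> \<open>The tensors of the vectors \<open>b\<close> and \<open>g\<close> inside
    \<open>L\<close>, enumerated by pairs.\<close>
  define w where "w p = b.j (g (fst (prod_decode p))) (b (snd (prod_decode p)))" for p
  have w_cinner: "cinner (w p) (w q) = cinner (b (snd (prod_decode p))) (b (snd (prod_decode q)))
      * cinner (g (fst (prod_decode p))) (g (fst (prod_decode q)))" for p q
    unfolding w_def using b(2) g by (intro b.cinner_j)
  have orth_b: "i \<noteq> i' \<Longrightarrow> cinner (b i) (b i') = 0" for i i'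
    using b(1) [of "Suc (max i i')"] by (auto simp: orthonormal_upto_def less_Suc_eq_le)
  have orth_g: "i \<noteq> i' \<Longrightarrow> cinner (g i) (g i') = 0" for i i'
    using g_on [of "Suc (max i i')"] by (auto simp: orthonormal_upto_def less_Suc_eq_le)
  have b01: "b n = 0 \<or> norm (b n) = 1" for n using b(1) [of "Suc n"] by (simp add: orthonormal_upto_def)
  have w_on: "orthonormal_upto w N" for N
    unfolding orthonormal_upto_def
  proof (intro conjI allI impI)
    fix p q :: nat assume "p \<noteq> q"
    then have "prod_decode p \<noteq> prod_decode q" by (metis prod_decode_inverse)
    then show "cinner (w p) (w q) = 0"
      unfolding w_cinner using orth_b orth_g by (auto simp: prod_eq_iff)
  next
    fix p
    have "of_real ((norm (w p))\<^sup>2) = (of_real ((norm (b (snd (prod_decode p))))\<^sup>2 * (norm (g (fst (prod_decode p))))\<^sup>2) :: complex)"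
      using w_cinner [of p p] by (simp add: cinner_self_of_real)
    then have "(norm (w p))\<^sup>2 = (norm (b (snd (prod_decode p))))\<^sup>2 * (norm (g (fst (prod_decode p))))\<^sup>2"
      using of_real_eq_iff by blast
    then have "(norm (w p))\<^sup>2 = 0 \<or> (norm (w p))\<^sup>2 = 1"
      using b01 [of "snd (prod_decode p)"] g01 [of "fst (prod_decode p)"] by auto
    then show "w p = 0 \<or> norm (w p) = 1" by (auto simp: abs_square_eq_1)
  qed
  have cW: "csubspace (fin_span w)" by (rule csubspace_fin_span [OF w_on])
  \<comment> \<open>By Gram-Schmidt \<open>z p\<close> is a finite combination of the
    \<open>g n\<close>, so its tensor with \<open>b i\<close> is the same combination of vectors
    \<open>w\<close>.\<close>
  have jz: "b.j (z p) (b i) \<in> fin_span w" for p i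
  proof -
    obtain N where N: "partial_proj g N (z p) = z p"
      using in_fin_span_gram_schmidt [of z p] by (auto simp: fin_span_def g_def)
    let ?T = "\<rho> (b.ro (b i) e)"
    have lin: "clinear_on L ?T" using b.rep_bounded [OF b.ro [OF b(2)]] by (rule bounded_opsD)
    have "b.j (z p) (b i) = ?T (\<Sum>n<N. cinner (g n) (z p) *\<^sub>C g n)"
      using N by (simp add: b.j_def partial_proj_def)
    also have "\<dots> = (\<Sum>n<N. cinner (g n) (z p) *\<^sub>C b.j (g n) (b i))"
      using g b.F_L b.cL by (simp add: clinear_on_sum [OF lin] clinear_on_scaleC [OF lin]
          csubspace_scaleC b.j_def)
    also have "\<dots> \<in> fin_span w"
    proof (intro csubspace_sum csubspace_scaleC cW)
      fix n
      have "w (prod_encode (n, i)) = b.j (g n) (b i)" by (simp add: w_def)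
      then show "b.j (g n) (b i) \<in> fin_span w" using in_fin_span [OF w_on] by metis
    qed
    finally show ?thesis .
  qed
  \<comment> \<open>By normality \<open>J (x m)\<close> is a limit of sums of its components along
    the \<open>b i\<close>, and each component is some \<open>z p\<close> moved back to
    \<open>b i\<close>.\<close>
  have "J (x m) \<in> closure (fin_span w)" for m
  proof -
    have n: "normal_map K L \<rho>" using \<rho> by (simp add: faithful_normal_rep_def)
    have "(\<Sum>i<N. \<rho> (rank_one K (b i) (b i)) (J (x m))) \<in> fin_span w" for N
    proof (intro csubspace_sum cW)
      fix i
      have "\<rho> (rank_one K (b i) (b i)) (J (x m)) = b.j (z (prod_encode (m, i))) (b i)"
        using b.ro_eq_j [OF b(2) Jx] by (simp add: z_def)
      then show "\<rho> (rank_one K (b i) (b i)) (J (x m)) \<in> fin_span w" using jz by simp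
    qed
    then have "{zz. \<exists>N. zz = (\<Sum>i<N. \<rho> (rank_one K (b i) (b i)) (J (x m)))} \<subseteq> fin_span w" by auto
    then show ?thesis
      using b.rep_partial_proj_closure [OF n b Jx] closure_mono by blast
  qed
  note Jx_closure = this
  have J_closure: "J y \<in> closure (fin_span w)" if y: "y \<in> H" for y
  proof -
    have "J y \<in> closure (closure (fin_span w))"
      unfolding closure_approachable [of _ "closure (fin_span w)"]
    proof (intro allI impI)
      fix r :: real assume "0 < r"
      have "y \<in> closure (range x)" using x(2) y by blast
      then obtain m where "dist (x m) y < r" using \<open>0 < r\<close> by (auto simp: closure_approachable)
      moreover have "x m \<in> H" using x(1) by blast
      ultimately have "dist (J (x m)) (J y) < r" using isometry_on_dist [OF J a.cH _ y] by simp
      then show "\<exists>q\<in>closure (fin_span w). dist q (J y) < r" using Jx_closure by blast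
    qed
    then show ?thesis by simp
  qed
  \<comment> \<open>The adjoint of \<open>b.j (g n)\<close>. For \<open>g n = 0\<close> that map is
    no isometry, and the default 0 makes the entry disappear.\<close>
  define T where "T n y = (if g n = 0 then 0 else isom_adj K (b.j (g n)) y)" for n y
  have iso_g: "isometry_on K L (b.j (g n))" if "g n \<noteq> 0" for n
    using g01 [of n] that by (intro b.isometry_j g) auto
  have T_in: "T n y \<in> K" for n y
    using isom_adj_in [OF iso_g K] csubspace_0 [OF b.cH] by (simp add: T_def)
  have j0: "b.j 0 a = 0" if "a \<in> K" for a
    using clinear_on_0 [OF bounded_opsD(2) [OF b.rep_bounded [OF b.ro [OF that]]] b.cL] by (simp add: b.j_def)
  have T_cinner: "cinner a (T n y) = cinner (b.j (g n) a) y" if "a \<in> K" for a n y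
    using cinner_isom_adj [OF iso_g K that] j0 [OF that] by (auto simp: T_def cinner.zero_left cinner.zero_right)
  have T_lin: "T n (y + y') = T n y + T n y'" "T n (c *\<^sub>C y) = c *\<^sub>C T n y" for n y y' c
    using isom_adj_linear [OF iso_g K] by (auto simp: T_def scaleC.zero_right)
  \<comment> \<open>Parseval for \<open>w\<close> is a double series; summing over the basis
    \<open>b\<close> first, for fixed \<open>n\<close>, gives the squared norm of
    \<open>T n y\<close> by Parseval for \<open>b\<close>.\<close>
  have T_sum: "((\<lambda>n. (norm (T n y))\<^sup>2) has_sum (norm y)\<^sup>2) UNIV" if "y \<in> closure (fin_span w)" for y
  proof (rule has_sum_SigmaD)
    have "((\<lambda>p. (cmod (cinner (w p) y))\<^sup>2) has_sum (norm y)\<^sup>2) UNIV"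
      by (rule parseval [OF w_on that])
    then have "((\<lambda>p. (\<lambda>(n, i). (cmod (cinner (b.j (g n) (b i)) y))\<^sup>2) (prod_decode p)) has_sum (norm y)\<^sup>2) UNIV"
      by (simp add: w_def case_prod_unfold)
    then show "((\<lambda>(n, i). (cmod (cinner (b.j (g n) (b i)) y))\<^sup>2) has_sum (norm y)\<^sup>2) (UNIV \<times> UNIV)"
      unfolding has_sum_prod_decode .
    fix n
    have "T n y \<in> closure (fin_span b)" using T_in b(3) by blast
    from parseval [OF b(1) this]
    show "((\<lambda>i. (\<lambda>(n, i). (cmod (cinner (b.j (g n) (b i)) y))\<^sup>2) (n, i)) has_sum (norm (T n y))\<^sup>2) UNIV"
      by (simp add: T_cinner [OF b(2)])
  qed
  define S where "S y = Abs_l2 (\<lambda>n. T n (J y))" for y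
  have RS: "Rep_l2 (S y) n = T n (J y)" and nS: "(norm (S y))\<^sup>2 = (norm (J y))\<^sup>2" if "y \<in> H" for y n
    unfolding S_def using l2_construct [OF T_sum [OF J_closure [OF that]]] by auto
  have Slin: "clinear_on H S"
    unfolding clinear_on_def
  proof (intro conjI ballI allI l2_eqI)
    fix y y' n c assume y: "y \<in> H"
    show "Rep_l2 (S (c *\<^sub>C y)) n = Rep_l2 (c *\<^sub>C S y) n"
      using y csubspace_scaleC [OF a.cH y] clinear_on_scaleC [OF isometry_onD(1) [OF J] y]
      by (simp add: RS scaleC_l2.rep_eq T_lin)
    assume y': "y' \<in> H"
    show "Rep_l2 (S (y + y')) n = Rep_l2 (S y + S y') n"
      using y y' csubspace_add [OF a.cH y y'] clinear_on_add [OF isometry_onD(1) [OF J] y y']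
      by (simp add: RS plus_l2.rep_eq T_lin)
  qed
  have SK: "S y \<in> ampl_space K" if "y \<in> H" for y using T_in by (simp add: ampl_space_def RS [OF that])
  have "isometry_on H (ampl_space K) S"
    unfolding isometry_on_def
  proof (intro conjI ballI Slin image_subsetI SK)
    fix y assume y: "y \<in> H"
    then show "norm (S y) = norm y" using nS [OF y] isometry_onD(3) [OF J y] by simp
  qed
  moreover have "ampl_op K (v k t) (S y) = S (u k t y)" if k: "k < d" and y: "y \<in> H" for k t y
  proof (rule l2_eqI)
    fix n
    have au: "isometric_action d H u" and av: "isometric_action d K v"
      using u v by (auto intro: unitary_tuple_isometric_action)
    have gu: "unitary_group H (u k)" and gv: "unitary_group K (v k)"
      using u v k by (auto simp: unitary_tuple_def)
    have uy: "u k t y \<in> H" by (rule isometric_actionD(4) [OF au k y])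
    have JL: "J y \<in> L" using isometry_onD(2) [OF J y] .
    have "J (u k t y) = \<pi> (u k t) (J y)"
      unfolding J_def using a.rep_j [OF unitary_bounded [OF gu] a.F_L [OF f(1)] y] by simp
    then have Ju: "J (u k t y) = \<rho> (v k t) (J y)" using eq k by simp
    \<comment> \<open>Tested against \<open>c\<close>, the group moves to the other side at time
      \<open>- t\<close>, where \<open>b.rep_j\<close> lets it pass through
      \<open>b.j (g n)\<close>.\<close>
    have "T n (\<rho> (v k t) (J y)) = v k t (T n (J y))"
    proof (rule isometry_ext_cinner [OF b.cH T_in isometric_actionD(4) [OF av k T_in]])
      fix c assume c: "c \<in> K"
      have vc: "v k (- t) c \<in> K" by (rule isometric_actionD(4) [OF av k c])
      have adj: "adjoint_pair K (v k (- t)) (v k t)"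
        using cinner_isometric_action [OF av k] by (simp add: adjoint_pair_def)
      have "cinner c (T n (\<rho> (v k t) (J y))) = cinner (b.j (g n) c) (\<rho> (v k t) (J y))"
        by (rule T_cinner [OF c])
      also have "\<dots> = cinner (\<rho> (v k (- t)) (b.j (g n) c)) (J y)"
        by (rule b.rep_adjoint [symmetric, OF unitary_bounded [OF gv] unitary_bounded [OF gv] adj
              b.j_in [OF c b.F_L [OF g]] JL])
      also have "\<rho> (v k (- t)) (b.j (g n) c) = b.j (g n) (v k (- t) c)"
        by (rule b.rep_j [OF unitary_bounded [OF gv] b.F_L [OF g] c])
      also have "cinner \<dots> (J y) = cinner (v k (- t) c) (T n (J y))"
        by (rule T_cinner [symmetric, OF vc])
      also have "\<dots> = cinner c (v k t (T n (J y)))"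
        by (rule cinner_isometric_action [symmetric, OF av k c T_in])
      finally show "cinner c (T n (\<rho> (v k t) (J y))) = cinner c (v k t (T n (J y)))" .
    qed
    then show "Rep_l2 (ampl_op K (v k t) (S y)) n = Rep_l2 (S (u k t y)) n"
      using Rep_ampl_map_isometry [OF isometric_actionD(1) [OF av k] SK [OF y]]
      by (simp add: ampl_op_eq SK y RS uy Ju)
  qed
  ultimately have "almost_intertwines d 0 H u (ampl_space K) (ampl_tuple K v) S"
    by (rule almost_intertwines_exact)
  then show ?thesis by blast
qed

lemma exists_unit_vector:
  assumes "csubspace H" "H \<noteq> {0 :: 'a :: complex_inner}"
  shows "\<exists>e\<in>H. norm e = 1"
proof -
  obtain x where "x \<in> H" "x \<noteq> 0" using assms csubspace_0 [OF assms(1)] by auto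
  then show ?thesis
    using csubspace_scaleR [OF assms(1), of x "inverse (norm x)"]
    by (intro bexI [of _ "sgn x"]) (auto simp: norm_sgn sgn_div_norm)
qed

text \<open>This supplies the unit vectors. If \<open>H\<close> is zero, the zero map does;
  otherwise \<open>K\<close> is nonzero as well, since \<open>K = {0}\<close> would force
  \<open>L = {0}\<close>, and \<pi> could not distinguish the identity from 0.\<close>

lemma equiv_imp_intertwiner:
  fixes H :: "'a :: chilbert_space set" and K :: "'b :: chilbert_space set"
  assumes u: "unitary_tuple d H u" and v: "unitary_tuple d K v" and eq: "tuple_equiv TYPE('l) d H u K v"
  shows "\<exists>S. almost_intertwines d 0 H u (ampl_space K) (ampl_tuple K v) S"
proof -
  obtain L :: "'l ell2 set" and \<pi> \<rho> where L: "hilbert L"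
    and \<pi>: "faithful_normal_rep H L \<pi>" and \<rho>: "faithful_normal_rep K L \<rho>"
    and e: "\<And>k t. k < d \<Longrightarrow> \<pi> (u k t) = \<rho> (v k t)"
    using eq by (auto simp: tuple_equiv_def)
  have H: "hilbert H" and K: "hilbert K" using u v by (auto simp: unitary_tuple_def)
  have cAK: "csubspace (ampl_space K)" by (intro hilbert_csubspace hilbert_ampl_space K)
  show ?thesis
  proof (cases "H = {0}")
    case True
    have av: "isometric_action d (ampl_space K) (ampl_tuple K v)"
      by (intro isometric_action_ampl unitary_tuple_isometric_action v)
    have "isometry_on H (ampl_space K) (\<lambda>_. 0)"
      using True csubspace_0 [OF cAK] by (auto simp: isometry_on_def clinear_on_def scaleC.zero_right)
    moreover have "ampl_op K (v k t) 0 = 0" if "k < d" for k t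
      by (rule clinear_on_0 [OF isometry_onD(1) [OF isometric_actionD(1) [OF av that]] cAK])
    ultimately have "almost_intertwines d 0 H u (ampl_space K) (ampl_tuple K v) (\<lambda>_. 0)"
      by (intro almost_intertwines_exact)
    then show ?thesis by blast
  next
    case False
    then obtain e0 where e0: "e0 \<in> H" "norm e0 = 1"
      using exists_unit_vector [OF hilbert_csubspace [OF H]] by blast
    interpret a: hilbert_rep H L \<pi>
      using H L \<pi> by unfold_locales (auto simp: faithful_normal_rep_def)
    interpret b: hilbert_rep K L \<rho>
      using K L \<rho> by unfold_locales (auto simp: faithful_normal_rep_def)
    have "K \<noteq> {0}"
    proof
      assume K0: "K = {0}"
      have "y = 0" if "y \<in> L" for y
      proof -
        have "(\<lambda>x\<in>K. x) = (\<lambda>x\<in>K. 0)" using K0 by (auto simp: fun_eq_iff)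
        then show ?thesis using b.rep_id b.rep_zero [OF that] that by (metis restrict_apply')
      qed
      then have L0: "L = {0}" using csubspace_0 [OF a.cL] by auto
      have z: "(\<lambda>x\<in>H. 0) \<in> bounded_ops H"
        by (rule bounded_opsI [where c = 0]) (auto simp: clinear_on_def csubspace_0 [OF a.cH]
          csubspace_add [OF a.cH] csubspace_scaleC [OF a.cH] scaleC.zero_right)
      have "\<pi> (\<lambda>x\<in>H. x) = \<pi> (\<lambda>x\<in>H. 0)"
        using bounded_opsD [OF a.rep_bounded [OF z]] bounded_opsD [OF a.rep_bounded [OF id_bounded [OF a.cH]]] L0
        by (intro extensionalityI [of _ L]) auto
      then have "(\<lambda>x\<in>H. x) = (\<lambda>x\<in>H. 0)"
        using \<pi> z id_bounded [OF a.cH] by (auto simp: faithful_normal_rep_def dest: inj_onD)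
      then show False using e0 by (metis norm_zero restrict_apply' zero_neq_one)
    qed
    then obtain e where "e \<in> K" "norm e = 1"
      using exists_unit_vector [OF hilbert_csubspace [OF K]] by blast
    then show ?thesis using equiv_imp_intertwiner_aux [OF u v L \<pi> \<rho>] e e0 by simp
  qed
qed

section \<open>Ampliations as normal representations\<close>

text \<open>Reach \<open>t\<close> in \<open>n\<close> steps of length \<open>t / n\<close>, each so
  short that the local identity applies, and iterate by the group law.\<close>

lemma intertwines_everywhere:
  assumes S: "almost_intertwines d 0 H u K v S"
    and u: "isometric_action d H u" and v: "isometric_action d K v"
    and k: "k < d" and x: "x \<in> H"
  shows "v k t (S x) = S (u k t x)"
proof -
  have iS: "isometry_on H K S" using S by (simp add: almost_intertwines_def)
  have "\<forall>\<^sub>F t in nhds 0. \<forall>k<d. \<forall>x\<in>H. norm (v k t (S x) - S (u k t x)) \<le> 0 * \<bar>t\<bar> * norm x"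
    using S by (simp add: almost_intertwines_def)
  then obtain \<eta> where \<eta>: "0 < \<eta>" "\<And>t x. \<bar>t\<bar> < \<eta> \<Longrightarrow> x \<in> H \<Longrightarrow> v k t (S x) = S (u k t x)"
    using k by (auto simp: eventually_nhds_metric dist_norm)
  obtain n :: nat where n: "\<bar>t\<bar> / \<eta> < n" using reals_Archimedean2 by blast
  then have n0: "0 < real n" using \<eta>(1) by (smt (verit) divide_nonneg_pos abs_ge_zero)
  define s where "s = t / n"
  have s: "\<bar>s\<bar> < \<eta>" using n n0 \<eta>(1) by (simp add: s_def field_simps)
  have "v k (m * s) (S x) = S (u k (m * s) x)" for m :: nat
  proof (induction m)
    case 0
    show ?case
      using isometric_actionD(2) [OF u k x] isometric_actionD(2) [OF v k isometry_onD(2) [OF iS x]] by simp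
  next
    case (Suc m)
    have e: "real (Suc m) * s = s + real m * s" by (simp add: algebra_simps)
    have "v k (real (Suc m) * s) (S x) = v k s (S (u k (real m * s) x))"
      unfolding e isometric_actionD(3) [OF v k isometry_onD(2) [OF iS x]] Suc ..
    also have "\<dots> = S (u k s (u k (real m * s) x))"
      by (rule \<eta>(2) [OF s isometric_actionD(4) [OF u k x]])
    finally show ?case unfolding e isometric_actionD(3) [OF u k x] .
  qed
  from this [of n] n0 show ?thesis by (simp add: s_def)
qed

section \<open>Truncation of sequences; separability and continuity of ampliations\<close>

lemma Rep_l2_sum: "Rep_l2 (\<Sum>i\<in>I. f i) m = (\<Sum>i\<in>I. Rep_l2 (f i) m)"
  by (induction I rule: infinite_finite_induct) (auto simp: zero_l2.rep_eq plus_l2.rep_eq)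

definition l2_single :: "nat \<Rightarrow> 'a :: complex_inner \<Rightarrow> (nat, 'a) l2" where
  "l2_single n x = Abs_l2 (\<lambda>m. if m = n then x else 0)"

lemma l2_single:
  shows Rep_l2_single: "Rep_l2 (l2_single n x) m = (if m = n then x else 0)"
    and norm_l2_single: "norm (l2_single n x) = norm x"
proof -
  have "((\<lambda>m. (norm (if m = n then x else 0))\<^sup>2) has_sum (norm x)\<^sup>2) {n}"
    by (intro has_sum_finiteI) auto
  then have "((\<lambda>m. (norm (if m = n then x else 0))\<^sup>2) has_sum (norm x)\<^sup>2) UNIV"
    by (rule has_sum_cong_neutral [THEN iffD1, rotated -1]) auto
  from l2_construct [OF this]
  show "Rep_l2 (l2_single n x) m = (if m = n then x else 0)" "norm (l2_single n x) = norm x"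
    unfolding l2_single_def by (auto simp: power2_eq_iff_nonneg)
qed

lemma l2_single_diff: "l2_single n (x - y) = l2_single n x - l2_single n y"
  by (rule l2_eqI) (simp add: Rep_l2_single minus_l2.rep_eq)

text \<open>The squared distance to a truncation is the tail of the series for the squared
  norm.\<close>

lemma l2_single_sum_tendsto:
  fixes f :: "(nat, 'a :: complex_inner) l2"
  shows "(\<lambda>N. \<Sum>n<N. l2_single n (Rep_l2 f n)) \<longlonglongrightarrow> f"
proof -
  have R: "Rep_l2 (\<Sum>n<N. l2_single n (Rep_l2 f n)) m = (if m < N then Rep_l2 f m else 0)" for N m
    by (simp add: Rep_l2_sum Rep_l2_single)
  have "(norm (f - (\<Sum>n<N. l2_single n (Rep_l2 f n))))\<^sup>2 = (norm f)\<^sup>2 - (\<Sum>n<N. (norm (Rep_l2 f n))\<^sup>2)" for N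
  proof -
    let ?g = "f - (\<Sum>n<N. l2_single n (Rep_l2 f n))"
    have "((\<lambda>m. (norm (Rep_l2 ?g m))\<^sup>2) has_sum (norm ?g)\<^sup>2) UNIV" by (rule has_sum_norm_l2)
    moreover have "((\<lambda>m. if m < N then (norm (Rep_l2 f m))\<^sup>2 else 0) has_sum (\<Sum>m<N. (norm (Rep_l2 f m))\<^sup>2)) UNIV"
    proof -
      have "((\<lambda>m. if m < N then (norm (Rep_l2 f m))\<^sup>2 else 0) has_sum (\<Sum>m<N. (norm (Rep_l2 f m))\<^sup>2)) {..<N}"
        by (intro has_sum_finiteI) auto
      then show ?thesis by (rule has_sum_cong_neutral [THEN iffD1, rotated -1]) auto
    qed
    ultimately have "((\<lambda>m. (norm (Rep_l2 ?g m))\<^sup>2 + (if m < N then (norm (Rep_l2 f m))\<^sup>2 else 0))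
        has_sum (norm ?g)\<^sup>2 + (\<Sum>m<N. (norm (Rep_l2 f m))\<^sup>2)) UNIV" by (rule has_sum_add)
    also have "(\<lambda>m. (norm (Rep_l2 ?g m))\<^sup>2 + (if m < N then (norm (Rep_l2 f m))\<^sup>2 else 0))
        = (\<lambda>m. (norm (Rep_l2 f m))\<^sup>2)"
      by (auto simp: minus_l2.rep_eq R)
    finally show ?thesis using has_sum_unique [OF has_sum_norm_l2 [of f]] by force
  qed
  moreover have "(\<lambda>N. (norm f)\<^sup>2 - (\<Sum>n<N. (norm (Rep_l2 f n))\<^sup>2)) \<longlonglongrightarrow> (norm f)\<^sup>2 - (norm f)\<^sup>2"
    using has_sum_imp_sums [OF has_sum_norm_l2 [of f]] by (intro tendsto_intros) (simp add: sums_def)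
  ultimately have "(\<lambda>N. (norm (f - (\<Sum>n<N. l2_single n (Rep_l2 f n))))\<^sup>2) \<longlonglongrightarrow> 0" by simp
  then have "(\<lambda>N. sqrt ((norm (f - (\<Sum>n<N. l2_single n (Rep_l2 f n))))\<^sup>2)) \<longlonglongrightarrow> sqrt 0"
    by (rule tendsto_real_sqrt)
  then have "(\<lambda>N. dist (\<Sum>n<N. l2_single n (Rep_l2 f n)) f) \<longlonglongrightarrow> 0"
    by (simp add: dist_norm norm_minus_commute)
  then show ?thesis by (rule tendsto_dist_iff [THEN iffD2])
qed

text \<open>Finite sequences with entries from a dense sequence are indexed by lists of natural
  numbers. Truncation uses half of the tolerance, and the \<open>N\<close> remaining entries share
  the other half.\<close>

lemma separable_ampl_space:
  fixes H :: "'a :: chilbert_space set"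
  assumes H: "hilbert H" and sep: "separable_space (top_of_set H)"
  shows "separable_space (top_of_set (ampl_space H))"
proof -
  have cH: "csubspace H" using H by (rule hilbert_csubspace)
  obtain x where x: "range x \<subseteq> H" "H \<subseteq> closure (range (x :: nat \<Rightarrow> 'a))"
    using separable_imp_dense_seq [OF sep] csubspace_0 [OF cH] by blast
  define s where "s xs = (\<Sum>n<length xs. l2_single n (x (xs ! n)))" for xs :: "nat list"
  show ?thesis
  proof (rule separable_spaceI)
    show "countable (range s)" by simp
    show "range s \<subseteq> ampl_space H"
    proof clarify
      fix xs
      have "Rep_l2 (s xs) m \<in> H" for m
        unfolding s_def Rep_l2_sum using x(1) csubspace_0 [OF cH]
        by (intro csubspace_sum cH) (auto simp: Rep_l2_single)
      then show "s xs \<in> ampl_space H" by (simp add: ampl_space_def)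
    qed
    show "ampl_space H \<subseteq> closure (range s)"
    proof
      fix f assume f: "f \<in> ampl_space H"
      show "f \<in> closure (range s)"
      proof (unfold closure_approachable, intro allI impI)
        fix r :: real assume "0 < r"
        then have "0 < r / 2" by simp
        then obtain N where N: "dist (\<Sum>n<N. l2_single n (Rep_l2 f n)) f < r / 2"
          using metric_LIMSEQ_D [OF l2_single_sum_tendsto [of f]] by blast
        \<comment> \<open>\<open>Suc N\<close> instead of \<open>N\<close> keeps the quotient
          positive when \<open>N = 0\<close>.\<close>
        have "\<exists>k. norm (x k - Rep_l2 f n) < r / (2 * real (Suc N))" for n
        proof -
          have "Rep_l2 f n \<in> closure (range x)" using x(2) f by (auto simp: ampl_space_def)
          then show ?thesis using \<open>0 < r\<close> by (auto simp: closure_approachable dist_norm)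
        qed
        then obtain k where k: "\<And>n. norm (x (k n) - Rep_l2 f n) < r / (2 * real (Suc N))" by metis
        have "dist (s (map k [0..<N])) (\<Sum>n<N. l2_single n (Rep_l2 f n))
            = norm (\<Sum>n<N. l2_single n (x (k n) - Rep_l2 f n))"
          by (simp add: s_def dist_norm l2_single_diff sum_subtractf)
        also have "\<dots> \<le> (\<Sum>n<N. norm (x (k n) - Rep_l2 f n))"
          by (rule order_trans [OF norm_sum]) (simp add: norm_l2_single)
        also have "\<dots> \<le> (\<Sum>n<N. r / (2 * real (Suc N)))" using k less_imp_le by (intro sum_mono) blast
        also have "\<dots> \<le> r / 2" using \<open>0 < r\<close> by (simp add: field_simps)
        finally have "dist (s (map k [0..<N])) f < r"
          using N dist_triangle [of "s (map k [0..<N])" f "\<Sum>n<N. l2_single n (Rep_l2 f n)"] by linarith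
        then show "\<exists>y\<in>range s. dist y f < r" by blast
      qed
    qed
  qed
qed

text \<open>The truncations are continuous in \<open>t\<close>, and they converge uniformly because
  the isometry \<open>w t\<close> gives the tail of \<open>f\<close> the same norm for every
  \<open>t\<close>.\<close>

lemma continuous_ampl:
  assumes w: "unitary_group H w" and iso: "\<And>t. isometry_on H H (w t)" and f: "f \<in> ampl_space H"
  shows "continuous_on UNIV (\<lambda>t. ampl_op H (w t) f)"
proof -
  have H: "hilbert H" using w by (simp add: unitary_group_def)
  have fH: "Rep_l2 f n \<in> H" for n using f by (simp add: ampl_space_def)
  define g where "g N t = (\<Sum>n<N. l2_single n (w t (Rep_l2 f n)))" for N t
  have eq: "ampl_op H (w t) f - g N t = ampl_map (w t) (f - (\<Sum>n<N. l2_single n (Rep_l2 f n)))"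
    and nrm: "norm (ampl_op H (w t) f - g N t) = norm (f - (\<Sum>n<N. l2_single n (Rep_l2 f n)))" for N t
  proof -
    let ?h = "f - (\<Sum>n<N. l2_single n (Rep_l2 f n))"
    have w0: "w t 0 = 0" by (rule clinear_on_0 [OF isometry_onD(1) [OF iso] hilbert_csubspace [OF H]])
    have h: "Rep_l2 ?h m = (if m < N then 0 else Rep_l2 f m)" for m
      by (simp add: minus_l2.rep_eq Rep_l2_sum Rep_l2_single)
    then have hH: "?h \<in> ampl_space H"
      using fH csubspace_0 [OF hilbert_csubspace [OF H]] by (simp add: ampl_space_def)
    show eq: "ampl_op H (w t) f - g N t = ampl_map (w t) ?h"
      by (rule l2_eqI)
        (simp add: Rep_ampl_map_isometry [OF iso hH] h ampl_op_eq [OF f] minus_l2.rep_eq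
          Rep_ampl_map_isometry [OF iso f] g_def Rep_l2_sum Rep_l2_single w0)
    show "norm (ampl_op H (w t) f - g N t) = norm ?h"
      unfolding eq by (rule isometry_onD(3) [OF isometry_on_ampl [OF iso H] hH])
  qed
  have "uniform_limit UNIV g (\<lambda>t. ampl_op H (w t) f) sequentially"
  proof (rule uniform_limitI)
    fix r :: real assume "0 < r"
    then have "\<forall>\<^sub>F N in sequentially. dist (\<Sum>n<N. l2_single n (Rep_l2 f n)) f < r"
      using l2_single_sum_tendsto [of f] by (auto simp: tendsto_iff)
    then show "\<forall>\<^sub>F N in sequentially. \<forall>t\<in>UNIV. dist (g N t) (ampl_op H (w t) f) < r"
      by eventually_elim (simp add: dist_norm norm_minus_commute [of "g _ _"] nrm,
        simp add: norm_minus_commute)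
  qed
  moreover have "continuous_on UNIV (g N)" for N
    unfolding g_def
  proof (intro continuous_on_sum)
    fix n
    have "continuous_on UNIV (\<lambda>t. w t (Rep_l2 f n))" using w fH by (simp add: unitary_group_def)
    then show "continuous_on UNIV (\<lambda>t. l2_single n (w t (Rep_l2 f n)))"
      by (simp add: continuous_on_iff dist_norm norm_l2_single flip: l2_single_diff)
  qed
  ultimately show ?thesis
    by (intro uniform_limit_theorem [where f = g and F = sequentially]) auto
qed

text \<open>The inequality A^2 \<le> c A for 0 \<le> A \<le> c, obtained from positivity of A at (1
  - A/c) x. It turns convergence of the quadratic forms of a monotone sequence into strong
  convergence.\<close>

lemma positive_form_sq:
  assumes H: "csubspace H" and lin: "clinear_on H A" and AH: "\<And>x. x \<in> H \<Longrightarrow> A x \<in> H"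
    and sym: "\<And>x y. x \<in> H \<Longrightarrow> y \<in> H \<Longrightarrow> cinner (A x) y = cinner x (A y)"
    and pos: "\<And>x. x \<in> H \<Longrightarrow> 0 \<le> Re (cinner x (A x))"
    and le: "\<And>x. x \<in> H \<Longrightarrow> Re (cinner x (A x)) \<le> c * (norm x)\<^sup>2" and c: "0 < c"
    and x: "x \<in> H"
  shows "(norm (A x))\<^sup>2 \<le> c * Re (cinner x (A x))"
proof -
  define s where "s = 1 / c"
  have AA: "A x \<in> H" "A (A x) \<in> H" "s *\<^sub>R A x \<in> H" using x AH H by (auto intro: csubspace_scaleR)
  have "0 \<le> Re (cinner (x - s *\<^sub>R A x) (A (x - s *\<^sub>R A x)))"
    using x AA H by (intro pos csubspace_diff)
  also have "A (x - s *\<^sub>R A x) = A x - s *\<^sub>R A (A x)"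
    using clinear_on_diff [OF lin H x AA(3)] clinear_on_scaleR [OF lin AA(1)] by simp
  also have "Re (cinner (x - s *\<^sub>R A x) (A x - s *\<^sub>R A (A x)))
      = Re (cinner x (A x)) - 2 * s * (norm (A x))\<^sup>2 + s\<^sup>2 * Re (cinner (A x) (A (A x)))"
  proof -
    have "cinner x (A (A x)) = cinner (A x) (A x)" using sym [OF x AA(1)] by simp
    then show ?thesis
      by (simp add: cinner.diff_left cinner.diff_right cinner.scaleR_left cinner.scaleR_right
          cinner_self_of_real power2_eq_square algebra_simps)
  qed
  also have "\<dots> \<le> Re (cinner x (A x)) - 2 * s * (norm (A x))\<^sup>2 + s\<^sup>2 * (c * (norm (A x))\<^sup>2)"
    using le [OF AA(1)] by (intro add_left_mono mult_left_mono) auto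
  also have "\<dots> = Re (cinner x (A x)) - (norm (A x))\<^sup>2 / c"
    using c by (simp add: s_def power2_eq_square field_simps)
  finally show ?thesis using c by (simp add: field_simps)
qed

lemma selfadjoint_opsD:
  assumes "T \<in> selfadjoint_ops H"
  shows "T \<in> bounded_ops H" "x \<in> H \<Longrightarrow> y \<in> H \<Longrightarrow> cinner (T x) y = cinner x (T y)"
  using assms by (auto simp: selfadjoint_ops_def adjoint_pair_def)

lemma op_le_trans: "op_le H A B \<Longrightarrow> op_le H B C \<Longrightarrow> op_le H A C"
  by (force simp: op_le_def)

lemma bounded_ops_bound:
  assumes "T \<in> bounded_ops H" shows "\<exists>c>0. \<forall>x\<in>H. norm (T x) \<le> c * norm x"
proof -
  obtain c where c: "\<forall>x\<in>H. norm (T x) \<le> c * norm x" using assms by (auto simp: bounded_ops_def)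
  have "norm (T x) \<le> max c 1 * norm x" if "x \<in> H" for x
    using c that order_trans [OF _ mult_right_mono [of c "max c 1" "norm x"]] by auto
  then show ?thesis by (intro exI [of _ "max c 1"]) auto
qed

lemma finite_directed_upper_bound:
  assumes "finite F" "F \<subseteq> \<D>" "\<D> \<noteq> {}"
    and dir: "\<And>A B. A \<in> \<D> \<Longrightarrow> B \<in> \<D> \<Longrightarrow> \<exists>C\<in>\<D>. op_le H A C \<and> op_le H B C"
  shows "\<exists>C\<in>\<D>. \<forall>A\<in>F. op_le H A C"
  using assms(1,2)
proof (induction F)
  case empty then show ?case using assms(3) by auto
next
  case (insert A F)
  then obtain C where C: "C \<in> \<D>" "\<forall>A\<in>F. op_le H A C" by auto
  obtain B where "B \<in> \<D>" "op_le H A B" "op_le H C B" using dir [of A C] insert C by auto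
  then show ?case using C op_le_trans by blast
qed

text \<open>On a separable space a directed set can be replaced by an increasing sequence that has the
  same supremum; the sequence converges strongly.\<close>

lemma directed_sup_sequence:
  fixes H :: "'a :: chilbert_space set"
  assumes H: "hilbert H" and sep: "separable_space (top_of_set H)"
    and \<D>: "\<D> \<subseteq> selfadjoint_ops H" "\<D> \<noteq> {}"
    and dir: "\<And>A B. A \<in> \<D> \<Longrightarrow> B \<in> \<D> \<Longrightarrow> \<exists>C\<in>\<D>. op_le H A C \<and> op_le H B C"
    and sup: "is_op_sup H \<D> S"
  obtains T :: "nat \<Rightarrow> 'a \<Rightarrow> 'a" where "\<And>n. T n \<in> \<D>" "\<And>m n. m \<le> n \<Longrightarrow> op_le H (T m) (T n)"
    "\<And>x. x \<in> H \<Longrightarrow> (\<lambda>n. Re (cinner x (T n x))) \<longlonglongrightarrow> Re (cinner x (S x))"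
proof -
  have cH: "csubspace H" using H by (rule hilbert_csubspace)
  obtain x where x: "range x \<subseteq> H" "H \<subseteq> closure (range (x :: nat \<Rightarrow> 'a))"
    using separable_imp_dense_seq [OF sep] csubspace_0 [OF cH] by blast
  have xH: "x i \<in> H" for i using x(1) by blast
  have ub: "op_le H A S" if "A \<in> \<D>" for A using sup that by (simp add: is_op_sup_def)
  have S: "S \<in> selfadjoint_ops H" using sup by (simp add: is_op_sup_def)
  define q where "q y = (SUP A\<in>\<D>. Re (cinner y (A y)))" for y
  have bdd: "bdd_above ((\<lambda>A. Re (cinner y (A y))) ` \<D>)" if "y \<in> H" for y
    using ub that by (intro bdd_aboveI2 [of _ _ "Re (cinner y (S y))"]) (auto simp: op_le_def)
  have q_upper: "Re (cinner y (A y)) \<le> q y" if "A \<in> \<D>" "y \<in> H" for A y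
    unfolding q_def using that bdd by (intro cSUP_upper)
  have approx: "\<exists>A\<in>\<D>. q (x j) - e < Re (cinner (x j) (A (x j)))" if "0 < e" for j e
    using less_cSUP_iff [OF \<D>(2) bdd [OF xH], of "q (x j) - e" j] that by (auto simp: q_def)
  \<comment> \<open>The next member dominates \<open>A\<close> and is almost optimal at the first
    \<open>n + 1\<close> points of the dense sequence simultaneously; directedness permits finitely
    many such demands.\<close>
  have step: "\<exists>B. B \<in> \<D> \<and> op_le H A B \<and> (\<forall>j\<le>n. q (x j) - 1 / Suc n < Re (cinner (x j) (B (x j))))"
    if A: "A \<in> \<D>" for A n
  proof -
    obtain C where C: "\<And>j. C j \<in> \<D>" "\<And>j. q (x j) - 1 / Suc n < Re (cinner (x j) (C j (x j)))"
      using approx [of "1 / Suc n"] by (metis zero_less_Suc of_nat_0_less_iff zero_less_divide_1_iff)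
    obtain B where B: "B \<in> \<D>" "\<forall>D\<in>insert A (C ` {..n}). op_le H D B"
      using finite_directed_upper_bound [of "insert A (C ` {..n})" \<D> H] A C(1) \<D>(2) dir by auto
    have "q (x j) - 1 / Suc n < Re (cinner (x j) (B (x j)))" if "j \<le> n" for j
    proof -
      have "op_le H (C j) B" using B(2) that by auto
      then show ?thesis using C(2) [of j] xH [of j] by (force simp: op_le_def)
    qed
    with B show ?thesis by blast
  qed
  obtain A0 where A0: "A0 \<in> \<D>" using \<D>(2) by blast
  have "\<exists>T. \<forall>n. T n \<in> \<D> \<and> (op_le H (T n) (T (Suc n)) \<and>
      (\<forall>j\<le>n. q (x j) - 1 / Suc n < Re (cinner (x j) (T (Suc n) (x j)))))"
    using A0 step by (intro dependent_nat_choice [where P = "\<lambda>_ A. A \<in> \<D>" and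
      Q = "\<lambda>n A B. op_le H A B \<and> (\<forall>j\<le>n. q (x j) - 1 / Suc n < Re (cinner (x j) (B (x j))))"]) blast+
  then obtain T where T: "\<And>n. T n \<in> \<D>" "\<And>n. op_le H (T n) (T (Suc n))"
    "\<And>n j. j \<le> n \<Longrightarrow> q (x j) - 1 / Suc n < Re (cinner (x j) (T (Suc n) (x j)))" by blast
  have mono: "op_le H (T m) (T n)" if "m \<le> n" for m n
    using that
  proof (induction rule: dec_induct)
    case base show ?case by (simp add: op_le_def)
  next
    case (step n) then show ?case using T(2) op_le_trans by blast
  qed
  have Tsa: "T n \<in> selfadjoint_ops H" for n using T(1) \<D>(1) by blast
  note Tb = selfadjoint_opsD(1) [OF Tsa] and Sb = selfadjoint_opsD(1) [OF S]
  obtain cS where cS: "0 < cS" "\<And>x. x \<in> H \<Longrightarrow> norm (S x) \<le> cS * norm x"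
    using bounded_ops_bound [OF Sb] by blast
  obtain c0 where c0: "0 < c0" "\<And>x. x \<in> H \<Longrightarrow> norm (T 0 x) \<le> c0 * norm x"
    using bounded_ops_bound [OF Tb] by blast
  \<comment> \<open>A constant for \<open>positive_form_sq\<close> that is uniform in
    \<open>m\<close> and \<open>n\<close>, since T n - T m \<le> S - T 0.\<close>
  define c where "c = cS + c0"
  have quad_bound: "\<bar>Re (cinner y (R y))\<bar> \<le> b * (norm y)\<^sup>2" if "norm (R y) \<le> b * norm y" for R b y
  proof -
    have "\<bar>Re (cinner y (R y))\<bar> \<le> norm y * norm (R y)"
      using abs_Re_le_cmod cmod_cinner_le order_trans by blast
    also have "\<dots> \<le> norm y * (b * norm y)" using that by (intro mult_left_mono) auto
    finally show ?thesis by (simp add: power2_eq_square mult_ac)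
  qed
  have diff_sq: "(norm (T n y - T m y))\<^sup>2 \<le> c * (Re (cinner y (T n y)) - Re (cinner y (T m y)))"
    if "m \<le> n" "y \<in> H" for m n y
  proof -
    have "(norm ((\<lambda>y. T n y - T m y) y))\<^sup>2 \<le> c * Re (cinner y ((\<lambda>y. T n y - T m y) y))"
    proof (rule positive_form_sq [OF cH])
      show "clinear_on H (\<lambda>y. T n y - T m y)"
        using bounded_opsD(2) [OF Tb [of n]] bounded_opsD(2) [OF Tb [of m]]
        by (auto simp: clinear_on_def scaleC.diff_right)
      show "T n z - T m z \<in> H" if "z \<in> H" for z
        using that bounded_opsD(1) [OF Tb] by (intro csubspace_diff cH)
      show "cinner (T n z - T m z) z' = cinner z (T n z' - T m z')" if "z \<in> H" "z' \<in> H" for z z'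
        using that selfadjoint_opsD(2) [OF Tsa] by (simp add: cinner.diff_left cinner.diff_right)
      show "0 \<le> Re (cinner z (T n z - T m z))" if "z \<in> H" for z
        using mono [OF \<open>m \<le> n\<close>] that by (simp add: op_le_def cinner.diff_right)
      show "Re (cinner z (T n z - T m z)) \<le> c * (norm z)\<^sup>2" if "z \<in> H" for z
      proof -
        have "Re (cinner z (T n z)) \<le> Re (cinner z (S z))" using ub [OF T(1)] that by (simp add: op_le_def)
        moreover have "Re (cinner z (T 0 z)) \<le> Re (cinner z (T m z))"
          using mono [of 0 m] that by (simp add: op_le_def)
        ultimately show ?thesis
          using quad_bound [of S z cS] quad_bound [of "T 0" z c0] cS(2) [OF that] c0(2) [OF that]
          by (simp add: cinner.diff_right c_def distrib_right)
      qed
    qed (use that cS(1) c0(1) in \<open>auto simp: c_def\<close>)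
    then show ?thesis by (simp add: cinner.diff_right)
  qed
  have qconv: "convergent (\<lambda>n. Re (cinner y (T n y)))" if "y \<in> H" for y
  proof (rule Bseq_monoseq_convergent [OF BseqI'])
    show "monoseq (\<lambda>n. Re (cinner y (T n y)))"
      using mono that by (intro monoI1) (auto simp: op_le_def)
    show "norm (Re (cinner y (T n y))) \<le> max \<bar>Re (cinner y (T 0 y))\<bar> \<bar>Re (cinner y (S y))\<bar>" for n
    proof -
      have "Re (cinner y (T 0 y)) \<le> Re (cinner y (T n y))" "Re (cinner y (T n y)) \<le> Re (cinner y (S y))"
        using mono [of 0 n] ub [OF T(1) [of n]] \<open>y \<in> H\<close> by (auto simp: op_le_def)
      then show ?thesis by (simp add: abs_le_iff max_def) linarith
    qed
  qed
  have "\<exists>l. (\<lambda>n. T n y) \<longlonglongrightarrow> l" if y: "y \<in> H" for y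
  proof -
    have "Cauchy (\<lambda>n. T n y)"
    proof (rule metric_CauchyI)
      fix e :: real assume "0 < e"
      then have "0 < e\<^sup>2 / c" using cS(1) c0(1) by (simp add: c_def)
      then obtain N where N: "\<And>m n. m \<ge> N \<Longrightarrow> n \<ge> N \<Longrightarrow>
          \<bar>Re (cinner y (T m y)) - Re (cinner y (T n y))\<bar> < e\<^sup>2 / c"
        using convergent_Cauchy [OF qconv [OF y]] by (auto simp: Cauchy_def dist_real_def) blast
      have *: "norm (T n y - T m y) < e" if "N \<le> m" "m \<le> n" for m n
      proof -
        have "c * (Re (cinner y (T n y)) - Re (cinner y (T m y))) < c * (e\<^sup>2 / c)"
          using N [of n m] that cS(1) c0(1) by (intro mult_strict_left_mono) (auto simp: c_def)
        then have "(norm (T n y - T m y))\<^sup>2 < e\<^sup>2"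
          using diff_sq [OF that(2) y] cS(1) c0(1) by (simp add: c_def)
        then show ?thesis using \<open>0 < e\<close> by (simp add: power2_less_imp_less)
      qed
      have "dist (T m y) (T n y) < e" if "N \<le> m" "N \<le> n" for m n
        using * [of m n] * [of n m] that by (cases "m \<le> n") (auto simp: dist_norm norm_minus_commute)
      then show "\<exists>N. \<forall>m\<ge>N. \<forall>n\<ge>N. dist (T m y) (T n y) < e" by blast
    qed
    then show ?thesis by (auto simp: Cauchy_convergent_iff convergent_def)
  qed
  then obtain S0 where S0: "\<And>y. y \<in> H \<Longrightarrow> (\<lambda>n. T n y) \<longlonglongrightarrow> S0 y" by metis
  define S' where "S' = restrict S0 H"
  have S': "(\<lambda>n. T n y) \<longlonglongrightarrow> S' y" if "y \<in> H" for y using S0 that by (simp add: S'_def)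
  have quadS': "(\<lambda>n. Re (cinner y (T n y))) \<longlonglongrightarrow> Re (cinner y (S' y))" if "y \<in> H" for y
    by (intro tendsto_Re cinner.tendsto tendsto_const S' that)
  have S'H: "S' y \<in> H" if "y \<in> H" for y
    using closed_sequentially [OF hilbert_closed [OF H] _ S' [OF that]] bounded_opsD(1) [OF Tb] that
    by blast
  have S'b: "S' \<in> bounded_ops H"
  proof (rule bounded_opsI)
    show "clinear_on H S'"
      unfolding clinear_on_def
    proof (intro conjI ballI allI)
      fix y z a assume y: "y \<in> H"
      show "S' (a *\<^sub>C y) = a *\<^sub>C S' y"
      proof (rule LIMSEQ_unique)
        show "(\<lambda>n. T n (a *\<^sub>C y)) \<longlonglongrightarrow> S' (a *\<^sub>C y)" using y cH by (intro S' csubspace_scaleC)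
        show "(\<lambda>n. T n (a *\<^sub>C y)) \<longlonglongrightarrow> a *\<^sub>C S' y"
          using clinear_on_scaleC [OF bounded_opsD(2) [OF Tb] y]
          by (simp add: scaleC.tendsto [OF tendsto_const S' [OF y]])
      qed
      assume z: "z \<in> H"
      show "S' (y + z) = S' y + S' z"
      proof (rule LIMSEQ_unique)
        show "(\<lambda>n. T n (y + z)) \<longlonglongrightarrow> S' (y + z)" using y z cH by (intro S' csubspace_add)
        show "(\<lambda>n. T n (y + z)) \<longlonglongrightarrow> S' y + S' z"
          using clinear_on_add [OF bounded_opsD(2) [OF Tb] y z]
          by (simp add: tendsto_add [OF S' [OF y] S' [OF z]])
      qed
    qed
    fix y assume y: "y \<in> H"
    show "norm (S' y) \<le> (c + c0) * norm y"
    proof (rule LIMSEQ_le_const2 [OF tendsto_norm [OF S' [OF y]]], intro exI allI impI)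
      fix n :: nat
      have "Re (cinner y (T n y)) - Re (cinner y (T 0 y)) \<le> Re (cinner y (S y)) - Re (cinner y (T 0 y))"
        using ub [OF T(1)] y by (simp add: op_le_def)
      also have "\<dots> \<le> c * (norm y)\<^sup>2"
        using quad_bound [of S y cS] quad_bound [of "T 0" y c0] cS(2) [OF y] c0(2) [OF y]
        by (simp add: c_def distrib_right)
      finally have "c * (Re (cinner y (T n y)) - Re (cinner y (T 0 y))) \<le> c * (c * (norm y)\<^sup>2)"
        using cS(1) c0(1) by (intro mult_left_mono) (auto simp: c_def)
      then have "(norm (T n y - T 0 y))\<^sup>2 \<le> (c * norm y)\<^sup>2"
        using diff_sq [OF _ y, of 0 n] by (simp add: power_mult_distrib power2_eq_square mult_ac)
      then have "norm (T n y - T 0 y) \<le> c * norm y"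
        by (rule power2_le_imp_le) (use cS(1) c0(1) in \<open>simp add: c_def\<close>)
      then show "norm (T n y) \<le> (c + c0) * norm y"
        using c0(2) [OF y] norm_triangle_sub [of "T n y" "T 0 y"] by (simp add: distrib_right)
    qed
  qed (use S'H in \<open>auto simp: S'_def\<close>)
  have "S' \<in> selfadjoint_ops H"
    unfolding selfadjoint_ops_def adjoint_pair_def
  proof (intro CollectI conjI ballI S'b)
    fix y z assume yz: "y \<in> H" "z \<in> H"
    show "cinner (S' y) z = cinner y (S' z)"
    proof (rule LIMSEQ_unique)
      show "(\<lambda>n. cinner (T n y) z) \<longlonglongrightarrow> cinner (S' y) z"
        by (intro cinner.tendsto S' yz tendsto_const)
      show "(\<lambda>n. cinner (T n y) z) \<longlonglongrightarrow> cinner y (S' z)"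
        using selfadjoint_opsD(2) [OF Tsa yz] by (simp add: cinner.tendsto [OF tendsto_const S' [OF yz(2)]])
    qed
  qed
  \<comment> \<open>At the points of the dense sequence the limit form reaches the supremum
    \<open>q\<close> by construction; forms of bounded operators are continuous, so the inequality
    extends to \<open>H\<close>.\<close>
  moreover have "op_le H A S'" if A: "A \<in> \<D>" for A
    unfolding op_le_def
  proof
    have Ab: "A \<in> bounded_ops H" using A \<D>(1) selfadjoint_opsD(1) by blast
    have cont: "((\<lambda>n. Re (cinner (f n) (R (f n)))) \<longlonglongrightarrow> Re (cinner y (R y)))"
      if prems: "R \<in> bounded_ops H" "\<And>n. f n \<in> H" "f \<longlonglongrightarrow> y" "y \<in> H" for R y and f :: "nat \<Rightarrow> 'a"
    proof -
      obtain b where b: "\<And>x. x \<in> H \<Longrightarrow> norm (R x) \<le> b * norm x"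
        using bounded_ops_bound [OF prems(1)] by blast
      have "(\<lambda>n. R (f n) - R y) \<longlonglongrightarrow> 0"
      proof (rule Lim_null_comparison)
        show "\<forall>\<^sub>F n in sequentially. norm (R (f n) - R y) \<le> b * norm (f n - y)"
          using b csubspace_diff [OF cH prems(2) prems(4)] clinear_on_diff [OF bounded_opsD(2) [OF prems(1)] cH prems(2) prems(4)]
          by (intro always_eventually allI) metis
        have "(\<lambda>n. b * norm (f n - y)) \<longlonglongrightarrow> b * norm (y - y)" by (intro tendsto_intros prems)
        then show "(\<lambda>n. b * norm (f n - y)) \<longlonglongrightarrow> 0" by simp
      qed
      then have "(\<lambda>n. R (f n)) \<longlonglongrightarrow> R y" by (rule LIM_zero_cancel)
      then show ?thesis by (intro tendsto_Re cinner.tendsto prems)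
    qed
    fix y assume y: "y \<in> H"
    have "y \<in> closure (range x)" using y x(2) by blast
    then obtain f where f: "\<And>n. f n \<in> range x" "f \<longlonglongrightarrow> y" by (auto simp: closure_sequential)
    have fH: "f n \<in> H" for n using f(1) x(1) by blast
    have "Re (cinner (x j) (A (x j))) \<le> Re (cinner (x j) (S' (x j)))" for j
    proof -
      have "(\<lambda>n. Re (cinner (x j) (T (Suc n) (x j)))) \<longlonglongrightarrow> Re (cinner (x j) (S' (x j)))"
        using quadS' [OF xH] by (rule LIMSEQ_Suc)
      moreover have "(\<lambda>n. q (x j) - 1 / Suc n) \<longlonglongrightarrow> q (x j) - 0"
        by (intro tendsto_diff tendsto_const) (use LIMSEQ_inverse_real_of_nat in \<open>simp add: inverse_eq_divide\<close>)
      ultimately have "q (x j) - 0 \<le> Re (cinner (x j) (S' (x j)))"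
        using T(3) less_imp_le by (intro LIMSEQ_le) blast+
      then show ?thesis using q_upper [OF A xH [of j]] by simp
    qed
    then have "Re (cinner (f n) (A (f n))) \<le> Re (cinner (f n) (S' (f n)))" for n using f(1) by (metis imageE)
    then show "Re (cinner y (A y)) \<le> Re (cinner y (S' y))"
      using cont [OF Ab fH f(2) y] cont [OF S'b fH f(2) y] by (intro LIMSEQ_le) blast+
  qed
  \<comment> \<open>\<open>S\<close> is below \<open>S'\<close> as the least upper bound; conversely
    every \<open>T n\<close> is below \<open>S\<close>, so the two forms agree.\<close>
  ultimately have "op_le H S S'" using sup by (simp add: is_op_sup_def)
  moreover have "Re (cinner y (S' y)) \<le> Re (cinner y (S y))" if "y \<in> H" for y
    using ub [OF T(1)] that by (intro LIMSEQ_le_const2 [OF quadS' [OF that]]) (auto simp: op_le_def)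
  ultimately have "Re (cinner y (S' y)) = Re (cinner y (S y))" if "y \<in> H" for y
    using that by (auto simp: op_le_def intro: antisym)
  with quadS' have "(\<lambda>n. Re (cinner y (T n y))) \<longlonglongrightarrow> Re (cinner y (S y))" if "y \<in> H" for y
    using that by metis
  with T(1) mono show thesis by (rule that)
qed

section \<open>Bounded operators under ampliation\<close>

lemma bounded_ops_add:
  assumes "csubspace H" "S \<in> bounded_ops H" "T \<in> bounded_ops H"
  shows "(\<lambda>x\<in>H. S x + T x) \<in> bounded_ops H"
proof -
  obtain a b where ab: "\<And>x. x \<in> H \<Longrightarrow> norm (S x) \<le> a * norm x" "\<And>x. x \<in> H \<Longrightarrow> norm (T x) \<le> b * norm x"
    using assms bounded_ops_bound by metis
  show ?thesis
  proof (rule bounded_opsI)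
    show "norm ((\<lambda>x\<in>H. S x + T x) x) \<le> (a + b) * norm x" if "x \<in> H" for x
      using that norm_triangle_mono [OF ab [OF that]] by (simp add: distrib_right)
    show "clinear_on H (\<lambda>x\<in>H. S x + T x)"
      using assms(1) bounded_opsD(2) [OF assms(2)] bounded_opsD(2) [OF assms(3)]
      by (auto simp: clinear_on_def csubspace_add csubspace_scaleC scaleC.add_right)
  qed (use assms bounded_opsD(1) [OF assms(2)] bounded_opsD(1) [OF assms(3)] in \<open>auto intro: csubspace_add\<close>)
qed

lemma bounded_ops_scaleC:
  assumes "csubspace H" "T \<in> bounded_ops H"
  shows "(\<lambda>x\<in>H. a *\<^sub>C T x) \<in> bounded_ops H"
proof -
  obtain b where b: "\<And>x. x \<in> H \<Longrightarrow> norm (T x) \<le> b * norm x" using assms bounded_ops_bound by metis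
  show ?thesis
  proof (rule bounded_opsI)
    show "norm ((\<lambda>x\<in>H. a *\<^sub>C T x) x) \<le> (cmod a * b) * norm x" if "x \<in> H" for x
      using that mult_left_mono [OF b [OF that], of "cmod a"] by (simp add: norm_scaleC mult.assoc)
    show "clinear_on H (\<lambda>x\<in>H. a *\<^sub>C T x)"
      using assms(1) bounded_opsD(2) [OF assms(2)]
      by (auto simp: clinear_on_def csubspace_add csubspace_scaleC scaleC.add_right scaleC_scaleC mult.commute)
  qed (use assms bounded_opsD(1) [OF assms(2)] in \<open>auto intro: csubspace_scaleC\<close>)
qed

lemma bounded_ops_compose:
  assumes "csubspace H" "S \<in> bounded_ops H" "T \<in> bounded_ops H"
  shows "compose H S T \<in> bounded_ops H"
proof -
  obtain a b where ab: "0 < a" "\<And>x. x \<in> H \<Longrightarrow> norm (S x) \<le> a * norm x" "\<And>x. x \<in> H \<Longrightarrow> norm (T x) \<le> b * norm x"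
    using assms bounded_ops_bound by metis
  note TH = bounded_opsD(1) [OF assms(3)]
  show ?thesis
  proof (rule bounded_opsI)
    show "norm (compose H S T x) \<le> (a * b) * norm x" if "x \<in> H" for x
      using that order_trans [OF ab(2) [OF TH [OF that]] mult_left_mono [OF ab(3) [OF that], of a]] ab(1)
      by (simp add: compose_def mult.assoc)
    show "clinear_on H (compose H S T)"
      using assms(1) bounded_opsD(2) [OF assms(2)] bounded_opsD(2) [OF assms(3)] TH
      by (auto simp: clinear_on_def csubspace_add csubspace_scaleC compose_def)
  qed (use bounded_opsD(1) [OF assms(2)] TH in \<open>auto simp: compose_def\<close>)
qed

lemma Rep_ampl_op:
  assumes T: "T \<in> bounded_ops H" and f: "f \<in> ampl_space H"
  shows "Rep_l2 (ampl_op H T f) n = T (Rep_l2 f n)"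
proof -
  obtain c where "\<And>x. x \<in> H \<Longrightarrow> norm (T x) \<le> c * norm x" using bounded_ops_bound [OF T] by blast
  then show ?thesis
    using f Rep_ampl_map [of T f c] by (simp add: ampl_op_eq) (simp add: ampl_space_def)
qed

lemma ampl_op_bounded:
  assumes H: "hilbert H" and T: "T \<in> bounded_ops H"
  shows "ampl_op H T \<in> bounded_ops (ampl_space H)"
proof -
  obtain c where c: "0 < c" "\<And>x. x \<in> H \<Longrightarrow> norm (T x) \<le> c * norm x" using bounded_ops_bound [OF T] by blast
  note cA = hilbert_csubspace [OF hilbert_ampl_space [OF H]] and R = Rep_ampl_op [OF T]
  have in_H: "f \<in> ampl_space H \<Longrightarrow> Rep_l2 f n \<in> H" for f n by (simp add: ampl_space_def)
  show ?thesis
  proof (rule bounded_opsI)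
    show "ampl_op H T f \<in> ampl_space H" if "f \<in> ampl_space H" for f
      using R [OF that] in_H [OF that] bounded_opsD(1) [OF T] by (simp add: ampl_space_def)
    show "norm (ampl_op H T f) \<le> c * norm f" if "f \<in> ampl_space H" for f
      using R [OF that] in_H [OF that] c by (intro norm_l2_le) auto
    show "clinear_on (ampl_space H) (ampl_op H T)"
      unfolding clinear_on_def
    proof (intro conjI ballI allI l2_eqI)
      fix f g a n assume f: "f \<in> ampl_space H"
      show "Rep_l2 (ampl_op H T (a *\<^sub>C f)) n = Rep_l2 (a *\<^sub>C ampl_op H T f) n"
        using csubspace_scaleC [OF cA f] clinear_on_scaleC [OF bounded_opsD(2) [OF T] in_H [OF f]]
        by (simp add: R f scaleC_l2.rep_eq)
      assume g: "g \<in> ampl_space H"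
      show "Rep_l2 (ampl_op H T (f + g)) n = Rep_l2 (ampl_op H T f + ampl_op H T g) n"
        using csubspace_add [OF cA f g] clinear_on_add [OF bounded_opsD(2) [OF T] in_H [OF f] in_H [OF g]]
        by (simp add: R f g plus_l2.rep_eq)
    qed
  qed (simp add: ampl_op_def)
qed

lemma cinner_summable: "(\<lambda>n. cinner (Rep_l2 f n) (Rep_l2 g n)) summable_on UNIV"
  using Rep_l2 [of f] Rep_l2 [of g] by (intro l2_cinner_summable) auto

lemma has_sum_cinner_ampl:
  assumes "T \<in> bounded_ops H" "f \<in> ampl_space H"
  shows "((\<lambda>n. Re (cinner (Rep_l2 f n) (T (Rep_l2 f n)))) has_sum Re (cinner f (ampl_op H T f))) UNIV"
proof -
  have "((\<lambda>n. cinner (Rep_l2 f n) (T (Rep_l2 f n))) has_sum cinner f (ampl_op H T f)) UNIV"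
    using cinner_summable [of f "ampl_op H T f"] has_sum_infsum
    unfolding cinner_l2.rep_eq Rep_ampl_op [OF assms] by blast
  then show ?thesis by (rule has_sum_Re)
qed

lemma ampl_op_selfadjoint:
  assumes H: "hilbert H" and T: "T \<in> selfadjoint_ops H"
  shows "ampl_op H T \<in> selfadjoint_ops (ampl_space H)"
  using selfadjoint_opsD [OF T] ampl_op_bounded [OF H]
  by (auto simp: selfadjoint_ops_def adjoint_pair_def cinner_l2.rep_eq Rep_ampl_op ampl_space_def
      intro!: infsum_cong)

lemma has_sum_real_diff:
  fixes f g :: "'i \<Rightarrow> real"
  assumes "(f has_sum a) A" "(g has_sum b) A"
  shows "((\<lambda>x. f x - g x) has_sum (a - b)) A"
  using has_sum_add [OF assms(1) has_sum_cmult_right [OF assms(2), of "-1"]] by simp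

text \<open>The quadratic form of an ampliation is a series over the entries, so preserving suprema
  is a monotone convergence statement for series. The increasing sequence of
  \<open>directed_sup_sequence\<close> makes it applicable to a directed set.\<close>

lemma normal_map_ampl:
  fixes H :: "'a :: chilbert_space set"
  assumes H: "hilbert H" and sep: "separable_space (top_of_set H)"
  shows "normal_map H (ampl_space H) (ampl_op H)"
  unfolding normal_map_def
proof (intro allI impI; elim conjE)
  fix \<D> S
  assume \<D>: "\<D> \<subseteq> selfadjoint_ops H" "\<D> \<noteq> {}" and sup: "is_op_sup H \<D> S"
    and dir: "\<forall>A\<in>\<D>. \<forall>B\<in>\<D>. \<exists>C\<in>\<D>. op_le H A C \<and> op_le H B C"
  obtain T where T: "\<And>n. T n \<in> \<D>" "\<And>m n. m \<le> n \<Longrightarrow> op_le H (T m) (T n)"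
    "\<And>x. x \<in> H \<Longrightarrow> (\<lambda>n. Re (cinner x (T n x))) \<longlonglongrightarrow> Re (cinner x (S x))"
    using directed_sup_sequence [OF H sep \<D> _ sup] dir by blast
  have S: "S \<in> selfadjoint_ops H" using sup by (simp add: is_op_sup_def)
  note Sb = selfadjoint_opsD(1) [OF S]
  have Tb: "T n \<in> bounded_ops H" for n using T(1) \<D>(1) selfadjoint_opsD(1) by blast
  show "is_op_sup (ampl_space H) (ampl_op H ` \<D>) (ampl_op H S)"
    unfolding is_op_sup_def
  proof (intro conjI ballI impI)
    show "ampl_op H S \<in> selfadjoint_ops (ampl_space H)" by (rule ampl_op_selfadjoint [OF H S])
    fix R assume "R \<in> ampl_op H ` \<D>"
    then obtain A where A: "A \<in> \<D>" "R = ampl_op H A" by blast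
    have Ab: "A \<in> bounded_ops H" using A \<D>(1) selfadjoint_opsD(1) by blast
    have AS: "op_le H A S" using sup A by (simp add: is_op_sup_def)
    show "op_le (ampl_space H) R (ampl_op H S)"
      unfolding op_le_def A
    proof
      fix f assume f: "f \<in> ampl_space H"
      show "Re (cinner f (ampl_op H A f)) \<le> Re (cinner f (ampl_op H S f))"
        by (rule has_sum_mono [OF has_sum_cinner_ampl [OF Ab f] has_sum_cinner_ampl [OF Sb f]])
          (use AS f in \<open>auto simp: op_le_def ampl_space_def\<close>)
    qed
  next
    fix R assume R: "R \<in> selfadjoint_ops (ampl_space H)" "\<forall>A\<in>ampl_op H ` \<D>. op_le (ampl_space H) A R"
    show "op_le (ampl_space H) (ampl_op H S) R"
      unfolding op_le_def
    proof
      fix f assume f: "f \<in> ampl_space H"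
      have fH: "Rep_l2 f i \<in> H" for i using f by (simp add: ampl_space_def)
      let ?a = "\<lambda>n i. Re (cinner (Rep_l2 f i) (T n (Rep_l2 f i)))"
      let ?s = "\<lambda>i. Re (cinner (Rep_l2 f i) (S (Rep_l2 f i)))"
      note sT = has_sum_cinner_ampl [OF Tb f] and sS = has_sum_cinner_ampl [OF Sb f]
      \<comment> \<open>Subtracting the form of \<open>T 0\<close> makes the terms for each
        \<open>T n\<close> nonnegative, so finite partial sums are bounded by the whole series
        before \<open>n\<close> tends to infinity.\<close>
      have d: "((\<lambda>i. ?s i - ?a 0 i) has_sum Re (cinner f (ampl_op H S f)) - Re (cinner f (ampl_op H (T 0) f))) UNIV"
        by (rule has_sum_real_diff [OF sS sT])
      have "Re (cinner f (ampl_op H S f)) - Re (cinner f (ampl_op H (T 0) f))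
          \<le> Re (cinner f (R f)) - Re (cinner f (ampl_op H (T 0) f))"
      proof (rule has_sum_le_finite_sums [OF d])
        fix I :: "nat set" assume I: "finite I"
        have "(\<Sum>i\<in>I. ?a n i - ?a 0 i) \<le> Re (cinner f (R f)) - Re (cinner f (ampl_op H (T 0) f))" for n
        proof -
          have dn: "((\<lambda>i. ?a n i - ?a 0 i) has_sum Re (cinner f (ampl_op H (T n) f)) - Re (cinner f (ampl_op H (T 0) f))) UNIV"
            by (rule has_sum_real_diff [OF sT sT])
          have "(\<Sum>i\<in>I. ?a n i - ?a 0 i) \<le> Re (cinner f (ampl_op H (T n) f)) - Re (cinner f (ampl_op H (T 0) f))"
          proof (rule has_sum_mono2 [OF has_sum_finite [OF I] dn])
            show "0 \<le> ?a n i - ?a 0 i" for i using T(2) [of 0 n] fH by (simp add: op_le_def)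
          qed simp
          also have "\<dots> \<le> Re (cinner f (R f)) - Re (cinner f (ampl_op H (T 0) f))"
            using R(2) T(1) f by (auto simp: op_le_def)
          finally show ?thesis .
        qed
        moreover have "(\<lambda>n. \<Sum>i\<in>I. ?a n i - ?a 0 i) \<longlonglongrightarrow> (\<Sum>i\<in>I. ?s i - ?a 0 i)"
          by (intro tendsto_intros T(3) fH)
        ultimately show "(\<Sum>i\<in>I. ?s i - ?a 0 i) \<le> Re (cinner f (R f)) - Re (cinner f (ampl_op H (T 0) f))"
          by (intro LIMSEQ_le_const2) auto
      qed
      then show "Re (cinner f (ampl_op H S f)) \<le> Re (cinner f (R f))" by simp
    qed
  qed
qed

lemma faithful_normal_rep_ampl:
  fixes H :: "'a :: chilbert_space set"
  assumes H: "hilbert H" and sep: "separable_space (top_of_set H)"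
  shows "faithful_normal_rep H (ampl_space H) (ampl_op H)"
  unfolding faithful_normal_rep_def
proof (intro conjI normal_map_ampl [OF H sep])
  have cH: "csubspace H" using H by (rule hilbert_csubspace)
  have in_H: "f \<in> ampl_space H \<Longrightarrow> Rep_l2 f n \<in> H" for f n by (simp add: ampl_space_def)
  note R = Rep_ampl_op and add = bounded_ops_add [OF cH] and sc = bounded_ops_scaleC [OF cH]
    and co = bounded_ops_compose [OF cH]
  have ext: "ampl_op H T \<in> extensional (ampl_space H)" for T by (simp add: ampl_op_def)
  have A: "ampl_op H T f \<in> ampl_space H" if "T \<in> bounded_ops H" "f \<in> ampl_space H" for T f
    using bounded_opsD(1) [OF ampl_op_bounded [OF H that(1)] that(2)] .
  show "representation H (ampl_space H) (ampl_op H)"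
    unfolding representation_def
  proof (intro conjI ballI allI impI)
    show "ampl_op H ` bounded_ops H \<subseteq> bounded_ops (ampl_space H)" using ampl_op_bounded [OF H] by blast
    show "ampl_op H (\<lambda>x\<in>H. x) = (\<lambda>x\<in>ampl_space H. x)"
      by (rule extensionalityI [OF ext]) (auto intro!: l2_eqI simp: R id_bounded [OF cH] in_H)
    fix T assume T: "T \<in> bounded_ops H"
    show "ampl_op H (\<lambda>x\<in>H. a *\<^sub>C T x) = (\<lambda>x\<in>ampl_space H. a *\<^sub>C ampl_op H T x)" for a
      by (rule extensionalityI [OF ext]) (auto intro!: l2_eqI simp: R sc T in_H scaleC_l2.rep_eq)
    fix S assume S: "S \<in> bounded_ops H"
    show "ampl_op H (\<lambda>x\<in>H. S x + T x) = (\<lambda>x\<in>ampl_space H. ampl_op H S x + ampl_op H T x)"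
      by (rule extensionalityI [OF ext]) (auto intro!: l2_eqI simp: R add T S in_H plus_l2.rep_eq)
    show "ampl_op H (compose H S T) = compose (ampl_space H) (ampl_op H S) (ampl_op H T)"
      by (rule extensionalityI [OF ext compose_extensional])
        (auto intro!: l2_eqI simp: R co T S A in_H compose_eq)
    assume "adjoint_pair H S T"
    then show "adjoint_pair (ampl_space H) (ampl_op H S) (ampl_op H T)"
      by (auto simp: adjoint_pair_def cinner_l2.rep_eq R S T in_H intro!: infsum_cong)
  qed
  show "inj_on (ampl_op H) (bounded_ops H)"
  proof (rule inj_onI)
    fix S T assume S: "S \<in> bounded_ops H" and T: "T \<in> bounded_ops H" and eq: "ampl_op H S = ampl_op H T"
    show "S = T"
    proof (rule extensionalityI [OF bounded_opsD(3) [OF S] bounded_opsD(3) [OF T]])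
      fix x assume x: "x \<in> H"
      have s: "l2_single 0 x \<in> ampl_space H" using x csubspace_0 [OF cH] by (simp add: ampl_space_def Rep_l2_single)
      have "Rep_l2 (ampl_op H S (l2_single 0 x)) 0 = Rep_l2 (ampl_op H T (l2_single 0 x)) 0" by (simp add: eq)
      then show "S x = T x" by (simp add: R [OF S s] R [OF T s] Rep_l2_single)
    qed
  qed
qed

subsection \<open>Transport along a unitary\<close>

definition transport ::
  "'a :: chilbert_space set \<Rightarrow> 'b :: chilbert_space set \<Rightarrow> ('a \<Rightarrow> 'b) \<Rightarrow> ('a \<Rightarrow> 'a) \<Rightarrow> 'b \<Rightarrow> 'b" where
  "transport N M W T = (\<lambda>y\<in>M. W (T (inv_into N W y)))"

locale unitary_map =
  fixes N :: "'a :: chilbert_space set" and M :: "'b :: chilbert_space set" and W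
  assumes N: "hilbert N" and W: "isometry_on N M W" and surj: "W ` N = M"
begin

abbreviation "Wi \<equiv> inv_into N W"
abbreviation "C \<equiv> transport N M W"

lemma M: "hilbert M" using hilbert_isometry_image [OF W N] surj by simp
lemma cN: "csubspace N" using N by (rule hilbert_csubspace)
lemma cM: "csubspace M" using M by (rule hilbert_csubspace)
lemma Wi: "y \<in> M \<Longrightarrow> Wi y \<in> N" "y \<in> M \<Longrightarrow> W (Wi y) = y"
  using surj by (auto intro: inv_into_into f_inv_into_f)
lemma Wi_W: "x \<in> N \<Longrightarrow> Wi (W x) = x" using isometry_on_inj [OF W cN] by simp
lemma W_in: "x \<in> N \<Longrightarrow> W x \<in> M" using W by (rule isometry_onD)
lemma iWi: "isometry_on M N Wi" by (rule isometry_on_inv_into [OF W cN surj])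
lemma C_eq: "y \<in> M \<Longrightarrow> C T y = W (T (Wi y))" by (simp add: transport_def)
lemma C_ext: "C T \<in> extensional M" by (simp add: transport_def)
lemma cinner_W: "x \<in> N \<Longrightarrow> y \<in> N \<Longrightarrow> cinner (W x) (W y) = cinner x y"
  by (rule isometry_on_cinner [OF W cN])
lemma W_Wi_cinner: "x \<in> N \<Longrightarrow> y \<in> M \<Longrightarrow> cinner (W x) y = cinner x (Wi y)"
  using cinner_W [of x "Wi y"] Wi by simp
lemma Wi_W_cinner: "x \<in> M \<Longrightarrow> y \<in> N \<Longrightarrow> cinner x (W y) = cinner (Wi x) y"
  using cinner_W [of "Wi x" y] Wi by simp

lemma bounded_C: "T \<in> bounded_ops N \<Longrightarrow> C T \<in> bounded_ops M"
proof -
  assume T: "T \<in> bounded_ops N"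
  note TN = bounded_opsD(1) [OF T] and lW = isometry_onD(1) [OF W] and lWi = isometry_onD(1) [OF iWi]
  obtain c where c: "\<And>x. x \<in> N \<Longrightarrow> norm (T x) \<le> c * norm x" using bounded_ops_bound [OF T] by blast
  show ?thesis
  proof (rule bounded_opsI [OF _ _ _ C_ext])
    fix y assume y: "y \<in> M"
    show "C T y \<in> M" using y by (simp add: C_eq W_in TN Wi)
    show "norm (C T y) \<le> c * norm y"
      using y c [OF Wi(1) [OF y]] isometry_onD(3) [OF W TN [OF Wi(1) [OF y]]] isometry_onD(3) [OF iWi y]
      by (simp add: C_eq)
  next
    show "clinear_on M (C T)"
      using cM Wi TN bounded_opsD(2) [OF T]
      by (auto simp: clinear_on_def C_eq csubspace_add csubspace_scaleC clinear_on_add [OF lWi]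
          clinear_on_scaleC [OF lWi] clinear_on_add [OF lW] clinear_on_scaleC [OF lW])
  qed
qed

lemma selfadjoint_C: "T \<in> selfadjoint_ops N \<Longrightarrow> C T \<in> selfadjoint_ops M"
  using bounded_C bounded_opsD(1) [of T N]
  by (auto simp: selfadjoint_ops_def adjoint_pair_def C_eq W_Wi_cinner Wi_W_cinner Wi)

lemma op_le_C:
  assumes "S \<in> bounded_ops N" "T \<in> bounded_ops N"
  shows "op_le M (C S) (C T) \<longleftrightarrow> op_le N S T"
proof
  assume le: "op_le M (C S) (C T)"
  show "op_le N S T"
    unfolding op_le_def
  proof
    fix x assume x: "x \<in> N"
    have "Re (cinner (W x) (C S (W x))) \<le> Re (cinner (W x) (C T (W x)))"
      using le W_in [OF x] by (simp add: op_le_def)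
    then show "Re (cinner x (S x)) \<le> Re (cinner x (T x))"
      using x assms by (simp add: C_eq W_in Wi_W cinner_W bounded_opsD)
  qed
qed (use assms in \<open>auto simp: op_le_def C_eq Wi_W_cinner Wi bounded_opsD\<close>)

lemma inverse_map: "unitary_map M N Wi"
proof
  show "Wi ` M = N"
  proof (intro equalityI subsetI)
    fix x assume "x \<in> N"
    then show "x \<in> Wi ` M" using Wi_W W_in by (intro image_eqI [of _ _ "W x"]) auto
  qed (auto intro: Wi)
qed (rule M iWi)+

end

context unitary_map
begin

text \<open>All facts on \<open>C\<close> now hold for conjugation by the inverse unitary too; this
  makes \<open>C\<close> a bijection and transfers upper bounds back to \<open>N\<close>.\<close>

interpretation inverse: unitary_map M N Wi by (rule inverse_map)

lemma inverse_Wi: "x \<in> N \<Longrightarrow> inverse.Wi x = W x"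
  using inverse.Wi_W [OF W_in] Wi_W by metis

lemma C_inverse: "T \<in> bounded_ops M \<Longrightarrow> C (inverse.C T) = T"
  using bounded_opsD(1,3) [of T M]
  by (intro extensionalityI [OF C_ext]) (auto simp: C_eq inverse.C_eq Wi inverse_Wi)

lemma inverse_C: "T \<in> bounded_ops N \<Longrightarrow> inverse.C (C T) = T"
  using bounded_opsD(1,3) [of T N]
  by (intro extensionalityI [OF inverse.C_ext]) (auto simp: C_eq inverse.C_eq W_in Wi_W inverse_Wi)

text \<open>Conjugation by a unitary is an order isomorphism, so normality is the transport of least
  upper bounds.\<close>

lemma faithful_normal_rep_C: "faithful_normal_rep N M C"
  unfolding faithful_normal_rep_def
proof (intro conjI)
  note lW = isometry_onD(1) [OF W]
  show "representation N M C"
    unfolding representation_def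
  proof (intro conjI ballI allI impI)
    show "C ` bounded_ops N \<subseteq> bounded_ops M" using bounded_C by blast
    show "C (\<lambda>x\<in>N. x) = (\<lambda>x\<in>M. x)" by (rule extensionalityI [OF C_ext]) (auto simp: C_eq Wi)
    fix T assume T: "T \<in> bounded_ops N"
    show "C (\<lambda>x\<in>N. a *\<^sub>C T x) = (\<lambda>x\<in>M. a *\<^sub>C C T x)" for a
      using bounded_opsD(1) [OF T]
      by (intro extensionalityI [OF C_ext]) (auto simp: C_eq Wi clinear_on_scaleC [OF lW])
    fix S assume S: "S \<in> bounded_ops N"
    show "C (\<lambda>x\<in>N. S x + T x) = (\<lambda>x\<in>M. C S x + C T x)"
      using bounded_opsD(1) [OF T] bounded_opsD(1) [OF S]
      by (intro extensionalityI [OF C_ext]) (auto simp: C_eq Wi clinear_on_add [OF lW])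
    show "C (compose N S T) = compose M (C S) (C T)"
      using bounded_opsD(1) [OF T]
      by (intro extensionalityI [OF C_ext compose_extensional]) (auto simp: C_eq Wi W_in Wi_W compose_eq)
    assume "adjoint_pair N S T"
    then show "adjoint_pair M (C S) (C T)"
      using bounded_opsD(1) [OF T] bounded_opsD(1) [OF S]
      by (auto simp: adjoint_pair_def C_eq W_Wi_cinner Wi_W_cinner Wi)
  qed
  show "inj_on C (bounded_ops N)" by (rule inj_on_inverseI [of _ inverse.C]) (rule inverse_C)
  show "normal_map N M C"
    unfolding normal_map_def
  proof (intro allI impI; elim conjE)
    fix \<D> S assume \<D>: "\<D> \<subseteq> selfadjoint_ops N" and sup: "is_op_sup N \<D> S"
    have Db: "A \<in> bounded_ops N" if "A \<in> \<D>" for A using \<D> that selfadjoint_opsD(1) by blast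
    have S: "S \<in> selfadjoint_ops N" using sup by (simp add: is_op_sup_def)
    note Sb = selfadjoint_opsD(1) [OF S]
    show "is_op_sup M (C ` \<D>) (C S)"
      unfolding is_op_sup_def
    proof (intro conjI ballI impI selfadjoint_C S)
      fix B assume "B \<in> C ` \<D>"
      then show "op_le M B (C S)" using sup Db Sb by (auto simp: op_le_C is_op_sup_def)
    next
      fix R assume R: "R \<in> selfadjoint_ops M" and ub: "\<forall>B\<in>C ` \<D>. op_le M B R"
      note Rb = selfadjoint_opsD(1) [OF R]
      have "op_le N A (inverse.C R)" if "A \<in> \<D>" for A
        using ub that op_le_C [OF Db [OF that] inverse.bounded_C [OF Rb]] by (simp add: C_inverse [OF Rb])
      then have "op_le N S (inverse.C R)"
        using sup inverse.selfadjoint_C [OF R] by (simp add: is_op_sup_def)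
      then show "op_le M (C S) R"
        using op_le_C [OF Sb inverse.bounded_C [OF Rb]] by (simp add: C_inverse [OF Rb])
    qed
  qed
qed

end

lemma faithful_normal_rep_id:
  assumes "hilbert M" shows "faithful_normal_rep M M (\<lambda>T. T)"
  by (simp add: faithful_normal_rep_def representation_def normal_map_def)

text \<open>\<open>T\<close> is the supremum of the directed set consisting of \<open>S\<close> and
  \<open>T\<close>. The resulting monotonicity keeps images of directed sets directed when normal
  maps are composed.\<close>

lemma normal_imp_op_le:
  assumes n: "normal_map H N \<pi>" and S: "S \<in> selfadjoint_ops H" and T: "T \<in> selfadjoint_ops H"
    and le: "op_le H S T"
  shows "op_le N (\<pi> S) (\<pi> T)"
proof -
  have "is_op_sup H {S, T} T" using le T by (auto simp: is_op_sup_def op_le_def)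
  moreover have "\<forall>A\<in>{S, T}. \<forall>B\<in>{S, T}. \<exists>C\<in>{S, T}. op_le H A C \<and> op_le H B C"
    using le by (auto simp: op_le_def)
  ultimately have "is_op_sup N (\<pi> ` {S, T}) (\<pi> T)"
    using S T by (intro n [unfolded normal_map_def, rule_format]) auto
  then show ?thesis by (auto simp: is_op_sup_def)
qed

lemma faithful_normal_rep_comp:
  assumes \<pi>: "faithful_normal_rep H N \<pi>" and \<rho>: "faithful_normal_rep N M \<rho>"
  shows "faithful_normal_rep H M (\<lambda>T. \<rho> (\<pi> T))"
  unfolding faithful_normal_rep_def
proof (intro conjI)
  have b: "\<pi> T \<in> bounded_ops N" if "T \<in> bounded_ops H" for T
    using \<pi> that by (auto simp: faithful_normal_rep_def representation_def)
  show "representation H M (\<lambda>T. \<rho> (\<pi> T))"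
    using \<pi> \<rho> b by (auto simp: faithful_normal_rep_def representation_def)
  show "inj_on (\<lambda>T. \<rho> (\<pi> T)) (bounded_ops H)"
    using \<pi> \<rho> b by (auto simp: faithful_normal_rep_def inj_on_def)
  have sa: "\<pi> T \<in> selfadjoint_ops N" if "T \<in> selfadjoint_ops H" for T
    using \<pi> that b by (auto simp: faithful_normal_rep_def representation_def selfadjoint_ops_def)
  have n: "normal_map H N \<pi>" "normal_map N M \<rho>" using \<pi> \<rho> by (auto simp: faithful_normal_rep_def)
  show "normal_map H M (\<lambda>T. \<rho> (\<pi> T))"
    unfolding normal_map_def
  proof (intro allI impI; elim conjE)
    fix \<D> S assume \<D>: "\<D> \<subseteq> selfadjoint_ops H" "\<D> \<noteq> {}" and sup: "is_op_sup H \<D> S"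
      and dir: "\<forall>A\<in>\<D>. \<forall>B\<in>\<D>. \<exists>C\<in>\<D>. op_le H A C \<and> op_le H B C"
    have 1: "is_op_sup N (\<pi> ` \<D>) (\<pi> S)"
      using \<D> dir sup by (intro n(1) [unfolded normal_map_def, rule_format]) auto
    have "\<exists>C\<in>\<pi> ` \<D>. op_le N A C \<and> op_le N B C" if AB: "A \<in> \<pi> ` \<D>" "B \<in> \<pi> ` \<D>" for A B
    proof -
      obtain A' B' where A': "A' \<in> \<D>" "A = \<pi> A'" "B' \<in> \<D>" "B = \<pi> B'" using AB by blast
      then obtain C where C: "C \<in> \<D>" "op_le H A' C" "op_le H B' C" using dir by blast
      then show ?thesis
        using A' \<D>(1) by (intro bexI [of _ "\<pi> C"]) (auto intro!: normal_imp_op_le [OF n(1)])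
    qed
    then have "is_op_sup M (\<rho> ` \<pi> ` \<D>) (\<rho> (\<pi> S))"
      using \<D> sa 1 by (intro n(2) [unfolded normal_map_def, rule_format]) auto
    then show "is_op_sup M ((\<lambda>T. \<rho> (\<pi> T)) ` \<D>) (\<rho> (\<pi> S))" by (simp add: image_image)
  qed
qed

abbreviation (input) "transport_tuple N M W w \<equiv> \<lambda>k t. transport N M W (w k t)"

lemma unitary_group_ampl_transport:
  assumes w: "unitary_group H w" and um: "unitary_map (ampl_space H) M W"
  shows "unitary_group M (\<lambda>t. transport (ampl_space H) M W (ampl_op H (w t)))"
proof -
  interpret unitary_map "ampl_space H" M W by (rule um)
  have H: "hilbert H" and sep: "separable_space (top_of_set H)" using w by (auto simp: unitary_group_def)
  \<comment> \<open>A single group is viewed as a tuple of length 1, so that the facts on tuples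
    apply.\<close>
  have "unitary_tuple 1 H (\<lambda>_. w)" using w H sep by (simp add: unitary_tuple_def)
  then have act: "isometric_action 1 H (\<lambda>_. w)" by (rule unitary_tuple_isometric_action)
  then have actA: "isometric_action 1 (ampl_space H) (\<lambda>_ t. ampl_op H (w t))" by (rule isometric_action_ampl)
  note A = isometric_actionD [OF actA zero_less_one]
  have iso: "isometry_on M M (C (ampl_op H (w t)))" for t
    using isometry_on_compose [OF isometry_on_compose [OF iWi A(1)] W] cM
    by (auto simp: isometry_on_def clinear_on_def C_eq csubspace_add csubspace_scaleC)
  have comp: "C (ampl_op H (w (s + t))) y = C (ampl_op H (w s)) (C (ampl_op H (w t)) y)" if "y \<in> M" for s t y
    using that A by (simp add: C_eq Wi W_in Wi_W)
  have zero: "C (ampl_op H (w 0)) y = y" if "y \<in> M" for y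
    using that A(2) by (simp add: C_eq Wi)
  show ?thesis
    unfolding unitary_group_def
  proof (intro conjI allI ballI)
    show "hilbert M" by (rule M)
    show "separable_space (top_of_set M)"
      using separable_isometry_image [OF W cN separable_ampl_space [OF H sep]] surj by simp
    show "C (ampl_op H (w t)) \<in> unitary_ops M" for t
      unfolding unitary_ops_def
    proof (intro CollectI conjI ballI)
      show "C (ampl_op H (w t)) \<in> bounded_ops M"
        by (intro bounded_C ampl_op_bounded H unitary_bounded [OF w])
      have "y \<in> C (ampl_op H (w t)) ` M" if y: "y \<in> M" for y
        using comp [OF y, of t "-t"] zero [OF y] isometry_onD(2) [OF iso y, of "-t"]
        by (metis add.right_inverse image_eqI)
      then show "C (ampl_op H (w t)) ` M = M" using isometry_onD(2) [OF iso] by blast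
      show "cinner (C (ampl_op H (w t)) x) (C (ampl_op H (w t)) y) = cinner x y" if "x \<in> M" "y \<in> M" for x y
        by (rule isometry_on_cinner [OF iso cM that])
    qed
    show "C (ampl_op H (w (s + t))) = compose M (C (ampl_op H (w s))) (C (ampl_op H (w t)))" for s t
      by (rule extensionalityI [OF C_ext compose_extensional]) (simp add: compose_eq comp)
    fix y assume y: "y \<in> M"
    have "continuous_on UNIV (\<lambda>t. ampl_op H (w t) (Wi y))"
      by (rule continuous_ampl [OF w isometric_actionD(1) [OF act zero_less_one] Wi(1) [OF y]])
    then show "continuous_on UNIV (\<lambda>t. C (ampl_op H (w t)) y)"
      using isometry_on_dist [OF W cN A(4) A(4)] Wi(1) [OF y] y by (simp add: continuous_on_iff C_eq)
  qed
qed

text \<open>All that is claimed of U and V individually. In the equivalence, one representation is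
  the ampliation followed by conjugation and the other is the identity; infinite multiplicity holds
  because an ampliation of an ampliation is again one.\<close>

lemma ampl_transport:
  fixes H :: "'a :: chilbert_space set" and M :: "'l ell2 set"
  assumes u: "unitary_tuple d H u" and um: "unitary_map (ampl_space H) M W"
  defines "U \<equiv> transport_tuple (ampl_space H) M W (ampl_tuple H u)"
  shows "unitary_tuple d M U" "tuple_equiv TYPE('l) d H u M U" "infinite_multiplicity d M U"
    "almost_intertwines d 0 (ampl_space H) (ampl_tuple H u) M U W"
proof -
  interpret unitary_map "ampl_space H" M W by (rule um)
  have H: "hilbert H" and sep: "separable_space (top_of_set H)" using u by (auto simp: unitary_tuple_def)
  show U: "unitary_tuple d M U"
    unfolding unitary_tuple_def
  proof (intro conjI allI impI)
    show "hilbert M" by (rule M)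
    show "separable_space (top_of_set M)"
      using separable_isometry_image [OF W cN separable_ampl_space [OF H sep]] surj by simp
    fix k assume "k < d"
    then have "unitary_group H (u k)" using u by (simp add: unitary_tuple_def)
    then show "unitary_group M (U k)" unfolding U_def by (rule unitary_group_ampl_transport [OF _ um])
  qed
  show "tuple_equiv TYPE('l) d H u M U"
    unfolding tuple_equiv_def
  proof (intro exI conjI allI impI)
    show "hilbert M" by (rule M)
    show "faithful_normal_rep H M (\<lambda>T. C (ampl_op H T))"
      by (rule faithful_normal_rep_comp [OF faithful_normal_rep_ampl [OF H sep] faithful_normal_rep_C])
    show "faithful_normal_rep M M (\<lambda>T. T)" by (rule faithful_normal_rep_id [OF M])
    show "C (ampl_op H (u k t)) = U k t" for k t by (simp add: U_def)
  qed
  have au: "isometric_action d H u" and aU: "isometric_action d M U"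
    using u U by (auto intro: unitary_tuple_isometric_action)
  note aA = isometric_action_ampl [OF au]
  show 1: "almost_intertwines d 0 (ampl_space H) (ampl_tuple H u) M U W"
    by (rule almost_intertwines_exact [OF W]) (simp add: U_def C_eq W_in Wi_W)
  note Wi_int = almost_intertwines_inverse [OF 1 surj aA aU]
  have csAA: "csubspace (ampl_space (ampl_space H))" by (intro hilbert_csubspace hilbert_ampl_space H)
  define F where "F = inv_into (ampl_space (ampl_space H)) flatten_l2"
  have F_int: "almost_intertwines d 0 (ampl_space H) (ampl_tuple H u) (ampl_space (ampl_space H))
      (ampl_tuple (ampl_space H) (ampl_tuple H u)) F"
    unfolding F_def
    by (rule almost_intertwines_inverse [OF intertwines_flatten [OF au] flatten_l2_surj
          isometric_action_ampl [OF aA] aA])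
  note AW_int = almost_intertwines_ampl [OF 1 order_refl aA aU]
  \<comment> \<open>Undo \<open>W\<close>, split one sequence into a sequence of sequences, and
    apply \<open>W\<close> to each of them.\<close>
  define X where "X y = ampl_map W (F (Wi y))" for y
  have X: "almost_intertwines d 0 M U (ampl_space M) (ampl_tuple M U) X"
    using almost_intertwines_compose [OF almost_intertwines_compose [OF Wi_int F_int aU aA] AW_int aU
        isometric_action_ampl [OF aA]]
    by (simp add: X_def [abs_def])
  have Ximg: "X ` M = ampl_space M"
  proof -
    have "X ` M = ampl_map W ` F ` Wi ` M" by (auto simp: X_def image_image)
    also have "Wi ` M = ampl_space H" by (rule unitary_map.surj [OF inverse_map])
    also have "F ` ampl_space H = ampl_space (ampl_space H)"
      using inv_into_image_cancel [OF isometry_on_inj [OF isometry_on_flatten csAA] order_refl]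
      by (simp add: F_def flatten_l2_surj)
    also have "ampl_map W ` \<dots> = ampl_space M" by (rule ampl_map_surj [OF W N surj])
    finally show ?thesis .
  qed
  have iX: "isometry_on M (ampl_space M) X" using X by (simp add: almost_intertwines_def)
  show "infinite_multiplicity d M U"
    unfolding infinite_multiplicity_def unitarily_equiv_def
    using iX Ximg isometry_on_cinner [OF iX cM]
      intertwines_everywhere [OF X aU isometric_action_ampl [OF aU]]
    by (intro exI [of _ X]) (simp add: isometry_on_def)
qed

section \<open>Bochner's theorem for one-parameter unitary groups\<close>

locale one_param_group =
  fixes H :: "'a :: chilbert_space set" and w :: "real \<Rightarrow> 'a \<Rightarrow> 'a"
  assumes grp: "unitary_group H w"
begin

lemma H: "hilbert H" using grp by (simp add: unitary_group_def)
lemma cH: "csubspace H" using H by (rule hilbert_csubspace)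

lemma act: "isometric_action 1 H (\<lambda>_. w)"
  using grp H by (intro unitary_tuple_isometric_action) (auto simp: unitary_tuple_def unitary_group_def)

lemma w_in: "x \<in> H \<Longrightarrow> w t x \<in> H"
  and w_norm: "x \<in> H \<Longrightarrow> norm (w t x) = norm x"
  and w_0: "x \<in> H \<Longrightarrow> w 0 x = x"
  and w_add: "x \<in> H \<Longrightarrow> w (s + t) x = w s (w t x)"
  and w_lin: "clinear_on H (w t)"
  using isometric_actionD [OF act zero_less_one]
    isometry_onD(1) [OF isometric_actionD(1) [OF act zero_less_one]] by auto

lemma cinner_w:
  assumes "x \<in> H" "y \<in> H" shows "cinner (w s x) (w t y) = cinner x (w (t - s) y)"
  using cinner_isometric_action [OF act zero_less_one w_in [OF assms(1)] assms(2), of s t]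
    cinner_isometric_action [OF act zero_less_one assms, of "t - s"] w_add [OF assms(1), of "-t" s]
  by (simp add: algebra_simps)

lemma w_tendsto: "x \<in> H \<Longrightarrow> ((\<lambda>t. w t x) \<longlongrightarrow> w a x) (nhds a)"
  by (rule unitary_group_tendsto [OF grp])

lemma cinner_w_isCont: "x \<in> H \<Longrightarrow> isCont (\<lambda>t. cinner x (w t x)) a"
  unfolding isCont_def
  by (intro cinner.tendsto tendsto_const tendsto_at_iff_tendsto_nhds [THEN iffD2] w_tendsto)

end

lemma sum_roots_of_unity:
  fixes N :: nat and q :: int
  assumes N: "0 < N" and q: "\<bar>q\<bar> < 2 * int N"
  shows "(\<Sum>m<2*N. iexp (of_int q * (pi * real m / real N - pi))) = (if q = 0 then 2 * of_nat N else 0)"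
proof (cases "q = 0")
  case False
  define z where "z = iexp (of_int q * (pi / N))"
  have e: "iexp (of_int q * (pi * real m / real N - pi)) = iexp (- (of_int q * pi)) * z ^ m" for m
    unfolding z_def exp_of_nat_mult [symmetric] exp_add [symmetric]
    by (rule arg_cong [where f = exp]) (simp add: algebra_simps)
  have "z \<noteq> 1"
  proof
    assume "z = 1"
    then obtain n :: int where "of_int q * (pi / N) = of_int (2 * n) * pi"
      unfolding z_def exp_eq_1 by auto
    then have "real_of_int q = of_int (2 * n * int N)" using N by (simp add: field_simps)
    then have "q = 2 * int N * n" by (metis mult.commute mult.left_commute of_int_eq_iff)
    then have "\<bar>q\<bar> = 2 * int N * \<bar>n\<bar>" by (simp add: abs_mult)
    moreover have "1 \<le> \<bar>n\<bar>" using \<open>q = 2 * int N * n\<close> False by auto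
    ultimately have "2 * int N * 1 \<le> \<bar>q\<bar>" by (metis mult_left_mono of_nat_0_le_iff mult_nonneg_nonneg zero_le_numeral)
    then show False using q by simp
  qed
  moreover have "z ^ (2 * N) = 1"
  proof -
    have "z ^ (2 * N) = iexp (2 * of_int q * pi)"
      unfolding z_def exp_of_nat_mult [symmetric]
      by (rule arg_cong [where f = exp]) (use N in \<open>simp add: field_simps\<close>)
    also have "\<dots> = 1" unfolding exp_eq_1 by (auto intro: exI [of _ q])
    finally show ?thesis .
  qed
  ultimately have "(\<Sum>m<2*N. z ^ m) = 0" by (simp add: geometric_sum)
  moreover have "(\<Sum>m<2*N. iexp (of_int q * (pi * real m / real N - pi)))
      = iexp (- (of_int q * pi)) * (\<Sum>m<2*N. z ^ m)"
    unfolding sum_distrib_left by (rule sum.cong [OF refl e])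
  ultimately show ?thesis using False by simp
qed simp

text \<open>On the grid of mesh \<open>h\<close>, the Fejer means of $t \mapsto \langle x, w(t) x \rangle$ are the
  characteristic function of the measure with the mass
  $\frac{1}{2N^2}\,\lVert \sum_{j<N} e^{-ij\theta} w(jh) x \rVert^2$ at $\theta/h$, where $\theta$ runs
  through the $2N$ equidistant points of $[-\pi, \pi)$.\<close>

lemma (in one_param_group) herglotz:
  assumes x: "x \<in> H" "norm x = 1" and N: "0 < N" and h: "0 < h"
  shows "\<exists>M. real_distribution M \<and> measure M {- (pi / h)..pi / h} = 1 \<and>
    (\<forall>k\<le>N. char M (real k * h) = of_real (1 - real k / real N) * cinner x (w (real k * h) x))"
proof -
  define \<phi> where "\<phi> t = cinner x (w t x)" for t
  define \<theta> where "\<theta> m = pi * real m / real N - pi" for m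
  define v where "v m = (\<Sum>j<N. iexp (- (real j * \<theta> m)) *\<^sub>C w (real j * h) x)" for m
  define p where "p m = (norm (v m))\<^sup>2 / (2 * (real N)\<^sup>2)" for m
  have p0: "0 \<le> p m" for m by (simp add: p_def)
  have v: "of_real ((norm (v m))\<^sup>2) = (\<Sum>j<N. \<Sum>l<N. iexp ((real j - real l) * \<theta> m) * \<phi> ((real l - real j) * h))" for m
  proof -
    have "of_real ((norm (v m))\<^sup>2) = cinner (v m) (v m)" by (rule cinner_self_of_real [symmetric])
    also have "\<dots> = (\<Sum>j<N. \<Sum>l<N. cnj (iexp (- (real j * \<theta> m))) * (iexp (- (real l * \<theta> m)) *
        cinner (w (real j * h) x) (w (real l * h) x)))"
      unfolding v_def cinner.sum_left
      by (rule sum.cong) (auto simp: cinner.sum_right cinner_scaleC_left cinner_scaleC_right sum_distrib_left mult.left_commute)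
    also have "\<dots> = (\<Sum>j<N. \<Sum>l<N. iexp ((real j - real l) * \<theta> m) * \<phi> ((real l - real j) * h))"
    proof (intro sum.cong refl)
      fix j l
      have "cnj (iexp (- (real j * \<theta> m))) * iexp (- (real l * \<theta> m)) = iexp ((real j - real l) * \<theta> m)"
        unfolding exp_cnj exp_add [symmetric] by (rule arg_cong [where f = exp]) (simp add: algebra_simps)
      moreover have "cinner (w (real j * h) x) (w (real l * h) x) = \<phi> ((real l - real j) * h)"
        using cinner_w [OF x(1) x(1)] by (simp add: \<phi>_def left_diff_distrib)
      ultimately show "cnj (iexp (- (real j * \<theta> m))) * (iexp (- (real l * \<theta> m)) *
          cinner (w (real j * h) x) (w (real l * h) x)) = iexp ((real j - real l) * \<theta> m) * \<phi> ((real l - real j) * h)"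
        by (metis mult.assoc)
    qed
    finally show ?thesis .
  qed
  have key: "(\<Sum>m<2*N. of_real (p m) * iexp (real k * \<theta> m)) = of_real (1 - real k / real N) * \<phi> (real k * h)"
    if k: "k \<le> N" for k
  proof -
    have "(\<Sum>m<2*N. of_real (p m) * iexp (real k * \<theta> m))
        = (\<Sum>m<2*N. \<Sum>j<N. \<Sum>l<N. iexp ((real j - real l) * \<theta> m) * \<phi> ((real l - real j) * h) * iexp (real k * \<theta> m)) / (2 * (of_nat N)\<^sup>2)"
      unfolding p_def of_real_divide v
      by (simp add: sum_distrib_right sum_divide_distrib)
    also have "(\<Sum>m<2*N. \<Sum>j<N. \<Sum>l<N. iexp ((real j - real l) * \<theta> m) * \<phi> ((real l - real j) * h) * iexp (real k * \<theta> m))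
        = (\<Sum>j<N. \<Sum>l<N. \<Sum>m<2*N. iexp ((real j - real l) * \<theta> m) * \<phi> ((real l - real j) * h) * iexp (real k * \<theta> m))"
      by (rule trans [OF sum.swap]) (rule sum.cong [OF refl sum.swap])
    also have "\<dots> = (\<Sum>j<N. \<Sum>l<N. if l = j + k then 2 * of_nat N * \<phi> (real k * h) else 0)"
    proof (intro sum.cong refl)
      fix j l assume jl: "j \<in> {..<N}" "l \<in> {..<N}"
      let ?q = "int j - int l + int k"
      have "(\<Sum>m<2*N. iexp ((real j - real l) * \<theta> m) * \<phi> ((real l - real j) * h) * iexp (real k * \<theta> m))
          = \<phi> ((real l - real j) * h) * (\<Sum>m<2*N. iexp (of_int ?q * (pi * real m / real N - pi)))"
        unfolding sum_distrib_left
      proof (rule sum.cong [OF refl])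
        fix m
        have eq: "iexp ((real j - real l) * \<theta> m) * iexp (real k * \<theta> m) = iexp (of_int ?q * (pi * real m / real N - pi))"
        proof -
          have "(real j - real l) * \<theta> m + real k * \<theta> m = of_int ?q * \<theta> m" by (simp add: algebra_simps)
          moreover have "iexp a * iexp b = iexp (a + b)" for a b by (simp add: exp_add distrib_left)
          ultimately show ?thesis unfolding \<theta>_def by metis
        qed
        show "iexp ((real j - real l) * \<theta> m) * \<phi> ((real l - real j) * h) * iexp (real k * \<theta> m)
          = \<phi> ((real l - real j) * h) * iexp (of_int ?q * (pi * real m / real N - pi))"
          unfolding eq [symmetric] by (simp only: mult_ac)
      qed
      also have "(\<Sum>m<2*N. iexp (of_int ?q * (pi * real m / real N - pi))) = (if ?q = 0 then 2 * of_nat N else 0)"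
        by (rule sum_roots_of_unity [OF N]) (use jl k in auto)
      also have "?q = 0 \<longleftrightarrow> l = j + k" by auto
      finally show "(\<Sum>m<2*N. iexp ((real j - real l) * \<theta> m) * \<phi> ((real l - real j) * h) * iexp (real k * \<theta> m))
          = (if l = j + k then 2 * of_nat N * \<phi> (real k * h) else 0)" by auto
    qed
    \<comment> \<open>Orthogonality left only the pairs with \<open>l = j + k\<close>. There are
      \<open>N - k\<close> of them, the source of the Fejer factor 1 - k/N.\<close>
    also have "\<dots> = (\<Sum>j<N. if j < N - k then 2 * of_nat N * \<phi> (real k * h) else 0)"
      by (intro sum.cong refl) auto
    also have "\<dots> = of_nat (N - k) * (2 * of_nat N * \<phi> (real k * h))"
    proof -
      have "{..<N} \<inter> {j. j < N - k} = {..<N - k}" by auto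
      then show ?thesis by (simp add: sum.If_cases)
    qed
    also have "of_nat (N - k) * (2 * of_nat N * \<phi> (real k * h)) / (2 * (of_nat N)\<^sup>2)
        = of_real (1 - real k / real N) * \<phi> (real k * h)"
      using k N by (simp add: field_simps power2_eq_square of_nat_diff)
    finally show ?thesis .
  qed
  define M0 where "M0 = point_measure {..<2*N} (\<lambda>m. ennreal (p m))"
  have "(\<Sum>m<2*N. of_real (p m)) = (1 :: complex)"
    using key [of 0] x w_0 [OF x(1)] by (simp add: \<phi>_def cinner_self_of_real)
  then have "of_real (\<Sum>m<2*N. p m) = (of_real 1 :: complex)" by simp
  then have p1: "(\<Sum>m<2*N. p m) = 1" using of_real_eq_iff by blast
  have sp: "space M0 = {..<2*N}" by (simp add: M0_def space_point_measure)
  have "emeasure M0 (space M0) = 1"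
    unfolding sp unfolding M0_def using p0 p1 by (subst emeasure_point_measure_finite) (auto simp: sum_ennreal)
  then interpret M0: prob_space M0 by (rule prob_spaceI)
  have rv: "(\<lambda>m. \<theta> m / h) \<in> borel_measurable M0" by (simp add: M0_def)
  define M where "M = distr M0 borel (\<lambda>m. \<theta> m / h)"
  have "real_distribution M" unfolding M_def using rv by (rule M0.real_distribution_distr)
  moreover have "measure M {- (pi / h)..pi / h} = 1"
  proof -
    have "\<theta> m / h \<in> {- (pi / h)..pi / h}" if "m < 2 * N" for m
    proof -
      have "real m \<le> 2 * real N" using that by simp
      then have "pi * real m \<le> pi * (2 * real N)" by (intro mult_left_mono) auto
      then have "- pi \<le> \<theta> m" "\<theta> m \<le> pi" using N by (auto simp: \<theta>_def field_simps)
      then show ?thesis using h by (auto simp: field_simps)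
    qed
    then have "(\<lambda>m. \<theta> m / h) -` {- (pi / h)..pi / h} \<inter> space M0 = space M0" by (auto simp: sp)
    then show ?thesis unfolding M_def by (subst measure_distr [OF rv]) (auto simp: M0.prob_space)
  qed
  moreover have "char M (real k * h) = of_real (1 - real k / real N) * cinner x (w (real k * h) x)" if "k \<le> N" for k
  proof -
    have "char M (real k * h) = (\<integral>m. iexp (real k * h * (\<theta> m / h)) \<partial>M0)"
      unfolding char_def M_def by (rule integral_distr [OF rv]) simp
    also have "\<dots> = (\<Sum>m<2*N. p m *\<^sub>R iexp (real k * h * (\<theta> m / h)))"
      unfolding M0_def by (rule lebesgue_integral_point_measure_finite) (auto simp: p0)
    also have "\<dots> = (\<Sum>m<2*N. of_real (p m) * iexp (real k * \<theta> m))"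
      using h by (simp add: scaleR_conv_of_real)
    finally show ?thesis using key [OF that] by (simp add: \<phi>_def)
  qed
  ultimately show ?thesis by blast
qed

section \<open>Tightness from values of the characteristic function on a grid\<close>

lemma jordan_sin_ge: "0 \<le> a \<Longrightarrow> a \<le> pi / 2 \<Longrightarrow> 2 * a / pi \<le> sin (a :: real)"
proof -
  assume a: "0 \<le> a" "a \<le> pi / 2"
  have "convex_on {0..pi / 2} (\<lambda>x. - sin x)"
  proof (rule f''_ge0_imp_convex)
    show "((\<lambda>x. - sin x) has_real_derivative - cos x) (at x)" for x :: real
      by (auto intro!: derivative_eq_intros)
    show "((\<lambda>x. - cos x) has_real_derivative sin x) (at x)" for x :: real
      by (auto intro!: derivative_eq_intros)
    show "0 \<le> sin x" if "x \<in> {0..pi / 2}" for x :: real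
      using that by (intro sin_ge_zero) auto
  qed simp
  \<comment> \<open>The chord of - sin between the end points 0 and pi/2.\<close>
  from convex_onD [OF this, of "2 * a / pi" 0 "pi / 2"] a
  show ?thesis by (simp add: field_simps)
qed

text \<open>The geometric sum is at most 2 / |z - 1| in modulus, and |z - 1| is twice the modulus of
  the sine of \<theta>/2, which \<open>jordan_sin_ge\<close> bounds from below.\<close>

lemma norm_sum_iexp_le:
  assumes \<theta>: "\<bar>\<theta>\<bar> \<le> pi" "\<theta> \<noteq> 0"
  shows "cmod (\<Sum>k<K. iexp (real k * \<theta>)) \<le> pi / \<bar>\<theta>\<bar>"
proof -
  define z where "z = iexp \<theta>"
  have "2 * \<bar>\<theta>\<bar> / pi \<le> 2 * sin (\<bar>\<theta>\<bar> / 2)"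
    using jordan_sin_ge [of "\<bar>\<theta>\<bar> / 2"] \<theta> by simp
  also have "\<dots> \<le> 2 * \<bar>sin (\<theta> / 2)\<bar>" by (cases "0 \<le> \<theta>") auto
  also have "\<dots> = cmod (z - 1)" unfolding z_def by (rule dist_exp_i_1 [symmetric])
  finally have lower: "2 * \<bar>\<theta>\<bar> / pi \<le> cmod (z - 1)" .
  have "0 < 2 * \<bar>\<theta>\<bar> / pi" using \<theta> by simp
  with lower have z1: "z \<noteq> 1" by auto
  have "(\<Sum>k<K. iexp (real k * \<theta>)) = (\<Sum>k<K. z ^ k)"
    unfolding z_def exp_of_nat_mult [symmetric] by (intro sum.cong refl arg_cong [where f = exp]) simp
  also have "\<dots> = (z ^ K - 1) / (z - 1)" using z1 by (rule geometric_sum)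
  finally have "cmod (\<Sum>k<K. iexp (real k * \<theta>)) = cmod (z ^ K - 1) / cmod (z - 1)" by (simp add: norm_divide)
  also have "\<dots> \<le> 2 / (2 * \<bar>\<theta>\<bar> / pi)"
  proof (intro frac_le)
    show "cmod (z ^ K - 1) \<le> 2"
      using norm_triangle_ineq4 [of "z ^ K" 1] by (simp add: z_def norm_power)
  qed (use lower \<theta> in auto)
  also have "\<dots> = pi / \<bar>\<theta>\<bar>" by simp
  finally show ?thesis .
qed

text \<open>A Markov inequality for \<open>f\<close>, the mean of 1 - cos(k h s) over k < K: its
  integral only involves grid values of the characteristic function. These cannot separate points
  that differ by 2 pi / h, hence the condition on the support.\<close>

lemma char_grid_tail_bound:
  assumes M: "real_distribution M" and supp: "measure M {- (pi / h)..pi / h} = 1" and h: "0 < h"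
    and K: "0 < K" and ch: "\<And>k. k < K \<Longrightarrow> 1 - Re (char M (real k * h)) \<le> \<epsilon>"
    and R: "2 * pi / (real K * h) \<le> R"
  shows "1 - 2 * \<epsilon> \<le> measure M {- R..R}"
proof -
  interpret real_distribution M by (rule M)
  define f where "f s = (\<Sum>k<K. 1 - cos (real k * h * s)) / real K" for s
  have int: "integrable M (\<lambda>s. iexp (t * s))" for t by (rule integrable_const_bound [where B = 1]) auto
  have intc: "integrable M (\<lambda>s. cos (t * s))" for t by (rule integrable_const_bound [where B = 1]) auto
  have Re_char: "Re (char M t) = (\<integral>s. cos (t * s) \<partial>M)" for t
    unfolding char_def using integral_Re [OF int [of t]] by (simp add: Re_exp)
  have intf: "integrable M f" unfolding f_def using intc by (intro integrable_divide integrable_sum integrable_diff) auto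
  have "(\<integral>s. f s \<partial>M) = (\<Sum>k<K. 1 - Re (char M (real k * h))) / real K"
    unfolding f_def using intc prob_space by (simp add: Re_char integral_sum)
  also have "\<dots> \<le> (\<Sum>k<K. \<epsilon>) / real K" using ch by (intro divide_right_mono sum_mono) auto
  also have "\<dots> = \<epsilon>" using K by simp
  finally have If: "(\<integral>s. f s \<partial>M) \<le> \<epsilon>" .
  let ?A = "{s. R < \<bar>s\<bar>} \<inter> {- (pi / h)..pi / h}"
  have A: "?A \<in> sets M" by auto
  have f0: "0 \<le> f s" for s unfolding f_def by (intro divide_nonneg_nonneg sum_nonneg) auto
  \<comment> \<open>Beyond \<open>R\<close> the exponential sum at h s is at most half of its number
    of terms, so the mean of 1 - cos is at least 1/2. The support condition keeps h s within the
    range of \<open>norm_sum_iexp_le\<close>.\<close>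
  have "(1/2) * indicator ?A s \<le> f s" for s
  proof (cases "s \<in> ?A")
    case True
    let ?\<theta> = "h * s"
    have R0: "0 < R" using R K h by (intro less_le_trans [OF _ R]) auto
    have s: "\<bar>s\<bar> \<le> pi / h" "R < \<bar>s\<bar>" using True by (auto simp: abs_le_iff)
    have \<theta>: "\<bar>?\<theta>\<bar> \<le> pi" "?\<theta> \<noteq> 0" using s h R0 by (auto simp: abs_mult field_simps)
    have "2 * pi / real K \<le> \<bar>?\<theta>\<bar>"
    proof -
      have "2 * pi / (real K * h) \<le> \<bar>s\<bar>" using R s by linarith
      then have "h * (2 * pi / (real K * h)) \<le> h * \<bar>s\<bar>" using h by (intro mult_left_mono) auto
      then show ?thesis using h by (simp add: abs_mult)
    qed
    then have "pi / \<bar>?\<theta>\<bar> \<le> real K / 2" using \<theta> K by (simp add: field_simps)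
    then have "cmod (\<Sum>k<K. iexp (real k * ?\<theta>)) \<le> real K / 2"
      using norm_sum_iexp_le [OF \<theta>, of K] by linarith
    then have "Re (\<Sum>k<K. iexp (real k * ?\<theta>)) \<le> real K / 2" using complex_Re_le_cmod order_trans by blast
    then have "(\<Sum>k<K. cos (real k * h * s)) \<le> real K / 2" by (simp add: Re_exp mult.assoc)
    then have "real K / 2 \<le> (\<Sum>k<K. 1 - cos (real k * h * s))" by (simp add: sum_subtractf)
    then show ?thesis using True K by (simp add: f_def field_simps)
  qed (simp add: f0)
  then have "(\<integral>s. (1/2) * indicator ?A s \<partial>M) \<le> (\<integral>s. f s \<partial>M)"
    using A intf by (intro integral_mono) (auto simp: emeasure_eq_measure)
  then have "(1/2) * prob ?A \<le> (\<integral>s. f s \<partial>M)" using A by simp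
  then have "prob ?A \<le> 2 * \<epsilon>" using If by simp
  moreover have "1 \<le> prob {- R..R} + prob ?A"
  proof -
    have "prob {- (pi / h)..pi / h} \<le> prob ({- R..R} \<union> ?A)" by (intro finite_measure_mono) auto
    also have "\<dots> \<le> prob {- R..R} + prob ?A" using A by (intro measure_Un_le) auto
    finally show ?thesis using supp by simp
  qed
  ultimately show ?thesis by simp
qed

text \<open>The measures on finer and finer grids are tight, so a subsequence converges weakly. By
  Levy continuity the limit has the right characteristic function at nonnegative dyadic times, by
  continuity at all nonnegative times, and by conjugation at negative ones.\<close>

lemma (in one_param_group) bochner_unit:
  assumes x: "x \<in> H" "norm x = 1"
  shows "\<exists>M. real_distribution M \<and> (\<forall>t. char M t = cinner x (w t x))"
proof -
  define \<phi> where "\<phi> t = cinner x (w t x)" for t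
  have \<phi>0: "\<phi> 0 = 1" using x w_0 [OF x(1)] by (simp add: \<phi>_def cinner_self_of_real)
  have \<phi>1: "Re (\<phi> t) \<le> 1" for t
    using cmod_cinner_le [of x "w t x"] complex_Re_le_cmod [of "\<phi> t"] w_norm [OF x(1), of t] x(2)
    by (simp add: \<phi>_def)
  have cont: "isCont \<phi> a" for a unfolding \<phi>_def by (rule cinner_w_isCont [OF x(1)])
  \<comment> \<open>Mesh 2^-n with 4^n points: the mesh tends to 0 while the covered time 2^n grows,
    so at a fixed time the Fejer factor tends to 1.\<close>
  have "\<exists>M. real_distribution M \<and> measure M {- (pi / (1 / 2 ^ n))..pi / (1 / 2 ^ n)} = 1 \<and>
    (\<forall>k\<le>4 ^ n. char M (real k * (1 / 2 ^ n)) = of_real (1 - real k / real (4 ^ n)) * \<phi> (real k * (1 / 2 ^ n)))" for n :: nat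
    using herglotz [OF x, of "4 ^ n" "1 / 2 ^ n"] by (simp add: \<phi>_def)
  then obtain \<mu> where dist: "\<And>n. real_distribution (\<mu> n)"
    and supp: "\<And>n :: nat. measure (\<mu> n) {- (pi / (1 / 2 ^ n))..pi / (1 / 2 ^ n)} = 1"
    and ch: "\<And>(n :: nat) k. k \<le> 4 ^ n \<Longrightarrow>
      char (\<mu> n) (real k * (1 / 2 ^ n)) = of_real (1 - real k / real (4 ^ n)) * \<phi> (real k * (1 / 2 ^ n))"
    by metis
  have "tight \<mu>"
    unfolding tight_def
  proof (intro conjI allI impI dist)
    fix \<epsilon> :: real assume \<epsilon>: "0 < \<epsilon>"
    have "\<forall>\<^sub>F t in nhds 0. dist (\<phi> t) (\<phi> 0) < \<epsilon> / 8"
      using cont [of 0] \<epsilon> unfolding isCont_def tendsto_at_iff_tendsto_nhds by (intro tendstoD) auto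
    then obtain a0 where a0: "0 < a0" "\<And>t. \<bar>t\<bar> < a0 \<Longrightarrow> cmod (\<phi> t - 1) < \<epsilon> / 8"
      by (auto simp: eventually_nhds_metric dist_norm \<phi>0)
    define a where "a = min (a0 / 2) 1"
    have a: "0 < a" "a \<le> 1" "a < a0" using a0(1) by (auto simp: a_def)
    obtain n0 :: nat where n0: "max (1 / a) (8 / \<epsilon>) < 2 ^ n0"
      using real_arch_pow [of 2 "max (1 / a) (8 / \<epsilon>)"] by auto
    have large: "1 - \<epsilon> < measure (\<mu> n) {- (4 * pi / a)..4 * pi / a}" if n: "n0 \<le> n" for n
    proof -
      have "(2 :: real) ^ n0 \<le> 2 ^ n" using n by simp
      then have n1: "1 < a * 2 ^ n" and n2: "8 < \<epsilon> * 2 ^ n"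
        using n0 a(1) \<epsilon> by (auto simp: field_simps intro: less_le_trans)
      \<comment> \<open>The number of mesh steps up to time \<open>a\<close>, within which \<phi> is
        still close to 1.\<close>
      define K where "K = nat \<lfloor>a * 2 ^ n\<rfloor>"
      have K: "real K \<le> a * 2 ^ n" "a * 2 ^ n < real K + 1" "0 < K"
        using n1 a(1) by (auto simp: K_def)
      have K2: "a * 2 ^ n \<le> 2 * real K" using K n1 by linarith
      have "1 - 2 * (\<epsilon> / 4) \<le> measure (\<mu> n) {- (4 * pi / a)..4 * pi / a}"
      proof (rule char_grid_tail_bound [OF dist supp _ K(3)])
        show "2 * pi / (real K * (1 / 2 ^ n)) \<le> 4 * pi / a"
        proof -
          have "pi * (a * 2 ^ n) \<le> pi * (2 * real K)" using K2 by (intro mult_left_mono) auto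
          then show ?thesis using K(3) a(1) by (simp add: field_simps)
        qed
        fix k assume k: "k < K"
        have kK: "real k < a * 2 ^ n" using k K(1) by linarith
        have "a * 2 ^ n \<le> 1 * 4 ^ n" using a by (intro mult_mono power_mono) auto
        then have "real k \<le> 4 ^ n" using kK by linarith
        then have k4: "k \<le> 4 ^ n" by (metis of_nat_le_iff of_nat_numeral of_nat_power)
        have "real k < a0 * 2 ^ n" by (rule less_trans [OF kK mult_strict_right_mono [OF a(3)]]) simp
        then have t: "\<bar>real k * (1 / 2 ^ n)\<bar> < a0" by (simp add: field_simps)
        have "cmod (\<phi> (real k * (1 / 2 ^ n)) - 1) < \<epsilon> / 8" by (rule a0(2) [OF t])
        then have 1: "1 - Re (\<phi> (real k * (1 / 2 ^ n))) < \<epsilon> / 8"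
          using abs_Re_le_cmod [of "\<phi> (real k * (1 / 2 ^ n)) - 1"] by simp
        have "real k / real (4 ^ n) \<le> 1 / 2 ^ n"
        proof -
          have "(4 :: real) ^ n = 2 ^ n * 2 ^ n" by (simp flip: power_mult_distrib)
          moreover have "a * 2 ^ n \<le> 1 * 2 ^ n" using a by (intro mult_right_mono) auto
          then have "real k \<le> 2 ^ n" using kK by linarith
          ultimately show ?thesis by (simp add: field_simps)
        qed
        also have "\<dots> \<le> \<epsilon> / 8" using n2 by (simp add: field_simps)
        finally have 2: "real k / real (4 ^ n) \<le> \<epsilon> / 8" .
        \<comment> \<open>One eighth of \<epsilon> comes from \<phi> and one from the Fejer factor;
          the tail bound doubles their sum to one half of \<epsilon>.\<close>
        have e: "1 - Re (of_real (1 - c) * z) \<le> \<epsilon> / 4"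
          if "0 \<le> c" "c \<le> \<epsilon> / 8" "1 - Re z < \<epsilon> / 8" "Re z \<le> 1" for c z
        proof -
          have "c * Re z \<le> c * 1" using that by (intro mult_left_mono) auto
          moreover have "Re (of_real (1 - c) * z) = Re z - c * Re z" by (simp add: left_diff_distrib)
          ultimately show ?thesis using that by linarith
        qed
        show "1 - Re (char (\<mu> n) (real k * (1 / 2 ^ n))) \<le> \<epsilon> / 4"
          unfolding ch [OF k4] by (rule e [OF _ 2 1 \<phi>1]) simp
      qed simp
      then show ?thesis using \<epsilon> by simp
    qed
    \<comment> \<open>The second entry contains the supports of the finitely many measures with n <
      n0. The left end \<open>- B - 1\<close> used below compensates for \<open>tight\<close>
      speaking of intervals open on the left.\<close>
    define B where "B = max (4 * pi / a) (pi * 2 ^ n0)"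
    have B0: "0 < B" using a(1) by (simp add: B_def less_max_iff_disj)
    have "1 - \<epsilon> < measure (\<mu> n) {- B - 1<..B}" for n
    proof -
      interpret \<mu>: real_distribution "\<mu> n" by (rule dist)
      show ?thesis
      proof (cases "n0 \<le> n")
        case True
        have "measure (\<mu> n) {- (4 * pi / a)..4 * pi / a} \<le> measure (\<mu> n) {- B - 1<..B}"
          by (intro \<mu>.finite_measure_mono) (auto simp: B_def)
        then show ?thesis using large [OF True] by linarith
      next
        case False
        then have "pi * 2 ^ n \<le> pi * 2 ^ n0" by simp
        then have "pi * 2 ^ n \<le> B" unfolding B_def by (rule max.coboundedI2)
        then have "measure (\<mu> n) {- (pi / (1 / 2 ^ n))..pi / (1 / 2 ^ n)} \<le> measure (\<mu> n) {- B - 1<..B}"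
          by (intro \<mu>.finite_measure_mono) auto
        then show ?thesis using supp [of n] \<epsilon> by linarith
      qed
    qed
    then show "\<exists>a b. a < b \<and> (\<forall>n. 1 - \<epsilon> < measure (\<mu> n) {a<..b})"
      using B0 by (intro exI [of _ "- B - 1"] exI [of _ B]) auto
  qed
  then obtain r M where r: "strict_mono r" and M: "real_distribution M" "weak_conv_m (\<mu> \<circ> id \<circ> r) M"
    using tight_imp_convergent_subsubsequence [of \<mu> id] by (auto simp: strict_mono_id)
  interpret M: real_distribution M by (rule M)
  have dyadic: "char M (real j / 2 ^ m) = \<phi> (real j / 2 ^ m)" for j m :: nat
  proof (rule LIMSEQ_unique)
    show "(\<lambda>n. char ((\<mu> \<circ> id \<circ> r) n) (real j / 2 ^ m)) \<longlonglongrightarrow> char M (real j / 2 ^ m)"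
      by (rule levy_continuity1 [OF _ M]) (simp add: dist)
    have "(\<lambda>n. of_real (1 - real j / 2 ^ m * (1 / 2) ^ n) * \<phi> (real j / 2 ^ m)) \<longlonglongrightarrow>
        of_real (1 - real j / 2 ^ m * 0) * \<phi> (real j / 2 ^ m)"
      by (intro tendsto_intros) auto
    moreover have "\<forall>\<^sub>F n in sequentially. char (\<mu> n) (real j / 2 ^ m)
        = of_real (1 - real j / 2 ^ m * (1 / 2) ^ n) * \<phi> (real j / 2 ^ m)"
      unfolding eventually_sequentially
    proof (intro exI allI impI)
      \<comment> \<open>n \<ge> m puts the dyadic time on the grid, and n \<ge> j keeps its index
        \<open>k\<close> within 4^n.\<close>
      fix n assume n: "m + j \<le> n"
      define k where "k = j * 2 ^ (n - m)"
      have "(2 :: real) ^ n = 2 ^ m * 2 ^ (n - m)" using n by (simp flip: power_add)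
      then have t: "real k * (1 / 2 ^ n) = real j / 2 ^ m" by (simp add: k_def)
      have "j \<le> 2 ^ j" using less_exp [of j] by simp
      also have "(2 :: nat) ^ j \<le> 2 ^ n" using n by simp
      finally have "j * 2 ^ (n - m) \<le> 2 ^ n * 2 ^ n" by (intro mult_mono) auto
      then have k4: "k \<le> 4 ^ n" by (simp add: k_def flip: power_mult_distrib)
      have "real k / real (4 ^ n) = real j / 2 ^ m * (1 / 2) ^ n"
      proof -
        have "(4 :: real) ^ n = 2 ^ n * 2 ^ n" by (simp flip: power_mult_distrib)
        then have "real k / real (4 ^ n) = real k * (1 / 2 ^ n) * (1 / 2) ^ n" by (simp add: power_one_over)
        then show ?thesis by (simp only: t)
      qed
      then show "char (\<mu> n) (real j / 2 ^ m) = of_real (1 - real j / 2 ^ m * (1 / 2) ^ n) * \<phi> (real j / 2 ^ m)"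
        using ch [OF k4] by (simp only: t)
    qed
    ultimately have "(\<lambda>n. char (\<mu> n) (real j / 2 ^ m)) \<longlonglongrightarrow> \<phi> (real j / 2 ^ m)"
      using tendsto_cong by (simp add: tendsto_cong)
    from LIMSEQ_subseq_LIMSEQ [OF this r]
    show "(\<lambda>n. char ((\<mu> \<circ> id \<circ> r) n) (real j / 2 ^ m)) \<longlonglongrightarrow> \<phi> (real j / 2 ^ m)" by (simp add: o_def)
  qed
  have nonneg: "char M t = \<phi> t" if t: "0 \<le> t" for t
  proof -
    define j where "j m = nat \<lfloor>t * 2 ^ m\<rfloor>" for m :: nat
    have j: "real (j m) \<le> t * 2 ^ m" "t * 2 ^ m \<le> real (j m) + 1" for m using t by (auto simp: j_def)
    have lim: "(\<lambda>m. real (j m) / 2 ^ m) \<longlonglongrightarrow> t"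
    proof (rule tendsto_sandwich [of "\<lambda>m. t - (1 / 2) ^ m" _ _ "\<lambda>_. t"])
      have "(\<lambda>m. t - (1 / 2) ^ m) \<longlonglongrightarrow> t - 0" by (intro tendsto_intros) auto
      then show "(\<lambda>m. t - (1 / 2) ^ m) \<longlonglongrightarrow> t" by simp
      show "\<forall>\<^sub>F m in sequentially. t - (1 / 2) ^ m \<le> real (j m) / 2 ^ m"
      proof (intro always_eventually allI)
        fix m
        have "t - (1 / 2) ^ m = (t * 2 ^ m - 1) / 2 ^ m" by (simp add: diff_divide_distrib power_one_over)
        also have "\<dots> \<le> real (j m) / 2 ^ m" using j(2) [of m] by (intro divide_right_mono) auto
        finally show "t - (1 / 2) ^ m \<le> real (j m) / 2 ^ m" .
      qed
      show "\<forall>\<^sub>F m in sequentially. real (j m) / 2 ^ m \<le> t"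
        using j(1) by (intro always_eventually allI) (simp add: field_simps)
    qed simp
    show ?thesis
    proof (rule LIMSEQ_unique)
      show "(\<lambda>m. char M (real (j m) / 2 ^ m)) \<longlonglongrightarrow> char M t" by (rule isCont_tendsto_compose [OF M.isCont_char lim])
      show "(\<lambda>m. char M (real (j m) / 2 ^ m)) \<longlonglongrightarrow> \<phi> t"
        unfolding dyadic by (rule isCont_tendsto_compose [OF cont lim])
    qed
  qed
  have "char M t = \<phi> t" for t
  proof (cases "0 \<le> t")
    case False
    have "char M t = cnj (char M (- t))"
    proof -
      have e: "iexp (t * s) = cnj (iexp (- t * s))" for s by (simp add: exp_cnj)
      have "integrable M (\<lambda>s. iexp (- t * s))" by (rule M.integrable_const_bound [where B = 1]) auto
      then show ?thesis unfolding char_def e by (rule integral_bounded_linear [OF bounded_linear_cnj])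
    qed
    also have "\<dots> = cnj (\<phi> (- t))" using nonneg [of "- t"] False by simp
    also have "\<dots> = cinner (w (- t) x) x" unfolding \<phi>_def by (metis cinner_commute)
    also have "\<dots> = \<phi> t" using cinner_w [OF x(1) x(1), of "- t" 0] w_0 [OF x(1)] by (simp add: \<phi>_def)
    finally show ?thesis .
  qed (rule nonneg)
  with M(1) show ?thesis unfolding \<phi>_def by blast
qed

text \<open>Normalise \<open>x\<close> and multiply the measure by the squared norm; for
  \<open>x = 0\<close> the Dirac measure at 0 receives the factor 0.\<close>

lemma (in one_param_group) bochner:
  assumes x: "x \<in> H"
  shows "\<exists>M. finite_measure M \<and> sets M = sets borel \<and> (\<forall>t. (\<integral>s. iexp (t * s) \<partial>M) = cinner x (w t x))"
proof -
  obtain M0 where M0: "real_distribution M0" "\<And>t. of_real ((norm x)\<^sup>2) * char M0 t = cinner x (w t x)"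
  proof (cases "x = 0")
    case True
    have "real_distribution (return borel 0)"
      by (simp add: real_distribution_def real_distribution_axioms_def prob_space_return)
    then show thesis using that True by (simp add: cinner.zero_left)
  next
    case False
    define e where "e = sgn x"
    have e: "e \<in> H" "norm e = 1" "x = norm x *\<^sub>R e"
      using x False csubspace_scaleR [OF cH x] by (auto simp: e_def sgn_div_norm norm_sgn)
    obtain M where M: "real_distribution M" "\<forall>t. char M t = cinner e (w t e)"
      using bochner_unit [OF e(1,2)] by blast
    have "of_real ((norm x)\<^sup>2) * char M t = cinner x (w t x)" for t
    proof -
      have "cinner x (w t x) = cinner (norm x *\<^sub>R e) (norm x *\<^sub>R w t e)"
        using e(3) clinear_on_scaleR [OF w_lin e(1)] by metis
      then show ?thesis using M(2)
        by (simp add: cinner.scaleR_left cinner.scaleR_right power2_eq_square scaleR_conv_of_real)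
    qed
    then show thesis using that M(1) by blast
  qed
  interpret M0: real_distribution M0 by (rule M0)
  define M where "M = density M0 (\<lambda>_. ennreal ((norm x)\<^sup>2))"
  have "finite_measure M"
    by (rule finite_measureI) (simp add: M_def emeasure_density_const ennreal_mult_less_top less_top [symmetric] M0.emeasure_finite ennreal_mult_eq_top_iff)
  moreover have "sets M = sets borel" by (simp add: M_def)
  moreover have "(\<integral>s. iexp (t * s) \<partial>M) = cinner x (w t x)" for t
  proof -
    have "(\<integral>s. iexp (t * s) \<partial>M) = (\<integral>s. (norm x)\<^sup>2 *\<^sub>R iexp (t * s) \<partial>M0)"
      unfolding M_def by (rule integral_density) auto
    also have "\<dots> = of_real ((norm x)\<^sup>2) * char M0 t" by (simp add: char_def scaleR_conv_of_real)
    finally show ?thesis using M0(2) by simp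
  qed
  ultimately show ?thesis by blast
qed

section \<open>Approximation by trigonometric polynomials\<close>

text \<open>A list of pairs \<open>(c, t)\<close> stands for the trigonometric polynomial with the terms
  $c\,e^{its}$.\<close>

definition trig_poly :: "(complex \<times> real) list \<Rightarrow> real \<Rightarrow> complex" where
  "trig_poly l s = (\<Sum>(c, t)\<leftarrow>l. c * iexp (t * s))"

lemma trig_poly_simps [simp]:
  "trig_poly [] s = 0" "trig_poly ((c, t) # l) s = c * iexp (t * s) + trig_poly l s"
  by (auto simp: trig_poly_def)

lemma trig_poly_append: "trig_poly (l @ l') s = trig_poly l s + trig_poly l' s"
  by (simp add: trig_poly_def)

definition trig_mult :: "complex \<Rightarrow> real \<Rightarrow> (complex \<times> real) list \<Rightarrow> (complex \<times> real) list" where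
  "trig_mult a r l = map (\<lambda>(c, t). (a * c, r + t)) l"

lemma trig_poly_mult: "trig_poly (trig_mult a r l) s = a * iexp (r * s) * trig_poly l s"
  by (induction l) (auto simp: trig_mult_def exp_add distrib_left distrib_right mult_ac)

definition trig_cnj :: "(complex \<times> real) list \<Rightarrow> (complex \<times> real) list" where
  "trig_cnj l = map (\<lambda>(c, t). (cnj c, - t)) l"

lemma trig_poly_cnj: "trig_poly (trig_cnj l) s = cnj (trig_poly l s)"
  by (induction l) (auto simp: trig_cnj_def exp_cnj)

lemma trig_poly_measurable [measurable]: "trig_poly l \<in> borel_measurable borel"
proof (induction l)
  case (Cons a l)
  then show ?case by (cases a) (simp add: trig_poly_def [abs_def])
qed (simp add: trig_poly_def [abs_def])

lemma trig_poly_bounded: "\<exists>B. \<forall>s. cmod (trig_poly l s) \<le> B"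
proof (induction l)
  case (Cons a l)
  then obtain B where B: "\<And>s. cmod (trig_poly l s) \<le> B" by blast
  obtain c t where a: "a = (c, t)" by (cases a)
  have "cmod (trig_poly (a # l) s) \<le> cmod c + B" for s
    using norm_triangle_mono [OF order_refl B, of "c * iexp (t * s)" s] by (simp add: a norm_mult)
  then show ?case by blast
qed (auto intro: exI [of _ 0])

section \<open>Square-integrable functions on the line\<close>

definition borel_finite :: "real measure \<Rightarrow> bool" where
  "borel_finite M \<longleftrightarrow> finite_measure M \<and> sets M = sets borel"

lemma borel_finite_measurable: "borel_finite M \<Longrightarrow> f \<in> borel_measurable borel \<Longrightarrow> f \<in> borel_measurable M"
  unfolding borel_finite_def by (metis measurable_cong_sets)

lemma borel_finite_integrable:
  fixes f :: "real \<Rightarrow> 'b :: {banach, second_countable_topology}"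
  assumes "borel_finite M" "f \<in> borel_measurable borel" "\<And>s. norm (f s) \<le> B"
  shows "integrable M f"
proof (rule finite_measure.integrable_const_bound)
  show "finite_measure M" using assms by (simp add: borel_finite_def)
  show "f \<in> borel_measurable M" by (rule borel_finite_measurable [OF assms(1,2)])
  show "AE s in M. norm (f s) \<le> B" using assms(3) by simp
qed

text \<open>The square of the distance in L^2 of \<open>M\<close>, on functions rather than on
  classes. Without a root the triangle inequality costs a factor 2, which limits do not
  notice.\<close>

definition l2_dist_sq :: "real measure \<Rightarrow> (real \<Rightarrow> complex) \<Rightarrow> (real \<Rightarrow> complex) \<Rightarrow> real" where
  "l2_dist_sq M f g = (\<integral>s. (cmod (f s - g s))\<^sup>2 \<partial>M)"

lemma cmod_add_sq_le: "(cmod (a + b))\<^sup>2 \<le> 2 * (cmod a)\<^sup>2 + 2 * (cmod b)\<^sup>2"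
proof -
  have "(cmod (a + b))\<^sup>2 \<le> (cmod a + cmod b)\<^sup>2" by (intro power_mono norm_triangle_ineq) auto
  also have "\<dots> \<le> 2 * (cmod a)\<^sup>2 + 2 * (cmod b)\<^sup>2"
    using zero_le_power2 [of "cmod a - cmod b"] by (simp add: power2_eq_square algebra_simps)
  finally show ?thesis .
qed

definition bounded_borel :: "(real \<Rightarrow> complex) \<Rightarrow> bool" where
  "bounded_borel g \<longleftrightarrow> g \<in> borel_measurable borel \<and> (\<exists>B. \<forall>s. cmod (g s) \<le> B)"

lemma bounded_borel_trig: "bounded_borel (trig_poly l)"
  by (simp add: bounded_borel_def trig_poly_bounded)

lemma bounded_borel_add: "bounded_borel f \<Longrightarrow> bounded_borel g \<Longrightarrow> bounded_borel (\<lambda>s. f s + g s)"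
  unfolding bounded_borel_def by (auto, meson norm_triangle_mono)

lemma bounded_borel_mult:
  assumes "bounded_borel f" "bounded_borel g" shows "bounded_borel (\<lambda>s. f s * g s)"
proof -
  obtain A B where AB: "\<And>s. cmod (f s) \<le> A" "\<And>s. cmod (g s) \<le> B"
    using assms by (auto simp: bounded_borel_def)
  have "cmod (f s * g s) \<le> A * B" for s
    unfolding norm_mult using order_trans [OF norm_ge_zero AB(1)] by (intro mult_mono AB) auto
  then show ?thesis using assms by (auto simp: bounded_borel_def)
qed

lemma bounded_borel_const: "bounded_borel (\<lambda>_. c)" by (auto simp: bounded_borel_def)

lemma bounded_borel_diff: "bounded_borel f \<Longrightarrow> bounded_borel g \<Longrightarrow> bounded_borel (\<lambda>s. f s - g s)"
  using bounded_borel_add [of f "\<lambda>s. (-1) * g s"] bounded_borel_mult [OF bounded_borel_const, of g "-1"] by simp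

lemma integrable_sq_diff:
  assumes M: "borel_finite M" and f: "bounded_borel f" and g: "bounded_borel g"
  shows "integrable M (\<lambda>s. (cmod (f s - g s))\<^sup>2)"
proof -
  obtain B where B: "\<And>s. cmod (f s - g s) \<le> B" and m: "(\<lambda>s. f s - g s) \<in> borel_measurable borel"
    using bounded_borel_diff [OF f g] by (auto simp: bounded_borel_def)
  show ?thesis
  proof (rule borel_finite_integrable [OF M])
    show "(\<lambda>s. (cmod (f s - g s))\<^sup>2) \<in> borel_measurable borel" using m by measurable
    show "norm ((cmod (f s - g s))\<^sup>2) \<le> B\<^sup>2" for s using power_mono [OF B [of s], of 2] by simp
  qed
qed

definition square_integrable :: "real measure \<Rightarrow> (real \<Rightarrow> complex) \<Rightarrow> bool" where
  "square_integrable M g \<longleftrightarrow> g \<in> borel_measurable borel \<and> integrable M (\<lambda>s. (cmod (g s))\<^sup>2)"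

lemma square_integrable_bounded: "borel_finite M \<Longrightarrow> bounded_borel g \<Longrightarrow> square_integrable M g"
  using integrable_sq_diff [of M g "\<lambda>_. 0"] bounded_borel_const [of 0]
  by (auto simp: square_integrable_def bounded_borel_def)

lemma square_integrable_diff:
  assumes M: "borel_finite M" and f: "square_integrable M f" and g: "square_integrable M g"
  shows "integrable M (\<lambda>s. (cmod (f s - g s))\<^sup>2)"
proof (rule Bochner_Integration.integrable_bound)
  show "integrable M (\<lambda>s. 2 * (cmod (f s))\<^sup>2 + 2 * (cmod (g s))\<^sup>2)"
    using f g by (auto simp: square_integrable_def)
  show "(\<lambda>s. (cmod (f s - g s))\<^sup>2) \<in> borel_measurable M"
    using f g by (intro borel_finite_measurable [OF M]) (auto simp: square_integrable_def)
  show "AE s in M. norm ((cmod (f s - g s))\<^sup>2) \<le> norm (2 * (cmod (f s))\<^sup>2 + 2 * (cmod (g s))\<^sup>2)"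
    using cmod_add_sq_le [of "f s" "- g s" for s] by (auto simp: abs_of_nonneg)
qed

lemma l2_dist_sq_triangle:
  assumes M: "borel_finite M" and f: "square_integrable M f" and g: "square_integrable M g" and h: "square_integrable M h"
  shows "l2_dist_sq M f h \<le> 2 * l2_dist_sq M f g + 2 * l2_dist_sq M g h"
proof -
  note i = square_integrable_diff [OF M]
  have "l2_dist_sq M f h \<le> (\<integral>s. 2 * (cmod (f s - g s))\<^sup>2 + 2 * (cmod (g s - h s))\<^sup>2 \<partial>M)"
    unfolding l2_dist_sq_def
  proof (rule integral_mono)
    show "(cmod (f s - h s))\<^sup>2 \<le> 2 * (cmod (f s - g s))\<^sup>2 + 2 * (cmod (g s - h s))\<^sup>2" for s
      using cmod_add_sq_le [of "f s - g s" "g s - h s"] by simp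
  qed (use i f g h in auto)
  also have "\<dots> = 2 * l2_dist_sq M f g + 2 * l2_dist_sq M g h"
    unfolding l2_dist_sq_def using i f g h by simp
  finally show ?thesis .
qed

text \<open>The approximation has to be simultaneous in finitely many measures: the functional calculus
  is additive because one sequence of polynomials serves the vectors \<open>x\<close>, \<open>y\<close> and \<open>x + y\<close>.\<close>

definition approximable :: "(real \<Rightarrow> complex) \<Rightarrow> bool" where
  "approximable g \<longleftrightarrow> bounded_borel g \<and>
     (\<forall>\<M>. finite \<M> \<and> (\<forall>M\<in>\<M>. borel_finite M) \<longrightarrow>
        (\<forall>\<delta>>0. \<exists>l. \<forall>M\<in>\<M>. l2_dist_sq M g (trig_poly l) < \<delta>))"

lemma approximable_bounded: "approximable g \<Longrightarrow> bounded_borel g" by (simp add: approximable_def)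

lemma approximableD:
  assumes "approximable g" "finite \<M>" "\<And>M. M \<in> \<M> \<Longrightarrow> borel_finite M" "0 < \<delta>"
  shows "\<exists>l. \<forall>M\<in>\<M>. l2_dist_sq M g (trig_poly l) < \<delta>"
  using assms by (simp add: approximable_def)

lemma approximable_trig: "approximable (trig_poly l)"
  unfolding approximable_def by (auto simp: bounded_borel_trig l2_dist_sq_def intro!: exI [of _ l])

text \<open>Functions that are themselves approximable may serve as approximants; two tolerances
  \<delta>/4 survive the factor 2 of \<open>l2_dist_sq_triangle\<close>.\<close>

lemma approximable_closed:
  assumes g: "bounded_borel g"
    and ap: "\<And>\<M> \<delta>. finite \<M> \<Longrightarrow> (\<And>M. M \<in> \<M> \<Longrightarrow> borel_finite M) \<Longrightarrow> 0 < \<delta> \<Longrightarrow>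
      \<exists>f. approximable f \<and> (\<forall>M\<in>\<M>. l2_dist_sq M g f < (\<delta> :: real))"
  shows "approximable g"
  unfolding approximable_def
proof (intro conjI g allI impI; elim conjE)
  fix \<M> :: "real measure set" and \<delta> :: real
  assume \<M>: "finite \<M>" "\<forall>M\<in>\<M>. borel_finite M" and \<delta>: "0 < \<delta>"
  obtain f where f: "approximable f" "\<forall>M\<in>\<M>. l2_dist_sq M g f < \<delta> / 4"
    using ap [of \<M> "\<delta> / 4"] \<M> \<delta> by auto
  obtain l where l: "\<forall>M\<in>\<M>. l2_dist_sq M f (trig_poly l) < \<delta> / 4"
    using approximableD [OF f(1) \<M>(1), of "\<delta> / 4"] \<M>(2) \<delta> by auto
  have "l2_dist_sq M g (trig_poly l) < \<delta>" if "M \<in> \<M>" for M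
  proof -
    have "l2_dist_sq M g (trig_poly l) \<le> 2 * l2_dist_sq M g f + 2 * l2_dist_sq M f (trig_poly l)"
      using \<M>(2) that g approximable_bounded [OF f(1)] bounded_borel_trig by (intro l2_dist_sq_triangle square_integrable_bounded) auto
    then show ?thesis using f(2) l that by force
  qed
  then show "\<exists>l. \<forall>M\<in>\<M>. l2_dist_sq M g (trig_poly l) < \<delta>" by blast
qed

text \<open>Dominated convergence in each measure; as there are finitely many measures, one index is
  good for all.\<close>

lemma approximable_bounded_limit:
  assumes f: "\<And>n :: nat. approximable (f n)" and B: "\<And>n s. cmod (f n s) \<le> B"
    and lim: "\<And>s. (\<lambda>n. f n s) \<longlonglongrightarrow> g s"
  shows "approximable g"
proof (rule approximable_closed)
  have fm: "f n \<in> borel_measurable borel" for n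
    using approximable_bounded [OF f] by (simp add: bounded_borel_def)
  have gm: "g \<in> borel_measurable borel" by (rule borel_measurable_LIMSEQ_metric [OF fm lim])
  have gB: "cmod (g s) \<le> B" for s
    using LIMSEQ_le_const2 [OF tendsto_norm [OF lim]] B by blast
  then show "bounded_borel g" using gm by (auto simp: bounded_borel_def)
  fix \<M> :: "real measure set" and \<delta> :: real
  assume \<M>: "finite \<M>" "\<And>M. M \<in> \<M> \<Longrightarrow> borel_finite M" and \<delta>: "0 < \<delta>"
  have "\<forall>\<^sub>F n in sequentially. l2_dist_sq M g (f n) < \<delta>" if M: "M \<in> \<M>" for M
  proof -
    note bM = \<M>(2) [OF M]
    have "(\<lambda>n. \<integral>s. (cmod (g s - f n s))\<^sup>2 \<partial>M) \<longlonglongrightarrow> (\<integral>s. 0 \<partial>M)"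
    proof (rule integral_dominated_convergence [where w = "\<lambda>_. (2 * B)\<^sup>2"])
      show "(\<lambda>s. (cmod (g s - f n s))\<^sup>2) \<in> borel_measurable M" for n
        using gm fm by (intro borel_finite_measurable [OF bM]) measurable
      show "integrable M (\<lambda>_. (2 * B)\<^sup>2)" by (rule borel_finite_integrable [OF bM, of _ "(2 * B)\<^sup>2"]) auto
      show "AE s in M. (\<lambda>n. (cmod (g s - f n s))\<^sup>2) \<longlonglongrightarrow> 0"
      proof (intro AE_I2)
        fix s
        have "(\<lambda>n. (cmod (g s - f n s))\<^sup>2) \<longlonglongrightarrow> (cmod (g s - g s))\<^sup>2" by (intro tendsto_intros lim)
        then show "(\<lambda>n. (cmod (g s - f n s))\<^sup>2) \<longlonglongrightarrow> 0" by simp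
      qed
      show "AE s in M. norm ((cmod (g s - f n s))\<^sup>2) \<le> (2 * B)\<^sup>2" for n
      proof (intro AE_I2)
        fix s
        have "cmod (g s - f n s) \<le> 2 * B" using norm_triangle_ineq4 [of "g s" "f n s"] gB [of s] B [of n s] by linarith
        then show "norm ((cmod (g s - f n s))\<^sup>2) \<le> (2 * B)\<^sup>2"
          using power_mono [of "cmod (g s - f n s)" "2 * B" 2] by simp
      qed
    qed simp
    then show ?thesis using \<delta> by (intro order_tendstoD(2)) (simp_all add: l2_dist_sq_def)
  qed
  then have "\<forall>\<^sub>F n in sequentially. \<forall>M\<in>\<M>. l2_dist_sq M g (f n) < \<delta>"
    using \<M>(1) by (simp add: eventually_ball_finite)
  then show "\<exists>h. approximable h \<and> (\<forall>M\<in>\<M>. l2_dist_sq M g h < \<delta>)"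
    using f by (auto simp: eventually_sequentially)
qed

lemma approximable_add:
  assumes f: "approximable f" and g: "approximable g" shows "approximable (\<lambda>s. f s + g s)"
  unfolding approximable_def
proof (intro conjI bounded_borel_add approximable_bounded assms allI impI; elim conjE)
  fix \<M> :: "real measure set" and \<delta> :: real
  assume \<M>: "finite \<M>" "\<forall>M\<in>\<M>. borel_finite M" and \<delta>: "0 < \<delta>"
  obtain l l' where l: "\<forall>M\<in>\<M>. l2_dist_sq M f (trig_poly l) < \<delta> / 4" "\<forall>M\<in>\<M>. l2_dist_sq M g (trig_poly l') < \<delta> / 4"
    using approximableD [OF f \<M>(1), of "\<delta> / 4"] approximableD [OF g \<M>(1), of "\<delta> / 4"] \<M>(2) \<delta> by auto
  have "l2_dist_sq M (\<lambda>s. f s + g s) (trig_poly (l @ l')) < \<delta>" if M: "M \<in> \<M>" for M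
  proof -
    note i = integrable_sq_diff [of M]
    have bM: "borel_finite M" using \<M>(2) M by blast
    have "l2_dist_sq M (\<lambda>s. f s + g s) (trig_poly (l @ l'))
        \<le> (\<integral>s. 2 * (cmod (f s - trig_poly l s))\<^sup>2 + 2 * (cmod (g s - trig_poly l' s))\<^sup>2 \<partial>M)"
      unfolding l2_dist_sq_def
    proof (rule integral_mono)
      show "(cmod (f s + g s - trig_poly (l @ l') s))\<^sup>2
          \<le> 2 * (cmod (f s - trig_poly l s))\<^sup>2 + 2 * (cmod (g s - trig_poly l' s))\<^sup>2" for s
        using cmod_add_sq_le [of "f s - trig_poly l s" "g s - trig_poly l' s"]
        by (simp add: trig_poly_append algebra_simps)
    qed (use bM approximable_bounded [OF f] approximable_bounded [OF g] bounded_borel_trig in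
        \<open>auto intro!: integrable_add integrable_mult_right i bounded_borel_add\<close>)
    also have "\<dots> = 2 * l2_dist_sq M f (trig_poly l) + 2 * l2_dist_sq M g (trig_poly l')"
      unfolding l2_dist_sq_def
      using i [OF bM approximable_bounded [OF f] bounded_borel_trig] i [OF bM approximable_bounded [OF g] bounded_borel_trig]
      by simp
    finally show ?thesis using l M by force
  qed
  then show "\<exists>l. \<forall>M\<in>\<M>. l2_dist_sq M (\<lambda>s. f s + g s) (trig_poly l) < \<delta>" by blast
qed

lemma l2_dist_sq_mult_le:
  assumes M: "borel_finite M" and k: "bounded_borel k" "\<And>s. cmod (k s) \<le> B" and f: "bounded_borel f" and g: "bounded_borel g"
  shows "l2_dist_sq M (\<lambda>s. k s * f s) (\<lambda>s. k s * g s) \<le> B\<^sup>2 * l2_dist_sq M f g"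
proof -
  have "l2_dist_sq M (\<lambda>s. k s * f s) (\<lambda>s. k s * g s) \<le> (\<integral>s. B\<^sup>2 * (cmod (f s - g s))\<^sup>2 \<partial>M)"
    unfolding l2_dist_sq_def
  proof (rule integral_mono)
    show "(cmod (k s * f s - k s * g s))\<^sup>2 \<le> B\<^sup>2 * (cmod (f s - g s))\<^sup>2" for s
      using power_mono [OF k(2) [of s], of 2]
      by (simp add: norm_mult power_mult_distrib mult_right_mono flip: right_diff_distrib)
  qed (use M k(1) f g in \<open>auto intro!: integrable_mult_right integrable_sq_diff bounded_borel_mult\<close>)
  then show ?thesis by (simp add: l2_dist_sq_def)
qed

lemma approximable_trigI: "(\<And>s. trig_poly l s = g s) \<Longrightarrow> approximable g"
  using approximable_trig [of l] by presburger

text \<open>Multiplication by one term c exp(its) is bounded in L^2 and merely shifts the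
  frequencies of an approximating polynomial; \<open>approximable_add\<close> collects the
  terms.\<close>

lemma approximable_mult_trig:
  assumes g: "approximable g" shows "approximable (\<lambda>s. trig_poly l s * g s)"
proof (induction l)
  case Nil
  show ?case by (rule approximable_trigI [of "[]"]) simp
next
  case (Cons a l)
  obtain c t where a: "a = (c, t)" by (cases a)
  have k: "bounded_borel (\<lambda>s. c * iexp (t * s))"
    by (rule approximable_bounded, rule approximable_trigI [of "[(c, t)]"]) simp
  have kB: "cmod (c * iexp (t * s)) \<le> cmod c" for s by (simp add: norm_mult)
  have "approximable (\<lambda>s. c * iexp (t * s) * g s)"
    unfolding approximable_def
  proof (intro conjI bounded_borel_mult k approximable_bounded [OF g] allI impI; elim conjE)
    fix \<M> :: "real measure set" and \<delta> :: real
    assume \<M>: "finite \<M>" "\<forall>M\<in>\<M>. borel_finite M" and \<delta>: "0 < \<delta>"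
    \<comment> \<open>The summand 1 keeps the divisor positive when \<open>c = 0\<close>.\<close>
    define C where "C = (cmod c)\<^sup>2 + 1"
    have C: "0 < C" by (simp add: C_def add_nonneg_pos)
    obtain l' where l': "\<forall>M\<in>\<M>. l2_dist_sq M g (trig_poly l') < \<delta> / C"
      using approximableD [OF g \<M>(1), of "\<delta> / C"] \<M>(2) \<delta> C by auto
    have "l2_dist_sq M (\<lambda>s. c * iexp (t * s) * g s) (trig_poly (trig_mult c t l')) < \<delta>" if M: "M \<in> \<M>" for M
    proof -
      have bM: "borel_finite M" using \<M>(2) M by blast
      have "l2_dist_sq M (\<lambda>s. c * iexp (t * s) * g s) (trig_poly (trig_mult c t l'))
          \<le> (cmod c)\<^sup>2 * l2_dist_sq M g (trig_poly l')"
        using l2_dist_sq_mult_le [OF bM k kB approximable_bounded [OF g] bounded_borel_trig [of l']]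
        by (simp add: trig_poly_mult [abs_def])
      also have "\<dots> \<le> C * l2_dist_sq M g (trig_poly l')"
        by (intro mult_right_mono) (auto simp: C_def l2_dist_sq_def)
      also have "\<dots> < C * (\<delta> / C)" using l' M C by (intro mult_strict_left_mono) auto
      finally show ?thesis using C by simp
    qed
    then show "\<exists>l. \<forall>M\<in>\<M>. l2_dist_sq M (\<lambda>s. c * iexp (t * s) * g s) (trig_poly l) < \<delta>" by blast
  qed
  from approximable_add [OF this Cons.IH] show ?case by (simp add: a distrib_right)
qed

text \<open>Replace only the first factor by a trigonometric polynomial: the second is bounded, so
  the error stays small, and \<open>approximable_mult_trig\<close> covers the new product.\<close>

lemma approximable_mult:
  assumes f: "approximable f" and g: "approximable g" shows "approximable (\<lambda>s. f s * g s)"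
proof (rule approximable_closed)
  note bf = approximable_bounded [OF f] and bg = approximable_bounded [OF g]
  show "bounded_borel (\<lambda>s. f s * g s)" using bf bg by (rule bounded_borel_mult)
  obtain B where B: "\<And>s. cmod (g s) \<le> B" using bg by (auto simp: bounded_borel_def)
  fix \<M> :: "real measure set" and \<delta> :: real
  assume \<M>: "finite \<M>" "\<And>M. M \<in> \<M> \<Longrightarrow> borel_finite M" and \<delta>: "0 < \<delta>"
  define C where "C = B\<^sup>2 + 1"
  have C: "0 < C" by (simp add: C_def add_nonneg_pos)
  obtain l where l: "\<forall>M\<in>\<M>. l2_dist_sq M f (trig_poly l) < \<delta> / C"
    using approximableD [OF f \<M>(1), of "\<delta> / C"] \<M>(2) \<delta> C by auto
  have "l2_dist_sq M (\<lambda>s. f s * g s) (\<lambda>s. trig_poly l s * g s) < \<delta>" if M: "M \<in> \<M>" for M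
  proof -
    have "l2_dist_sq M (\<lambda>s. f s * g s) (\<lambda>s. trig_poly l s * g s) \<le> B\<^sup>2 * l2_dist_sq M f (trig_poly l)"
      using l2_dist_sq_mult_le [OF \<M>(2) [OF M] bg B bf bounded_borel_trig [of l]] by (simp add: mult.commute)
    also have "\<dots> \<le> C * l2_dist_sq M f (trig_poly l)"
      by (intro mult_right_mono) (auto simp: C_def l2_dist_sq_def)
    also have "\<dots> < C * (\<delta> / C)" using l M C by (intro mult_strict_left_mono) auto
    finally show ?thesis using C by simp
  qed
  then show "\<exists>h. approximable h \<and> (\<forall>M\<in>\<M>. l2_dist_sq M (\<lambda>s. f s * g s) h < \<delta>)"
    using approximable_mult_trig [OF g] by blast
qed

lemma approximable_const: "approximable (\<lambda>_. c)"
  by (rule approximable_trigI [of "[(c, 0)]"]) simp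

lemma approximable_power: "approximable f \<Longrightarrow> approximable (\<lambda>s. f s ^ n)"
  by (induction n) (auto simp: approximable_const intro: approximable_mult)

lemma approximable_sum: "(\<And>i. i \<in> I \<Longrightarrow> approximable (f i)) \<Longrightarrow> approximable (\<lambda>s. \<Sum>i\<in>I. f i s)"
  by (induction I rule: infinite_finite_induct) (auto simp: approximable_const intro: approximable_add)

lemma approximable_diff: "approximable f \<Longrightarrow> approximable g \<Longrightarrow> approximable (\<lambda>s. f s - g s)"
  using approximable_add [of f "\<lambda>s. (-1) * g s"] approximable_mult [OF approximable_const, of g "-1"] by simp

text \<open>Bernstein polynomials converge uniformly on the unit interval, and polynomials in an
  approximable function are approximable because products and sums are.\<close>

lemma approximable_continuous_comp:
  assumes x: "approximable (\<lambda>s. of_real (x s))" "\<And>s. x s \<in> {0..1}" and f: "continuous_on {0..1} f"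
  shows "approximable (\<lambda>s. of_real (f (x s)))"
proof -
  have "\<exists>N. \<forall>y\<in>{0..1}. \<bar>f y - (\<Sum>k\<le>N. f (k / N) * Bernstein N k y)\<bar> < 1 / Suc n" for n
  proof -
    have "0 < 1 / real (Suc n)" by simp
    from Bernstein_Weierstrass [OF f this] show ?thesis by blast
  qed
  then obtain N where N: "\<And>n y. y \<in> {0..1} \<Longrightarrow> \<bar>f y - (\<Sum>k\<le>N n. f (k / N n) * Bernstein (N n) k y)\<bar> < 1 / Suc n"
    by metis
  let ?p = "\<lambda>n s. \<Sum>k\<le>N n. f (k / N n) * Bernstein (N n) k (x s)"
  obtain B where "\<forall>z\<in>f ` {0..1}. norm z \<le> B"
    using compact_imp_bounded [OF compact_continuous_image [OF f compact_Icc]] unfolding bounded_iff by blast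
  then have B: "\<And>y. y \<in> {0..1} \<Longrightarrow> \<bar>f y\<bar> \<le> B" by auto
  show ?thesis
  proof (rule approximable_bounded_limit)
  show "approximable (\<lambda>s. of_real (?p n s))" for n
  proof -
    have "approximable (\<lambda>s. \<Sum>k\<le>N n. of_real (f (k / N n)) * (of_nat (N n choose k) *
        of_real (x s) ^ k * (1 - of_real (x s)) ^ (N n - k)))"
      by (intro approximable_sum approximable_mult approximable_const approximable_power approximable_diff x)
    then show ?thesis by (simp add: Bernstein_def)
  qed
  show "cmod (of_real (?p n s)) \<le> B + 1" for n s
  proof -
    have "1 / real (Suc n) \<le> 1" by simp
    then show ?thesis using N [OF x(2), of s n] B [OF x(2), of s] unfolding norm_of_real by linarith
  qed
  show "(\<lambda>n. of_real (?p n s)) \<longlonglongrightarrow> (of_real (f (x s)) :: complex)" for s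
  proof (intro tendsto_of_real)
    have "(\<lambda>n. f (x s) - ?p n s) \<longlonglongrightarrow> 0"
    proof (rule Lim_null_comparison)
      show "\<forall>\<^sub>F n in sequentially. norm (f (x s) - ?p n s) \<le> 1 / Suc n"
        using N [OF x(2)] by (intro always_eventually allI) (simp add: less_imp_le)
      show "(\<lambda>n. 1 / Suc n) \<longlonglongrightarrow> 0" using LIMSEQ_inverse_real_of_nat by (simp add: inverse_eq_divide)
    qed
    then have "(\<lambda>n. f (x s) - (f (x s) - ?p n s)) \<longlonglongrightarrow> f (x s) - 0" by (intro tendsto_intros)
    then show "(\<lambda>n. ?p n s) \<longlonglongrightarrow> f (x s)" by simp
  qed
qed
qed

text \<open>The half-line $(a,\infty)$ is the limit of the periodic sets where $\sin((s - a)/n)$ is positive.\<close>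

lemma approximable_greaterThan: "approximable (\<lambda>s. of_real (indicator {a<..} s))"
proof -
  \<comment> \<open>The sine rescaled to the unit interval, so that positivity of the sine reads as
    exceeding 1/2.\<close>
  define x where "x n s = (1 + sin ((s - a) / real (Suc n))) / 2" for n s
  have x01: "x n s \<in> {0..1}" for n s
    using sin_ge_minus_one [of "(s - a) / real (Suc n)"] sin_le_one [of "(s - a) / real (Suc n)"]
    by (simp add: x_def del: sin_ge_minus_one sin_le_one)
  have ax: "approximable (\<lambda>s. of_real (x n s))" for n
  proof -
    let ?m = "real (Suc n)"
    let ?l = "[(1 / 2, 0), (iexp (- a / ?m) / (4 * \<i>), 1 / ?m), (- iexp (a / ?m) / (4 * \<i>), - 1 / ?m)]"
    have "of_real (x n s) = trig_poly ?l s" for s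
    proof -
      have "of_real (sin ((s - a) / ?m)) = (iexp ((s - a) / ?m) - iexp (- ((s - a) / ?m))) / (2 * \<i>)"
        unfolding sin_of_real [symmetric] sin_exp_eq by (simp add: exp_minus)
      also have "iexp ((s - a) / ?m) = iexp (- a / ?m) * iexp (1 / ?m * s)"
        unfolding exp_add [symmetric] by (rule arg_cong [where f = exp]) (simp add: diff_divide_distrib algebra_simps)
      also have "iexp (- ((s - a) / ?m)) = iexp (a / ?m) * iexp (- 1 / ?m * s)"
        unfolding exp_add [symmetric] by (rule arg_cong [where f = exp]) (simp add: diff_divide_distrib algebra_simps)
      finally have sin: "of_real (sin ((s - a) / ?m)) = (iexp (- a / ?m) * iexp (1 / ?m * s)
          - iexp (a / ?m) * iexp (- 1 / ?m * s)) / (2 * \<i>)" .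
      have e: "(1 + (e1 * f1 - e2 * f2) / (2 * \<i>)) / 2 =
          1 / 2 * iexp (0 * s) + (e1 / (4 * \<i>) * f1 + (- e2 / (4 * \<i>) * f2 + 0))" for e1 e2 f1 f2
        by (simp add: field_simps)
      have "of_real (x n s) = (1 + of_real (sin ((s - a) / ?m))) / (2 :: complex)" by (simp add: x_def)
      also note sin
      also note e
      also have "1 / 2 * iexp (0 * s) + (iexp (- a / ?m) / (4 * \<i>) * iexp (1 / ?m * s) +
          (- iexp (a / ?m) / (4 * \<i>) * iexp (- 1 / ?m * s) + 0)) = trig_poly ?l s"
        by (simp only: trig_poly_simps)
      finally show ?thesis .
    qed
    then show ?thesis by (intro approximable_trigI [of ?l]) (simp only:)
  qed
  have ind: "approximable (\<lambda>s. of_real (indicator {1/2<..} (x n s)))" for n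
  proof (rule approximable_bounded_limit)
    \<comment> \<open>Continuous ramps that converge pointwise to the indicator of the values above
      1/2.\<close>
    let ?f = "\<lambda>k y. min 1 (max 0 (real k * (y - 1 / 2)))"
    show "approximable (\<lambda>s. of_real (?f k (x n s)))" for k :: nat
      by (rule approximable_continuous_comp [OF ax x01]) (intro continuous_intros)
    show "cmod (of_real (?f k (x n s))) \<le> 1" for k s unfolding norm_of_real by (auto simp: min_def max_def)
    show "(\<lambda>k. of_real (?f k (x n s))) \<longlonglongrightarrow> (of_real (indicator {1/2<..} (x n s)) :: complex)" for s
    proof (intro tendsto_of_real)
      show "(\<lambda>k. ?f k (x n s)) \<longlonglongrightarrow> indicator {1/2<..} (x n s)"
      proof (cases "1/2 < x n s")
        case True
        obtain k0 :: nat where k0: "1 / (x n s - 1/2) < k0" using reals_Archimedean2 by blast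
        have "?f k (x n s) = 1" if "k0 \<le> k" for k
        proof -
          have "1 < real k0 * (x n s - 1/2)" using k0 True by (simp add: field_simps)
          also have "\<dots> \<le> real k * (x n s - 1/2)" using that True by (intro mult_right_mono) auto
          finally show ?thesis by simp
        qed
        then have "\<forall>\<^sub>F k in sequentially. ?f k (x n s) = 1" by (auto simp: eventually_sequentially)
        then show ?thesis using True by (simp add: tendsto_eventually)
      next
        case False
        then have le: "real k * (x n s - 1 / 2) \<le> 0" for k :: nat by (intro mult_nonneg_nonpos) auto
        have "?f k (x n s) = 0" for k :: nat using le [of k] by (simp only: max_absorb1 max_absorb2 min_absorb1 min_absorb2 zero_le_one)
        then show ?thesis using False by simp
      qed
    qed
  qed
  show ?thesis
  proof (rule approximable_bounded_limit [OF ind])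
  show "cmod (of_real (indicator {1/2<..} (x n s))) \<le> 1" for n s by (simp add: indicator_def)
  show "(\<lambda>n. of_real (indicator {1/2<..} (x n s))) \<longlonglongrightarrow> (of_real (indicator {a<..} s) :: complex)" for s
  proof (rule tendsto_eventually)
    \<comment> \<open>From \<open>n0\<close> on the argument of the sine has modulus below 1, where
      the sine has the sign of its argument.\<close>
    obtain n0 :: nat where n0: "\<bar>s - a\<bar> < n0" using reals_Archimedean2 by blast
    have "indicator {1/2<..} (x n s) = (indicator {a<..} s :: real)" if "n0 \<le> n" for n
    proof -
      let ?y = "(s - a) / real (Suc n)"
      have "\<bar>s - a\<bar> < real (Suc n)" using n0 that by linarith
      then have y: "\<bar>?y\<bar> < 1" by simp
      have "0 < sin ?y \<longleftrightarrow> a < s"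
      proof (cases "a < s")
        case True
        then have "0 < ?y" by simp
        moreover have "?y < pi" using y pi_gt3 by linarith
        ultimately have "0 < sin ?y" by (rule sin_gt_zero)
        then show ?thesis using True by blast
      next
        case False
        then have "0 \<le> - ?y" by (simp add: divide_nonpos_pos)
        then have "0 \<le> sin (- ?y)" using y pi_gt3 by (intro sin_ge_zero) linarith+
        then show ?thesis using False by simp
      qed
      then show ?thesis by (simp add: x_def indicator_def)
    qed
    then show "\<forall>\<^sub>F n in sequentially. of_real (indicator {1/2<..} (x n s)) = (of_real (indicator {a<..} s) :: complex)"
      by (auto simp: eventually_sequentially)
  qed
qed
qed

text \<open>Dynkin's theorem: the half-lines are stable under intersection and generate the Borel
  sets, and approximability passes to complements by subtraction and to disjoint unions by bounded
  limits.\<close>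

lemma approximable_indicator:
  assumes "S \<in> sets borel" shows "approximable (\<lambda>s. of_real (indicator S s))"
proof -
  let ?G = "range (\<lambda>a :: real. {a<..})"
  have "sets borel = sigma_sets UNIV ?G"
    unfolding borel_Ioi by (rule sets_measure_of) simp
  then have S: "S \<in> sigma_sets UNIV ?G" using assms by simp
  have stable: "Int_stable ?G"
  proof (rule Int_stableI)
    fix A B assume "A \<in> ?G" "B \<in> ?G"
    then obtain a b where "A = {a<..}" "B = {b<..}" by auto
    then have "A \<inter> B = {max a b<..}" by auto
    then show "A \<inter> B \<in> ?G" by blast
  qed
  have closed: "?G \<subseteq> Pow UNIV" by simp
  from stable closed S show ?thesis
  proof (induction S rule: sigma_sets_induct_disjoint)
    case (basic A)
    then show ?case using approximable_greaterThan by auto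
  next
    case empty show ?case using approximable_const [of 0] by simp
  next
    case (compl A)
    have "(\<lambda>s. 1 - of_real (indicator A s)) = (\<lambda>s. of_real (indicator (UNIV - A) s) :: complex)"
      by (auto simp: indicator_def)
    then show ?case using approximable_diff [OF approximable_const [of 1] compl(2)] by simp
  next
    case (union A)
    show ?case
    proof (rule approximable_bounded_limit)
      have u: "(\<Sum>i<n. of_real (indicator (A i) s)) = (of_real (indicator (\<Union>i<n. A i) s) :: complex)" for n s
      proof -
        have "disjoint_family_on A {..<n}" using union(1) by (rule disjoint_family_on_mono [rotated]) simp
        then have "indicator (\<Union>i<n. A i) s = (\<Sum>i<n. indicator (A i) s :: real)"
          by (intro indicator_UN_disjoint) simp_all
        then show ?thesis by (simp only: of_real_sum)
      qed
      show "approximable (\<lambda>s. \<Sum>i<n. of_real (indicator (A i) s))" for n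
        by (intro approximable_sum union)
      show "cmod (\<Sum>i<n. of_real (indicator (A i) s)) \<le> 1" for n s unfolding u by (simp add: indicator_def)
      show "(\<lambda>n. \<Sum>i<n. of_real (indicator (A i) s)) \<longlonglongrightarrow> (of_real (indicator (\<Union> (range A)) s) :: complex)" for s
        unfolding u by (intro tendsto_of_real LIMSEQ_indicator_UN)
    qed
  qed
qed

section \<open>The spectral theorem for one-parameter unitary groups\<close>

lemma square_integrable_integrable:
  assumes M: "borel_finite M" and f: "square_integrable M f"
  shows "integrable M f"
proof (rule Bochner_Integration.integrable_bound)
  have "integrable M (\<lambda>_. 1 :: real)" by (rule borel_finite_integrable [OF M, of _ 1]) auto
  then show "integrable M (\<lambda>s. 1 + (cmod (f s))\<^sup>2)" using f by (auto simp: square_integrable_def)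
  show "f \<in> borel_measurable M" using f by (intro borel_finite_measurable [OF M]) (simp add: square_integrable_def)
  have "a \<le> 1 + a\<^sup>2" for a :: real using zero_le_power2 [of "a - 1/2"] by (simp add: power2_eq_square algebra_simps)
  then show "AE s in M. norm (f s) \<le> norm (1 + (cmod (f s))\<^sup>2)" by (simp add: abs_of_nonneg add_nonneg_nonneg)
qed

lemma l2_dist_sq_commute: "l2_dist_sq M f g = l2_dist_sq M g f"
  by (simp add: l2_dist_sq_def norm_minus_commute)

lemma l2_dist_sq_nonneg: "0 \<le> l2_dist_sq M f g"
  by (simp add: l2_dist_sq_def)

text \<open>Convergence in L^2 implies convergence in L^1 on a finite measure. In place of the
  Cauchy-Schwarz inequality the proof integrates the pointwise bound a \<le> e + a^2 / e.\<close>

lemma l2_null_imp_integral_tendsto: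
  assumes M: "borel_finite M" and g: "square_integrable M g" and f: "\<And>n :: nat. square_integrable M (f n)"
    and lim: "(\<lambda>n. l2_dist_sq M g (f n)) \<longlonglongrightarrow> 0"
  shows "(\<lambda>n. \<integral>s. f n s \<partial>M) \<longlonglongrightarrow> (\<integral>s. g s \<partial>M)"
proof -
  interpret finite_measure M using M by (simp add: borel_finite_def)
  let ?m = "measure M (space M)"
  have bound: "cmod ((\<integral>s. f n s \<partial>M) - (\<integral>s. g s \<partial>M)) \<le> e * ?m + l2_dist_sq M g (f n) / e" if e: "0 < e" for e n
  proof -
    have fi: "integrable M (f n)" and gi: "integrable M g" by (auto intro: square_integrable_integrable [OF M] f g)
    have d: "integrable M (\<lambda>s. (cmod (g s - f n s))\<^sup>2)" by (rule square_integrable_diff [OF M g f])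
    have "cmod ((\<integral>s. f n s \<partial>M) - (\<integral>s. g s \<partial>M)) = cmod (\<integral>s. f n s - g s \<partial>M)" using fi gi by simp
    also have "\<dots> \<le> (\<integral>s. cmod (f n s - g s) \<partial>M)" by (rule integral_norm_bound)
    also have "\<dots> \<le> (\<integral>s. e + (cmod (g s - f n s))\<^sup>2 / e \<partial>M)"
    proof (rule integral_mono)
      show "integrable M (\<lambda>s. cmod (f n s - g s))" using fi gi by auto
      show "integrable M (\<lambda>s. e + (cmod (g s - f n s))\<^sup>2 / e)" using d by auto
      show "cmod (f n s - g s) \<le> e + (cmod (g s - f n s))\<^sup>2 / e" for s
      proof -
        let ?a = "cmod (g s - f n s)"
        have "0 \<le> (e - ?a)\<^sup>2 + e * ?a" using e by simp
        then have "?a * e \<le> e * e + ?a\<^sup>2" by (simp add: power2_eq_square algebra_simps)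
        then show ?thesis using e by (simp add: norm_minus_commute field_simps)
      qed
    qed
    also have "\<dots> = e * ?m + l2_dist_sq M g (f n) / e"
      using d by (simp add: l2_dist_sq_def mult.commute)
    finally show ?thesis .
  qed
  show ?thesis
  proof (rule metric_LIMSEQ_I)
    fix r :: real assume r: "0 < r"
    define e where "e = r / (2 * (?m + 1))"
    have m: "0 < ?m + 1" by (simp add: add_nonneg_pos)
    then have e: "0 < e" using r by (simp add: e_def)
    have "e * ?m \<le> e * (?m + 1)" using e by simp
    also have "\<dots> = r / 2" using m by (simp add: e_def field_simps)
    finally have em: "e * ?m \<le> r / 2" .
    have "\<forall>\<^sub>F n in sequentially. l2_dist_sq M g (f n) < e * (r / 2)"
      using lim e r by (intro order_tendstoD(2)) auto
    then obtain N where N: "\<And>n. N \<le> n \<Longrightarrow> l2_dist_sq M g (f n) < e * (r / 2)" by (auto simp: eventually_sequentially)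
    have "dist (\<integral>s. f n s \<partial>M) (\<integral>s. g s \<partial>M) < r" if "N \<le> n" for n
    proof -
      have "l2_dist_sq M g (f n) / e < r / 2" using N [OF that] e by (simp add: field_simps)
      then show ?thesis using bound [OF e, of n] em unfolding dist_norm by linarith
    qed
    then show "\<exists>N. \<forall>n\<ge>N. dist (\<integral>s. f n s \<partial>M) (\<integral>s. g s \<partial>M) < r" by blast
  qed
qed

section \<open>The functional calculus\<close>

context one_param_group
begin

text \<open>The scalar spectral measure of \<open>x\<close>, available before the projections are;
  \<open>vector_measure_spec\<close> later recovers it from them.\<close>

definition \<mu> :: "'a \<Rightarrow> real measure" where
  "\<mu> x = (SOME M. finite_measure M \<and> sets M = sets borel \<and> (\<forall>t. (\<integral>s. iexp (t * s) \<partial>M) = cinner x (w t x)))"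

lemma \<mu>:
  assumes "x \<in> H"
  shows \<mu>_finite: "borel_finite (\<mu> x)" and \<mu>_char: "(\<integral>s. iexp (t * s) \<partial>\<mu> x) = cinner x (w t x)"
  using someI_ex [OF bochner [OF assms]] by (auto simp: \<mu>_def borel_finite_def)

definition tp_op :: "(complex \<times> real) list \<Rightarrow> 'a \<Rightarrow> 'a" where
  "tp_op l x = (\<Sum>(c, t)\<leftarrow>l. c *\<^sub>C w t x)"

lemma tp_op_simps [simp]: "tp_op [] x = 0" "tp_op ((c, t) # l) x = c *\<^sub>C w t x + tp_op l x"
  by (auto simp: tp_op_def)

lemma tp_op_append: "tp_op (l @ l') x = tp_op l x + tp_op l' x"
  by (simp add: tp_op_def)

lemma tp_op_in: "x \<in> H \<Longrightarrow> tp_op l x \<in> H"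
  by (induction l) (auto simp: csubspace_0 [OF cH] intro!: csubspace_add [OF cH] csubspace_scaleC [OF cH] w_in)

lemma tp_op_add: "x \<in> H \<Longrightarrow> y \<in> H \<Longrightarrow> tp_op l (x + y) = tp_op l x + tp_op l y"
  by (induction l) (auto simp: clinear_on_add [OF w_lin] scaleC.add_right)

lemma tp_op_scaleC: "x \<in> H \<Longrightarrow> tp_op l (a *\<^sub>C x) = a *\<^sub>C tp_op l x"
  by (induction l) (auto simp: clinear_on_scaleC [OF w_lin] scaleC.add_right scaleC_scaleC mult.commute scaleC.zero_right)

lemma tp_op_mult: "x \<in> H \<Longrightarrow> tp_op (trig_mult a r l) x = a *\<^sub>C w r (tp_op l x)"
proof (induction l)
  case Nil then show ?case by (simp add: trig_mult_def clinear_on_0 [OF w_lin cH] scaleC.zero_right)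
next
  case (Cons p l)
  obtain c t where p: "p = (c, t)" by (cases p)
  have "tp_op (trig_mult a r (p # l)) x = (a * c) *\<^sub>C w (r + t) x + a *\<^sub>C w r (tp_op l x)"
    using Cons by (simp add: p trig_mult_def)
  also have "\<dots> = a *\<^sub>C w r (tp_op (p # l) x)"
    using Cons.prems
    by (simp add: p clinear_on_add [OF w_lin] clinear_on_scaleC [OF w_lin] w_in tp_op_in w_add
        csubspace_scaleC [OF cH] scaleC.add_right scaleC_scaleC)
  finally show ?case .
qed

lemma cinner_tp_op_left:
  assumes "x \<in> H" "y \<in> H"
  shows "cinner (tp_op l x) y = cinner x (tp_op (trig_cnj l) y)"
proof (induction l)
  case Nil then show ?case by (simp add: trig_cnj_def cinner.zero_left cinner.zero_right)
next
  case (Cons p l)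
  obtain c t where p: "p = (c, t)" by (cases p)
  have "cinner (w t x) y = cinner x (w (- t) y)"
    using cinner_w [OF assms, of t 0] w_0 [OF assms(2)] by simp
  then show ?case using Cons
    by (simp add: p trig_cnj_def cinner.add_left cinner.add_right cinner_scaleC_left cinner_scaleC_right)
qed

lemma trig_integrable: "x \<in> H \<Longrightarrow> integrable (\<mu> x) (trig_poly l)"
  using trig_poly_bounded [of l] borel_finite_integrable [OF \<mu>_finite trig_poly_measurable, of x l] by blast

lemma cinner_tp_op: "x \<in> H \<Longrightarrow> cinner x (tp_op l x) = (\<integral>s. trig_poly l s \<partial>\<mu> x)"
proof (induction l)
  case Nil then show ?case by (simp add: cinner.zero_right)
next
  case (Cons p l)
  obtain c t where p: "p = (c, t)" by (cases p)
  have i: "integrable (\<mu> x) (\<lambda>s. iexp (t * s))"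
    using trig_integrable [OF Cons.prems, of "[(1, t)]"] by (simp add: trig_poly_def [abs_def])
  have "(\<integral>s. trig_poly (p # l) s \<partial>\<mu> x) = (\<integral>s. c * iexp (t * s) + trig_poly l s \<partial>\<mu> x)"
    by (simp only: p trig_poly_simps)
  also have "\<dots> = (\<integral>s. c * iexp (t * s) \<partial>\<mu> x) + (\<integral>s. trig_poly l s \<partial>\<mu> x)"
    by (rule Bochner_Integration.integral_add [OF integrable_mult_right [OF i] trig_integrable [OF Cons.prems]])
  also have "(\<integral>s. c * iexp (t * s) \<partial>\<mu> x) = c * cinner x (w t x)"
    using \<mu>_char [OF Cons.prems, of t] by (simp only: integral_mult_right_zero)
  finally show ?case using Cons by (simp add: p cinner.add_right cinner_scaleC_right)
qed

lemma tp_op_tp_op: "x \<in> H \<Longrightarrow> \<exists>l''. (\<forall>s. trig_poly l'' s = trig_poly l s * trig_poly l' s) \<and> tp_op l'' x = tp_op l (tp_op l' x)"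
proof (induction l)
  case Nil then show ?case by (intro exI [of _ "[]"]) simp
next
  case (Cons p l)
  obtain c t where p: "p = (c, t)" by (cases p)
  obtain l'' where "\<forall>s. trig_poly l'' s = trig_poly l s * trig_poly l' s" "tp_op l'' x = tp_op l (tp_op l' x)"
    using Cons by blast
  then show ?case using Cons.prems
    by (intro exI [of _ "trig_mult c t l' @ l''"])
      (simp add: p trig_poly_append trig_poly_mult tp_op_append tp_op_mult distrib_right)
qed

text \<open>The adjoint of p(A) is the polynomial with conjugated values, so |p(A) x|^2 = <x,
  |p|^2(A) x>. This isometry from L^2 of \<open>\<mu> x\<close> is what the extension to limits
  rests on.\<close>

lemma norm_tp_op_sq: "x \<in> H \<Longrightarrow> (norm (tp_op l x))\<^sup>2 = (\<integral>s. (cmod (trig_poly l s))\<^sup>2 \<partial>\<mu> x)"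
proof -
  assume x: "x \<in> H"
  obtain l'' where l'': "\<forall>s. trig_poly l'' s = trig_poly (trig_cnj l) s * trig_poly l s"
    "tp_op l'' x = tp_op (trig_cnj l) (tp_op l x)"
    using tp_op_tp_op [OF x] by blast
  have "of_real ((norm (tp_op l x))\<^sup>2) = cinner x (tp_op l'' x)"
    using cinner_tp_op_left [OF x tp_op_in [OF x], of l l] l''(2) by (simp only: cinner_self_of_real [symmetric])
  also have "\<dots> = (\<integral>s. trig_poly l'' s \<partial>\<mu> x)" by (rule cinner_tp_op [OF x])
  also have "\<dots> = (\<integral>s. of_real ((cmod (trig_poly l s))\<^sup>2) \<partial>\<mu> x)"
    unfolding l''(1) [rule_format] trig_poly_cnj by (simp only: complex_norm_square mult.commute)
  also have "\<dots> = of_real (\<integral>s. (cmod (trig_poly l s))\<^sup>2 \<partial>\<mu> x)" 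
    using square_integrable_bounded [OF \<mu>_finite [OF x] bounded_borel_trig]
    by (intro integral_of_real) (simp add: square_integrable_def)
  finally show ?thesis using of_real_eq_iff by blast
qed

lemma norm_tp_op_diff_sq:
  assumes "x \<in> H" shows "(norm (tp_op l x - tp_op l' x))\<^sup>2 = l2_dist_sq (\<mu> x) (trig_poly l) (trig_poly l')"
proof -
  have "tp_op l x - tp_op l' x = tp_op (l @ trig_mult (- 1) 0 l') x"
    using assms by (simp add: tp_op_append tp_op_mult w_0 tp_op_in scaleC.minus_left)
  moreover have "trig_poly l s - trig_poly l' s = trig_poly (l @ trig_mult (- 1) 0 l') s" for s
    by (simp add: trig_poly_append trig_poly_mult)
  ultimately show ?thesis using norm_tp_op_sq [OF assms] by (simp add: l2_dist_sq_def)
qed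

lemma sq_int_trig: "x \<in> H \<Longrightarrow> square_integrable (\<mu> x) (trig_poly l)"
  by (intro square_integrable_bounded \<mu>_finite bounded_borel_trig)

text \<open>Approximation in the measure of a single vector, with \<open>g\<close> merely
  square-integrable there: unlike \<open>approximable\<close> this admits the unbounded identity
  function, which yields the generator.\<close>

definition approx_seq :: "'a \<Rightarrow> (real \<Rightarrow> complex) \<Rightarrow> (nat \<Rightarrow> (complex \<times> real) list) \<Rightarrow> bool" where
  "approx_seq x g l \<longleftrightarrow> square_integrable (\<mu> x) g \<and> (\<lambda>n. l2_dist_sq (\<mu> x) g (trig_poly (l n))) \<longlonglongrightarrow> 0"

text \<open>The functional calculus \<open>fc g x\<close> is $g(A)x$, where \<open>A\<close> is the generator.\<close>

definition fc :: "(real \<Rightarrow> complex) \<Rightarrow> 'a \<Rightarrow> 'a" where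
  "fc g x = lim (\<lambda>n. tp_op ((SOME l. approx_seq x g l) n) x)"

text \<open>Both claims follow from the isometry \<open>norm_tp_op_diff_sq\<close>; the first makes
  \<open>fc\<close> independent of the sequence that \<open>SOME\<close> picks.\<close>

lemma approx_seq_Cauchy:
  assumes x: "x \<in> H" and l: "approx_seq x g l" and l': "approx_seq x g l'"
  shows "(\<lambda>n. norm (tp_op (l n) x - tp_op (l' n) x)) \<longlonglongrightarrow> 0" "convergent (\<lambda>n. tp_op (l n) x)"
proof -
  let ?M = "\<mu> x"
  have g: "square_integrable ?M g" using l by (simp add: approx_seq_def)
  have le: "(norm (tp_op k x - tp_op k' x))\<^sup>2 \<le> 2 * l2_dist_sq ?M g (trig_poly k) + 2 * l2_dist_sq ?M g (trig_poly k')" for k k'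
    unfolding norm_tp_op_diff_sq [OF x]
    using l2_dist_sq_triangle [OF \<mu>_finite [OF x] sq_int_trig [OF x] g sq_int_trig [OF x], of k k']
    by (simp add: l2_dist_sq_commute)
  have "(\<lambda>n. (norm (tp_op (l n) x - tp_op (l' n) x))\<^sup>2) \<longlonglongrightarrow> 0"
  proof (rule tendsto_sandwich [OF _ _ tendsto_const])
    show "\<forall>\<^sub>F n in sequentially. (norm (tp_op (l n) x - tp_op (l' n) x))\<^sup>2
        \<le> 2 * l2_dist_sq ?M g (trig_poly (l n)) + 2 * l2_dist_sq ?M g (trig_poly (l' n))"
      using le by simp
    have "(\<lambda>n. 2 * l2_dist_sq ?M g (trig_poly (l n)) + 2 * l2_dist_sq ?M g (trig_poly (l' n))) \<longlonglongrightarrow> 2 * 0 + 2 * 0"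
      using l l' by (intro tendsto_intros) (auto simp: approx_seq_def)
    then show "(\<lambda>n. 2 * l2_dist_sq ?M g (trig_poly (l n)) + 2 * l2_dist_sq ?M g (trig_poly (l' n))) \<longlonglongrightarrow> 0" by simp
  qed simp
  from tendsto_real_sqrt [OF this]
  show "(\<lambda>n. norm (tp_op (l n) x - tp_op (l' n) x)) \<longlonglongrightarrow> 0" by simp
  have "Cauchy (\<lambda>n. tp_op (l n) x)"
  proof (rule metric_CauchyI)
    fix e :: real assume e: "0 < e"
    have "\<forall>\<^sub>F n in sequentially. l2_dist_sq ?M g (trig_poly (l n)) < e\<^sup>2 / 4"
      using l e by (intro order_tendstoD(2)) (auto simp: approx_seq_def)
    then obtain N where N: "\<And>n. N \<le> n \<Longrightarrow> l2_dist_sq ?M g (trig_poly (l n)) < e\<^sup>2 / 4"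
      by (auto simp: eventually_sequentially)
    have "dist (tp_op (l m) x) (tp_op (l n) x) < e" if "N \<le> m" "N \<le> n" for m n
    proof -
      have "(norm (tp_op (l m) x - tp_op (l n) x))\<^sup>2 < e\<^sup>2"
        using le [of "l m" "l n"] N [OF that(1)] N [OF that(2)] by linarith
      then show ?thesis using e by (simp add: dist_norm power2_less_imp_less)
    qed
    then show "\<exists>N. \<forall>m\<ge>N. \<forall>n\<ge>N. dist (tp_op (l m) x) (tp_op (l n) x) < e" by blast
  qed
  then show "convergent (\<lambda>n. tp_op (l n) x)" by (simp add: Cauchy_convergent_iff)
qed

lemma fc_tendsto:
  assumes x: "x \<in> H" and l: "approx_seq x g l"
  shows "(\<lambda>n. tp_op (l n) x) \<longlonglongrightarrow> fc g x"
proof -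
  define k where "k = (SOME l. approx_seq x g l)"
  have k: "approx_seq x g k" unfolding k_def by (rule someI [where P = "approx_seq x g", OF l])
  have "(\<lambda>n. tp_op (k n) x) \<longlonglongrightarrow> fc g x"
    using approx_seq_Cauchy(2) [OF x k k] by (simp add: fc_def k_def [symmetric] convergent_LIMSEQ_iff)
  moreover have "(\<lambda>n. tp_op (l n) x - tp_op (k n) x) \<longlonglongrightarrow> 0"
    by (rule tendsto_norm_zero_cancel [OF approx_seq_Cauchy(1) [OF x l k]])
  ultimately have "(\<lambda>n. (tp_op (l n) x - tp_op (k n) x) + tp_op (k n) x) \<longlonglongrightarrow> 0 + fc g x" by (intro tendsto_add)
  then show ?thesis by simp
qed

lemma fc_in: "x \<in> H \<Longrightarrow> approx_seq x g l \<Longrightarrow> fc g x \<in> H"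
  by (rule closed_sequentially [OF hilbert_closed [OF H] _ fc_tendsto]) (simp_all add: tp_op_in)

lemma approximable_seq:
  assumes g: "approximable g" and X: "finite X" "X \<subseteq> H"
  shows "\<exists>l. \<forall>x\<in>X. approx_seq x g l"
proof -
  have "\<exists>l. \<forall>M\<in>\<mu> ` X. l2_dist_sq M g (trig_poly l) < 1 / Suc n" for n
    using X \<mu>_finite by (intro approximableD [OF g]) auto
  then obtain l where l: "\<And>n x. x \<in> X \<Longrightarrow> l2_dist_sq (\<mu> x) g (trig_poly (l n)) < 1 / Suc n"
    by (metis imageI)
  have "approx_seq x g l" if x: "x \<in> X" for x
    unfolding approx_seq_def
  proof
    show "square_integrable (\<mu> x) g"
      using x X(2) by (intro square_integrable_bounded \<mu>_finite approximable_bounded [OF g]) auto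
    show "(\<lambda>n. l2_dist_sq (\<mu> x) g (trig_poly (l n))) \<longlonglongrightarrow> 0"
    proof (rule tendsto_sandwich [OF _ _ tendsto_const])
      show "(\<lambda>n. 1 / real (Suc n)) \<longlonglongrightarrow> 0" using LIMSEQ_inverse_real_of_nat by (simp add: inverse_eq_divide)
      show "\<forall>\<^sub>F n in sequentially. l2_dist_sq (\<mu> x) g (trig_poly (l n)) \<le> 1 / real (Suc n)"
        using l [OF x] by (intro always_eventually allI less_imp_le)
    qed (simp add: l2_dist_sq_nonneg)
  qed
  then show ?thesis by blast
qed

lemma approx_seq_trig: "x \<in> H \<Longrightarrow> (\<And>s. g s = trig_poly l s) \<Longrightarrow> approx_seq x g (\<lambda>_. l)"
  using sq_int_trig [of x l] by (simp add: approx_seq_def l2_dist_sq_def square_integrable_def cong: measurable_cong)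

lemma fc_trig: "x \<in> H \<Longrightarrow> (\<And>s. g s = trig_poly l s) \<Longrightarrow> fc g x = tp_op l x"
  using fc_tendsto [OF _ approx_seq_trig, of x g l] by (simp add: LIMSEQ_const_iff)

lemma fc_linear:
  assumes "approximable g" "x \<in> H" "y \<in> H"
  shows fc_add: "fc g (x + y) = fc g x + fc g y" and fc_scaleC: "fc g (a *\<^sub>C x) = a *\<^sub>C fc g x"
proof -
  have xy: "x + y \<in> H" "a *\<^sub>C x \<in> H" using assms cH by (auto intro: csubspace_add csubspace_scaleC)
  obtain l where l: "approx_seq x g l" "approx_seq y g l" "approx_seq (x + y) g l" "approx_seq (a *\<^sub>C x) g l"
    using approximable_seq [OF assms(1), of "{x, y, x + y, a *\<^sub>C x}"] assms xy by auto
  show "fc g (x + y) = fc g x + fc g y"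
  proof (rule LIMSEQ_unique)
    show "(\<lambda>n. tp_op (l n) (x + y)) \<longlonglongrightarrow> fc g (x + y)" by (rule fc_tendsto [OF xy(1) l(3)])
    show "(\<lambda>n. tp_op (l n) (x + y)) \<longlonglongrightarrow> fc g x + fc g y"
      unfolding tp_op_add [OF assms(2,3)] by (intro tendsto_add fc_tendsto assms l)
  qed
  show "fc g (a *\<^sub>C x) = a *\<^sub>C fc g x"
  proof (rule LIMSEQ_unique)
    show "(\<lambda>n. tp_op (l n) (a *\<^sub>C x)) \<longlonglongrightarrow> fc g (a *\<^sub>C x)" by (rule fc_tendsto [OF xy(2) l(4)])
    show "(\<lambda>n. tp_op (l n) (a *\<^sub>C x)) \<longlonglongrightarrow> a *\<^sub>C fc g x"
      unfolding tp_op_scaleC [OF assms(2)] by (intro scaleC.tendsto tendsto_const fc_tendsto assms l)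
  qed
qed

lemma cinner_fc:
  assumes x: "x \<in> H" and l: "approx_seq x g l"
  shows "cinner x (fc g x) = (\<integral>s. g s \<partial>\<mu> x)"
proof (rule LIMSEQ_unique)
  show "(\<lambda>n. cinner x (tp_op (l n) x)) \<longlonglongrightarrow> cinner x (fc g x)"
    by (intro cinner.tendsto tendsto_const fc_tendsto x l)
  show "(\<lambda>n. cinner x (tp_op (l n) x)) \<longlonglongrightarrow> (\<integral>s. g s \<partial>\<mu> x)"
    unfolding cinner_tp_op [OF x] using l
    by (intro l2_null_imp_integral_tendsto \<mu>_finite x sq_int_trig) (auto simp: approx_seq_def)
qed

text \<open>Pass to the limit in \<open>norm_tp_op_sq\<close>. Continuity of the L^2 norm is
  obtained from two integral inequalities with a factor 1 + e, where e is finally sent to 0.\<close>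

lemma norm_fc_sq:
  assumes x: "x \<in> H" and g: "approximable g"
  shows "(norm (fc g x))\<^sup>2 = (\<integral>s. (cmod (g s))\<^sup>2 \<partial>\<mu> x)"
proof -
  note bM = \<mu>_finite [OF x] and bg = approximable_bounded [OF g]
  obtain B where B: "\<And>s. cmod (g s) \<le> B" using bg by (auto simp: bounded_borel_def)
  have B0: "0 \<le> B" using order_trans [OF norm_ge_zero B] .
  obtain l where l: "approx_seq x g l" using approximable_seq [OF g, of "{x}"] x by auto
  define D where "D n = l2_dist_sq (\<mu> x) g (trig_poly (l n))" for n
  have D: "D \<longlonglongrightarrow> 0" using l unfolding D_def approx_seq_def by blast
  have gi: "integrable (\<mu> x) (\<lambda>s. (cmod (g s))\<^sup>2)" using l by (simp add: approx_seq_def square_integrable_def)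
  have ti: "integrable (\<mu> x) (\<lambda>s. (cmod (trig_poly (l n) s))\<^sup>2)" for n
    using sq_int_trig [OF x] by (simp add: square_integrable_def)
  have di: "integrable (\<mu> x) (\<lambda>s. (cmod (g s - trig_poly (l n) s))\<^sup>2)" for n
    by (rule integrable_sq_diff [OF bM bg bounded_borel_trig])
  have g1: "(\<integral>s. (cmod (g s))\<^sup>2 \<partial>\<mu> x) \<le> (1 + e) * (norm (tp_op (l n) x))\<^sup>2 + (1 + 1 / e) * D n"
    and g2: "(norm (tp_op (l n) x))\<^sup>2 \<le> (1 + e) * (\<integral>s. (cmod (g s))\<^sup>2 \<partial>\<mu> x) + (1 + 1 / e) * D n"
    if e: "0 < e" for e n
  proof -
    \<comment> \<open>Young's inequality with weight e: the mixed term of the square is split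
      between the two squares, and the large factor 1 + 1/e falls on the part that tends to
      0.\<close>
    have *: "(cmod a)\<^sup>2 \<le> (1 + e) * (cmod b)\<^sup>2 + (1 + 1 / e) * (cmod (a - b))\<^sup>2" for a b
    proof -
      have "cmod a \<le> cmod b + cmod (a - b)" using norm_triangle_sub [of a b] by simp
      then have "(cmod a)\<^sup>2 \<le> (cmod b + cmod (a - b))\<^sup>2" by (intro power_mono) auto
      also have "\<dots> = (cmod b)\<^sup>2 + (cmod (a - b))\<^sup>2 + 2 * (cmod b * cmod (a - b))" by (simp add: power2_sum)
      also have "2 * (cmod b * cmod (a - b)) \<le> e * (cmod b)\<^sup>2 + (1 / e) * (cmod (a - b))\<^sup>2"
      proof -
        have "0 \<le> (e * cmod b - cmod (a - b))\<^sup>2 / e" using e by simp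
        then show ?thesis using e by (simp add: power2_eq_square field_simps)
      qed
      finally show ?thesis by (simp add: algebra_simps)
    qed
    have "(\<integral>s. (cmod (g s))\<^sup>2 \<partial>\<mu> x) \<le> (\<integral>s. (1 + e) * (cmod (trig_poly (l n) s))\<^sup>2 + (1 + 1 / e) * (cmod (g s - trig_poly (l n) s))\<^sup>2 \<partial>\<mu> x)"
      using gi ti di * by (intro integral_mono) auto
    then show "(\<integral>s. (cmod (g s))\<^sup>2 \<partial>\<mu> x) \<le> (1 + e) * (norm (tp_op (l n) x))\<^sup>2 + (1 + 1 / e) * D n"
      using ti di by (simp add: norm_tp_op_sq [OF x] D_def l2_dist_sq_def)
    have "(\<integral>s. (cmod (trig_poly (l n) s))\<^sup>2 \<partial>\<mu> x) \<le> (\<integral>s. (1 + e) * (cmod (g s))\<^sup>2 + (1 + 1 / e) * (cmod (g s - trig_poly (l n) s))\<^sup>2 \<partial>\<mu> x)"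
      using gi ti di * [of "trig_poly (l n) s" "g s" for s] by (intro integral_mono) (auto simp: norm_minus_commute)
    then show "(norm (tp_op (l n) x))\<^sup>2 \<le> (1 + e) * (\<integral>s. (cmod (g s))\<^sup>2 \<partial>\<mu> x) + (1 + 1 / e) * D n"
      using gi di by (simp add: norm_tp_op_sq [OF x] D_def l2_dist_sq_def)
  qed
  have N: "(\<lambda>n. (norm (tp_op (l n) x))\<^sup>2) \<longlonglongrightarrow> (norm (fc g x))\<^sup>2" by (intro tendsto_intros fc_tendsto x l)
  let ?G = "\<integral>s. (cmod (g s))\<^sup>2 \<partial>\<mu> x"
  have l1: "?G \<le> (1 + e) * (norm (fc g x))\<^sup>2" and l2: "(norm (fc g x))\<^sup>2 \<le> (1 + e) * ?G" if e: "0 < e" for e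
  proof -
    have "(\<lambda>n. (1 + e) * (norm (tp_op (l n) x))\<^sup>2 + (1 + 1 / e) * D n) \<longlonglongrightarrow> (1 + e) * (norm (fc g x))\<^sup>2 + (1 + 1 / e) * 0"
      by (intro tendsto_intros N D)
    then show "?G \<le> (1 + e) * (norm (fc g x))\<^sup>2" using g1 [OF e] by (intro LIMSEQ_le_const) auto
    have "(\<lambda>n. (1 + e) * ?G + (1 + 1 / e) * D n) \<longlonglongrightarrow> (1 + e) * ?G + (1 + 1 / e) * 0"
      by (intro tendsto_intros D)
    then show "(norm (fc g x))\<^sup>2 \<le> (1 + e) * ?G" using LIMSEQ_le [OF N] g2 [OF e] by auto
  qed
  have le: "a \<le> b" if "\<And>e. 0 < e \<Longrightarrow> a \<le> (1 + e) * b" for a b :: real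
  proof (rule tendsto_lowerbound)
    have "(\<lambda>n. (1 + inverse (real (Suc n))) * b) \<longlonglongrightarrow> (1 + 0) * b"
      by (intro tendsto_intros LIMSEQ_inverse_real_of_nat)
    then show "(\<lambda>n. (1 + inverse (real (Suc n))) * b) \<longlonglongrightarrow> b" by simp
    show "\<forall>\<^sub>F n in sequentially. a \<le> (1 + inverse (real (Suc n))) * b" using that by (intro always_eventually allI) simp
  qed simp
  show ?thesis using le [OF l1] le [OF l2] by linarith
qed

lemma fc_diff:
  assumes g: "approximable g" and h: "approximable h" and x: "x \<in> H"
  shows "fc (\<lambda>s. g s - h s) x = fc g x - fc h x"
proof -
  obtain l where l: "approx_seq x g l" using approximable_seq [OF g, of "{x}"] x by auto
  obtain k where k: "approx_seq x h k" using approximable_seq [OF h, of "{x}"] x by auto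
  let ?m = "\<lambda>n. l n @ trig_mult (- 1) 0 (k n)"
  note bM = \<mu>_finite [OF x] and bg = approximable_bounded [OF g] and bh = approximable_bounded [OF h]
  have tm: "trig_poly (?m n) s = trig_poly (l n) s - trig_poly (k n) s" for n s
    by (simp add: trig_poly_append trig_poly_mult)
  have "approx_seq x (\<lambda>s. g s - h s) ?m"
    unfolding approx_seq_def
  proof
    show "square_integrable (\<mu> x) (\<lambda>s. g s - h s)"
      by (intro square_integrable_bounded bM bounded_borel_diff bg bh)
    show "(\<lambda>n. l2_dist_sq (\<mu> x) (\<lambda>s. g s - h s) (trig_poly (?m n))) \<longlonglongrightarrow> 0"
    proof (rule tendsto_sandwich [OF _ _ tendsto_const])
      have "(\<lambda>n. 2 * l2_dist_sq (\<mu> x) g (trig_poly (l n)) + 2 * l2_dist_sq (\<mu> x) h (trig_poly (k n))) \<longlonglongrightarrow> 2 * 0 + 2 * 0"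
        using l k by (intro tendsto_intros) (auto simp: approx_seq_def)
      then show "(\<lambda>n. 2 * l2_dist_sq (\<mu> x) g (trig_poly (l n)) + 2 * l2_dist_sq (\<mu> x) h (trig_poly (k n))) \<longlonglongrightarrow> 0" by simp
      have "l2_dist_sq (\<mu> x) (\<lambda>s. g s - h s) (trig_poly (?m n))
          \<le> (\<integral>s. 2 * (cmod (g s - trig_poly (l n) s))\<^sup>2 + 2 * (cmod (h s - trig_poly (k n) s))\<^sup>2 \<partial>\<mu> x)" for n
        unfolding l2_dist_sq_def
      proof (rule integral_mono)
        show "(cmod (g s - h s - trig_poly (?m n) s))\<^sup>2
            \<le> 2 * (cmod (g s - trig_poly (l n) s))\<^sup>2 + 2 * (cmod (h s - trig_poly (k n) s))\<^sup>2" for s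
          using cmod_add_sq_le [of "g s - trig_poly (l n) s" "trig_poly (k n) s - h s"]
          by (simp add: tm norm_minus_commute algebra_simps)
      qed (auto intro!: integrable_add integrable_mult_right integrable_sq_diff bM bg bh bounded_borel_trig bounded_borel_diff)
      then show "\<forall>\<^sub>F n in sequentially. l2_dist_sq (\<mu> x) (\<lambda>s. g s - h s) (trig_poly (?m n))
          \<le> 2 * l2_dist_sq (\<mu> x) g (trig_poly (l n)) + 2 * l2_dist_sq (\<mu> x) h (trig_poly (k n))"
        using integrable_sq_diff [OF bM bg bounded_borel_trig] integrable_sq_diff [OF bM bh bounded_borel_trig]
        by (simp add: l2_dist_sq_def)
    qed (simp add: l2_dist_sq_nonneg)
  qed
  from fc_tendsto [OF x this] have "(\<lambda>n. tp_op (l n) x - tp_op (k n) x) \<longlonglongrightarrow> fc (\<lambda>s. g s - h s) x"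
    using x by (simp add: tp_op_append tp_op_mult w_0 tp_op_in scaleC.minus_left)
  moreover have "(\<lambda>n. tp_op (l n) x - tp_op (k n) x) \<longlonglongrightarrow> fc g x - fc h x"
    by (intro tendsto_diff fc_tendsto x l k)
  ultimately show ?thesis by (rule LIMSEQ_unique)
qed

text \<open>As \<open>g\<close> is real, conjugating an approximating sequence does not change its
  distance from \<open>g\<close>, while it replaces the operators by their adjoints.\<close>

lemma fc_selfadjoint:
  assumes g: "approximable g" and real: "\<And>s. cnj (g s) = g s" and x: "x \<in> H" and y: "y \<in> H"
  shows "cinner (fc g x) y = cinner x (fc g y)"
proof -
  obtain l where l: "approx_seq x g l" "approx_seq y g l" using approximable_seq [OF g, of "{x, y}"] x y by auto
  have "cmod (g s - trig_poly (trig_cnj (l n)) s) = cmod (g s - trig_poly (l n) s)" for s n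
  proof -
    have "g s - trig_poly (trig_cnj (l n)) s = cnj (g s - trig_poly (l n) s)" by (simp add: trig_poly_cnj real)
    then show ?thesis by (simp only: complex_mod_cnj)
  qed
  then have "approx_seq y g (\<lambda>n. trig_cnj (l n))"
    using l(2) by (simp add: approx_seq_def l2_dist_sq_def)
  then have "(\<lambda>n. cinner x (tp_op (trig_cnj (l n)) y)) \<longlonglongrightarrow> cinner x (fc g y)"
    by (intro cinner.tendsto tendsto_const fc_tendsto y)
  moreover have "(\<lambda>n. cinner (tp_op (l n) x) y) \<longlonglongrightarrow> cinner (fc g x) y"
    by (intro cinner.tendsto tendsto_const fc_tendsto x l)
  ultimately show ?thesis unfolding cinner_tp_op_left [OF x y] by (intro LIMSEQ_unique)
qed

text \<open>Multiplying the approximating polynomials by the unimodular function exp(its) keeps the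
  distances and applies \<open>w t\<close> to their operators.\<close>

lemma w_fc:
  assumes g: "approximable g" and x: "x \<in> H"
  shows "w t (fc g x) = fc (\<lambda>s. iexp (t * s) * g s) x"
proof -
  obtain l where l: "approx_seq x g l" using approximable_seq [OF g, of "{x}"] x by auto
  have k: "bounded_borel (\<lambda>s. iexp (t * s))"
    by (rule approximable_bounded, rule approximable_trigI [of "[(1, t)]"]) simp
  have "approx_seq x (\<lambda>s. iexp (t * s) * g s) (\<lambda>n. trig_mult 1 t (l n))"
    unfolding approx_seq_def
  proof
    show "square_integrable (\<mu> x) (\<lambda>s. iexp (t * s) * g s)"
      by (intro square_integrable_bounded \<mu>_finite x bounded_borel_mult k approximable_bounded g)
    have "l2_dist_sq (\<mu> x) (\<lambda>s. iexp (t * s) * g s) (trig_poly (trig_mult 1 t (l n))) = l2_dist_sq (\<mu> x) g (trig_poly (l n))" for n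
    proof -
      have "cmod (iexp (t * s) * g s - trig_poly (trig_mult 1 t (l n)) s) = cmod (g s - trig_poly (l n) s)" for s
      proof -
        have "iexp (t * s) * g s - trig_poly (trig_mult 1 t (l n)) s = iexp (t * s) * (g s - trig_poly (l n) s)"
          by (simp add: trig_poly_mult right_diff_distrib)
        then show ?thesis by (simp only: norm_mult norm_exp_i_times mult_1)
      qed
      then show ?thesis by (simp add: l2_dist_sq_def)
    qed
    then show "(\<lambda>n. l2_dist_sq (\<mu> x) (\<lambda>s. iexp (t * s) * g s) (trig_poly (trig_mult 1 t (l n)))) \<longlonglongrightarrow> 0"
      using l by (simp add: approx_seq_def)
  qed
  from fc_tendsto [OF x this] have 1: "(\<lambda>n. w t (tp_op (l n) x)) \<longlonglongrightarrow> fc (\<lambda>s. iexp (t * s) * g s) x"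
    using x by (simp add: tp_op_mult)
  have fH: "fc g x \<in> H" by (rule fc_in [OF x l])
  have "(\<lambda>n. w t (tp_op (l n) x)) \<longlonglongrightarrow> w t (fc g x)"
  proof (rule tendsto_dist_iff [THEN iffD2])
    have "dist (w t (tp_op (l n) x)) (w t (fc g x)) = dist (tp_op (l n) x) (fc g x)" for n
      by (rule isometry_on_dist [OF isometric_actionD(1) [OF act zero_less_one] cH tp_op_in [OF x] fH])
    then show "(\<lambda>n. dist (w t (tp_op (l n) x)) (w t (fc g x))) \<longlonglongrightarrow> 0"
      using tendsto_dist_iff [THEN iffD1, OF fc_tendsto [OF x l]] by simp
  qed
  with 1 show ?thesis by (metis LIMSEQ_unique)
qed

end

context one_param_group
begin

subsection \<open>The spectral measure\<close>

lemma fc_in_H: "x \<in> H \<Longrightarrow> approximable g \<Longrightarrow> fc g x \<in> H"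
  using approximable_seq [of g "{x}"] fc_in by auto

definition spec :: "real set \<Rightarrow> 'a \<Rightarrow> 'a" where
  "spec S = (\<lambda>x\<in>H. fc (\<lambda>s. of_real (indicator S s)) x)"

lemma spec_in: "x \<in> H \<Longrightarrow> S \<in> sets borel \<Longrightarrow> spec S x \<in> H"
  by (simp add: spec_def fc_in_H approximable_indicator)

lemma space_\<mu>: "x \<in> H \<Longrightarrow> space (\<mu> x) = UNIV" and sets_\<mu>: "x \<in> H \<Longrightarrow> sets (\<mu> x) = sets borel"
  using \<mu>_finite [of x] sets_eq_imp_space_eq [of "\<mu> x" borel] by (auto simp: borel_finite_def)

text \<open>An indicator equals its square. That this value agrees with the quadratic form in
  \<open>cinner_spec\<close> is what makes \<open>spec S\<close> a projection.\<close>

lemma norm_spec_sq: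
  assumes "x \<in> H" "S \<in> sets borel" shows "(norm (spec S x))\<^sup>2 = measure (\<mu> x) S"
proof -
  have "(norm (spec S x))\<^sup>2 = (\<integral>s. (cmod (of_real (indicator S s)))\<^sup>2 \<partial>\<mu> x)"
    using norm_fc_sq [OF assms(1) approximable_indicator [OF assms(2)]] assms by (simp add: spec_def)
  also have "\<dots> = (\<integral>s. indicator S s \<partial>\<mu> x)"
    by (rule Bochner_Integration.integral_cong) (auto simp: indicator_def)
  also have "\<dots> = measure (\<mu> x) S" using assms by (simp add: space_\<mu>)
  finally show ?thesis .
qed

lemma cinner_spec:
  assumes "x \<in> H" "S \<in> sets borel" shows "cinner x (spec S x) = of_real (measure (\<mu> x) S)"
proof -
  obtain l where l: "approx_seq x (\<lambda>s. of_real (indicator S s)) l"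
    using approximable_seq [OF approximable_indicator [OF assms(2)], of "{x}"] assms(1) by auto
  have "cinner x (spec S x) = (\<integral>s. of_real (indicator S s) \<partial>\<mu> x)"
    using cinner_fc [OF assms(1) l] assms by (simp add: spec_def)
  also have "\<dots> = of_real (\<integral>s. indicator S s \<partial>\<mu> x)"
    by (rule integral_of_real)
      (rule borel_finite_integrable [OF \<mu>_finite [OF assms(1)], of _ 1], use assms in \<open>auto simp: indicator_def\<close>)
  also have "\<dots> = of_real (measure (\<mu> x) S)" using assms by (simp add: space_\<mu>)
  finally show ?thesis .
qed

lemma norm_spec_le: assumes "x \<in> H" "S \<in> sets borel" shows "norm (spec S x) \<le> norm x"
proof (cases "spec S x = 0")
  case False
  have "(norm (spec S x))\<^sup>2 = Re (cinner x (spec S x))"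
    using norm_spec_sq [OF assms] cinner_spec [OF assms] by simp
  also have "\<dots> \<le> norm x * norm (spec S x)"
    using complex_Re_le_cmod cmod_cinner_le order_trans by blast
  finally show ?thesis using False by (simp add: power2_eq_square)
qed simp

lemma spec_selfadjoint:
  assumes "x \<in> H" "y \<in> H" "S \<in> sets borel" shows "cinner (spec S x) y = cinner x (spec S y)"
  using fc_selfadjoint [OF approximable_indicator [OF assms(3)] _ assms(1,2)] assms by (simp add: spec_def)

lemma spec_linear: "S \<in> sets borel \<Longrightarrow> clinear_on H (spec S)"
  unfolding clinear_on_def spec_def
  by (auto simp: fc_add fc_scaleC approximable_indicator csubspace_add [OF cH] csubspace_scaleC [OF cH])

text \<open>The symmetric operator $N = E^2 - E$ vanishes because its quadratic form does.\<close>

lemma spec_idem: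
  assumes x: "x \<in> H" and S: "S \<in> sets borel" shows "spec S (spec S x) = spec S x"
proof -
  define N where "N y = spec S (spec S y) - spec S y" for y
  note lin = spec_linear [OF S]
  have NH: "N y \<in> H" if "y \<in> H" for y using that S by (simp add: N_def spec_in csubspace_diff [OF cH])
  have sym: "cinner (N y) z = cinner y (N z)" if "y \<in> H" "z \<in> H" for y z
    using that S by (simp add: N_def cinner.diff_left cinner.diff_right spec_selfadjoint spec_in)
  have form: "cinner y (N y) = 0" if y: "y \<in> H" for y
  proof -
    have "cinner y (spec S (spec S y)) = of_real ((norm (spec S y))\<^sup>2)"
      using spec_selfadjoint [OF y spec_in [OF y S] S] by (simp only: cinner_self_of_real [symmetric])
    then show ?thesis using norm_spec_sq [OF y S] cinner_spec [OF y S] by (simp add: N_def cinner.diff_right)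
  qed
  let ?z = "N x"
  have z: "?z \<in> H" by (rule NH [OF x])
  have add: "N (x + ?z) = N x + N ?z"
    using x z S by (simp add: N_def clinear_on_add [OF lin] spec_in)
  have "0 = cinner (x + ?z) (N (x + ?z))" using form csubspace_add [OF cH x z] by simp
  also have "\<dots> = cinner x (N ?z) + cinner ?z ?z"
    unfolding add cinner.add_left cinner.add_right using form [OF x] form [OF z] by simp
  also have "\<dots> = 2 * of_real ((norm ?z)\<^sup>2)"
    using sym [OF x z] by (simp add: cinner_self_of_real)
  finally show ?thesis by (simp add: N_def)
qed

lemma spec_UNIV: "x \<in> H \<Longrightarrow> spec UNIV x = x"
  using fc_trig [of x "\<lambda>s. of_real (indicator UNIV s)" "[(1, 0)]"] by (simp add: spec_def w_0 scaleC_one)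

lemma spec_diff:
  assumes "x \<in> H" "A \<in> sets borel" "B \<in> sets borel" "A \<subseteq> B"
  shows "spec (B - A) x = spec B x - spec A x"
proof -
  have "(of_real (indicator (B - A) s) :: complex) = of_real (indicator B s) - of_real (indicator A s)" for s
    using assms(4) by (auto simp: indicator_def)
  then show ?thesis
    using fc_diff [OF approximable_indicator [OF assms(3)] approximable_indicator [OF assms(2)] assms(1)] assms(1)
    by (simp add: spec_def)
qed

text \<open>The squared norm of the remainder is the measure of the part of the union not yet
  covered, so strong convergence is continuity of \<open>\<mu> x\<close> from below.\<close>

lemma spec_incseq:
  assumes x: "x \<in> H" and F: "\<And>n :: nat. F n \<in> sets borel" "incseq F"
  shows "(\<lambda>n. spec (F n) x) \<longlonglongrightarrow> spec (\<Union>n. F n) x"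
proof -
  interpret finite_measure "\<mu> x" using \<mu>_finite [OF x] by (simp add: borel_finite_def)
  let ?U = "\<Union>n. F n"
  have U: "?U \<in> sets borel" using F by auto
  have "(norm (spec ?U x - spec (F n) x))\<^sup>2 = measure (\<mu> x) ?U - measure (\<mu> x) (F n)" for n
  proof -
    have "spec ?U x - spec (F n) x = spec (?U - F n) x" using spec_diff [OF x F(1) U UN_upper [OF UNIV_I]] by simp
    then have "(norm (spec ?U x - spec (F n) x))\<^sup>2 = measure (\<mu> x) (?U - F n)"
      using norm_spec_sq [OF x] U F by simp
    also have "\<dots> = measure (\<mu> x) ?U - measure (\<mu> x) (F n)"
      by (rule finite_measure_Diff) (use U F x in \<open>auto simp: sets_\<mu>\<close>)
    finally show ?thesis .
  qed
  moreover have "(\<lambda>n. measure (\<mu> x) (F n)) \<longlonglongrightarrow> measure (\<mu> x) ?U"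
    by (rule finite_Lim_measure_incseq) (use F x in \<open>auto simp: sets_\<mu>\<close>)
  then have "(\<lambda>n. measure (\<mu> x) ?U - measure (\<mu> x) (F n)) \<longlonglongrightarrow> measure (\<mu> x) ?U - measure (\<mu> x) ?U"
    by (intro tendsto_diff tendsto_const)
  ultimately have "(\<lambda>n. (norm (spec ?U x - spec (F n) x))\<^sup>2) \<longlonglongrightarrow> 0" by simp
  from tendsto_real_sqrt [OF this] have "(\<lambda>n. norm (spec ?U x - spec (F n) x)) \<longlonglongrightarrow> 0" by simp
  then have "(\<lambda>n. spec ?U x - (spec ?U x - spec (F n) x)) \<longlonglongrightarrow> spec ?U x - 0"
    by (intro tendsto_diff tendsto_const tendsto_norm_zero_cancel [of "\<lambda>n. spec ?U x - spec (F n) x"])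
  then show ?thesis by simp
qed

lemma spec_sums:
  assumes x: "x \<in> H" and F: "\<And>n :: nat. F n \<in> sets borel" "disjoint_family F"
  shows "(\<lambda>n. spec (F n) x) sums spec (\<Union>n. F n) x"
proof -
  let ?G = "\<lambda>n. \<Union>i<n. F i"
  have G: "?G n \<in> sets borel" for n using F by auto
  have "spec {} x = 0" using spec_diff [OF x, of UNIV UNIV] by simp
  then have "(\<Sum>i<n. spec (F i) x) = spec (?G n) x" for n
  proof (induction n)
    case (Suc n)
    have "?G (Suc n) - ?G n = F n"
      using F(2) by (auto simp: disjoint_family_on_def lessThan_Suc) (metis UNIV_I disjoint_iff less_irrefl)
    then have "spec (F n) x = spec (?G (Suc n)) x - spec (?G n) x"
      using spec_diff [OF x G [of n] G [of "Suc n"]] by (simp add: lessThan_Suc subset_insertI)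
    then show ?case using Suc by simp
  qed simp
  moreover have "(\<lambda>n. spec (?G n) x) \<longlonglongrightarrow> spec (\<Union>n. ?G n) x"
    by (rule spec_incseq [OF x G]) (intro monoI UN_mono, auto)
  moreover have "(\<Union>n. ?G n) = (\<Union>n. F n)" by blast
  ultimately show ?thesis by (simp add: sums_def)
qed

lemma spec_pvm: "projection_valued_measure H spec"
  unfolding projection_valued_measure_def
proof (intro conjI ballI allI impI)
  fix S :: "real set" assume S: "S \<in> sets borel"
  have "spec S \<in> H \<rightarrow>\<^sub>E H" using spec_in [OF _ S] by (auto simp: spec_def)
  moreover have "\<exists>c. \<forall>x\<in>H. norm (spec S x) \<le> c * norm x" using norm_spec_le [OF _ S] by (intro exI [of _ 1]) simp
  ultimately show "spec S \<in> selfadjoint_ops H"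
    using spec_selfadjoint S by (simp add: selfadjoint_ops_def bounded_ops_def adjoint_pair_def spec_linear)
  show "compose H (spec S) (spec S) = spec S"
  proof
    fix x
    show "compose H (spec S) (spec S) x = spec S x"
      using spec_idem [OF _ S, of x] by (cases "x \<in> H") (simp_all add: compose_def, simp add: spec_def)
  qed
next
  show "spec UNIV = (\<lambda>x\<in>H. x)"
  proof
    fix x show "spec UNIV x = (\<lambda>x\<in>H. x) x"
      using spec_UNIV [of x] by (cases "x \<in> H") (simp_all add: spec_def)
  qed
next
  fix F :: "nat \<Rightarrow> real set" and x
  assume "range F \<subseteq> sets borel \<and> disjoint_family F" "x \<in> H"
  then show "(\<lambda>n. spec (F n) x) sums spec (\<Union>n. F n) x" by (intro spec_sums) auto
qed

lemma vector_measure_spec: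
  assumes x: "x \<in> H" shows "vector_measure spec x = \<mu> x"
proof -
  interpret finite_measure "\<mu> x" using \<mu>_finite [OF x] by (simp add: borel_finite_def)
  have "measure_of UNIV (sets borel) (\<lambda>S. ennreal (Re (cinner x (spec S x)))) = measure_of UNIV (sets borel) (emeasure (\<mu> x))"
  proof (rule measure_of_eq)
    fix S :: "real set" assume "S \<in> sigma_sets UNIV (sets borel)"
    then have "S \<in> sets borel" using sets.sigma_sets_eq [of "borel :: real measure"] by simp
    then show "ennreal (Re (cinner x (spec S x))) = emeasure (\<mu> x) S"
      by (simp add: cinner_spec [OF x] emeasure_eq_measure)
  qed simp
  also have "\<dots> = \<mu> x"
    using measure_of_of_measure [of "\<mu> x"] by (simp add: space_\<mu> [OF x] sets_\<mu> [OF x])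
  finally show ?thesis by (simp add: vector_measure_def)
qed

lemma spectral_integral_w: "is_spectral_integral H spec (\<lambda>s. exp (\<i> * complex_of_real (t * s))) H (w t)"
  unfolding is_spectral_integral_def
proof (intro conjI ballI)
  have "integrable (\<mu> x) (\<lambda>s. (cmod (iexp (t * s)))\<^sup>2)" if "x \<in> H" for x
    by (rule borel_finite_integrable [OF \<mu>_finite [OF that], of _ 1]) (simp_all only: norm_exp_i_times, simp_all)
  then show "H = {x \<in> H. integrable (vector_measure spec x) (\<lambda>s. (cmod (iexp (t * s)))\<^sup>2)}"
    by (auto simp only: vector_measure_spec)
  show "w t ` H \<subseteq> H" using w_in by auto
  show "clinear_on H (w t)" by (rule w_lin)
  show "cinner x (w t x) = (\<integral>s. iexp (t * s) \<partial>vector_measure spec x)" if "x \<in> H" for x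
    using that \<mu>_char by (simp only: vector_measure_spec)
qed

subsection \<open>The generator\<close>

text \<open>Lipschitz continuity at 0 instead of differentiability, being an inequality, is stable
  under perturbation of the group. It amounts to a finite second moment of
  \<open>\<mu> x\<close>.\<close>

definition gen_dom :: "'a set" where
  "gen_dom = {x\<in>H. \<exists>C. \<forall>\<^sub>F t in nhds 0. norm (w t x - x) \<le> C * \<bar>t\<bar>}"

text \<open>The function of the spectral variable that corresponds to the difference quotient (w(t)
  x - x) / (i t); it tends to \<open>s\<close> as \<open>t\<close> tends to 0.\<close>

definition diff_quot :: "real \<Rightarrow> real \<Rightarrow> complex" where
  "diff_quot t s = (iexp (t * s) - 1) / (\<i> * of_real t)"

definition quot_list :: "real \<Rightarrow> (complex \<times> real) list" where
  "quot_list t = [(1 / (\<i> * of_real t), t), (- 1 / (\<i> * of_real t), 0)]"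

lemma trig_poly_quot: "trig_poly (quot_list t) s = diff_quot t s"
  by (simp add: quot_list_def diff_quot_def diff_divide_distrib)

lemma tp_op_quot:
  assumes "x \<in> H" shows "tp_op (quot_list t) x = (1 / (\<i> * of_real t)) *\<^sub>C (w t x - x)"
proof -
  have "(- 1 / (\<i> * of_real t)) *\<^sub>C x = - ((1 / (\<i> * of_real t)) *\<^sub>C x)"
    unfolding minus_divide_left [symmetric] by (rule scaleC.minus_left)
  then show ?thesis using assms by (simp add: quot_list_def w_0 scaleC.diff_right)
qed

lemma cmod_iexp_minus_1_le: "cmod (iexp y - 1) \<le> \<bar>y\<bar>"
  using iexp_approx1 [of y 0] by simp

lemma diff_quot_bound: "t \<noteq> 0 \<Longrightarrow> cmod (diff_quot t s) \<le> \<bar>s\<bar>"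
  using cmod_iexp_minus_1_le [of "t * s"]
  by (simp add: diff_quot_def norm_divide norm_mult abs_mult field_simps)

lemma diff_quot_approx:
  assumes t: "t \<noteq> 0" shows "cmod (diff_quot t s - of_real s) \<le> \<bar>t\<bar> * s\<^sup>2"
proof -
  have "diff_quot t s - of_real s = (iexp (t * s) - (1 + \<i> * of_real (t * s))) / (\<i> * of_real t)"
    using t by (simp add: diff_quot_def field_simps)
  moreover have "cmod (iexp (t * s) - (1 + \<i> * of_real (t * s))) \<le> (t * s)\<^sup>2"
  proof -
    have "cmod (iexp (t * s) - (1 + \<i> * of_real (t * s))) \<le> \<bar>t * s\<bar>\<^sup>2 / 2"
      using iexp_approx1 [of "t * s" 1] by (simp add: numeral_2_eq_2)
    moreover have "\<bar>t * s\<bar>\<^sup>2 / 2 \<le> (t * s)\<^sup>2" by simp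
    ultimately show ?thesis by (rule order_trans)
  qed
  ultimately have "cmod (diff_quot t s - of_real s) \<le> (t * s)\<^sup>2 / \<bar>t\<bar>"
    using t by (simp add: norm_divide norm_mult divide_right_mono)
  also have "\<dots> = \<bar>t\<bar> * s\<^sup>2" using t by (simp add: power2_eq_square field_simps)
  finally show ?thesis .
qed

lemma diff_quot_tendsto:
  assumes "\<tau> \<longlonglongrightarrow> 0" "\<And>n :: nat. \<tau> n \<noteq> 0" shows "(\<lambda>n. diff_quot (\<tau> n) s) \<longlonglongrightarrow> of_real s"
proof (rule LIM_zero_cancel, rule Lim_null_comparison)
  show "\<forall>\<^sub>F n in sequentially. norm (diff_quot (\<tau> n) s - of_real s) \<le> \<bar>\<tau> n\<bar> * s\<^sup>2"
    using assms(2) by (intro always_eventually allI diff_quot_approx)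
  show "(\<lambda>n. \<bar>\<tau> n\<bar> * s\<^sup>2) \<longlonglongrightarrow> 0"
    using tendsto_mult [OF tendsto_rabs [OF assms(1)] tendsto_const, of "s\<^sup>2"] by simp
qed

lemma norm_w_diff_sq:
  assumes "x \<in> H" shows "(norm (w t x - x))\<^sup>2 = (\<integral>s. (cmod (iexp (t * s) - 1))\<^sup>2 \<partial>\<mu> x)"
  using norm_tp_op_sq [OF assms, of "[(1, t), (- 1, 0)]"] assms
  by (simp add: w_0 scaleC_one scaleC.minus_left)

lemma norm_quot_sq: "x \<in> H \<Longrightarrow> (norm ((1 / (\<i> * of_real t)) *\<^sub>C (w t x - x)))\<^sup>2 = (\<integral>s. (cmod (diff_quot t s))\<^sup>2 \<partial>\<mu> x)"
  using norm_tp_op_sq [of x "quot_list t"] by (simp add: tp_op_quot trig_poly_quot)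

lemma gen_dom_sub: "gen_dom \<subseteq> H" by (auto simp: gen_dom_def)

lemma null_seq_inverse: "(\<lambda>n. 1 / real (Suc n)) \<longlonglongrightarrow> 0"
  using LIMSEQ_inverse_real_of_nat by (simp add: inverse_eq_divide)

text \<open>Integrate the square of |exp(its) - 1| \<le> |t s|; the Lipschitz constant is the root
  of the second moment.\<close>

lemma square_integrable_imp_gen_dom:
  assumes x: "x \<in> H" and i: "integrable (\<mu> x) (\<lambda>s. (cmod (of_real s))\<^sup>2)"
  shows "x \<in> gen_dom"
proof -
  let ?I = "\<integral>s. (cmod (of_real s))\<^sup>2 \<partial>\<mu> x"
  have I0: "0 \<le> ?I" by simp
  have "norm (w t x - x) \<le> sqrt ?I * \<bar>t\<bar>" for t
  proof (rule power2_le_imp_le)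
    have "(norm (w t x - x))\<^sup>2 \<le> (\<integral>s. t\<^sup>2 * (cmod (of_real s))\<^sup>2 \<partial>\<mu> x)"
      unfolding norm_w_diff_sq [OF x]
    proof (rule integral_mono)
      show "integrable (\<mu> x) (\<lambda>s. (cmod (iexp (t * s) - 1))\<^sup>2)"
        using sq_int_trig [OF x, of "[(1, t), (- 1, 0)]"] by (simp add: square_integrable_def)
      show "integrable (\<mu> x) (\<lambda>s. t\<^sup>2 * (cmod (of_real s))\<^sup>2)" using i by simp
      show "(cmod (iexp (t * s) - 1))\<^sup>2 \<le> t\<^sup>2 * (cmod (of_real s))\<^sup>2" for s
        using power_mono [OF cmod_iexp_minus_1_le [of "t * s"], of 2] by (simp add: power_mult_distrib)
    qed
    also have "\<dots> = t\<^sup>2 * ?I" by (rule integral_mult_right_zero)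
    also have "\<dots> = (sqrt ?I * \<bar>t\<bar>)\<^sup>2" using I0 by (simp only: power_mult_distrib real_sqrt_pow2 power2_abs mult.commute)
    finally show "(norm (w t x - x))\<^sup>2 \<le> (sqrt ?I * \<bar>t\<bar>)\<^sup>2" .
    show "0 \<le> sqrt ?I * \<bar>t\<bar>" using I0 by (intro mult_nonneg_nonneg) simp_all
  qed
  then show ?thesis using x unfolding gen_dom_def by (auto intro!: exI [of _ "sqrt ?I"] always_eventually)
qed

text \<open>Fatou: the squared difference quotients tend to s^2 pointwise, and the Lipschitz
  condition bounds their integrals by C^2.\<close>

lemma gen_dom_square_integrable:
  assumes x: "x \<in> gen_dom"
  shows "integrable (\<mu> x) (\<lambda>s. (cmod (of_real s))\<^sup>2)"
proof -
  have xH: "x \<in> H" using x gen_dom_sub by auto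
  obtain C where C: "\<forall>\<^sub>F t in nhds 0. norm (w t x - x) \<le> C * \<bar>t\<bar>" using x by (auto simp: gen_dom_def)
  define \<tau> :: "nat \<Rightarrow> real" where "\<tau> n = 1 / real (Suc n)" for n
  have \<tau>: "\<tau> \<longlonglongrightarrow> 0" "\<tau> n \<noteq> 0" for n using null_seq_inverse by (simp_all add: \<tau>_def [abs_def])
  have ev: "\<forall>\<^sub>F n in sequentially. norm (w (\<tau> n) x - x) \<le> C * \<bar>\<tau> n\<bar>"
    by (rule eventually_compose_filterlim [OF C \<tau>(1)])
  let ?f = "\<lambda>n s. ennreal ((cmod (diff_quot (\<tau> n) s))\<^sup>2)"
  have meas: "(\<lambda>s. (cmod (diff_quot (\<tau> n) s))\<^sup>2) \<in> borel_measurable (\<mu> x)" for n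
    using sq_int_trig [OF xH, of "quot_list (\<tau> n)"] by (simp add: square_integrable_def trig_poly_quot borel_measurable_integrable)
  have int: "integrable (\<mu> x) (\<lambda>s. (cmod (diff_quot (\<tau> n) s))\<^sup>2)" for n
    using sq_int_trig [OF xH, of "quot_list (\<tau> n)"] by (simp add: square_integrable_def trig_poly_quot)
  have lim: "liminf (\<lambda>n. ?f n s) = ennreal ((cmod (of_real s))\<^sup>2)" for s
    by (intro lim_imp_Liminf tendsto_ennrealI tendsto_power tendsto_norm diff_quot_tendsto \<tau>) simp
  have "(\<integral>\<^sup>+s. ennreal ((cmod (of_real s))\<^sup>2) \<partial>\<mu> x) \<le> liminf (\<lambda>n. \<integral>\<^sup>+s. ?f n s \<partial>\<mu> x)"
    unfolding lim [symmetric] by (rule nn_integral_liminf) (use meas in measurable)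
  also have "\<dots> \<le> limsup (\<lambda>n. \<integral>\<^sup>+s. ?f n s \<partial>\<mu> x)" by (rule Liminf_le_Limsup) simp
  also have "\<dots> \<le> ennreal (C\<^sup>2)"
  proof (rule Limsup_bounded, rule eventually_mono [OF ev])
    fix n assume n: "norm (w (\<tau> n) x - x) \<le> C * \<bar>\<tau> n\<bar>"
    have "(\<integral>\<^sup>+s. ?f n s \<partial>\<mu> x) = ennreal (\<integral>s. (cmod (diff_quot (\<tau> n) s))\<^sup>2 \<partial>\<mu> x)"
      by (rule nn_integral_eq_integral [OF int]) simp
    also have "\<dots> = ennreal ((norm ((1 / (\<i> * of_real (\<tau> n))) *\<^sub>C (w (\<tau> n) x - x)))\<^sup>2)"
      by (simp only: norm_quot_sq [OF xH])
    also have "\<dots> \<le> ennreal (C\<^sup>2)"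
    proof (rule ennreal_leI, rule power_mono)
      show "norm ((1 / (\<i> * of_real (\<tau> n))) *\<^sub>C (w (\<tau> n) x - x)) \<le> C"
        using n \<tau>(2) [of n] by (simp add: norm_scaleC norm_divide norm_mult field_simps)
    qed simp
    finally show "(\<integral>\<^sup>+s. ?f n s \<partial>\<mu> x) \<le> ennreal (C\<^sup>2)" .
  qed
  finally have "(\<integral>\<^sup>+s. ennreal ((cmod (of_real s))\<^sup>2) \<partial>\<mu> x) < \<infinity>"
    using ennreal_less_top [of "C\<^sup>2"] by (simp add: order_le_less_trans)
  then show ?thesis
    by (intro integrableI_nonneg borel_finite_measurable [OF \<mu>_finite [OF xH]]) auto
qed

text \<open>Here \<open>of_real\<close> is the identity function of the spectral variable. It is
  unbounded, so \<open>fc_linear\<close> does not cover it and linearity is taken from difference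
  quotients in \<open>gen_linear\<close>.\<close>

definition gen :: "'a \<Rightarrow> 'a" where "gen x = fc of_real x"

text \<open>Dominated convergence with majorant 4 s^2. As the approximants are the difference
  quotients themselves, the generator is at once the derivative of the group at 0.\<close>

lemma approx_seq_gen:
  assumes x: "x \<in> gen_dom" and \<tau>: "\<tau> \<longlonglongrightarrow> 0" "\<And>n :: nat. \<tau> n \<noteq> 0"
  shows "approx_seq x of_real (\<lambda>n. quot_list (\<tau> n))"
  unfolding approx_seq_def
proof
  have xH: "x \<in> H" using x gen_dom_sub by auto
  note sq = gen_dom_square_integrable [OF x]
  show "square_integrable (\<mu> x) of_real" using sq by (simp add: square_integrable_def)
  note m = borel_finite_measurable [OF \<mu>_finite [OF xH]]
  have dq: "diff_quot t \<in> borel_measurable borel" for t unfolding diff_quot_def [abs_def] by measurable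
  have "(\<lambda>n. \<integral>s. (cmod (of_real s - diff_quot (\<tau> n) s))\<^sup>2 \<partial>\<mu> x) \<longlonglongrightarrow> (\<integral>s. 0 \<partial>\<mu> x)"
  proof (rule integral_dominated_convergence)
    show "(\<lambda>s. (cmod (of_real s - diff_quot (\<tau> n) s))\<^sup>2) \<in> borel_measurable (\<mu> x)" for n
      by (rule m) (use dq in measurable)
    show "integrable (\<mu> x) (\<lambda>s. 4 * (cmod (of_real s))\<^sup>2)" using sq by simp
    show "AE s in \<mu> x. (\<lambda>n. (cmod (of_real s - diff_quot (\<tau> n) s))\<^sup>2) \<longlonglongrightarrow> 0"
    proof (intro AE_I2)
      fix s
      have "(\<lambda>n. (cmod (of_real s - diff_quot (\<tau> n) s))\<^sup>2) \<longlonglongrightarrow> (cmod (of_real s - of_real s))\<^sup>2"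
        by (intro tendsto_power tendsto_norm tendsto_diff tendsto_const diff_quot_tendsto \<tau>)
      then show "(\<lambda>n. (cmod (of_real s - diff_quot (\<tau> n) s))\<^sup>2) \<longlonglongrightarrow> 0" by simp
    qed
    show "AE s in \<mu> x. norm ((cmod (of_real s - diff_quot (\<tau> n) s))\<^sup>2) \<le> 4 * (cmod (of_real s))\<^sup>2" for n
    proof (intro AE_I2)
      fix s
      have "cmod (of_real s - diff_quot (\<tau> n) s) \<le> cmod (of_real s) + cmod (diff_quot (\<tau> n) s)" by (rule norm_triangle_ineq4)
      also have "\<dots> \<le> 2 * \<bar>s\<bar>" using diff_quot_bound [OF \<tau>(2), of n s] by simp
      finally have "(cmod (of_real s - diff_quot (\<tau> n) s))\<^sup>2 \<le> (2 * \<bar>s\<bar>)\<^sup>2" by (intro power_mono) auto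
      then show "norm ((cmod (of_real s - diff_quot (\<tau> n) s))\<^sup>2) \<le> 4 * (cmod (of_real s))\<^sup>2"
        by (simp add: power_mult_distrib)
    qed
  qed simp
  then show "(\<lambda>n. l2_dist_sq (\<mu> x) of_real (trig_poly (quot_list (\<tau> n)))) \<longlonglongrightarrow> 0"
    by (simp add: l2_dist_sq_def trig_poly_quot)
qed

lemma gen_tendsto_seq:
  assumes x: "x \<in> gen_dom" and \<tau>: "\<tau> \<longlonglongrightarrow> 0" "\<And>n :: nat. \<tau> n \<noteq> 0"
  shows "(\<lambda>n. (1 / (\<i> * of_real (\<tau> n))) *\<^sub>C (w (\<tau> n) x - x)) \<longlonglongrightarrow> gen x"
  using fc_tendsto [OF _ approx_seq_gen [OF assms]] x gen_dom_sub by (auto simp: gen_def tp_op_quot subset_iff)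

lemma gen_tendsto:
  assumes x: "x \<in> gen_dom"
  shows "((\<lambda>t. (1 / (\<i> * of_real t)) *\<^sub>C (w t x - x)) \<longlongrightarrow> gen x) (at 0)"
  unfolding tendsto_at_iff_sequentially
  using gen_tendsto_seq [OF x] by (auto simp: o_def)

lemma gen_in: "x \<in> gen_dom \<Longrightarrow> gen x \<in> H"
  unfolding gen_def using gen_dom_sub approx_seq_gen [OF _ null_seq_inverse] by (intro fc_in) auto

lemma csubspace_gen_dom: "csubspace gen_dom"
  unfolding csubspace_def
proof (intro conjI ballI allI)
  show "0 \<in> gen_dom" by (simp add: gen_dom_def csubspace_0 [OF cH] clinear_on_0 [OF w_lin cH] exI [of _ 0])
next
  fix x y assume xy: "x \<in> gen_dom" "y \<in> gen_dom"
  then have xyH: "x \<in> H" "y \<in> H" using gen_dom_sub by auto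
  obtain C D where "\<forall>\<^sub>F t in nhds 0. norm (w t x - x) \<le> C * \<bar>t\<bar>" "\<forall>\<^sub>F t in nhds 0. norm (w t y - y) \<le> D * \<bar>t\<bar>"
    using xy by (auto simp: gen_dom_def)
  then have "\<forall>\<^sub>F t in nhds 0. norm (w t (x + y) - (x + y)) \<le> (C + D) * \<bar>t\<bar>"
  proof eventually_elim
    case (elim t)
    have "w t (x + y) - (x + y) = (w t x - x) + (w t y - y)" by (simp add: clinear_on_add [OF w_lin xyH])
    also have "norm \<dots> \<le> C * \<bar>t\<bar> + D * \<bar>t\<bar>" by (rule norm_triangle_mono [OF elim])
    finally show ?case by (simp add: distrib_right)
  qed
  then show "x + y \<in> gen_dom" using xyH csubspace_add [OF cH] unfolding gen_dom_def by blast
next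
  fix a x assume x: "x \<in> gen_dom"
  then have xH: "x \<in> H" using gen_dom_sub by auto
  obtain C where "\<forall>\<^sub>F t in nhds 0. norm (w t x - x) \<le> C * \<bar>t\<bar>" using x by (auto simp: gen_dom_def)
  then have "\<forall>\<^sub>F t in nhds 0. norm (w t (a *\<^sub>C x) - a *\<^sub>C x) \<le> (cmod a * C) * \<bar>t\<bar>"
  proof eventually_elim
    case (elim t)
    have "w t (a *\<^sub>C x) - a *\<^sub>C x = a *\<^sub>C (w t x - x)" by (simp add: clinear_on_scaleC [OF w_lin xH] scaleC.diff_right)
    then show ?case using mult_left_mono [OF elim norm_ge_zero [of a]] by (simp add: norm_scaleC mult.assoc)
  qed
  then show "a *\<^sub>C x \<in> gen_dom" using xH csubspace_scaleC [OF cH] unfolding gen_dom_def by blast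
qed

lemma gen_linear: "clinear_on gen_dom gen"
  unfolding clinear_on_def
proof (intro conjI ballI allI)
  let ?q = "\<lambda>x t. (1 / (\<i> * complex_of_real t)) *\<^sub>C (w t x - x)"
  show "gen (x + y) = gen x + gen y" if xy: "x \<in> gen_dom" "y \<in> gen_dom" for x y
  proof (rule tendsto_unique [OF _ gen_tendsto [OF csubspace_add [OF csubspace_gen_dom xy]]])
    have xyH: "x \<in> H" "y \<in> H" using xy gen_dom_sub by auto
    have "?q (x + y) t = ?q x t + ?q y t" for t
      by (simp add: clinear_on_add [OF w_lin xyH] scaleC.add_right [symmetric] algebra_simps)
    then show "(?q (x + y) \<longlongrightarrow> gen x + gen y) (at 0)"
      using tendsto_add [OF gen_tendsto [OF xy(1)] gen_tendsto [OF xy(2)]] by simp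
  qed simp
  show "gen (a *\<^sub>C x) = a *\<^sub>C gen x" if x: "x \<in> gen_dom" for a x
  proof (rule tendsto_unique [OF _ gen_tendsto [OF csubspace_scaleC [OF csubspace_gen_dom x]]])
    have xH: "x \<in> H" using x gen_dom_sub by auto
    have "?q (a *\<^sub>C x) t = a *\<^sub>C ?q x t" for t
      by (simp add: clinear_on_scaleC [OF w_lin xH] scaleC.diff_right scaleC_scaleC mult.commute)
    then show "(?q (a *\<^sub>C x) \<longlongrightarrow> a *\<^sub>C gen x) (at 0)"
      using scaleC.tendsto [OF tendsto_const gen_tendsto [OF x], of a] by simp
  qed simp
qed

text \<open>Spectral truncation to the interval from -n to n converges to the identity, and a
  truncated vector satisfies the Lipschitz condition with constant n times the norm of
  \<open>x\<close>.\<close>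

lemma gen_dom_dense: "H \<subseteq> closure gen_dom"
proof
  fix x assume x: "x \<in> H"
  let ?F = "\<lambda>n :: nat. {- real n..real n}"
  have F: "(\<Union>n. ?F n) = UNIV"
  proof (intro set_eqI iffI UNIV_I)
    fix s :: real
    obtain n :: nat where "\<bar>s\<bar> \<le> n" using real_arch_simple by blast
    then show "s \<in> (\<Union>n. ?F n)" by (intro UN_I [of n]) auto
  qed
  have "(\<lambda>n. spec (?F n) x) \<longlonglongrightarrow> spec (\<Union>n. ?F n) x" by (rule spec_incseq [OF x]) (auto simp: incseq_def)
  then have lim: "(\<lambda>n. spec (?F n) x) \<longlonglongrightarrow> x" using x by (simp only: F spec_UNIV)
  have "spec (?F n) x \<in> gen_dom" for n
  proof -
    let ?g = "\<lambda>s. complex_of_real (indicator (?F n) s)"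
    have g: "approximable ?g" by (rule approximable_indicator) simp
    have "norm (w t (fc ?g x) - fc ?g x) \<le> (n * norm x) * \<bar>t\<bar>" for t
    proof (rule power2_le_imp_le)
      have tg: "approximable (\<lambda>s. iexp (t * s) * ?g s)"
        by (intro approximable_mult g, rule approximable_trigI [of "[(1, t)]"]) simp
      have d: "approximable (\<lambda>s. iexp (t * s) * ?g s - ?g s)" by (intro approximable_diff tg g)
      have "(norm (w t (fc ?g x) - fc ?g x))\<^sup>2 = (norm (fc (\<lambda>s. iexp (t * s) * ?g s - ?g s) x))\<^sup>2"
        by (simp only: w_fc [OF g x] fc_diff [OF tg g x])
      also have "\<dots> = (\<integral>s. (cmod (iexp (t * s) * ?g s - ?g s))\<^sup>2 \<partial>\<mu> x)" by (rule norm_fc_sq [OF x d])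
      also have "\<dots> \<le> (\<integral>s. (real n * \<bar>t\<bar>)\<^sup>2 \<partial>\<mu> x)"
      proof (rule integral_mono)
        show "integrable (\<mu> x) (\<lambda>s. (cmod (iexp (t * s) * ?g s - ?g s))\<^sup>2)"
          using square_integrable_bounded [OF \<mu>_finite [OF x] approximable_bounded [OF d]]
          by (simp add: square_integrable_def)
        show "integrable (\<mu> x) (\<lambda>s. (real n * \<bar>t\<bar>)\<^sup>2)"
          by (rule borel_finite_integrable [OF \<mu>_finite [OF x] _ order_refl]) simp
        show "(cmod (iexp (t * s) * ?g s - ?g s))\<^sup>2 \<le> (real n * \<bar>t\<bar>)\<^sup>2" for s
        proof (cases "s \<in> ?F n")
          case True
          have "\<bar>s\<bar> \<le> real n" using True by auto
          then have n: "\<bar>s\<bar> * \<bar>t\<bar> \<le> real n * \<bar>t\<bar>" by (rule mult_right_mono) simp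
          have "cmod (iexp (t * s) - 1) \<le> \<bar>t * s\<bar>" by (rule cmod_iexp_minus_1_le)
          also have "\<dots> \<le> real n * \<bar>t\<bar>" using n by (simp add: abs_mult mult.commute)
          finally show ?thesis using True by (intro power_mono) auto
        qed simp
      qed
      also have "\<dots> = (real n * \<bar>t\<bar>)\<^sup>2 * measure (\<mu> x) (space (\<mu> x))" by simp
      also have "measure (\<mu> x) (space (\<mu> x)) = (norm x)\<^sup>2"
        using norm_spec_sq [OF x, of UNIV] by (simp add: spec_UNIV [OF x] space_\<mu> [OF x])
      finally show "(norm (w t (fc ?g x) - fc ?g x))\<^sup>2 \<le> ((n * norm x) * \<bar>t\<bar>)\<^sup>2"
        by (simp add: power_mult_distrib mult_ac)
    qed simp
    moreover have "spec (?F n) x = fc ?g x" using x by (simp add: spec_def)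
    ultimately show ?thesis
      using spec_in [OF x, of "?F n"] by (auto simp: gen_dom_def intro!: exI [of _ "n * norm x"] always_eventually)
  qed
  then show "x \<in> closure gen_dom"
    unfolding closure_sequential using lim by (intro exI [of _ "\<lambda>n. spec (?F n) x"] conjI allI)
qed

text \<open>The adjoint of the difference quotient at \<open>t\<close> is the one at
  \<open>- t\<close>; both have the generator as their limit.\<close>

lemma gen_symmetric:
  assumes x: "x \<in> gen_dom" and y: "y \<in> gen_dom"
  shows "cinner (gen x) y = cinner x (gen y)"
proof (rule LIMSEQ_unique)
  have H: "x \<in> H" "y \<in> H" using x y gen_dom_sub by auto
  let ?\<tau> = "\<lambda>n. 1 / real (Suc n)"
  let ?q = "\<lambda>x t. (1 / (\<i> * complex_of_real t)) *\<^sub>C (w t x - x)"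
  have "cinner (?q x t) y = cinner x (?q y (- t))" for t
  proof -
    have "cinner (w t x) y = cinner x (w (- t) y)" using cinner_w [OF H, of t 0] w_0 [OF H(2)] by simp
    then have "cinner (w t x - x) y = cinner x (w (- t) y - y)" by (simp add: cinner.diff_left cinner.diff_right)
    then show ?thesis by (simp add: cinner_scaleC_left cinner_scaleC_right)
  qed
  moreover have "(\<lambda>n. cinner (?q x (?\<tau> n)) y) \<longlonglongrightarrow> cinner (gen x) y"
    by (intro cinner.tendsto tendsto_const gen_tendsto_seq [OF x] null_seq_inverse) simp
  ultimately show "(\<lambda>n. cinner x (?q y (- ?\<tau> n))) \<longlonglongrightarrow> cinner (gen x) y" by (simp only:)
  have "(\<lambda>n. - ?\<tau> n) \<longlonglongrightarrow> 0" using tendsto_minus [OF null_seq_inverse] by simp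
  then show "(\<lambda>n. cinner x (?q y (- ?\<tau> n))) \<longlonglongrightarrow> cinner x (gen y)"
    by (intro cinner.tendsto tendsto_const gen_tendsto_seq [OF y]) simp_all
qed

lemma w_gen_dom:
  assumes x: "x \<in> gen_dom" shows "w s x \<in> gen_dom"
proof -
  have xH: "x \<in> H" using x gen_dom_sub by auto
  have "norm (w t (w s x) - w s x) = norm (w t x - x)" for t
  proof -
    have "w t (w s x) = w s (w t x)" using w_add [OF xH, of t s] w_add [OF xH, of s t] by (simp add: add.commute)
    then have "w t (w s x) - w s x = w s (w t x - x)"
      by (simp add: clinear_on_diff [OF w_lin cH w_in [OF xH] xH])
    then show ?thesis by (simp add: w_norm csubspace_diff [OF cH w_in [OF xH] xH])
  qed
  then show ?thesis using x w_in [OF xH] by (simp add: gen_dom_def)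
qed

text \<open>The adjoint of the generator has no larger domain: if \<open>z\<close> is the value of the adjoint at \<open>y\<close>,
  then $\frac{d}{ds} \langle y, w(s) x\rangle = i \langle z, w(s) x\rangle$, so the mean value theorem
  bounds $\lVert w(t) y - y \rVert$ by $|t|\,\lVert z\rVert$.\<close>

lemma gen_adjoint:
  assumes y: "y \<in> H" and z: "z \<in> H" and adj: "\<And>x. x \<in> gen_dom \<Longrightarrow> cinner y (gen x) = cinner z x"
  shows "y \<in> gen_dom"
proof -
  have mvt: "Re (cinner (w (- t) y - y) x) \<le> t * norm z * norm x" if x: "x \<in> gen_dom" and t: "0 < t" for x t
  proof -
    have xH: "x \<in> H" using x gen_dom_sub by auto
    let ?r = "\<lambda>s. Re (cinner y (w s x))"
    have der: "DERIV ?r s :> Re (\<i> * cinner z (w s x))" for s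
      unfolding DERIV_def
    proof -
      have wx: "w s x \<in> gen_dom" "w s x \<in> H" using w_gen_dom [OF x] w_in [OF xH] by auto
      have "((\<lambda>h. Re (\<i> * cinner y ((1 / (\<i> * of_real h)) *\<^sub>C (w h (w s x) - w s x)))) \<longlongrightarrow> Re (\<i> * cinner y (gen (w s x)))) (at 0)"
        by (intro tendsto_Re tendsto_mult tendsto_const cinner.tendsto gen_tendsto wx)
      moreover have "Re (\<i> * cinner y ((1 / (\<i> * of_real h)) *\<^sub>C (w h (w s x) - w s x))) = (?r (s + h) - ?r s) / h" for h
      proof -
        have "w (s + h) x = w h (w s x)" using w_add [OF xH, of h s] by (simp add: add.commute)
        moreover have "\<i> * ((1 / (\<i> * of_real h)) * c) = c / of_real h" for c by simp
        ultimately show ?thesis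
          by (simp only: cinner_scaleC_right Re_divide_of_real cinner.diff_right minus_complex.sel)
      qed
      ultimately show "((\<lambda>h. (?r (s + h) - ?r s) / h) \<longlongrightarrow> Re (\<i> * cinner z (w s x))) (at 0)"
        by (simp only: adj [OF wx(1)])
    qed
    obtain \<xi> where \<xi>: "?r t - ?r 0 = (t - 0) * Re (\<i> * cinner z (w \<xi> x))" using MVT2 [OF t der] by blast
    have "Re (cinner (w (- t) y - y) x) = ?r t - ?r 0"
    proof -
      have "cinner (w (- t) y) x = cinner y (w t x)" using cinner_w [OF y xH, of "- t" 0] w_0 [OF xH] by simp
      then show ?thesis using w_0 [OF xH] by (simp add: cinner.diff_left)
    qed
    also have "\<dots> = t * Re (\<i> * cinner z (w \<xi> x))" using \<xi> by simp
    also have "\<dots> \<le> t * (norm z * norm x)"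
    proof (rule mult_left_mono)
      have "Re (\<i> * cinner z (w \<xi> x)) \<le> cmod (\<i> * cinner z (w \<xi> x))" by (rule complex_Re_le_cmod)
      also have "\<dots> \<le> norm z * norm x" using cmod_cinner_le [of z "w \<xi> x"] w_norm [OF xH] by (simp add: norm_mult)
      finally show "Re (\<i> * cinner z (w \<xi> x)) \<le> norm z * norm x" .
    qed (use t in simp)
    finally show ?thesis by (simp add: mult.assoc)
  qed
  \<comment> \<open>Test vectors from the dense domain approach the difference vector itself, which
    turns the bound on inner products into a bound on its norm.\<close>
  have pos: "norm (w (- t) y - y) \<le> t * norm z" if t: "0 < t" for t
  proof -
    let ?v = "w (- t) y - y"
    have v: "?v \<in> H" by (rule csubspace_diff [OF cH w_in [OF y] y])
    obtain X where X: "\<And>n :: nat. X n \<in> gen_dom" "X \<longlonglongrightarrow> ?v"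
      using closure_sequential [THEN iffD1, OF subsetD [OF gen_dom_dense v]] by auto
    have "Re (cinner ?v ?v) \<le> t * norm z * norm ?v"
    proof (rule LIMSEQ_le)
      show "(\<lambda>n. Re (cinner ?v (X n))) \<longlonglongrightarrow> Re (cinner ?v ?v)"
        by (intro tendsto_Re cinner.tendsto tendsto_const X(2))
      show "(\<lambda>n. t * norm z * norm (X n)) \<longlonglongrightarrow> t * norm z * norm ?v" by (intro tendsto_intros X(2))
      show "\<exists>N. \<forall>n\<ge>N. Re (cinner ?v (X n)) \<le> t * norm z * norm (X n)" using mvt [OF X(1) t] by blast
    qed
    then have "norm ?v * norm ?v \<le> (t * norm z) * norm ?v" by (simp add: cinner_self_of_real power2_eq_square)
    then show ?thesis using t by (cases "norm ?v = 0") (simp_all add: mult_le_cancel_right)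
  qed
  have "norm (w t y - y) \<le> norm z * \<bar>t\<bar>" for t
  proof -
    consider "t = 0" | "t < 0" | "0 < t" by linarith
    then show ?thesis
    proof cases
      case 1 then show ?thesis by (simp add: w_0 [OF y])
    next
      case 2 then show ?thesis using pos [of "- t"] by (simp add: mult.commute)
    next
      case 3
      \<comment> \<open>The bound is known at negative times; applying the isometry
        \<open>w t\<close> carries it over to positive ones.\<close>
      have "w t y - y = w t (y - w (- t) y)"
        using w_add [OF y, of t "- t"] by (simp add: clinear_on_diff [OF w_lin cH y w_in [OF y]] w_0 [OF y])
      then have "norm (w t y - y) = norm (y - w (- t) y)"
        using w_norm [OF csubspace_diff [OF cH y w_in [OF y]]] by simp
      then show ?thesis using pos [OF 3] 3 by (simp add: norm_minus_commute mult.commute)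
    qed
  qed
  then show ?thesis using y unfolding gen_dom_def by (auto intro!: exI [of _ "norm z"] always_eventually)
qed

lemma gen_selfadjoint: "selfadjoint_operator H gen_dom gen"
  unfolding selfadjoint_operator_def
proof (intro conjI ballI csubspace_gen_dom gen_dom_sub gen_dom_dense gen_linear)
  show "gen ` gen_dom \<subseteq> H" using gen_in by auto
  fix y z assume yz: "y \<in> H" "z \<in> H"
  show "(\<forall>x\<in>gen_dom. cinner y (gen x) = cinner z x) \<longleftrightarrow> y \<in> gen_dom \<and> z = gen y"
  proof
    assume adj: "\<forall>x\<in>gen_dom. cinner y (gen x) = cinner z x"
    then have y: "y \<in> gen_dom" by (intro gen_adjoint [OF yz]) blast
    have "z - gen y = 0"
    proof (rule orth_dense_imp_0)
      show "cinner (z - gen y) x = 0" if "x \<in> gen_dom" for x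
        using adj that gen_symmetric [OF y that] by (simp add: cinner.diff_left)
      show "z - gen y \<in> closure gen_dom" using gen_dom_dense csubspace_diff [OF cH yz(2) gen_in [OF y]] by blast
    qed
    then show "y \<in> gen_dom \<and> z = gen y" using y by simp
  qed (use gen_symmetric in auto)
qed

lemma exp_i_gen: "is_exp_i t H gen_dom gen (w t)"
  unfolding is_exp_i_def
proof (intro exI [of _ spec] conjI spec_pvm spectral_integral_w)
  show "is_spectral_integral H spec (\<lambda>s. complex_of_real s) gen_dom gen"
    unfolding is_spectral_integral_def
  proof (intro conjI ballI gen_linear)
    show "gen_dom = {x \<in> H. integrable (vector_measure spec x) (\<lambda>s. (cmod (complex_of_real s))\<^sup>2)}"
      using gen_dom_square_integrable square_integrable_imp_gen_dom gen_dom_sub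
      by (auto simp only: vector_measure_spec subset_iff)
    show "gen ` gen_dom \<subseteq> H" using gen_in by auto
    show "cinner x (gen x) = (\<integral>s. of_real s \<partial>vector_measure spec x)" if x: "x \<in> gen_dom" for x
    proof -
      have xH: "x \<in> H" using x gen_dom_sub by auto
      have "approx_seq x of_real (\<lambda>n. quot_list (1 / real (Suc n)))"
        by (rule approx_seq_gen [OF x null_seq_inverse]) simp
      from cinner_fc [OF xH this] show ?thesis unfolding gen_def vector_measure_spec [OF xH] .
    qed
  qed
qed

end

section \<open>Nearby one-parameter groups and their generators\<close>

text \<open>Besides the properties asked for in the end, it records the description of the domain by
  increments and the derivative, through which two groups can be compared without their spectral
  measures.\<close>

definition stone_generator ::
  "'a :: chilbert_space set \<Rightarrow> (real \<Rightarrow> 'a \<Rightarrow> 'a) \<Rightarrow> 'a set \<Rightarrow> ('a \<Rightarrow> 'a) \<Rightarrow> bool" where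
  "stone_generator H w D A \<longleftrightarrow> selfadjoint_operator H D A \<and> (\<forall>t. is_exp_i t H D A (w t)) \<and>
     D = {x\<in>H. \<exists>C. \<forall>\<^sub>F t in nhds 0. norm (w t x - x) \<le> C * \<bar>t\<bar>} \<and>
     (\<forall>x\<in>D. ((\<lambda>t. (1 / (\<i> * of_real t)) *\<^sub>C (w t x - x)) \<longlongrightarrow> A x) (at 0))"

lemma stone:
  assumes "unitary_group H w"
  shows "\<exists>D A. stone_generator H w D A"
proof -
  interpret one_param_group H w by unfold_locales (rule assms)
  show ?thesis
    using gen_selfadjoint exp_i_gen gen_tendsto
    by (intro exI [of _ gen_dom] exI [of _ gen]) (simp add: stone_generator_def gen_dom_def)
qed

lemma stone_tuple:
  assumes "unitary_tuple d H u"
  shows "\<exists>D A. \<forall>k<d. stone_generator H (u k) (D k) (A k)"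
proof -
  have "\<forall>k. \<exists>p. k < d \<longrightarrow> stone_generator H (u k) (fst p) (snd p)"
  proof
    fix k show "\<exists>p. k < d \<longrightarrow> stone_generator H (u k) (fst p) (snd p)"
    proof (cases "k < d")
      case True
      then have "unitary_group H (u k)" using assms by (simp add: unitary_tuple_def)
      from stone [OF this] obtain D A where "stone_generator H (u k) D A" by blast
      then show ?thesis by (intro exI [of _ "(D, A)"]) simp
    qed simp
  qed
  from choice [OF this] obtain f where "\<forall>k. k < d \<longrightarrow> stone_generator H (u k) (fst (f k)) (snd (f k))" by blast
  then show ?thesis by (intro exI [of _ "\<lambda>k. fst (f k)"] exI [of _ "\<lambda>k. snd (f k)"]) simp
qed

lemma lipschitz_domain_mono:
  assumes close: "\<forall>\<^sub>F t in nhds 0. \<forall>x\<in>H. norm (V t x - U t x) \<le> \<epsilon> * \<bar>t\<bar> * norm x"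
  shows "{x\<in>H. \<exists>C. \<forall>\<^sub>F t in nhds 0. norm (U t x - x) \<le> C * \<bar>t\<bar>}
    \<subseteq> {x\<in>H. \<exists>C. \<forall>\<^sub>F t in nhds (0 :: real). norm (V t x - x) \<le> C * \<bar>t\<bar>}"
proof
  fix x :: 'a assume "x \<in> {x\<in>H. \<exists>C. \<forall>\<^sub>F t in nhds 0. norm (U t x - x) \<le> C * \<bar>t\<bar>}"
  then obtain C where x: "x \<in> H" and C: "\<forall>\<^sub>F t in nhds 0. norm (U t x - x) \<le> C * \<bar>t\<bar>" by blast
  from close C have "\<forall>\<^sub>F t in nhds 0. norm (V t x - x) \<le> (\<epsilon> * norm x + C) * \<bar>t\<bar>"
  proof eventually_elim
    case (elim t)
    have "norm (V t x - x) \<le> norm (V t x - U t x) + norm (U t x - x)" 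
      using norm_triangle_ineq [of "V t x - U t x" "U t x - x"] by simp
    then show ?case using elim x by (simp add: algebra_simps) (smt (verit))
  qed
  then show "x \<in> {x\<in>H. \<exists>C. \<forall>\<^sub>F t in nhds 0. norm (V t x - x) \<le> C * \<bar>t\<bar>}" using x by blast
qed

lemma generator_difference_bound:
  fixes a b :: "'a :: complex_inner"
  assumes close: "\<forall>\<^sub>F t in nhds 0. \<forall>x\<in>H. norm (V t x - U t x) \<le> \<epsilon> * \<bar>t\<bar> * norm x" and x: "x \<in> H"
    and a: "((\<lambda>t. (1 / (\<i> * of_real t)) *\<^sub>C (U t x - x)) \<longlongrightarrow> a) (at 0)"
    and b: "((\<lambda>t. (1 / (\<i> * of_real t)) *\<^sub>C (V t x - x)) \<longlongrightarrow> b) (at 0)"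
  shows "norm (b - a) \<le> \<epsilon> * norm x"
proof (rule tendsto_upperbound)
  have q: "(1 / (\<i> * of_real t)) *\<^sub>C (V t x - U t x)
      = (1 / (\<i> * of_real t)) *\<^sub>C (V t x - x) - (1 / (\<i> * of_real t)) *\<^sub>C (U t x - x)" for t
    by (simp add: scaleC.diff_right)
  show "((\<lambda>t. norm ((1 / (\<i> * of_real t)) *\<^sub>C (V t x - U t x))) \<longlongrightarrow> norm (b - a)) (at 0)"
    unfolding q by (intro tendsto_norm tendsto_diff a b)
  have "\<forall>\<^sub>F t in at 0. \<forall>x\<in>H. norm (V t x - U t x) \<le> \<epsilon> * \<bar>t\<bar> * norm x"
    using close unfolding eventually_at_filter by (rule eventually_mono) simp
  moreover have "\<forall>\<^sub>F t in at (0 :: real). t \<noteq> 0" by (rule eventually_neq_at_within)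
  ultimately show "\<forall>\<^sub>F t in at 0. norm ((1 / (\<i> * of_real t)) *\<^sub>C (V t x - U t x)) \<le> \<epsilon> * norm x"
  proof eventually_elim
    case (elim t)
    have "norm (V t x - U t x) \<le> \<epsilon> * \<bar>t\<bar> * norm x" using elim(1) x by blast
    then show ?case using elim(2) by (simp add: norm_scaleC norm_divide norm_mult field_simps)
  qed
qed simp

section \<open>Almost intertwining unitaries\<close>

lemma tuple_equiv_sym: "tuple_equiv T d H u K v \<Longrightarrow> tuple_equiv T d K v H u"
  unfolding tuple_equiv_def by metis

lemma unitary_tuple_hilbert: "unitary_tuple d H u \<Longrightarrow> hilbert H"
  by (simp add: unitary_tuple_def)

text \<open>With primes for ampliations, the chain runs from the space of u to H', on to K' by
  inclusion, then to the twofold ampliation of the space of v, which is flattened. Only the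
  inclusion is inexact.\<close>

lemma dilates_to_imp_intertwiner:
  assumes u: "unitary_tuple d H\<^sub>0 u" and v: "unitary_tuple d K\<^sub>0 v" and c: "0 \<le> c"
    and dil: "dilates_to TYPE('l) c d H\<^sub>0 u K\<^sub>0 v"
  shows "\<exists>S. almost_intertwines d (sqrt (2 * c)) H\<^sub>0 u (ampl_space K\<^sub>0) (ampl_tuple K\<^sub>0 v) S"
proof -
  obtain H K :: "'l ell2 set" and U V and C :: "real \<Rightarrow> real" where HK: "H \<subseteq> K"
    and U: "unitary_tuple d H U" and V: "unitary_tuple d K V"
    and eu: "tuple_equiv TYPE('l) d H\<^sub>0 u H U" and ev: "tuple_equiv TYPE('l) d K\<^sub>0 v K V"
    and C: "\<forall>t. C t \<le> exp (t\<^sup>2 * c)"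
    and d: "\<forall>\<^sub>F t in nhds 0. \<forall>k<d. \<forall>x\<in>H. U k t x = C t *\<^sub>R orth_proj H (V k t x)"
    using dil unfolding dilates_to_def by (elim exE conjE)
  note act = unitary_tuple_isometric_action
  note uH = act [OF u] and vK = act [OF v] and UH = act [OF U] and VK = act [OF V]
  obtain S where S: "almost_intertwines d 0 H\<^sub>0 u (ampl_space H) (ampl_tuple H U) S"
    using equiv_imp_intertwiner [OF u U eu] by blast
  obtain T where T: "almost_intertwines d 0 K V (ampl_space K\<^sub>0) (ampl_tuple K\<^sub>0 v) T"
    using equiv_imp_intertwiner [OF V v tuple_equiv_sym [OF ev]] by blast
  have J: "almost_intertwines d (sqrt (2 * c)) H U K V (\<lambda>x. x)"
    by (rule dilation_almost_intertwines [OF U V HK C [rule_format] c d])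
  have J': "almost_intertwines d (sqrt (2 * c)) (ampl_space H) (ampl_tuple H U) (ampl_space K) (ampl_tuple K V) (ampl_map (\<lambda>x. x))"
    by (rule almost_intertwines_ampl [OF J _ UH VK]) (simp add: c)
  note aH = isometric_action_ampl [OF UH] and aK = isometric_action_ampl [OF VK] and aK0 = isometric_action_ampl [OF vK]
  note T' = almost_intertwines_ampl [OF T order_refl VK aK0]
  note F = intertwines_flatten [OF vK]
  note 1 = almost_intertwines_compose [OF S J' uH aH]
  note 2 = almost_intertwines_compose [OF 1 T' uH aK]
  note 3 = almost_intertwines_compose [OF 2 F uH isometric_action_ampl [OF aK0]]
  then show ?thesis by auto
qed

lemma intertwines_prod_right:
  assumes T: "almost_intertwines d 0 K v K' v' T" and v: "isometric_action d K v" and v': "isometric_action d K' v'"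
  shows "almost_intertwines d 0 (H \<times> K) (sum_tuple u v) (H \<times> K') (sum_tuple u v') (map_prod (\<lambda>x. x) T)"
proof (rule almost_intertwines_exact)
  have iT: "isometry_on K K' T" using T by (simp add: almost_intertwines_def)
  note iD = isometry_onD [OF iT]
  show "isometry_on (H \<times> K) (H \<times> K') (map_prod (\<lambda>x. x) T)"
    using iD(2,3) clinear_on_add [OF iD(1)] clinear_on_scaleC [OF iD(1)]
    by (auto simp: isometry_on_def clinear_on_def norm_prod_def scaleC_prod_def)
  show "sum_tuple u v' k t (map_prod (\<lambda>x. x) T x) = map_prod (\<lambda>x. x) T (sum_tuple u v k t x)"
    if "k < d" "x \<in> H \<times> K" for k t x
    using that intertwines_everywhere [OF T v v' that(1), of "snd x" t] by (cases x) (simp add: sum_tuple_def)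
qed

lemma inv_into_surj: "inj_on S H \<Longrightarrow> S ` H = K \<Longrightarrow> inv_into H S ` K = H"
  using bij_betw_imp_surj_on [OF bij_betw_inv_into] by (auto simp: bij_betw_def)

lemma almost_intertwines_isometry: "almost_intertwines d \<epsilon> H u K v S \<Longrightarrow> isometry_on H K S"
  by (simp add: almost_intertwines_def)

text \<open>The isometry maps into an ampliation, so \<open>swindle\<close> yields twofold
  ampliations; flattening on both sides is exact and reduces them to simple ones.\<close>

lemma swindle_ampl:
  assumes S: "almost_intertwines d \<epsilon> H u (ampl_space K) (ampl_tuple K v) S" and \<epsilon>: "0 \<le> \<epsilon>"
    and u: "isometric_action d H u" and v: "isometric_action d K v"
  shows "\<exists>Z. almost_intertwines d (sqrt 5 * \<epsilon>) (ampl_space K) (ampl_tuple K v)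
      (ampl_space H \<times> ampl_space K) (sum_tuple (ampl_tuple H u) (ampl_tuple K v)) Z \<and>
    Z ` ampl_space K = ampl_space H \<times> ampl_space K"
proof -
  note aH = isometric_action_ampl [OF u] and aK = isometric_action_ampl [OF v]
  note aaK = isometric_action_ampl [OF aK]
  obtain Z where Z: "almost_intertwines d (sqrt 5 * \<epsilon>) (ampl_space (ampl_space K)) (ampl_tuple (ampl_space K) (ampl_tuple K v))
      (ampl_space H \<times> ampl_space (ampl_space K))
      (sum_tuple (ampl_tuple H u) (ampl_tuple (ampl_space K) (ampl_tuple K v))) Z"
    and ran: "Z ` ampl_space (ampl_space K) = ampl_space H \<times> ampl_space (ampl_space K)"
    using swindle [OF S \<epsilon> u aK] by blast
  note F = intertwines_flatten [OF v]
  note Fi = almost_intertwines_inverse [OF F flatten_l2_surj aaK aK]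
  note P = intertwines_prod_right [OF F aaK aK, of "ampl_space H" "ampl_tuple H u"]
  note 1 = almost_intertwines_compose [OF Fi Z aK aaK]
  note 2 = almost_intertwines_compose [OF 1 P aK isometric_action_sum [OF aH aaK]]
  let ?Z = "\<lambda>x. map_prod (\<lambda>x. x) flatten_l2 (Z (inv_into (ampl_space (ampl_space K)) flatten_l2 x))"
  have "inj_on flatten_l2 (ampl_space (ampl_space K))"
    by (rule isometry_on_inj [OF almost_intertwines_isometry [OF F] hilbert_csubspace [OF isometric_action_hilbert [OF aaK]]])
  note inv = inv_into_surj [OF this flatten_l2_surj]
  have "?Z ` ampl_space K = map_prod (\<lambda>x. x) flatten_l2 ` (Z ` (inv_into (ampl_space (ampl_space K)) flatten_l2 ` ampl_space K))"
    by (simp only: image_image)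
  also have "\<dots> = ampl_space H \<times> ampl_space K"
    unfolding inv ran by (simp add: map_prod_surj_on [OF image_ident flatten_l2_surj])
  finally show ?thesis using 2 by (intro exI [of _ ?Z]) simp
qed

text \<open>Let K' absorb H', swap the summands, and undo the absorption of K' by H'. The two
  swindles account for the factor 2; the swap is exact.\<close>

lemma almost_intertwining_unitary:
  assumes S: "almost_intertwines d \<epsilon> H u (ampl_space K) (ampl_tuple K v) S"
    and S': "almost_intertwines d \<epsilon> K v (ampl_space H) (ampl_tuple H u) S'" and \<epsilon>: "0 \<le> \<epsilon>"
    and u: "isometric_action d H u" and v: "isometric_action d K v"
  shows "\<exists>Y. almost_intertwines d (2 * sqrt 5 * \<epsilon>) (ampl_space K) (ampl_tuple K v) (ampl_space H) (ampl_tuple H u) Y \<and>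
    Y ` ampl_space K = ampl_space H"
proof -
  note aH = isometric_action_ampl [OF u] and aK = isometric_action_ampl [OF v]
  note aHK = isometric_action_sum [OF aH aK] and aKH = isometric_action_sum [OF aK aH]
  obtain Z where Z: "almost_intertwines d (sqrt 5 * \<epsilon>) (ampl_space K) (ampl_tuple K v)
      (ampl_space H \<times> ampl_space K) (sum_tuple (ampl_tuple H u) (ampl_tuple K v)) Z"
    and Zr: "Z ` ampl_space K = ampl_space H \<times> ampl_space K"
    using swindle_ampl [OF S \<epsilon> u v] by blast
  obtain Z' where Z': "almost_intertwines d (sqrt 5 * \<epsilon>) (ampl_space H) (ampl_tuple H u)
      (ampl_space K \<times> ampl_space H) (sum_tuple (ampl_tuple K v) (ampl_tuple H u)) Z'"
    and Zr': "Z' ` ampl_space H = ampl_space K \<times> ampl_space H"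
    using swindle_ampl [OF S' \<epsilon> v u] by blast
  note Zi = almost_intertwines_inverse [OF Z' Zr' aH aKH]
  note 1 = almost_intertwines_compose [OF Z intertwines_swap aK aHK]
  note 2 = almost_intertwines_compose [OF 1 Zi aK aKH]
  let ?Y = "\<lambda>x. inv_into (ampl_space H) Z' (prod.swap (Z x))"
  have "inj_on Z' (ampl_space H)"
    by (rule isometry_on_inj [OF almost_intertwines_isometry [OF Z'] hilbert_csubspace [OF isometric_action_hilbert [OF aH]]])
  note inv = inv_into_surj [OF this Zr']
  have "?Y ` ampl_space K = inv_into (ampl_space H) Z' ` (prod.swap ` (Z ` ampl_space K))" by (simp only: image_image)
  also have "\<dots> = ampl_space H" unfolding Zr product_swap inv ..
  finally have r: "?Y ` ampl_space K = ampl_space H" .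
  have "almost_intertwines d (2 * sqrt 5 * \<epsilon>) (ampl_space K) (ampl_tuple K v) (ampl_space H) (ampl_tuple H u) ?Y"
    by (rule almost_intertwines_mono [OF 2]) simp
  then show ?thesis using r by (intro exI [of _ ?Y] conjI)
qed

theorem theorem1p7:
  fixes H\<^sub>0 :: "'a :: chilbert_space set" and u :: "nat \<Rightarrow> real \<Rightarrow> 'a \<Rightarrow> 'a"
    and K\<^sub>0 :: "'b :: chilbert_space set" and v :: "nat \<Rightarrow> real \<Rightarrow> 'b \<Rightarrow> 'b"
    and d :: nat and \<delta> :: real
  assumes "unitary_tuple d H\<^sub>0 u" and "unitary_tuple d K\<^sub>0 v"
    and "0 < \<delta>"
    and "dilation_dist TYPE('l :: infinite) d H\<^sub>0 u K\<^sub>0 v \<le> ereal \<delta>"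
  shows "\<exists>(H :: 'l ell2 set) U V dom\<^sub>A A dom\<^sub>B B.
    unitary_tuple d H U \<and> unitary_tuple d H V \<and>
    infinite_multiplicity d H U \<and> infinite_multiplicity d H V \<and>
    tuple_equiv TYPE('l) d H\<^sub>0 u H U \<and> tuple_equiv TYPE('l) d K\<^sub>0 v H V \<and>
    (\<forall>k<d. selfadjoint_operator H (dom\<^sub>A k) (A k) \<and> selfadjoint_operator H (dom\<^sub>B k) (B k) \<and>
       dom\<^sub>A k = dom\<^sub>B k \<and>
       (\<forall>t. is_exp_i t H (dom\<^sub>A k) (A k) (U k t)) \<and>
       (\<forall>t. is_exp_i t H (dom\<^sub>B k) (B k) (V k t)) \<and>
       (\<forall>x\<in>dom\<^sub>A k. norm (B k x - A k x) \<le> 5 * sqrt 2 * sqrt \<delta> * norm x))"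
proof -
  note u = assms(1) and v = assms(2) and \<delta> = assms(3)
  note uH = unitary_tuple_isometric_action [OF u] and vK = unitary_tuple_isometric_action [OF v]
  note aH = isometric_action_ampl [OF uH] and aK = isometric_action_ampl [OF vK]
  \<comment> \<open>The infimum need not be attained, so some c below (5/4) \<delta> is used;
    \<delta> > 0 leaves room for it. With this slack 2 sqrt 5 times \<epsilon> is exactly the
    required constant.\<close>
  define \<epsilon> where "\<epsilon> = sqrt (2 * (5 / 4 * \<delta>))"
  have \<epsilon>0: "0 \<le> \<epsilon>" using \<delta> by (simp add: \<epsilon>_def)
  have inf: "\<exists>c. 0 < c \<and> c < 5 / 4 * \<delta> \<and> P c" if "Inf {ereal c | c. 0 < c \<and> P c} \<le> ereal \<delta>" for P
  proof -
    have "Inf {ereal c | c. 0 < c \<and> P c} < ereal (5 / 4 * \<delta>)"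
      using that by (rule order_le_less_trans) (simp add: \<delta>)
    then show ?thesis unfolding Inf_less_iff by auto
  qed
  have d1: "Inf {ereal c | c. 0 < c \<and> dilates_to TYPE('l) c d H\<^sub>0 u K\<^sub>0 v} \<le> ereal \<delta>"
    and d2: "Inf {ereal c | c. 0 < c \<and> dilates_to TYPE('l) c d K\<^sub>0 v H\<^sub>0 u} \<le> ereal \<delta>"
    using assms(4) unfolding dilation_dist_def by simp_all
  have S: "\<exists>S. almost_intertwines d \<epsilon> H\<^sub>0 u (ampl_space K\<^sub>0) (ampl_tuple K\<^sub>0 v) S"
  proof -
    obtain c where c: "0 < c" "c < 5 / 4 * \<delta>" "dilates_to TYPE('l) c d H\<^sub>0 u K\<^sub>0 v" using inf [OF d1] by blast
    then obtain S where "almost_intertwines d (sqrt (2 * c)) H\<^sub>0 u (ampl_space K\<^sub>0) (ampl_tuple K\<^sub>0 v) S"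
      using dilates_to_imp_intertwiner [OF u v _ c(3)] by auto
    then have "almost_intertwines d \<epsilon> H\<^sub>0 u (ampl_space K\<^sub>0) (ampl_tuple K\<^sub>0 v) S"
      by (rule almost_intertwines_mono) (use c in \<open>simp add: \<epsilon>_def\<close>)
    then show ?thesis by (rule exI [of _ S])
  qed
  have S': "\<exists>S. almost_intertwines d \<epsilon> K\<^sub>0 v (ampl_space H\<^sub>0) (ampl_tuple H\<^sub>0 u) S"
  proof -
    obtain c where c: "0 < c" "c < 5 / 4 * \<delta>" "dilates_to TYPE('l) c d K\<^sub>0 v H\<^sub>0 u" using inf [OF d2] by blast
    then obtain S where "almost_intertwines d (sqrt (2 * c)) K\<^sub>0 v (ampl_space H\<^sub>0) (ampl_tuple H\<^sub>0 u) S"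
      using dilates_to_imp_intertwiner [OF v u _ c(3)] by auto
    then have "almost_intertwines d \<epsilon> K\<^sub>0 v (ampl_space H\<^sub>0) (ampl_tuple H\<^sub>0 u) S"
      by (rule almost_intertwines_mono) (use c in \<open>simp add: \<epsilon>_def\<close>)
    then show ?thesis by (rule exI [of _ S])
  qed
  let ?N = "ampl_space H\<^sub>0" and ?N' = "ampl_space K\<^sub>0"
  have "2 * sqrt 5 * \<epsilon> = 5 * sqrt 2 * sqrt \<delta>"
  proof (rule power2_eq_imp_eq)
    show "(2 * sqrt 5 * \<epsilon>)\<^sup>2 = (5 * sqrt 2 * sqrt \<delta>)\<^sup>2" using \<delta> by (simp add: \<epsilon>_def power_mult_distrib)
  qed (use \<epsilon>0 \<delta> in simp_all)
  then obtain Y where Y: "almost_intertwines d (5 * sqrt 2 * sqrt \<delta>) ?N' (ampl_tuple K\<^sub>0 v) ?N (ampl_tuple H\<^sub>0 u) Y"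
    and Yr: "Y ` ?N' = ?N"
    using S S' almost_intertwining_unitary [OF _ _ \<epsilon>0 uH vK] by metis
  note hH = unitary_tuple_hilbert [OF u] and hK = unitary_tuple_hilbert [OF v]
  note hN = hilbert_ampl_space [OF hH] and hN' = hilbert_ampl_space [OF hK]
  have "separable_space (top_of_set ?N)"
    using u by (intro separable_ampl_space hH) (simp add: unitary_tuple_def)
  then obtain \<Phi> :: "(nat, 'a) l2 \<Rightarrow> 'l ell2" where \<Phi>: "isometry_on ?N UNIV \<Phi>"
    using separable_embeds_ell2 [OF hilbert_csubspace [OF hN]] by blast
  \<comment> \<open>The common space has to lie in \<open>'l ell2\<close>, so the ampliation of the
    first space is embedded there.\<close>
  define M where "M = \<Phi> ` ?N"
  have \<Phi>M: "isometry_on ?N M \<Phi>" using \<Phi> by (auto simp: isometry_on_def M_def)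
  \<comment> \<open>Transporting the second tuple along \<open>Y\<close> as well puts both tuples on
    \<open>M\<close> and turns the almost intertwining unitary into the identity of
    \<open>M\<close>, as \<open>T\<close> below confirms.\<close>
  define \<Psi> where "\<Psi> = (\<lambda>x. \<Phi> (Y x))"
  have umU: "unitary_map ?N M \<Phi>" by unfold_locales (use hN \<Phi>M in \<open>auto simp: M_def\<close>)
  have YI: "isometry_on ?N' ?N Y" by (rule almost_intertwines_isometry [OF Y])
  have \<Psi>r: "\<Psi> ` ?N' = M" using Yr by (simp add: \<Psi>_def M_def image_image flip: Yr)
  have umV: "unitary_map ?N' M \<Psi>"
  proof
    show "isometry_on ?N' M \<Psi>"
      using isometry_onD [OF YI] isometry_onD [OF \<Phi>M] unfolding isometry_on_def \<Psi>_def clinear_on_def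
      by (auto simp: image_subset_iff)
  qed (rule hN' \<Psi>r)+
  define U where "U = transport_tuple ?N M \<Phi> (ampl_tuple H\<^sub>0 u)"
  define V where "V = transport_tuple ?N' M \<Psi> (ampl_tuple K\<^sub>0 v)"
  note Uf = ampl_transport [OF u umU, folded U_def] and Vf = ampl_transport [OF v umV, folded V_def]
  note UM = unitary_tuple_isometric_action [OF Uf(1)] and VM = unitary_tuple_isometric_action [OF Vf(1)]
  note 1 = almost_intertwines_inverse [OF Vf(4) \<Psi>r aK VM]
  note 2 = almost_intertwines_compose [OF 1 Y VM aK]
  note 3 = almost_intertwines_compose [OF 2 Uf(4) VM aH]
  let ?T = "\<lambda>x. \<Phi> (Y (inv_into ?N' \<Psi> x))"
  have T: "?T x = x" if "x \<in> M" for x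
    using f_inv_into_f [of x \<Psi> ?N'] that unfolding \<Psi>r by (simp add: \<Psi>_def)
  have close: "\<forall>\<^sub>F t in nhds 0. \<forall>k<d. \<forall>x\<in>M. norm (U k t x - V k t x) \<le> 5 * sqrt 2 * sqrt \<delta> * \<bar>t\<bar> * norm x"
  proof -
    have "\<forall>\<^sub>F t in nhds 0. \<forall>k<d. \<forall>x\<in>M. norm (U k t (?T x) - ?T (V k t x)) \<le> (0 + 5 * sqrt 2 * sqrt \<delta> + 0) * \<bar>t\<bar> * norm x"
      using 3 unfolding almost_intertwines_def by (rule conjunct2)
    then show ?thesis
    proof eventually_elim
      case (elim t)
      show ?case
      proof (intro allI impI ballI)
        fix k x assume "k < d" "x \<in> M"
        then show "norm (U k t x - V k t x) \<le> 5 * sqrt 2 * sqrt \<delta> * \<bar>t\<bar> * norm x"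
          using elim [rule_format, of k x] T [of x] T [of "V k t x"] isometric_actionD(4) [OF VM, of k x t] by simp
      qed
    qed
  qed
  obtain dA A where A': "\<forall>k<d. stone_generator M (U k) (dA k) (A k)"
    using stone_tuple [OF Uf(1)] by blast
  have A: "selfadjoint_operator M (dA k) (A k)" "is_exp_i t M (dA k) (A k) (U k t)"
      "dA k = {x\<in>M. \<exists>C. \<forall>\<^sub>F t in nhds 0. norm (U k t x - x) \<le> C * \<bar>t\<bar>}"
      "x \<in> dA k \<Longrightarrow> ((\<lambda>t. (1 / (\<i> * of_real t)) *\<^sub>C (U k t x - x)) \<longlongrightarrow> A k x) (at 0)"
    if "k < d" for k t x
    using A' [rule_format, OF that] unfolding stone_generator_def by blast+
  obtain dB B where B': "\<forall>k<d. stone_generator M (V k) (dB k) (B k)"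
    using stone_tuple [OF Vf(1)] by blast
  have B: "selfadjoint_operator M (dB k) (B k)" "is_exp_i t M (dB k) (B k) (V k t)"
      "dB k = {x\<in>M. \<exists>C. \<forall>\<^sub>F t in nhds 0. norm (V k t x - x) \<le> C * \<bar>t\<bar>}"
      "x \<in> dB k \<Longrightarrow> ((\<lambda>t. (1 / (\<i> * of_real t)) *\<^sub>C (V k t x - x)) \<longlongrightarrow> B k x) (at 0)"
    if "k < d" for k t x
    using B' [rule_format, OF that] unfolding stone_generator_def by blast+
  have dom: "dA k = dB k" and bound: "\<And>x. x \<in> dA k \<Longrightarrow> norm (B k x - A k x) \<le> 5 * sqrt 2 * sqrt \<delta> * norm x"
    if k: "k < d" for k
  proof -
    have UV: "\<forall>\<^sub>F t in nhds 0. \<forall>x\<in>M. norm (U k t x - V k t x) \<le> 5 * sqrt 2 * sqrt \<delta> * \<bar>t\<bar> * norm x"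
      using close by (rule eventually_mono) (use k in blast)
    then have VU: "\<forall>\<^sub>F t in nhds 0. \<forall>x\<in>M. norm (V k t x - U k t x) \<le> 5 * sqrt 2 * sqrt \<delta> * \<bar>t\<bar> * norm x"
      by (simp only: norm_minus_commute)
    show dom: "dA k = dB k"
      unfolding A(3) [OF k] B(3) [OF k] by (intro equalityI lipschitz_domain_mono [OF UV] lipschitz_domain_mono [OF VU])
    show "norm (B k x - A k x) \<le> 5 * sqrt 2 * sqrt \<delta> * norm x" if x: "x \<in> dA k" for x
    proof (rule generator_difference_bound [OF VU _ A(4) [OF k x]])
      show "x \<in> M" using x A(3) [OF k] by blast
      show "((\<lambda>t. (1 / (\<i> * of_real t)) *\<^sub>C (V k t x - x)) \<longlongrightarrow> B k x) (at 0)" using B(4) [OF k] x dom by simp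
    qed
  qed
  show ?thesis
    by (rule exI [of _ M], rule exI [of _ U], rule exI [of _ V], rule exI [of _ dA], rule exI [of _ A],
        rule exI [of _ dB], rule exI [of _ B])
      (use Uf(1-3) Vf(1-3) A(1,2) B(1,2) dom bound in simp)
qed

end
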